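(* Let $L$ be a geometric lattice and $\mathcal H$ a partial building set for $L$. Fix a linear order $\prec$ on $\mathcal H$ such that $p\ge q$ implies $p\prec q$; this induces an order among the variables $e_g$ and among the variables $x_g$ ($g\in\mathcal H$), and further require $x_g\prec e_h$ for all $g,h$. Consider the corresponding deg-lex monomial order on $R(\mathcal H)$. Then the following elements form a Gröbner basis for the ideal $I(L,\mathcal H)$ in $R(\mathcal H)$: (i) $e_Sx_T$ whenever $S\cup T\notin N(L,\mathcal H)$; (ii) $\partial e_S$ whenever $S\in N(L,\mathcal H)$ is a circuit; (iii$'$) $e_Sx_Tc_g^{\,k}$ whenever $S\cup T\in N(L,\mathcal H)$ and $g\in\mathcal H$ are such that $S\cap T=\emptyset$, $S\cup T$ is an antichain, $\bigvee(S\cup T)<g$, and $k=\operatorname{rank}[\bigvee(S\cup T),g]$ (order, joins and rank taken in $L$).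
   Context: All posets are finite. For a meet-semilattice $P$ with least element $\hat 0$, write $P_+=P\setminus\{\hat 0\}$, $\mathrm{a}(P)$ for its set of atoms. $P$ is locally geometric if every interval $[\hat 0,x]$ is a geometric lattice; $M(P_{\le x})$ is the simple matroid on the atoms below $x$ whose lattice of flats is $[\hat 0,x]$. Blowups. For $p\in P_+$, let $P_{(p)}=\{x\in P: x\not\ge p,\ p\vee x \text{ exists}\}$ and $\mathrm{Bl}_p(P)=\{x\in P:x\not\ge p\}\cup\{(p,x):x\in P_{(p)}\}$, ordered by: $y>x$ if $y>x$ in $P$; $(p,y)>(p,x)$ if $y>x$ in $P$; $(p,y)>x$ if $y\ge x$ in $P$. Building sets. $\mathcal G\subseteq L_+$ is a building set if for every $x\in L_+$ with $\max \mathcal G_{\le x}=\{x_1,\dots,x_k\}$ there is a poset isomorphism $\prod_j[\hat 0,x_j]\to[\hat 0,x]$ sending $(\hat 0,\dots,x_j,\dots,\hat 0)$ to $x_j$; always $\hat 1\in\mathcal G$. A partial building set is $\mathcal H\subseteq\mathcal G$ (for some building set $\mathcal G$) with $\mathrm{a}(L)\subseteq\mathcal H$ and $\mathcal H^\circ:=\mathcal H\setminus \mathrm{a}(L)$ upward closed in $\mathcal G$. Writing $\mathcal H^\circ=\{p_1,\dots,p_m\}$ with $p_i\ge p_j\Rightarrow i\le j$, set $\mathcal L(L,\mathcal H)=\mathrm{Bl}_{p_m}\circ\cdots\circ\mathrm{Bl}_{p_1}(L)$, a locally geometric semilattice whose atoms are identified with $\mathcal H$. $S\subseteq\mathcal H$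 is $\mathcal H$-nested if the join in $L$ of any two or more pairwise incomparable elements of $S$ is not in $\mathcal H$; $N(L,\mathcal H)$ is the complex of nested sets (equivalently, sets of atoms of $\mathcal L(L,\mathcal H)$ with an upper bound). $S\in N(L,\mathcal H)$ is a circuit if it is a circuit of the matroid $M(\mathcal L(L,\mathcal H)_{\le\bigvee S})$, join in $\mathcal L(L,\mathcal H)$. Algebra. $R(\mathcal H)=\mathbb Q[e_g,x_g:g\in\mathcal H]$ is the free graded-commutative algebra with $e_g$ in bidegree $(0,1)$ and $x_g$ in bidegree $(2,0)$ (so the $e_g$ anticommute and square to zero, the $x_g$ are central). Put $e_S=e_{g_1}\cdots e_{g_k}$ for $S=\{g_1\prec\dots\prec g_k\}$, $x_T=\prod_{g\in T}x_g$, $\partial e_S=\sum_j(-1)^{j-1}e_{g_1}\cdots\widehat{e_{g_j}}\cdots e_{g_k}$, $c_g=\sum_{h\in\mathcal H,\,h\ge g}x_h$. The ideal $I(L,\mathcal H)$ is by definition generated by the elements (i), (ii), and (iii) $c_g$ for $g\in\mathrm{a}(L)$. A subset of an ideal is a Gröbner basis if the initial (largest) monomial of each nonzero element of the ideal is divisible by the initial monomial of some member of the subset. *)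

theory Defs
  imports
    Complex_Main
    "HOL-Algebra.Lattice"
    "HOL-Algebra.Ideal"
    "HOL-Library.FuncSet"
    "HOL-Library.Poly_Mapping"
begin

section \<open>Finite posets and geometric lattices\<close>

definition positive_part :: "'a gorder \<Rightarrow> 'a set" where
  "positive_part P = carrier P - {\<bottom>\<^bsub>P\<^esub>}"

definition covers :: "'a gorder \<Rightarrow> 'a \<Rightarrow> 'a \<Rightarrow> bool" where
  "covers P x y \<longleftrightarrow> x \<sqsubset>\<^bsub>P\<^esub> y \<and> \<not> (\<exists>z\<in>carrier P. x \<sqsubset>\<^bsub>P\<^esub> z \<and> z \<sqsubset>\<^bsub>P\<^esub> y)"

definition atoms :: "'a gorder \<Rightarrow> 'a set" where
  "atoms P = {a \<in> carrier P. covers P \<bottom>\<^bsub>P\<^esub> a}"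

definition geometric_lattice :: "'a gorder \<Rightarrow> bool" where
  "geometric_lattice L \<longleftrightarrow>
     bounded_lattice L \<and> finite (carrier L) \<and>
     (\<forall>x\<in>carrier L. x = \<Squnion>\<^bsub>L\<^esub>{a \<in> atoms L. a \<sqsubseteq>\<^bsub>L\<^esub> x}) \<and>
     (\<forall>x\<in>carrier L. \<forall>y\<in>carrier L.
        covers L (x \<sqinter>\<^bsub>L\<^esub> y) x \<longrightarrow> covers L y (x \<squnion>\<^bsub>L\<^esub> y))"

text \<open>The rank of an interval is the length of a longest chain in it.\<close>

definition interval_rank :: "'a gorder \<Rightarrow> 'a \<Rightarrow> 'a \<Rightarrow> nat" where
  "interval_rank P x y =
     Max ((\<lambda>C. card C - 1) `
       {C. C \<subseteq> \<lbrace>x..y\<rbrace>\<^bsub>P\<^esub> \<and> C \<noteq> {} \<and> (\<forall>u\<in>C. \<forall>v\<in>C. u \<sqsubseteq>\<^bsub>P\<^esub> v \<or> v \<sqsubseteq>\<^bsub>P\<^esub> u)})"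

definition antichain_in :: "'a gorder \<Rightarrow> 'a set \<Rightarrow> bool" where
  "antichain_in P A \<longleftrightarrow> (\<forall>x\<in>A. \<forall>y\<in>A. x \<sqsubseteq>\<^bsub>P\<^esub> y \<longrightarrow> x = y)"


section \<open>Building sets and nested sets\<close>

definition maximal_below :: "'a gorder \<Rightarrow> 'a set \<Rightarrow> 'a \<Rightarrow> 'a set" where
  "maximal_below L G x =
     {y \<in> G. y \<sqsubseteq>\<^bsub>L\<^esub> x \<and> (\<forall>z\<in>G. z \<sqsubseteq>\<^bsub>L\<^esub> x \<and> y \<sqsubseteq>\<^bsub>L\<^esub> z \<longrightarrow> z = y)}"

text \<open>The product of the intervals below the maximal elements is realised as the
  dependent function space over the set of these elements.\<close>

definition building_set :: "'a gorder \<Rightarrow> 'a set \<Rightarrow> bool" where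
  "building_set L G \<longleftrightarrow>
     G \<subseteq> positive_part L \<and> \<top>\<^bsub>L\<^esub> \<in> G \<and>
     (\<forall>x\<in>positive_part L.
        let M = maximal_below L G x; D = (\<Pi>\<^sub>E y\<in>M. \<lbrace>\<bottom>\<^bsub>L\<^esub>..y\<rbrace>\<^bsub>L\<^esub>)
        in \<exists>\<phi>. bij_betw \<phi> D \<lbrace>\<bottom>\<^bsub>L\<^esub>..x\<rbrace>\<^bsub>L\<^esub> \<and>
             (\<forall>u\<in>D. \<forall>v\<in>D. \<phi> u \<sqsubseteq>\<^bsub>L\<^esub> \<phi> v \<longleftrightarrow> (\<forall>y\<in>M. u y \<sqsubseteq>\<^bsub>L\<^esub> v y)) \<and>
             (\<forall>y\<in>M. \<phi> (\<lambda>z\<in>M. if z = y then y else \<bottom>\<^bsub>L\<^esub>) = y))"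

definition partial_building_set :: "'a gorder \<Rightarrow> 'a set \<Rightarrow> bool" where
  "partial_building_set L H \<longleftrightarrow>
     (\<exists>G. building_set L G \<and> H \<subseteq> G \<and> atoms L \<subseteq> H \<and>
        (\<forall>p \<in> H - atoms L. \<forall>g\<in>G. p \<sqsubseteq>\<^bsub>L\<^esub> g \<longrightarrow> g \<in> H - atoms L))"

definition nested :: "'a gorder \<Rightarrow> 'a set \<Rightarrow> 'a set \<Rightarrow> bool" where
  "nested L H S \<longleftrightarrow> S \<subseteq> H \<and>
     (\<forall>A\<subseteq>S. card A \<ge> 2 \<and> antichain_in L A \<longrightarrow> \<Squnion>\<^bsub>L\<^esub>A \<notin> H)"


section \<open>Blowups\<close>

text \<open>One type closed under the formation of pairs (p, x), so that blowups can be iterated: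
  Elem embeds the original poset and Exc p x stands for the new element (p, x).\<close>

datatype 'a blow = Elem 'a | Exc "'a blow" "'a blow"

definition blow_embed :: "'a gorder \<Rightarrow> 'a blow gorder" where
  "blow_embed P =
     \<lparr>carrier = Elem ` carrier P, eq = (=),
      le = (\<lambda>u v. \<exists>x y. u = Elem x \<and> v = Elem y \<and> x \<sqsubseteq>\<^bsub>P\<^esub> y)\<rparr>"

definition blow_old :: "'a blow gorder \<Rightarrow> 'a blow \<Rightarrow> 'a blow set" where
  "blow_old P p = {x \<in> carrier P. \<not> p \<sqsubseteq>\<^bsub>P\<^esub> x}"

definition blow_link :: "'a blow gorder \<Rightarrow> 'a blow \<Rightarrow> 'a blow set" where
  "blow_link P p = {x \<in> blow_old P p. \<exists>s. is_lub P s {p, x}}"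

text \<open>The old and new elements are disjoint as long as no element of P is already of the form
  Exc p x. This is the case in the iteration below, since it blows up each p once.\<close>

definition blowup :: "'a blow gorder \<Rightarrow> 'a blow \<Rightarrow> 'a blow gorder" where
  "blowup P p =
     \<lparr>carrier = blow_old P p \<union> Exc p ` blow_link P p, eq = (=),
      le = (\<lambda>u v.
        (u \<in> blow_old P p \<and> v \<in> blow_old P p \<and> u \<sqsubseteq>\<^bsub>P\<^esub> v) \<or>
        (\<exists>x\<in>blow_link P p. \<exists>y\<in>blow_link P p. u = Exc p x \<and> v = Exc p y \<and> x \<sqsubseteq>\<^bsub>P\<^esub> y) \<or>
        (u \<in> blow_old P p \<and> (\<exists>y\<in>blow_link P p. v = Exc p y \<and> u \<sqsubseteq>\<^bsub>P\<^esub> y)))\<rparr>"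

definition blowup_sequence :: "'a gorder \<Rightarrow> 'a set \<Rightarrow> 'a list \<Rightarrow> bool" where
  "blowup_sequence L H ps \<longleftrightarrow> distinct ps \<and> set ps = H - atoms L \<and>
     (\<forall>i<length ps. \<forall>j<length ps. ps ! j \<sqsubseteq>\<^bsub>L\<^esub> ps ! i \<longrightarrow> i \<le> j)"

definition iterated_blowup :: "'a gorder \<Rightarrow> 'a list \<Rightarrow> 'a blow gorder" where
  "iterated_blowup L ps = foldl (\<lambda>P p. blowup P (Elem p)) (blow_embed L) ps"

text \<open>The identification of H with the atoms of the iterated blowup.\<close>

definition blow_atom :: "'a gorder \<Rightarrow> 'a \<Rightarrow> 'a blow" where
  "blow_atom L g = (if g \<in> atoms L then Elem g else Exc (Elem g) (Elem \<bottom>\<^bsub>L\<^esub>))"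


section \<open>Matroids and circuits\<close>

text \<open>A matroid is represented by its set of flats; the closure of A is the least flat
  containing A.\<close>

definition flat_closure :: "'b set set \<Rightarrow> 'b set \<Rightarrow> 'b set" where
  "flat_closure F A = \<Inter>{X \<in> F. A \<subseteq> X}"

definition matroid_indep :: "'b set set \<Rightarrow> 'b set \<Rightarrow> bool" where
  "matroid_indep F A \<longleftrightarrow> A \<subseteq> \<Union>F \<and> (\<forall>a\<in>A. a \<notin> flat_closure F (A - {a}))"

definition matroid_circuit :: "'b set set \<Rightarrow> 'b set \<Rightarrow> bool" where
  "matroid_circuit F C \<longleftrightarrow>
     C \<subseteq> \<Union>F \<and> \<not> matroid_indep F C \<and> (\<forall>D. D \<subset> C \<longrightarrow> matroid_indep F D)"

definition interval_flats :: "'b gorder \<Rightarrow> 'b \<Rightarrow> 'b set set" where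
  "interval_flats P x = (\<lambda>z. {a \<in> atoms P. a \<sqsubseteq>\<^bsub>P\<^esub> z}) ` \<lbrace>\<bottom>\<^bsub>P\<^esub>..x\<rbrace>\<^bsub>P\<^esub>"

definition nested_circuit :: "'a gorder \<Rightarrow> 'a set \<Rightarrow> 'a list \<Rightarrow> 'a set \<Rightarrow> bool" where
  "nested_circuit L H ps S \<longleftrightarrow> nested L H S \<and>
     (let P = iterated_blowup L ps; A = blow_atom L ` S
      in matroid_circuit (interval_flats P (\<Squnion>\<^bsub>P\<^esub>A)) A)"


section \<open>The free graded-commutative algebra\<close>

text \<open>For a finite set H with linear order r, where (g, h) in r means that g precedes or equals
  h, the algebra R(H) is the exterior algebra on the e_g over the polynomial ring in the x_g:
  an element f is the sum of f S times e_S over the subsets S of H, with e_S the product of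
  the e_g in increasing order. Elements of the polynomial ring are finitely supported maps
  from exponent vectors to the rationals.\<close>

type_synonym 'a qpoly = "('a \<Rightarrow>\<^sub>0 nat) \<Rightarrow>\<^sub>0 rat"
type_synonym 'a gca = "'a set \<Rightarrow> 'a qpoly"

definition qpolys :: "'a set \<Rightarrow> 'a qpoly set" where
  "qpolys H = {p. \<forall>m\<in>Poly_Mapping.keys p. Poly_Mapping.keys m \<subseteq> H}"

definition qvar :: "'a \<Rightarrow> 'a qpoly" where
  "qvar g = Poly_Mapping.single (Poly_Mapping.single g 1) 1"

definition precedes :: "'a rel \<Rightarrow> 'a \<Rightarrow> 'a \<Rightarrow> bool" where
  "precedes r g h \<longleftrightarrow> (g, h) \<in> r \<and> g \<noteq> h"

text \<open>For disjoint A and B, the product of e_A and e_B is this sign times the basis element of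
  the union.\<close>

definition shuffle_sign :: "'a rel \<Rightarrow> 'a set \<Rightarrow> 'a set \<Rightarrow> 'a qpoly" where
  "shuffle_sign r A B = (-1) ^ card {(a, b) \<in> A \<times> B. precedes r b a}"

definition gca_ring :: "'a set \<Rightarrow> 'a rel \<Rightarrow> 'a gca ring" where
  "gca_ring H r =
     \<lparr>carrier = {f. (\<forall>S. f S \<noteq> 0 \<longrightarrow> S \<subseteq> H) \<and> (\<forall>S. f S \<in> qpolys H)},
      mult = (\<lambda>f g S. \<Sum>A\<in>Pow S. shuffle_sign r A (S - A) * f A * g (S - A)),
      one = (\<lambda>S. if S = {} then 1 else 0),
      zero = (\<lambda>S. 0),
      add = (\<lambda>f g S. f S + g S)\<rparr>"

definition gca_e :: "'a set \<Rightarrow> 'a gca" where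
  "gca_e S = (\<lambda>A. if A = S then 1 else 0)"

definition gca_poly :: "'a qpoly \<Rightarrow> 'a gca" where
  "gca_poly p = (\<lambda>A. if A = {} then p else 0)"

definition gca_x :: "'a set \<Rightarrow> 'a gca" where
  "gca_x T = gca_poly (\<Prod>g\<in>T. qvar g)"

definition gca_boundary :: "'a rel \<Rightarrow> 'a set \<Rightarrow> 'a gca" where
  "gca_boundary r S =
     (\<lambda>A. \<Sum>g\<in>S. (-1) ^ card {h \<in> S. precedes r h g} * gca_e (S - {g}) A)"

definition gca_c :: "'a gorder \<Rightarrow> 'a set \<Rightarrow> 'a \<Rightarrow> 'a gca" where
  "gca_c L H g = gca_poly (\<Sum>h\<in>{h \<in> H. g \<sqsubseteq>\<^bsub>L\<^esub> h}. qvar h)"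

lemma shuffle_sign_simps [simp]: "shuffle_sign r {} B = 1" "shuffle_sign r A {} = 1"
  by (simp_all add: shuffle_sign_def)

lemma shuffle_sign_Un:
  assumes "finite A" "finite B" "finite C" "A \<inter> B = {}" "B \<inter> C = {}"
  shows "shuffle_sign r A B * shuffle_sign r (A \<union> B) C =
         shuffle_sign r A (B \<union> C) * shuffle_sign r B C"
proof -
  let ?I = "\<lambda>A B. {(a, b) \<in> A \<times> B. precedes r b a}"
  have fin: "finite (?I X Y)" if "finite X" "finite Y" for X Y
    by (rule finite_subset[of _ "X \<times> Y"]) (use that in auto)
  have "?I (A \<union> B) C = ?I A C \<union> ?I B C" by auto
  moreover have "card (?I A C \<union> ?I B C) = card (?I A C) + card (?I B C)"
    by (intro card_Un_disjoint fin) (use assms in auto)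
  moreover have "?I A (B \<union> C) = ?I A B \<union> ?I A C" by auto
  moreover have "card (?I A B \<union> ?I A C) = card (?I A B) + card (?I A C)"
    by (intro card_Un_disjoint fin) (use assms in auto)
  ultimately have "card (?I (A \<union> B) C) = card (?I A C) + card (?I B C)"
    "card (?I A (B \<union> C)) = card (?I A B) + card (?I A C)" by presburger+
  thus ?thesis unfolding shuffle_sign_def by (simp add: power_add)
qed

lemma qpolys_closed:
  "0 \<in> qpolys H" "1 \<in> qpolys H" "- 1 \<in> qpolys H" "p \<in> qpolys H \<Longrightarrow> - p \<in> qpolys H"
  "p \<in> qpolys H \<Longrightarrow> q \<in> qpolys H \<Longrightarrow> p + q \<in> qpolys H"
  "p \<in> qpolys H \<Longrightarrow> q \<in> qpolys H \<Longrightarrow> p * q \<in> qpolys H"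
proof -
  show "0 \<in> qpolys H" "1 \<in> qpolys H" "- 1 \<in> qpolys H" by (auto simp: qpolys_def)
  show "p \<in> qpolys H \<Longrightarrow> - p \<in> qpolys H" by (auto simp: qpolys_def)
  show "p \<in> qpolys H \<Longrightarrow> q \<in> qpolys H \<Longrightarrow> p + q \<in> qpolys H"
    using Poly_Mapping.keys_add[of p q] by (fastforce simp: qpolys_def)
  assume pq: "p \<in> qpolys H" "q \<in> qpolys H"
  show "p * q \<in> qpolys H" unfolding qpolys_def
  proof (intro CollectI ballI)
    fix m assume "m \<in> Poly_Mapping.keys (p * q)"
    then obtain a b where "m = a + b" "a \<in> Poly_Mapping.keys p" "b \<in> Poly_Mapping.keys q"
      using keys_mult[of p q] by blast
    thus "Poly_Mapping.keys m \<subseteq> H"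
      using pq Poly_Mapping.keys_add[of a b] unfolding qpolys_def by blast
  qed
qed

lemma qpolys_sum: "(\<And>i. i \<in> A \<Longrightarrow> f i \<in> qpolys H) \<Longrightarrow> sum f A \<in> qpolys H"
  by (induction A rule: infinite_finite_induct) (auto intro: qpolys_closed)

lemma qpolys_power: "p \<in> qpolys H \<Longrightarrow> p ^ n \<in> qpolys H"
  by (induction n) (auto intro: qpolys_closed)

lemma Diff_Diff_sub: "B \<subseteq> A \<Longrightarrow> S - B - (A - B) = S - A"
  by auto

lemma gca_mult_assoc:
  assumes "finite S"
  shows "(\<Sum>U\<in>Pow S. shuffle_sign r U (S - U) *
           (\<Sum>A\<in>Pow U. shuffle_sign r A (U - A) * f A * g (U - A)) * h (S - U)) =
         (\<Sum>A\<in>Pow S. shuffle_sign r A (S - A) * f A *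
           (\<Sum>B\<in>Pow (S - A). shuffle_sign r B (S - A - B) * g B * h (S - A - B)))"
proof -
  let ?t = "\<lambda>A B C. shuffle_sign r A B * shuffle_sign r (A \<union> B) C * f A * g B * h C"
  have fin: "finite X" if "X \<subseteq> S" for X using that assms by (rule finite_subset)
  have "(\<Sum>U\<in>Pow S. shuffle_sign r U (S - U) *
           (\<Sum>A\<in>Pow U. shuffle_sign r A (U - A) * f A * g (U - A)) * h (S - U)) =
        (\<Sum>U\<in>Pow S. \<Sum>A\<in>Pow U. ?t A (U - A) (S - U))"
    by (intro sum.cong refl)
       (auto simp: sum_distrib_left sum_distrib_right Un_absorb1 mult_ac intro!: sum.cong)
  also have "\<dots> = (\<Sum>(U, A)\<in>Sigma (Pow S) Pow. ?t A (U - A) (S - U))"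
    by (rule sum.Sigma) (use assms fin in auto)
  also have "\<dots> = (\<Sum>(A, B)\<in>Sigma (Pow S) (\<lambda>A. Pow (S - A)). ?t A B (S - A - B))"
    by (rule sum.reindex_bij_witness[of _ "\<lambda>(A, B). (A \<union> B, A)" "\<lambda>(U, A). (A, U - A)"])
       (auto simp: Un_absorb1 Diff_Diff_sub intro!: arg_cong2[where f = "(*)"] arg_cong[where f = h])
  also have "\<dots> = (\<Sum>A\<in>Pow S. \<Sum>B\<in>Pow (S - A). ?t A B (S - A - B))"
    by (rule sum.Sigma[symmetric]) (use assms fin in auto)
  also have "\<dots> = (\<Sum>A\<in>Pow S. shuffle_sign r A (S - A) * f A *
           (\<Sum>B\<in>Pow (S - A). shuffle_sign r B (S - A - B) * g B * h (S - A - B)))"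
  proof (intro sum.cong refl)
    fix A assume A: "A \<in> Pow S"
    have "?t A B (S - A - B) =
        shuffle_sign r A (S - A) * f A * (shuffle_sign r B (S - A - B) * g B * h (S - A - B))"
      if "B \<in> Pow (S - A)" for B
    proof -
      have eq: "B \<union> (S - A - B) = S - A" using that by auto
      have "finite A" "finite B" "finite (S - A - B)" "A \<inter> B = {}" "B \<inter> (S - A - B) = {}"
        using A that by (auto intro: fin)
      from shuffle_sign_Un[OF this, of r, unfolded eq]
      have "shuffle_sign r A B * shuffle_sign r (A \<union> B) (S - A - B) =
            shuffle_sign r A (S - A) * shuffle_sign r B (S - A - B)" .
      thus ?thesis by (simp add: mult_ac)
    qed
    thus "(\<Sum>B\<in>Pow (S - A). ?t A B (S - A - B)) = shuffle_sign r A (S - A) * f A *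
           (\<Sum>B\<in>Pow (S - A). shuffle_sign r B (S - A - B) * g B * h (S - A - B))"
      by (simp add: sum_distrib_left)
  qed
  finally show ?thesis .
qed

lemma gca_mult_one:
  assumes "finite S"
  shows "(\<Sum>A\<in>Pow S. shuffle_sign r A (S - A) * (if A = {} then p else 0) * f (S - A)) = p * f S"
    and "(\<Sum>A\<in>Pow S. shuffle_sign r A (S - A) * f A * (if S - A = {} then p else 0)) = p * f S"
proof -
  have "(\<Sum>A\<in>Pow S. shuffle_sign r A (S - A) * (if A = {} then p else 0) * f (S - A)) =
        (\<Sum>A\<in>{{}}. shuffle_sign r A (S - A) * (if A = {} then p else 0) * f (S - A))"
    by (rule sum.mono_neutral_right) (use assms in auto)
  thus "(\<Sum>A\<in>Pow S. shuffle_sign r A (S - A) * (if A = {} then p else 0) * f (S - A)) = p * f S"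
    by simp
  have "(\<Sum>A\<in>Pow S. shuffle_sign r A (S - A) * f A * (if S - A = {} then p else 0)) =
        (\<Sum>A\<in>{S}. shuffle_sign r A (S - A) * f A * (if S - A = {} then p else 0))"
    by (rule sum.mono_neutral_right) (use assms in auto)
  thus "(\<Sum>A\<in>Pow S. shuffle_sign r A (S - A) * f A * (if S - A = {} then p else 0)) = p * f S"
    by simp
qed

lemma gca_ring_simps:
  "f \<in> carrier (gca_ring H r) \<longleftrightarrow> (\<forall>S. f S \<noteq> 0 \<longrightarrow> S \<subseteq> H) \<and> (\<forall>S. f S \<in> qpolys H)"
  "(f \<otimes>\<^bsub>gca_ring H r\<^esub> g) = (\<lambda>S. \<Sum>A\<in>Pow S. shuffle_sign r A (S - A) * f A * g (S - A))"
  "\<one>\<^bsub>gca_ring H r\<^esub> = (\<lambda>S. if S = {} then 1 else 0)"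
  "\<zero>\<^bsub>gca_ring H r\<^esub> = (\<lambda>S. 0)"
  "(f \<oplus>\<^bsub>gca_ring H r\<^esub> g) = (\<lambda>S. f S + g S)"
  by (simp_all add: gca_ring_def)

lemma gca_mult_outside:
  assumes "f \<in> carrier (gca_ring H r)" "g \<in> carrier (gca_ring H r)" "\<not> S \<subseteq> H"
  shows "(f \<otimes>\<^bsub>gca_ring H r\<^esub> g) S = 0"
proof -
  have "f A = 0 \<or> g (S - A) = 0" if "A \<subseteq> S" for A
    using assms that unfolding gca_ring_simps by blast
  hence "shuffle_sign r A (S - A) * f A * g (S - A) = 0" if "A \<in> Pow S" for A
    using that by (metis PowD mult_zero_left mult_zero_right)
  thus ?thesis unfolding gca_ring_simps by (intro sum.neutral ballI)
qed

lemma gca_mult_closed: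
  assumes "f \<in> carrier (gca_ring H r)" "g \<in> carrier (gca_ring H r)"
  shows "f \<otimes>\<^bsub>gca_ring H r\<^esub> g \<in> carrier (gca_ring H r)"
proof -
  have "f A \<in> qpolys H" "g A \<in> qpolys H" for A
    using assms unfolding gca_ring_simps by blast+
  hence "(f \<otimes>\<^bsub>gca_ring H r\<^esub> g) S \<in> qpolys H" for S
    unfolding gca_ring_simps shuffle_sign_def
    by (intro qpolys_sum qpolys_closed(6) qpolys_power qpolys_closed(3))
  thus ?thesis using gca_mult_outside[OF assms]
    by (subst gca_ring_simps(1)) blast
qed

lemma ring_gca_ring:
  assumes "finite H"
  shows "ring (gca_ring H r)"
proof (rule ringI)
  let ?R = "gca_ring H r"
  have fin: "finite S" if "S \<subseteq> H" for S using that assms by (rule finite_subset)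
  show "abelian_group ?R"
  proof (rule abelian_groupI)
    fix f assume f: "f \<in> carrier ?R"
    have "(\<lambda>S. - f S) \<in> carrier ?R" using f unfolding gca_ring_simps
      by (auto intro: qpolys_closed)
    moreover have "(\<lambda>S. - f S) \<oplus>\<^bsub>?R\<^esub> f = \<zero>\<^bsub>?R\<^esub>" by (simp add: gca_ring_simps)
    ultimately show "\<exists>g\<in>carrier ?R. g \<oplus>\<^bsub>?R\<^esub> f = \<zero>\<^bsub>?R\<^esub>" by blast
  next
    fix f g assume "f \<in> carrier ?R" "g \<in> carrier ?R"
    hence "f S \<noteq> 0 \<Longrightarrow> S \<subseteq> H" "g S \<noteq> 0 \<Longrightarrow> S \<subseteq> H" "f S \<in> qpolys H" "g S \<in> qpolys H" for S
      unfolding gca_ring_simps by blast+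
    hence "(f S + g S \<noteq> 0 \<longrightarrow> S \<subseteq> H) \<and> f S + g S \<in> qpolys H" for S
      by (metis add_0 qpolys_closed(5))
    thus "f \<oplus>\<^bsub>?R\<^esub> g \<in> carrier ?R" unfolding gca_ring_simps by blast
  qed (auto simp: gca_ring_simps add_ac qpolys_closed)
  show "monoid ?R"
  proof (rule monoidI)
    fix f g assume "f \<in> carrier ?R" "g \<in> carrier ?R"
    thus "f \<otimes>\<^bsub>?R\<^esub> g \<in> carrier ?R" by (rule gca_mult_closed)
  next
    show "\<one>\<^bsub>?R\<^esub> \<in> carrier ?R" by (auto simp: gca_ring_simps qpolys_closed)
  next
    fix f g h assume fgh: "f \<in> carrier ?R" "g \<in> carrier ?R" "h \<in> carrier ?R"
    show "f \<otimes>\<^bsub>?R\<^esub> g \<otimes>\<^bsub>?R\<^esub> h = f \<otimes>\<^bsub>?R\<^esub> (g \<otimes>\<^bsub>?R\<^esub> h)"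
    proof
      fix S
      show "(f \<otimes>\<^bsub>?R\<^esub> g \<otimes>\<^bsub>?R\<^esub> h) S = (f \<otimes>\<^bsub>?R\<^esub> (g \<otimes>\<^bsub>?R\<^esub> h)) S"
      proof (cases "S \<subseteq> H")
        case True
        thus ?thesis unfolding gca_ring_simps by (intro gca_mult_assoc fin)
      next
        case False
        thus ?thesis using fgh by (simp add: gca_mult_outside gca_mult_closed)
      qed
    qed
  next
    fix f assume f: "f \<in> carrier ?R"
    have one: "\<one>\<^bsub>?R\<^esub> \<in> carrier ?R" by (auto simp: gca_ring_simps qpolys_closed)
    have z: "f S = 0" if "\<not> S \<subseteq> H" for S using f that unfolding gca_ring_simps by blast
    show "\<one>\<^bsub>?R\<^esub> \<otimes>\<^bsub>?R\<^esub> f = f"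
    proof
      fix S show "(\<one>\<^bsub>?R\<^esub> \<otimes>\<^bsub>?R\<^esub> f) S = f S"
      proof (cases "S \<subseteq> H")
        case True
        thus ?thesis unfolding gca_ring_simps using gca_mult_one(1)[OF fin, of S r 1 f] by simp
      qed (simp add: gca_mult_outside one f z)
    qed
    show "f \<otimes>\<^bsub>?R\<^esub> \<one>\<^bsub>?R\<^esub> = f"
    proof
      fix S show "(f \<otimes>\<^bsub>?R\<^esub> \<one>\<^bsub>?R\<^esub>) S = f S"
      proof (cases "S \<subseteq> H")
        case True
        thus ?thesis unfolding gca_ring_simps using gca_mult_one(2)[OF fin, of S r f 1] by simp
      qed (simp add: gca_mult_outside one f z)
    qed
  qed
  fix f g h
  show "(f \<oplus>\<^bsub>?R\<^esub> g) \<otimes>\<^bsub>?R\<^esub> h = f \<otimes>\<^bsub>?R\<^esub> h \<oplus>\<^bsub>?R\<^esub> g \<otimes>\<^bsub>?R\<^esub> h"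
    by (simp add: gca_ring_simps(2,5) algebra_simps sum.distrib)
  show "h \<otimes>\<^bsub>?R\<^esub> (f \<oplus>\<^bsub>?R\<^esub> g) = h \<otimes>\<^bsub>?R\<^esub> f \<oplus>\<^bsub>?R\<^esub> h \<otimes>\<^bsub>?R\<^esub> g"
    by (simp add: gca_ring_simps(2,5) algebra_simps sum.distrib)
qed

text \<open>The defining relations, and the basis element e_S as the ordered product of its
  factors.\<close>

lemma gca_poly_mult:
  "gca_poly p \<otimes>\<^bsub>gca_ring H r\<^esub> f = (\<lambda>S. if finite S then p * f S else 0)" (is "?l = ?g")
  "f \<otimes>\<^bsub>gca_ring H r\<^esub> gca_poly p = (\<lambda>S. if finite S then p * f S else 0)" (is "?r = ?g")
proof -
  have "?l S = ?g S \<and> ?r S = ?g S" for S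
  proof (cases "finite S")
    case True
    thus ?thesis using gca_mult_one[OF True, of r]
      by (simp only: gca_ring_simps gca_poly_def if_True simp_thms)
  qed (simp add: gca_ring_simps)
  thus "?l = ?g" "?r = ?g" by blast+
qed

lemma gca_poly_central: "gca_poly p \<otimes>\<^bsub>gca_ring H r\<^esub> f = f \<otimes>\<^bsub>gca_ring H r\<^esub> gca_poly p"
  by (simp only: gca_poly_mult)

lemma gca_e_mult:
  assumes "finite A" "finite B"
  shows "gca_e A \<otimes>\<^bsub>gca_ring H r\<^esub> gca_e B =
    (if A \<inter> B = {} then gca_poly (shuffle_sign r A B) \<otimes>\<^bsub>gca_ring H r\<^esub> gca_e (A \<union> B)
     else \<zero>\<^bsub>gca_ring H r\<^esub>)"
proof
  fix S
  have "(gca_e A \<otimes>\<^bsub>gca_ring H r\<^esub> gca_e B) S =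
        (if S = A \<union> B \<and> A \<inter> B = {} then shuffle_sign r A B else 0)"
  proof (cases "finite S")
    case False
    hence "S \<noteq> A \<union> B" using assms by blast
    with False show ?thesis by (simp add: gca_ring_simps)
  next
    case True
    have "(gca_e A \<otimes>\<^bsub>gca_ring H r\<^esub> gca_e B) S =
          (\<Sum>U\<in>Pow S. if U = A then shuffle_sign r A (S - A) * gca_e B (S - A) else 0)"
      unfolding gca_ring_simps by (intro sum.cong) (auto simp: gca_e_def)
    also have "\<dots> = (if A \<subseteq> S then shuffle_sign r A (S - A) * gca_e B (S - A) else 0)"
      using True by simp
    also have "\<dots> = (if S = A \<union> B \<and> A \<inter> B = {} then shuffle_sign r A B else 0)"
    proof (cases "A \<subseteq> S \<and> S - A = B")
      case True
      hence "S = A \<union> B \<and> A \<inter> B = {}" by blast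
      with True show ?thesis by (simp add: gca_e_def)
    next
      case False
      hence no: "\<not> (S = A \<union> B \<and> A \<inter> B = {})" by blast
      from False show ?thesis unfolding if_not_P[OF no] by (auto simp: gca_e_def)
    qed
    finally show ?thesis .
  qed
  thus "(gca_e A \<otimes>\<^bsub>gca_ring H r\<^esub> gca_e B) S =
    (if A \<inter> B = {} then gca_poly (shuffle_sign r A B) \<otimes>\<^bsub>gca_ring H r\<^esub> gca_e (A \<union> B)
     else \<zero>\<^bsub>gca_ring H r\<^esub>) S"
    using assms by (simp add: gca_poly_mult gca_ring_simps(4) gca_e_def)
qed

lemma gca_e_square: "gca_e {g} \<otimes>\<^bsub>gca_ring H r\<^esub> gca_e {g} = \<zero>\<^bsub>gca_ring H r\<^esub>"
  by (simp add: gca_e_mult)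

lemma gca_e_anticommute:
  assumes "linear_order_on H r" "g \<in> H" "h \<in> H" "g \<noteq> h"
  shows "gca_e {g} \<otimes>\<^bsub>gca_ring H r\<^esub> gca_e {h} \<oplus>\<^bsub>gca_ring H r\<^esub>
         gca_e {h} \<otimes>\<^bsub>gca_ring H r\<^esub> gca_e {g} = \<zero>\<^bsub>gca_ring H r\<^esub>"
proof -
  have "antisym r" "total_on H r"
    using assms(1) by (auto simp: linear_order_on_def partial_order_on_def)
  hence *: "precedes r g h \<longleftrightarrow> \<not> precedes r h g"
    using assms by (auto simp: precedes_def total_on_def dest: antisymD)
  have "{(a, b) \<in> {x} \<times> {y}. precedes r b a} = (if precedes r y x then {(x, y)} else {})"
    for x y :: 'a by auto
  hence "shuffle_sign r {g} {h} = - shuffle_sign r {h} {g}"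
    unfolding shuffle_sign_def using * by simp
  thus ?thesis using assms(4)
    by (simp add: gca_e_mult gca_poly_mult gca_ring_simps(4,5) insert_commute fun_eq_iff)
qed

lemma gca_e_ordered_product:
  "sorted_wrt (precedes r) gs \<Longrightarrow> antisym r \<Longrightarrow>
   foldr (\<lambda>g f. gca_e {g} \<otimes>\<^bsub>gca_ring H r\<^esub> f) gs \<one>\<^bsub>gca_ring H r\<^esub> = gca_e (set gs)"
proof (induction gs)
  case Nil
  show ?case by (simp add: gca_ring_simps(3) gca_e_def)
next
  case (Cons g gs)
  have *: "\<not> precedes r h g \<and> h \<noteq> g" if "h \<in> set gs" for h
    using Cons.prems that by (auto simp: precedes_def dest: antisymD)
  hence "{(a, b) \<in> {g} \<times> set gs. precedes r b a} = {}" by auto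
  hence "shuffle_sign r {g} (set gs) = 1" by (simp only: shuffle_sign_def) simp
  moreover have "{g} \<inter> set gs = {}" using * by auto
  moreover have "foldr (\<lambda>g f. gca_e {g} \<otimes>\<^bsub>gca_ring H r\<^esub> f) gs \<one>\<^bsub>gca_ring H r\<^esub> = gca_e (set gs)"
    using Cons by simp
  ultimately have "foldr (\<lambda>g f. gca_e {g} \<otimes>\<^bsub>gca_ring H r\<^esub> f) (g # gs) \<one>\<^bsub>gca_ring H r\<^esub> =
      (\<lambda>S. if finite S then gca_e (set (g # gs)) S else 0)"
    by (subst foldr.simps) (simp add: gca_e_mult gca_poly_mult cong: if_cong)
  also have "\<dots> = gca_e (set (g # gs))" by (auto simp: gca_e_def fun_eq_iff)
  finally show ?case .
qed

definition nonnested_monomials :: "'a gorder \<Rightarrow> 'a set \<Rightarrow> 'a rel \<Rightarrow> 'a gca set" where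
  "nonnested_monomials L H r =
     {gca_e S \<otimes>\<^bsub>gca_ring H r\<^esub> gca_x T | S T. S \<subseteq> H \<and> T \<subseteq> H \<and> \<not> nested L H (S \<union> T)}"

definition circuit_boundaries :: "'a gorder \<Rightarrow> 'a set \<Rightarrow> 'a rel \<Rightarrow> 'a list \<Rightarrow> 'a gca set" where
  "circuit_boundaries L H r ps = {gca_boundary r S | S. nested_circuit L H ps S}"

definition nested_ideal :: "'a gorder \<Rightarrow> 'a set \<Rightarrow> 'a rel \<Rightarrow> 'a list \<Rightarrow> 'a gca set" where
  "nested_ideal L H r ps =
     Idl\<^bsub>gca_ring H r\<^esub>
       (nonnested_monomials L H r \<union> circuit_boundaries L H r ps \<union> gca_c L H ` atoms L)"

definition power_relations :: "'a gorder \<Rightarrow> 'a set \<Rightarrow> 'a rel \<Rightarrow> 'a gca set" where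
  "power_relations L H r =
     {gca_e S \<otimes>\<^bsub>gca_ring H r\<^esub> gca_x T \<otimes>\<^bsub>gca_ring H r\<^esub> (gca_c L H g [^]\<^bsub>gca_ring H r\<^esub> k) | S T g k.
        nested L H (S \<union> T) \<and> g \<in> H \<and> S \<inter> T = {} \<and> antichain_in L (S \<union> T) \<and>
        \<Squnion>\<^bsub>L\<^esub>(S \<union> T) \<sqsubset>\<^bsub>L\<^esub> g \<and> k = interval_rank L (\<Squnion>\<^bsub>L\<^esub>(S \<union> T)) g}"


section \<open>Monomial orders and Groebner bases\<close>

text \<open>The pair (S, m) is the monomial e_S times x^m.\<close>

type_synonym 'a gca_monomial = "'a set \<times> ('a \<Rightarrow>\<^sub>0 nat)"

datatype 'a gca_var = XVar 'a | EVar 'a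

fun var_precedes :: "'a rel \<Rightarrow> 'a gca_var \<Rightarrow> 'a gca_var \<Rightarrow> bool" where
  "var_precedes r (XVar g) (XVar h) \<longleftrightarrow> precedes r g h"
| "var_precedes r (EVar g) (EVar h) \<longleftrightarrow> precedes r g h"
| "var_precedes r (XVar g) (EVar h) \<longleftrightarrow> True"
| "var_precedes r (EVar g) (XVar h) \<longleftrightarrow> False"

fun var_exponent :: "'a gca_monomial \<Rightarrow> 'a gca_var \<Rightarrow> nat" where
  "var_exponent (S, m) (XVar g) = Poly_Mapping.lookup m g"
| "var_exponent (S, m) (EVar g) = of_bool (g \<in> S)"

definition monomial_degree :: "'a gca_monomial \<Rightarrow> nat" where
  "monomial_degree M =
     card (fst M) + (\<Sum>g\<in>Poly_Mapping.keys (snd M). Poly_Mapping.lookup (snd M) g)"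

text \<open>Every variable has degree 1 here. Since the ideals considered are bihomogeneous, weighting
  the variables by the cohomological degree would give the same Groebner bases. Ties in degree
  are decided by the largest variable in which the exponents differ.\<close>

definition deglex_less :: "'a rel \<Rightarrow> 'a gca_monomial \<Rightarrow> 'a gca_monomial \<Rightarrow> bool" where
  "deglex_less r M N \<longleftrightarrow>
     monomial_degree M < monomial_degree N \<or>
     (monomial_degree M = monomial_degree N \<and>
      (\<exists>v. var_exponent M v < var_exponent N v \<and>
           (\<forall>w. var_precedes r v w \<longrightarrow> var_exponent M w = var_exponent N w)))"

definition monomial_dvd :: "'a gca_monomial \<Rightarrow> 'a gca_monomial \<Rightarrow> bool" where
  "monomial_dvd M N \<longleftrightarrow> (\<forall>v. var_exponent M v \<le> var_exponent N v)"

definition gca_monomials :: "'a gca \<Rightarrow> 'a gca_monomial set" where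
  "gca_monomials f = {(S, m). Poly_Mapping.lookup (f S) m \<noteq> 0}"

definition initial_monomial :: "'a rel \<Rightarrow> 'a gca \<Rightarrow> 'a gca_monomial" where
  "initial_monomial r f =
     (THE M. M \<in> gca_monomials f \<and> (\<forall>N \<in> gca_monomials f - {M}. deglex_less r N M))"

definition groebner_basis :: "'a set \<Rightarrow> 'a rel \<Rightarrow> 'a gca set \<Rightarrow> 'a gca set \<Rightarrow> bool" where
  "groebner_basis H r B I \<longleftrightarrow> B \<subseteq> I \<and>
     (\<forall>f \<in> I - {\<zero>\<^bsub>gca_ring H r\<^esub>}. \<exists>b \<in> B - {\<zero>\<^bsub>gca_ring H r\<^esub>}.
        monomial_dvd (initial_monomial r b) (initial_monomial r f))"

end

theory Submission
  imports Defs "HOL-Computational_Algebra.Polynomial"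
begin

text \<open>
  Every element of the three families lies in the ideal, so it remains to show that no nonzero f in the ideal
  has a standard initial monomial (S, m), one divisible by no initial monomial of the families. For such an
  (S, m), the set S joined with the support of m is nested and the atoms in S form a set without broken
  circuits. Hence every atom b below the join of the atoms in S has a layer: the last element a of S for which
  b lies below the join of the atoms of S from a on. Mapping e_b to e_a defines a homomorphism of exterior
  algebras which kills the boundaries of circuits, and it sends f to an element whose coefficient at e_S has
  the x-part m as its initial monomial. This reduces the theorem to commutative ideals, one for each nested set.

  These are treated by induction on the non-atoms of H, removing the largest one, p, which is the last one to
  be blown up. As for the Chow ring of a blowup, the ideal corresponds to one of the form
  (J0, t K, q(t)) in A[t], where q is monic and its degree is at least the rank of the interval that
  governs the exponent of x_p. An element of this ideal of degree less than deg q in t has all its coefficients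
  in K, so the induction hypothesis applies to its leading coefficient.
\<close>

section \<open>Geometric lattices\<close>

text \<open>The commutative ideals have to be treated for all nested sets N at once, since N does
  not survive the removal of p: as soon as p occurs, one restricts to the centre, which replaces p
  by all atoms below it. That smaller lattice elements come later in the order makes p, the last
  element of \<open>Q\<close>, minimal in \<open>Q\<close> and its variable dominant, so the leading
  coefficient in t = x_p still carries the initial monomial; it also ensures that eliminating the
  x_a of atoms a by the linear relations never raises a monomial. The polynomial q is a product of
  linear factors over a minimal set of atoms that, together with the atoms of N below p, spans p;
  semimodularity bounds the rank by the size of this set. On the exterior side, the absence of
  broken circuits is what makes the layer of an atom b equal to b or earlier than b. Hence any other
  set A mapped bijectively onto S is larger than S, and its coefficient in f cannot contain a
  monomial of the degree of m. The terms at A therefore do not disturb the initial monomial of the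
  image.\<close>

locale geo =
  fixes L :: "'a gorder" (structure)
  assumes geo: "geometric_lattice L"
begin

sublocale bounded_lattice L
  using geo by (simp add: geometric_lattice_def)

lemma fin_carrier: "finite (carrier L)"
  using geo by (simp add: geometric_lattice_def)

section \<open>Joins of finite subsets, including the empty one\<close>

lemma J_lub:
  assumes "A \<subseteq> carrier L"
  shows "is_lub L (\<Squnion>A) A"
proof (cases "A = {}")
  case True
  have "is_lub L \<bottom> {}"
    by (auto simp: least_def Upper_def intro: bottom_lower)
  then show ?thesis unfolding True Lattice.sup_def by (rule someI)
next
  case False
  then show ?thesis using assms finite_sup_least fin_carrier finite_subset by blast
qed

lemma J_closed: "A \<subseteq> carrier L \<Longrightarrow> \<Squnion>A \<in> carrier L"
  using J_lub[of A] by (auto simp: least_def Upper_def)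

lemma J_upper: "A \<subseteq> carrier L \<Longrightarrow> a \<in> A \<Longrightarrow> a \<sqsubseteq> \<Squnion>A"
  using J_lub[of A] by (auto simp: least_def Upper_def)

lemma J_least: "A \<subseteq> carrier L \<Longrightarrow> z \<in> carrier L \<Longrightarrow> (\<And>a. a \<in> A \<Longrightarrow> a \<sqsubseteq> z) \<Longrightarrow> \<Squnion>A \<sqsubseteq> z"
  using J_lub[of A] by (auto simp: least_def Upper_def)

lemma J_eqI:
  assumes "A \<subseteq> carrier L" "z \<in> carrier L" "\<And>a. a \<in> A \<Longrightarrow> a \<sqsubseteq> z" "z \<sqsubseteq> \<Squnion>A"
  shows "\<Squnion>A = z"
  using assms J_least[of A z] J_closed le_antisym by blast

lemma J_mono: "A \<subseteq> B \<Longrightarrow> B \<subseteq> carrier L \<Longrightarrow> \<Squnion>A \<sqsubseteq> \<Squnion>B"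
  by (rule J_least) (auto intro: J_upper J_closed)

lemma J_in_le: "A \<subseteq> carrier L \<Longrightarrow> z \<in> carrier L \<Longrightarrow> y \<in> A \<Longrightarrow> z \<sqsubseteq> y \<Longrightarrow> z \<sqsubseteq> \<Squnion>A"
  using J_upper[of A y] J_closed[of A] le_trans[of z y "\<Squnion>A"] by blast

lemma J_empty: "\<Squnion>{} = \<bottom>"
  by (rule J_eqI) (auto intro: bottom_lower J_closed)

lemma J_union:
  assumes "A \<subseteq> carrier L" "B \<subseteq> carrier L"
  shows "\<Squnion>(insert (\<Squnion>A) B) = \<Squnion>(A \<union> B)"
proof (rule J_eqI)
  have AB: "A \<union> B \<subseteq> carrier L" using assms by auto
  have c: "insert (\<Squnion>A) B \<subseteq> carrier L" using J_closed assms by auto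
  show "insert (\<Squnion>A) B \<subseteq> carrier L" by (rule c)
  show "\<Squnion>(A \<union> B) \<in> carrier L" by (rule J_closed[OF AB])
  fix a assume "a \<in> insert (\<Squnion>A) B"
  then show "a \<sqsubseteq> \<Squnion>(A \<union> B)" using J_upper[OF AB] J_mono[of A "A \<union> B"] AB by auto
next
  have c: "insert (\<Squnion>A) B \<subseteq> carrier L" using J_closed assms by auto
  show "\<Squnion>(A \<union> B) \<sqsubseteq> \<Squnion>(insert (\<Squnion>A) B)"
  proof (rule J_least[OF _ J_closed[OF c]])
    fix a assume "a \<in> A \<union> B"
    then show "a \<sqsubseteq> \<Squnion>(insert (\<Squnion>A) B)"
      using J_upper[OF c] J_in_le[OF c, of a "\<Squnion>A"] J_upper[OF assms(1)] assms by auto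
  qed (use assms in auto)
qed

lemma J_insert_absorb:
  assumes "insert x B \<subseteq> carrier L" "A \<subseteq> carrier L"
  shows "\<Squnion>(insert (\<Squnion>(insert x A)) B) = \<Squnion>(insert x (A \<union> B))"
  using J_union[of "insert x A" B] assms by simp

lemma atoms_carrier: "atoms L \<subseteq> carrier L"
  by (auto simp: atoms_def)

lemma atom_not_bot: "a \<in> atoms L \<Longrightarrow> \<not> a \<sqsubseteq> \<bottom>"
  using le_antisym bottom_lower by (fastforce simp: atoms_def covers_def lless_def)

lemma atom_below: "a \<in> atoms L \<Longrightarrow> y \<in> carrier L \<Longrightarrow> y \<sqsubseteq> a \<Longrightarrow> y = \<bottom> \<or> y = a"
  using bottom_lower[of y] by (auto simp: atoms_def covers_def lless_def eq_is_equal)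

lemma atomistic_le:
  assumes "x \<in> carrier L" "y \<in> carrier L" "\<And>a. a \<in> atoms L \<Longrightarrow> a \<sqsubseteq> x \<Longrightarrow> a \<sqsubseteq> y"
  shows "x \<sqsubseteq> y"
proof -
  have "x = \<Squnion>{a \<in> atoms L. a \<sqsubseteq> x}" using geo assms by (auto simp: geometric_lattice_def)
  then show ?thesis using J_least[of "{a \<in> atoms L. a \<sqsubseteq> x}" y] assms atoms_carrier by auto
qed

lemma atom_exists:
  assumes "x \<in> carrier L" "x \<noteq> \<bottom>"
  shows "\<exists>a\<in>atoms L. a \<sqsubseteq> x"
  using atomistic_le[of x \<bottom>] assms le_antisym bottom_lower by auto

text \<open>Semimodularity in the form used later. The meet of an atom with an element not above it
  is the bottom, so joining this atom to \<open>y\<close> is a covering step.\<close>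

lemma atom_cover:
  assumes "a \<in> atoms L" "y \<in> carrier L" "\<not> a \<sqsubseteq> y" "z \<in> carrier L" "y \<sqsubseteq> z" "z \<sqsubseteq> \<Squnion>{y, a}"
  shows "z = y \<or> z = \<Squnion>{y, a}"
proof -
  have a: "a \<in> carrier L" using assms atoms_carrier by auto
  have "a \<sqinter> y \<in> carrier L" "a \<sqinter> y \<sqsubseteq> a" "a \<sqinter> y \<sqsubseteq> y"
    using a assms meet_left meet_right by auto
  then have "a \<sqinter> y = \<bottom>" using atom_below[of a "a \<sqinter> y"] assms by auto
  then have "covers L (a \<sqinter> y) a" using assms by (simp add: atoms_def)
  then have "covers L y (a \<squnion> y)" using geo a assms by (auto simp: geometric_lattice_def)
  moreover have "a \<squnion> y = \<Squnion>{y, a}" by (simp add: join_def insert_commute)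
  ultimately show ?thesis using assms by (auto simp: covers_def lless_def eq_is_equal)
qed

section \<open>Chains, spanning sets of atoms and ranks of intervals\<close>

lemma chain_max:
  assumes "finite X" "X \<noteq> {}" "X \<subseteq> carrier L"
    "\<And>c d. c \<in> X \<Longrightarrow> d \<in> X \<Longrightarrow> c \<sqsubseteq> d \<or> d \<sqsubseteq> c"
  shows "\<exists>m\<in>X. \<forall>c\<in>X. c \<sqsubseteq> m"
  using assms
proof (induction X rule: finite_ne_induct)
  case (singleton u)
  then show ?case by auto
next
  case (insert u X)
  have "\<exists>m\<in>X. \<forall>c\<in>X. c \<sqsubseteq> m"
    by (rule insert.IH) (use insert.prems in auto)
  then obtain m where m: "m \<in> X" "\<forall>c\<in>X. c \<sqsubseteq> m" by auto
  have car: "u \<in> carrier L" "m \<in> carrier L" "\<And>c. c \<in> X \<Longrightarrow> c \<in> carrier L"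
    using m insert.prems by auto
  show ?case
  proof (cases "u \<sqsubseteq> m")
    case True
    then show ?thesis using m by auto
  next
    case False
    then have "m \<sqsubseteq> u" using insert.prems(2)[of u m] m by auto
    then have "c \<sqsubseteq> u" if "c \<in> insert u X" for c
      using that m(2) car le_trans[of c m u] by auto
    then show ?thesis by blast
  qed
qed

text \<open>Joining every member of the chain with one atom \<open>b\<close> moves the chain into
  the interval above \<open>\<Squnion>{x, b}\<close>, which the remaining atoms still span. By the
  covering property at most two members become equal, so each atom costs at most one element of the
  chain.\<close>

lemma chain_bound:
  assumes "finite B" "B \<subseteq> atoms L" "x \<in> carrier L" "C \<subseteq> carrier L"
    "\<And>c. c \<in> C \<Longrightarrow> x \<sqsubseteq> c \<and> c \<sqsubseteq> \<Squnion>(insert x B)"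
    "\<And>c d. c \<in> C \<Longrightarrow> d \<in> C \<Longrightarrow> c \<sqsubseteq> d \<or> d \<sqsubseteq> c"
  shows "card C \<le> card B + 1"
  using assms
proof (induction B arbitrary: x C rule: finite_induct)
  case empty
  have "\<Squnion>(insert x {}) = x" by (rule J_eqI) (use empty in \<open>auto intro: J_upper\<close>)
  then have "C \<subseteq> {x}" using empty le_antisym by auto
  then show ?case using card_mono[of "{x}" C] by auto
next
  case (insert b B)
  have b: "b \<in> atoms L" "b \<in> carrier L" and B: "B \<subseteq> carrier L"
    using insert.prems atoms_carrier by auto
  have finC: "finite C" using insert.prems fin_carrier finite_subset by blast
  define y where "y = \<Squnion>{x, b}"
  have y: "y \<in> carrier L" unfolding y_def by (rule J_closed) (use insert.prems b in auto)
  have yB: "\<Squnion>(insert y B) = \<Squnion>(insert x (insert b B))"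
    unfolding y_def using J_insert_absorb[of x B "{b}"] insert.prems b B by auto
  define f where "f c = \<Squnion>{c, b}" for c
  have fcl: "f c \<in> carrier L" "c \<sqsubseteq> f c" "b \<sqsubseteq> f c" if "c \<in> carrier L" for c
    unfolding f_def using that b by (auto intro!: J_closed J_upper)
  have fle: "f c \<sqsubseteq> z" if "c \<in> carrier L" "z \<in> carrier L" "c \<sqsubseteq> z" "b \<sqsubseteq> z" for c z
    unfolding f_def using that b by (intro J_least) auto
  have fmono: "f c \<sqsubseteq> f d" if "c \<in> carrier L" "d \<in> carrier L" "c \<sqsubseteq> d" for c d
    using that fcl[of d] le_trans[of c d "f d"] by (intro fle) auto
  have top: "b \<sqsubseteq> \<Squnion>(insert x (insert b B))" "\<Squnion>(insert x (insert b B)) \<in> carrier L"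
    using insert.prems b B by (auto intro!: J_closed J_upper)
  have xf: "y = f x" unfolding y_def f_def ..
  have 1: "card (f ` C) \<le> card B + 1"
  proof (rule insert.IH[of y])
    show "f ` C \<subseteq> carrier L" using fcl insert.prems by auto
    fix c assume "c \<in> f ` C"
    then obtain c' where c': "c' \<in> C" "c = f c'" by auto
    have c'': "c' \<in> carrier L" using c' insert.prems by auto
    have "y \<sqsubseteq> f c'"
      unfolding xf using insert.prems(4)[OF c'(1)] insert.prems(2) c'' by (intro fmono) auto
    moreover have "f c' \<sqsubseteq> \<Squnion>(insert y B)"
      unfolding yB using insert.prems(4)[OF c'(1)] c'' top by (intro fle) auto
    ultimately show "y \<sqsubseteq> c \<and> c \<sqsubseteq> \<Squnion>(insert y B)"
      using c'(2) by blast
  next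
    fix c d assume "c \<in> f ` C" "d \<in> f ` C"
    then obtain c' d' where cd: "c' \<in> C" "c = f c'" "d' \<in> C" "d = f d'" by auto
    then have "c' \<in> carrier L" "d' \<in> carrier L" using insert.prems(3) by auto
    then show "c \<sqsubseteq> d \<or> d \<sqsubseteq> c"
      using insert.prems(5)[OF cd(1,3)] fmono[of c' d'] fmono[of d' c'] cd(2,4) by blast
  qed (use insert.prems(1) y in auto)
  \<comment> \<open>The only possible collision is between the largest member \<open>c0\<close> not
    above \<open>b\<close> and its own image: the covering property leaves no room for a further
    member between them. If all members are above \<open>b\<close>, then \<open>f\<close> is the
    identity on \<open>C\<close>.\<close>
  have "\<exists>c0. inj_on f (C - {c0})"
  proof (cases "\<exists>c\<in>C. \<not> b \<sqsubseteq> c")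
    case True
    define C1 where "C1 = {c \<in> C. \<not> b \<sqsubseteq> c}"
    have "\<exists>c0\<in>C1. \<forall>c\<in>C1. c \<sqsubseteq> c0"
    proof -
      have sub: "C1 \<subseteq> C" "C1 \<noteq> {}" using True by (auto simp: C1_def)
      have "\<exists>m\<in>C1. \<forall>c\<in>C1. c \<sqsubseteq> m"
      proof (rule chain_max)
        show "finite C1" using sub finC finite_subset by auto
        show "C1 \<noteq> {}" "C1 \<subseteq> carrier L" using sub insert.prems(3) by auto
        fix c d assume "c \<in> C1" "d \<in> C1"
        then show "c \<sqsubseteq> d \<or> d \<sqsubseteq> c" using sub insert.prems(5)[of c d] by blast
      qed
      then show ?thesis by blast
    qed
    then obtain c0 where c0: "c0 \<in> C1" "\<And>c. c \<in> C1 \<Longrightarrow> c \<sqsubseteq> c0" by blast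
    have *: "c = d" if cd: "c \<in> C - {c0}" "d \<in> C - {c0}" "f c = f d" "c \<sqsubseteq> d" for c d
    proof (rule ccontr)
      assume "c \<noteq> d"
      have car: "c \<in> carrier L" "d \<in> carrier L" "c0 \<in> carrier L"
        using cd c0 insert.prems by (auto simp: C1_def)
      have dle: "d \<sqsubseteq> f c" using fcl car cd by auto
      have nb: "\<not> b \<sqsubseteq> c"
      proof
        assume "b \<sqsubseteq> c"
        then have "f c \<sqsubseteq> c" using fle[of c c] car by auto
        then show False using dle cd car \<open>c \<noteq> d\<close> fcl le_antisym le_trans by metis
      qed
      have df: "d = f c" using atom_cover[of b c d] b nb car cd dle \<open>c \<noteq> d\<close> unfolding f_def by auto
      then have bd: "b \<sqsubseteq> d" using fcl car by auto
      have "c \<in> C1" using nb cd by (auto simp: C1_def)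
      then have cc0: "c \<sqsubseteq> c0" using c0 by auto
      have "\<not> d \<sqsubseteq> c0" using bd c0 car b le_trans by (auto simp: C1_def)
      then have "c0 \<sqsubseteq> d" using insert.prems(5)[of c0 d] c0 cd by (auto simp: C1_def)
      then have "c0 = c \<or> c0 = d"
        using atom_cover[of b c c0] b nb car cc0 df unfolding f_def by auto
      then show False using \<open>\<not> d \<sqsubseteq> c0\<close> cd car by auto
    qed
    have "inj_on f (C - {c0})"
    proof (rule inj_onI)
      fix c d assume "c \<in> C - {c0}" "d \<in> C - {c0}" "f c = f d"
      then show "c = d" using *[of c d] *[of d c] insert.prems(5)[of c d] by auto
    qed
    then show ?thesis by blast
  next
    case False
    then have "f c = c" if "c \<in> C" for c
      using that fle[of c c] fcl[of c] insert.prems(3) le_antisym[of c "f c"] by auto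
    then show ?thesis by (metis inj_on_def DiffD1)
  qed
  then obtain c0 where inj: "inj_on f (C - {c0})" by blast
  have "card C \<le> card (C - {c0}) + 1" using finC by (cases "c0 \<in> C") (auto simp: card_Diff_singleton)
  also have "card (C - {c0}) = card (f ` (C - {c0}))" using inj by (simp add: card_image)
  also have "\<dots> \<le> card (f ` C)" using finC by (intro card_mono) auto
  finally show ?case using 1 insert.hyps by simp
qed

lemma interval_mem: "u \<in> \<lbrace>x..y\<rbrace> \<longleftrightarrow> u \<in> carrier L \<and> x \<sqsubseteq> u \<and> u \<sqsubseteq> y"
  by (auto simp: at_least_at_most_def)

lemma rank_set_finite:
  "finite {C. C \<subseteq> \<lbrace>x..y\<rbrace> \<and> C \<noteq> {} \<and> (\<forall>u\<in>C. \<forall>v\<in>C. u \<sqsubseteq> v \<or> v \<sqsubseteq> u)}"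
  by (rule finite_subset[of _ "Pow (carrier L)"]) (use fin_carrier interval_mem in auto)

lemma rank_le_card:
  assumes "B \<subseteq> atoms L" "x \<in> carrier L" "\<Squnion>(insert x B) = p"
  shows "interval_rank L x p \<le> card B"
proof -
  have finB: "finite B" using assms atoms_carrier fin_carrier finite_subset by metis
  have xp: "x \<in> \<lbrace>x..p\<rbrace>" unfolding interval_mem assms(3)[symmetric]
    using assms(1,2) atoms_carrier J_upper[of "insert x B" x] by auto
  have "card C - 1 \<le> card B"
    if "C \<subseteq> \<lbrace>x..p\<rbrace>" "(\<forall>u\<in>C. \<forall>v\<in>C. u \<sqsubseteq> v \<or> v \<sqsubseteq> u)" for C
  proof -
    have "card C \<le> card B + 1"
      by (rule chain_bound[OF finB assms(1,2)]) (use that interval_mem assms(3) in auto)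
    then show ?thesis by auto
  qed
  moreover have "{x} \<in> {C. C \<subseteq> \<lbrace>x..p\<rbrace> \<and> C \<noteq> {} \<and> (\<forall>u\<in>C. \<forall>v\<in>C. u \<sqsubseteq> v \<or> v \<sqsubseteq> u)}"
    using xp assms by auto
  ultimately show ?thesis unfolding interval_rank_def
    by (subst Max_le_iff) (use rank_set_finite in auto)
qed

text \<open>Atoms are added greedily, each one not below the join reached so far. The successive
  joins form a chain with at least one more element than there are atoms, and the rank is the length
  of a longest chain.\<close>

lemma spanning_exists:
  assumes "x \<in> carrier L" "p \<in> carrier L" "x \<sqsubseteq> p"
  shows "\<exists>B\<subseteq>atoms L. (\<forall>b\<in>B. b \<sqsubseteq> p) \<and> \<Squnion>(insert x B) = p \<and> card B \<le> interval_rank L x p"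
proof -
  have "\<exists>B\<subseteq>atoms L. finite B \<and> (\<forall>b\<in>B. b \<sqsubseteq> p) \<and> \<Squnion>(insert x B) = p \<and>
     (\<exists>C\<subseteq>\<lbrace>x..p\<rbrace>. (\<forall>u\<in>C. \<forall>v\<in>C. u \<sqsubseteq> v \<or> v \<sqsubseteq> u) \<and> card B + 1 \<le> card C)"
    using assms(1,3)
  proof (induction "card {y \<in> carrier L. x \<sqsubseteq> y}" arbitrary: x rule: less_induct)
    case less
    show ?case
    proof (cases "x = p")
      case True
      have "\<Squnion>{p} = p" by (rule J_eqI) (use assms in \<open>auto intro: J_upper\<close>)
      then show ?thesis
        using True assms by (intro exI[of _ "{}"]) (auto intro!: exI[of _ "{p}"] simp: interval_mem)
    next
      case False
      then obtain b where b: "b \<in> atoms L" "b \<sqsubseteq> p" "\<not> b \<sqsubseteq> x"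
        using atomistic_le[of p x] assms less le_antisym by blast
      have bc: "b \<in> carrier L" using b atoms_carrier by auto
      define y where "y = \<Squnion>{x, b}"
      have y: "y \<in> carrier L" "x \<sqsubseteq> y" "b \<sqsubseteq> y" "y \<sqsubseteq> p"
        unfolding y_def using less bc b assms by (auto intro!: J_closed J_upper J_least)
      have nyx: "\<not> y \<sqsubseteq> x" using y b(3) less.prems(1) bc le_trans[of b y x] by blast
      have sub: "{z \<in> carrier L. y \<sqsubseteq> z} \<subseteq> {z \<in> carrier L. x \<sqsubseteq> z} - {x}"
        using y nyx less.prems(1) le_trans[of x y] by blast
      have "card {z \<in> carrier L. y \<sqsubseteq> z} < card {z \<in> carrier L. x \<sqsubseteq> z}"
        by (rule psubset_card_mono) (use sub less.prems fin_carrier in auto)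
      from less(1)[OF this y(1,4)] obtain B C where BC:
        "B \<subseteq> atoms L" "finite B" "\<forall>b\<in>B. b \<sqsubseteq> p" "\<Squnion>(insert y B) = p" "C \<subseteq> \<lbrace>y..p\<rbrace>"
        "\<forall>u\<in>C. \<forall>v\<in>C. u \<sqsubseteq> v \<or> v \<sqsubseteq> u" "card B + 1 \<le> card C" by blast
      have finC: "finite C" using BC(5) interval_mem fin_carrier by (meson finite_subset subsetI)
      have Cp: "c \<in> carrier L \<and> y \<sqsubseteq> c \<and> c \<sqsubseteq> p \<and> x \<sqsubseteq> c" if "c \<in> C" for c
        using BC(5) that interval_mem[of c y p] y less.prems(1) le_trans[of x y c] by blast
      have "x \<notin> C" using Cp nyx by blast
      then have "card (insert x C) = card C + 1" using finC by auto
      moreover have "insert x C \<subseteq> \<lbrace>x..p\<rbrace>" using Cp less.prems by (auto simp: interval_mem)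
      moreover have "\<forall>u\<in>insert x C. \<forall>v\<in>insert x C. u \<sqsubseteq> v \<or> v \<sqsubseteq> u"
        using Cp BC(6) less.prems by auto
      moreover have "card (insert b B) \<le> card B + 1" using BC(2) by (simp add: card_insert_if)
      moreover have "\<Squnion>(insert x (insert b B)) = p"
        using J_insert_absorb[of x B "{b}"] BC(1,4) less.prems bc atoms_carrier unfolding y_def by auto
      ultimately show ?thesis using BC b
        by (intro exI[of _ "insert b B"]) (auto intro!: exI[of _ "insert x C"])
    qed
  qed
  then obtain B C where BC: "B \<subseteq> atoms L" "\<forall>b\<in>B. b \<sqsubseteq> p" "\<Squnion>(insert x B) = p"
    "C \<subseteq> \<lbrace>x..p\<rbrace>" "\<forall>u\<in>C. \<forall>v\<in>C. u \<sqsubseteq> v \<or> v \<sqsubseteq> u" "card B + 1 \<le> card C" by blast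
  then have "C \<noteq> {}" by auto
  then have "card C - 1 \<le> interval_rank L x p" unfolding interval_rank_def
    using BC by (intro Max_ge finite_imageI rank_set_finite imageI) auto
  then show ?thesis using BC by (intro exI[of _ B]) auto
qed

text \<open>For an atom \<open>a\<close>, the power relation with empty \<open>S\<close> and
  \<open>T\<close> thus has exponent at most 1. This later excludes the variables of atoms from
  standard monomials.\<close>

lemma atom_rank: "a \<in> atoms L \<Longrightarrow> interval_rank L \<bottom> a \<le> 1"
proof -
  assume a: "a \<in> atoms L"
  have "\<Squnion>{\<bottom>, a} = a" by (rule J_eqI) (use a atoms_carrier in \<open>auto intro: J_upper bottom_lower\<close>)
  then show ?thesis using rank_le_card[of "{a}" \<bottom> a] a by auto
qed

end

section \<open>Building sets and nested sets\<close>

context geo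
begin

section \<open>Maximal elements and antichains\<close>

lemma maximal_exists:
  assumes "X \<subseteq> carrier L" "y \<in> X"
  shows "\<exists>z\<in>X. y \<sqsubseteq> z \<and> (\<forall>w\<in>X. z \<sqsubseteq> w \<longrightarrow> w = z)"
proof -
  \<comment> \<open>The number of elements below grows strictly along the order, so an element
    maximising it is maximal.\<close>
  define f where "f z = card {w \<in> carrier L. w \<sqsubseteq> z}" for z
  have "\<exists>z. (z \<in> X \<and> y \<sqsubseteq> z) \<and> (\<forall>w. w \<in> X \<and> y \<sqsubseteq> w \<longrightarrow> f w \<le> f z)"
  proof (rule ex_has_greatest_nat[of "\<lambda>z. z \<in> X \<and> y \<sqsubseteq> z" y f "Suc (card (carrier L))"])
    show "y \<in> X \<and> y \<sqsubseteq> y" using assms by auto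
    show "\<forall>w. w \<in> X \<and> y \<sqsubseteq> w \<longrightarrow> f w < Suc (card (carrier L))"
      unfolding f_def using fin_carrier by (auto simp: less_Suc_eq_le intro!: card_mono)
  qed
  then obtain z where z: "z \<in> X" "y \<sqsubseteq> z" "\<And>w. w \<in> X \<Longrightarrow> y \<sqsubseteq> w \<Longrightarrow> f w \<le> f z" by auto
  have "w = z" if w: "w \<in> X" "z \<sqsubseteq> w" for w
  proof (rule ccontr)
    assume "w \<noteq> z"
    have car: "w \<in> carrier L" "z \<in> carrier L" "y \<in> carrier L" using assms w z by auto
    have "\<not> w \<sqsubseteq> z" using \<open>w \<noteq> z\<close> w car le_antisym[of w z] by auto
    moreover have "{u \<in> carrier L. u \<sqsubseteq> z} \<subseteq> {u \<in> carrier L. u \<sqsubseteq> w}"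
      using w car le_trans[of _ z w] by auto
    ultimately have "{u \<in> carrier L. u \<sqsubseteq> z} \<subset> {u \<in> carrier L. u \<sqsubseteq> w}" using car by auto
    then have "f z < f w" unfolding f_def using fin_carrier by (intro psubset_card_mono) auto
    moreover have "y \<sqsubseteq> w" using z w car le_trans[of y z w] by auto
    ultimately show False using z(3)[OF w(1)] by auto
  qed
  then show ?thesis using z by auto
qed

text \<open>Nested sets and power relations are phrased with antichains; passing to the maximal
  elements produces an antichain with the same join.\<close>

definition maxel :: "'a set \<Rightarrow> 'a set" where
  "maxel X = {x \<in> X. \<forall>w\<in>X. x \<sqsubseteq> w \<longrightarrow> w = x}"

lemma maxel_sub: "maxel X \<subseteq> X"
  by (auto simp: maxel_def)

lemma maxel_antichain: "antichain_in L (maxel X)"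
  by (auto simp: maxel_def antichain_in_def)

lemma maxel_join:
  assumes "X \<subseteq> carrier L"
  shows "\<Squnion>(maxel X) = \<Squnion>X"
proof -
  have M: "maxel X \<subseteq> carrier L" using assms maxel_sub by auto
  show ?thesis
  proof (rule J_eqI[OF M J_closed[OF assms]])
    fix a assume "a \<in> maxel X" then show "a \<sqsubseteq> \<Squnion>X" by (auto simp: maxel_def intro: J_upper[OF assms])
  next
    show "\<Squnion>X \<sqsubseteq> \<Squnion>(maxel X)"
    proof (rule J_least[OF assms J_closed[OF M]])
      fix a assume "a \<in> X"
      then obtain z where "z \<in> maxel X" "a \<sqsubseteq> z"
        using maximal_exists[OF assms, of a] unfolding maxel_def by blast
      then show "a \<sqsubseteq> \<Squnion>(maxel X)" using J_in_le[OF M, of a z] assms \<open>a \<in> X\<close> by auto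
    qed
  qed
qed

end

locale building = geo +
  fixes G :: "'a set"
  assumes bset: "building_set L G" and atoms_G: "atoms L \<subseteq> G"
begin

section \<open>Product decompositions given by a building set\<close>

lemma G_carrier: "G \<subseteq> carrier L"
  using bset by (auto simp: building_set_def positive_part_def)

lemma G_pos: "g \<in> G \<Longrightarrow> \<not> g \<sqsubseteq> \<bottom>"
proof -
  assume g: "g \<in> G"
  then have "g \<in> carrier L" "g \<noteq> \<bottom>" using bset by (auto simp: building_set_def positive_part_def)
  then show ?thesis using le_antisym[of g \<bottom>] bottom_lower by auto
qed

lemma max_above:
  assumes "x \<in> carrier L" "g \<in> G" "g \<sqsubseteq> x"
  shows "\<exists>z\<in>maximal_below L G x. g \<sqsubseteq> z"
proof -
  have "\<exists>z\<in>{z \<in> G. z \<sqsubseteq> x}. g \<sqsubseteq> z \<and> (\<forall>w\<in>{z \<in> G. z \<sqsubseteq> x}. z \<sqsubseteq> w \<longrightarrow> w = z)"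
    by (rule maximal_exists) (use assms G_carrier in auto)
  then show ?thesis by (auto simp: maximal_below_def)
qed

text \<open>\<open>c x v\<close> is the component of \<open>x\<close> in the factor below
  \<open>v\<close> of the interval below \<open>y\<close>. The clauses give the range of the
  components, the order, the members of \<open>maximal_below\<close> as unit vectors, and
  surjectivity.\<close>

definition coordinates :: "'a \<Rightarrow> ('a \<Rightarrow> 'a \<Rightarrow> 'a) \<Rightarrow> bool" where
  "coordinates y c \<longleftrightarrow>
     (\<forall>x v. x \<in> carrier L \<longrightarrow> x \<sqsubseteq> y \<longrightarrow> v \<in> maximal_below L G y \<longrightarrow> c x v \<in> carrier L \<and> c x v \<sqsubseteq> v) \<and>
     (\<forall>x x'. x \<in> carrier L \<longrightarrow> x' \<in> carrier L \<longrightarrow> x \<sqsubseteq> y \<longrightarrow> x' \<sqsubseteq> y \<longrightarrow>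
       (x \<sqsubseteq> x' \<longleftrightarrow> (\<forall>v\<in>maximal_below L G y. c x v \<sqsubseteq> c x' v))) \<and>
     (\<forall>z v. z \<in> maximal_below L G y \<longrightarrow> v \<in> maximal_below L G y \<longrightarrow>
       c z v = (if v = z then z else \<bottom>)) \<and>
     (\<forall>u. (\<forall>v. v \<in> maximal_below L G y \<longrightarrow> u v \<in> carrier L \<and> u v \<sqsubseteq> v) \<longrightarrow>
       (\<exists>x\<in>carrier L. x \<sqsubseteq> y \<and> (\<forall>v\<in>maximal_below L G y. c x v = u v)))"

lemma coordinatesD:
  assumes "coordinates y c"
  shows "\<And>x v. x \<in> carrier L \<Longrightarrow> x \<sqsubseteq> y \<Longrightarrow> v \<in> maximal_below L G y \<Longrightarrow> c x v \<in> carrier L \<and> c x v \<sqsubseteq> v"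
    "\<And>x x'. x \<in> carrier L \<Longrightarrow> x' \<in> carrier L \<Longrightarrow> x \<sqsubseteq> y \<Longrightarrow> x' \<sqsubseteq> y \<Longrightarrow>
       x \<sqsubseteq> x' \<longleftrightarrow> (\<forall>v\<in>maximal_below L G y. c x v \<sqsubseteq> c x' v)"
    "\<And>z v. z \<in> maximal_below L G y \<Longrightarrow> v \<in> maximal_below L G y \<Longrightarrow> c z v = (if v = z then z else \<bottom>)"
    "\<And>u. (\<And>v. v \<in> maximal_below L G y \<Longrightarrow> u v \<in> carrier L \<and> u v \<sqsubseteq> v) \<Longrightarrow>
       \<exists>x\<in>carrier L. x \<sqsubseteq> y \<and> (\<forall>v\<in>maximal_below L G y. c x v = u v)"
  subgoal using assms[unfolded coordinates_def, THEN conjunct1] by blast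
  subgoal using assms[unfolded coordinates_def, THEN conjunct2, THEN conjunct1] by blast
  subgoal using assms[unfolded coordinates_def, THEN conjunct2, THEN conjunct2, THEN conjunct1] by blast
  subgoal using assms[unfolded coordinates_def, THEN conjunct2, THEN conjunct2, THEN conjunct2] by blast
  done

lemma product_coordinates:
  assumes "y \<in> carrier L" "y \<noteq> \<bottom>"
  shows "\<exists>c. coordinates y c"
proof -
  define M where "M = maximal_below L G y"
  define D where "D = (\<Pi>\<^sub>E v\<in>M. \<lbrace>\<bottom>..v\<rbrace>)"
  have "y \<in> positive_part L" using assms by (auto simp: positive_part_def)
  note bset[unfolded building_set_def Let_def, THEN conjunct2, THEN conjunct2, THEN bspec, OF this,
      folded M_def, folded D_def]
  then obtain \<phi> where \<phi>: "bij_betw \<phi> D \<lbrace>\<bottom>..y\<rbrace> \<and>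
      (\<forall>u\<in>D. \<forall>v\<in>D. \<phi> u \<sqsubseteq> \<phi> v \<longleftrightarrow> (\<forall>w\<in>M. u w \<sqsubseteq> v w)) \<and>
      (\<forall>z\<in>M. \<phi> (\<lambda>w\<in>M. if w = z then z else \<bottom>) = z)" by (elim exE)
  have bij: "bij_betw \<phi> D \<lbrace>\<bottom>..y\<rbrace>" using \<phi> by simp
  have ord: "\<phi> u \<sqsubseteq> \<phi> v \<longleftrightarrow> (\<forall>w\<in>M. u w \<sqsubseteq> v w)" if "u \<in> D" "v \<in> D" for u v
    using \<phi> that by simp
  have unit: "\<phi> (\<lambda>w\<in>M. if w = z then z else \<bottom>) = z" if "z \<in> M" for z
    using \<phi> that by simp
  have Mc: "v \<in> carrier L" if "v \<in> M" for v
    using that G_carrier by (auto simp: M_def maximal_below_def)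
  define c where "c = inv_into D \<phi>"
  have cD: "c x \<in> D" "\<phi> (c x) = x" if "x \<in> carrier L" "x \<sqsubseteq> y" for x
  proof -
    have "x \<in> \<phi> ` D" using bij that by (auto simp: bij_betw_def interval_mem intro: bottom_lower)
    then show "c x \<in> D" "\<phi> (c x) = x" unfolding c_def by (rule inv_into_into, rule f_inv_into_f)
  qed
  have cinv: "c (\<phi> u) = u" if "u \<in> D" for u
    unfolding c_def using bij that by (auto simp: bij_betw_def)
  have "coordinates y c" unfolding coordinates_def M_def[symmetric]
  proof (intro conjI allI impI)
    fix x v assume "x \<in> carrier L" "x \<sqsubseteq> y" "v \<in> M"
    then have "c x v \<in> \<lbrace>\<bottom>..v\<rbrace>" using cD(1)[of x] by (auto simp: D_def)
    then show "c x v \<in> carrier L" "c x v \<sqsubseteq> v" by (auto simp: interval_mem)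
  next
    fix x x' assume x: "x \<in> carrier L" "x' \<in> carrier L" "x \<sqsubseteq> y" "x' \<sqsubseteq> y"
    show "x \<sqsubseteq> x' \<longleftrightarrow> (\<forall>v\<in>M. c x v \<sqsubseteq> c x' v)"
      using ord[OF cD(1)[OF x(1,3)] cD(1)[OF x(2,4)]] cD(2)[OF x(1,3)] cD(2)[OF x(2,4)] by simp
  next
    fix z v assume zv: "z \<in> M" "v \<in> M"
    have "(\<lambda>w\<in>M. if w = z then z else \<bottom>) \<in> D"
      unfolding D_def by (rule restrict_PiE_iff[THEN iffD2]) (use Mc zv in \<open>auto simp: interval_mem\<close>)
    then have "c z = (\<lambda>w\<in>M. if w = z then z else \<bottom>)" using cinv unit[OF zv(1)] by metis
    then show "c z v = (if v = z then z else \<bottom>)" using zv by simp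
  next
    fix u assume u: "\<forall>v. v \<in> M \<longrightarrow> u v \<in> carrier L \<and> u v \<sqsubseteq> v"
    have D: "restrict u M \<in> D"
      unfolding D_def by (rule restrict_PiE_iff[THEN iffD2]) (use u in \<open>auto simp: interval_mem intro: bottom_lower\<close>)
    then have "\<phi> (restrict u M) \<in> \<lbrace>\<bottom>..y\<rbrace>" using bij by (auto simp: bij_betw_def)
    then show "\<exists>x\<in>carrier L. x \<sqsubseteq> y \<and> (\<forall>v\<in>M. c x v = u v)"
      using cinv[OF D] by (intro bexI[of _ "\<phi> (restrict u M)"]) (auto simp: interval_mem)
  qed
  then show ?thesis by (rule exI[of _ c])
qed

text \<open>Let \<open>u\<close> have at \<open>z\<close> the component of the join of those
  elements of \<open>X\<close> that lie below \<open>z\<close>, and the maximal component everywhere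
  else. An element of \<open>X\<close> has at most one nonzero component, so \<open>u\<close> bounds
  all of \<open>X\<close> and hence \<open>z\<close>; comparing the components at \<open>z\<close>
  gives the claim.\<close>

lemma factor_join:
  assumes "X \<subseteq> G" "z \<in> maximal_below L G (\<Squnion>X)"
  shows "\<Squnion>{x \<in> X. x \<sqsubseteq> z} = z"
proof -
  define y where "y = \<Squnion>X"
  define M where "M = maximal_below L G y"
  have Xc: "X \<subseteq> carrier L" using assms G_carrier by auto
  have yc: "y \<in> carrier L" unfolding y_def by (rule J_closed[OF Xc])
  have z: "z \<in> G" "z \<sqsubseteq> y" "z \<in> M" "z \<in> carrier L"
    using assms G_carrier by (auto simp: y_def M_def maximal_below_def)
  have y0: "y \<noteq> \<bottom>" using z G_pos by auto
  have Mle: "v \<in> carrier L \<and> v \<sqsubseteq> y" if "v \<in> M" for v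
    using that G_carrier by (auto simp: M_def maximal_below_def)
  obtain c where "coordinates y c" using product_coordinates[OF yc y0] ..
  note c = coordinatesD[OF this, folded M_def]
  define w where "w = \<Squnion>{x \<in> X. x \<sqsubseteq> z}"
  have Wc: "{x \<in> X. x \<sqsubseteq> z} \<subseteq> carrier L" using Xc by auto
  have w: "w \<in> carrier L" "w \<sqsubseteq> z" unfolding w_def using J_closed[OF Wc] J_least[OF Wc z(4)] by auto
  then have wy: "w \<sqsubseteq> y" using le_trans[of w z y] z yc by auto
  obtain u where u: "u \<in> carrier L" "u \<sqsubseteq> y" "\<And>v. v \<in> M \<Longrightarrow> c u v = (if v = z then c w z else v)"
  proof -
    have "(if v = z then c w z else v) \<in> carrier L \<and> (if v = z then c w z else v) \<sqsubseteq> v" if "v \<in> M" for v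
      using c(1)[OF w(1) wy z(3)] Mle[OF that] by auto
    from c(4)[of "\<lambda>v. if v = z then c w z else v", OF this] show ?thesis using that by auto
  qed
  have "x \<sqsubseteq> u" if x: "x \<in> X" for x
  proof -
    have xc: "x \<in> carrier L" "x \<sqsubseteq> y" using x Xc J_upper[OF Xc x] y_def by auto
    obtain z' where z': "z' \<in> M" "x \<sqsubseteq> z'"
      using max_above[OF yc, of x] x assms xc by (auto simp: M_def)
    have "c x v \<sqsubseteq> c u v" if v: "v \<in> M" for v
    proof (cases "v = z")
      case False
      then show ?thesis using u(3)[OF v] c(1)[OF xc v] by auto
    next
      case True
      show ?thesis
      proof (cases "z' = z")
        case True
        then have "x \<sqsubseteq> w" unfolding w_def using J_upper[OF Wc] x z' by auto
        then show ?thesis using c(2)[OF xc(1) w(1) xc(2) wy] \<open>v = z\<close> v u(3)[OF v] by auto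
      next
        case False
        have "c x v \<sqsubseteq> c z' v" using c(2)[of x z'] xc z' Mle v by auto
        then have "c x v \<sqsubseteq> \<bottom>" using c(3)[OF z'(1) v] False True by auto
        moreover have "c u v \<in> carrier L" using c(1)[OF u(1,2) v] by auto
        ultimately show ?thesis using le_trans[of "c x v" \<bottom> "c u v"] c(1)[OF xc v] by auto
      qed
    qed
    then show ?thesis using c(2)[OF xc(1) u(1) xc(2) u(2)] by auto
  qed
  then have "y \<sqsubseteq> u" unfolding y_def using J_least[OF Xc u(1)] by auto
  then have "z \<sqsubseteq> u" using le_trans[of z y u] z yc u by auto
  then have "c z z \<sqsubseteq> c u z" using c(2)[of z u] z u by auto
  then have zz: "z \<sqsubseteq> c w z" using c(3)[OF z(3,3)] u(3)[OF z(3)] by auto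
  have "c z v \<sqsubseteq> c w v" if v: "v \<in> M" for v
    using c(3)[OF z(3) v] zz c(1)[OF w(1) wy v] by (auto intro: bottom_lower)
  then have "z \<sqsubseteq> w" using c(2)[of z w] z w wy by auto
  then show ?thesis using w le_antisym[of w z] z by (auto simp: w_def)
qed

text \<open>The later arguments use the building set through this lemma and
  \<open>join_in_G\<close>. A bound by a join is improved to a bound by a member of
  \<open>G\<close>, which upward closure then puts into \<open>Q\<close>.\<close>

lemma factor:
  assumes "X \<subseteq> G" "g \<in> G" "g \<sqsubseteq> \<Squnion>X"
  obtains z where "z \<in> G" "g \<sqsubseteq> z" "\<Squnion>{x \<in> X. x \<sqsubseteq> z} = z"
proof -
  have Xc: "X \<subseteq> carrier L" using assms G_carrier by auto
  obtain z where z: "z \<in> maximal_below L G (\<Squnion>X)" "g \<sqsubseteq> z"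
    using max_above[OF J_closed[OF Xc] assms(2,3)] by auto
  then show ?thesis using that[of z] factor_join[OF assms(1) z(1)] by (auto simp: maximal_below_def)
qed

text \<open>If the two elements lay in different factors, all components of a common atom would
  vanish.\<close>

lemma join_in_G:
  assumes "g \<in> G" "h \<in> G" "a \<in> atoms L" "a \<sqsubseteq> g" "a \<sqsubseteq> h"
  shows "\<Squnion>{g, h} \<in> G"
proof -
  define y where "y = \<Squnion>{g, h}"
  define M where "M = maximal_below L G y"
  have gh: "{g, h} \<subseteq> carrier L" using assms G_carrier by auto
  have yc: "y \<in> carrier L" "g \<sqsubseteq> y" "h \<sqsubseteq> y" unfolding y_def using J_closed[OF gh] J_upper[OF gh] by auto
  have ac: "a \<in> carrier L" using assms atoms_carrier by auto
  have ay: "a \<sqsubseteq> y" using le_trans[of a g y] assms gh yc ac by auto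
  have y0: "y \<noteq> \<bottom>" using ay atom_not_bot assms by auto
  have Mle: "v \<in> carrier L \<and> v \<sqsubseteq> y \<and> v \<in> G" if "v \<in> M" for v
    using that G_carrier by (auto simp: M_def maximal_below_def)
  obtain c where "coordinates y c" using product_coordinates[OF yc(1) y0] ..
  note c = coordinatesD[OF this, folded M_def]
  obtain z1 where z1: "z1 \<in> M" "g \<sqsubseteq> z1" using max_above[OF yc(1) assms(1) yc(2)] by (auto simp: M_def)
  obtain z2 where z2: "z2 \<in> M" "h \<sqsubseteq> z2" using max_above[OF yc(1) assms(2) yc(3)] by (auto simp: M_def)
  have az: "a \<sqsubseteq> z1" "a \<sqsubseteq> z2"
    using le_trans[of a g z1] le_trans[of a h z2] assms(4,5) gh z1 z2 Mle ac by auto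
  have "z1 = z2"
  proof (rule ccontr)
    assume ne: "z1 \<noteq> z2"
    have "c a v \<sqsubseteq> c \<bottom> v" if v: "v \<in> M" for v
    proof -
      have "c a v \<sqsubseteq> c z1 v" "c a v \<sqsubseteq> c z2 v"
        using c(2)[of a z1] c(2)[of a z2] az ac ay z1 z2 Mle v by auto
      then have "c a v \<sqsubseteq> \<bottom>" using c(3)[OF z1(1) v] c(3)[OF z2(1) v] ne by (auto split: if_splits)
      moreover have "c \<bottom> v \<in> carrier L" using c(1)[of \<bottom> v] v yc by auto
      ultimately show ?thesis using le_trans[of "c a v" \<bottom> "c \<bottom> v"] c(1)[OF ac ay v] by auto
    qed
    then have "a \<sqsubseteq> \<bottom>" using c(2)[of a \<bottom>] ac ay yc by auto
    then show False using assms atom_not_bot by auto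
  qed
  then have "y \<sqsubseteq> z1" unfolding y_def using J_least[OF gh, of z1] z1 z2 Mle by auto
  then have "y = z1" using le_antisym[of y z1] yc Mle[OF z1(1)] by auto
  then show ?thesis using Mle[OF z1(1)] y_def by auto
qed

text \<open>The shape of the set of non-atoms of a partial building set. It is preserved when a
  minimal element is removed, which is the step of the induction.\<close>

definition upper :: "'a set \<Rightarrow> bool" where
  "upper Q \<longleftrightarrow> Q \<subseteq> G \<and> Q \<inter> atoms L = {} \<and> (\<forall>p\<in>Q. \<forall>g\<in>G. p \<sqsubseteq> g \<longrightarrow> g \<in> Q)"

text \<open>By nested_iff, this is the negation of nestedness for subsets of H; unlike the definition, it does
  not refer to antichains.\<close>

definition violates :: "'a set \<Rightarrow> 'a set \<Rightarrow> bool" where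
  "violates Q S \<longleftrightarrow> (\<exists>h\<in>Q. h \<sqsubseteq> \<Squnion>{s \<in> S. \<not> h \<sqsubseteq> s})"

section \<open>Violations, nested sets and the effect of removing a minimal element\<close>

lemma not_le_atom:
  assumes "upper Q" "h \<in> Q" "a \<in> atoms L"
  shows "\<not> h \<sqsubseteq> a"
proof
  assume "h \<sqsubseteq> a"
  moreover have "h \<in> G" "h \<notin> atoms L" using assms(1,2) by (auto simp: upper_def)
  ultimately have "h = \<bottom>" using atom_below[OF assms(3)] assms(3) G_carrier by blast
  then show False using G_pos[OF \<open>h \<in> G\<close>] by simp
qed

lemma violates_mono:
  assumes "violates Q S" "Q \<subseteq> Q'" "S \<subseteq> S'" "S' \<subseteq> carrier L" "Q \<subseteq> carrier L"
  shows "violates Q' S'"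
proof -
  obtain h where h: "h \<in> Q" "h \<sqsubseteq> \<Squnion>{s \<in> S. \<not> h \<sqsubseteq> s}" using assms(1) by (auto simp: violates_def)
  have c: "{s \<in> S. \<not> h \<sqsubseteq> s} \<subseteq> carrier L" "{s \<in> S'. \<not> h \<sqsubseteq> s} \<subseteq> carrier L" "h \<in> carrier L"
    using assms h by auto
  have "\<Squnion>{s \<in> S. \<not> h \<sqsubseteq> s} \<sqsubseteq> \<Squnion>{s \<in> S'. \<not> h \<sqsubseteq> s}" by (rule J_mono) (use assms in auto)
  then have "h \<sqsubseteq> \<Squnion>{s \<in> S'. \<not> h \<sqsubseteq> s}"
    using le_trans[OF h(2) _ c(3) J_closed[OF c(1)] J_closed[OF c(2)]] by blast
  then show ?thesis using h assms by (auto simp: violates_def)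
qed

text \<open>Elements lying above no member of \<open>Q\<close> are never discarded by the condition
  \<open>\<not> h \<sqsubseteq> s\<close>, so only the join of \<open>Y\<close> matters.\<close>

lemma violates_replace:
  assumes "X \<subseteq> carrier L" "Y \<subseteq> carrier L" "R \<subseteq> carrier L" "Q \<subseteq> carrier L" "\<Squnion>X \<sqsubseteq> \<Squnion>Y"
    "\<And>h y. h \<in> Q \<Longrightarrow> y \<in> Y \<Longrightarrow> \<not> h \<sqsubseteq> y" "violates Q (X \<union> R)"
  shows "violates Q (Y \<union> R)"
proof -
  obtain h where h: "h \<in> Q" "h \<sqsubseteq> \<Squnion>{s \<in> X \<union> R. \<not> h \<sqsubseteq> s}" using assms(7) by (auto simp: violates_def)
  have c: "{s \<in> X \<union> R. \<not> h \<sqsubseteq> s} \<subseteq> carrier L" "{s \<in> Y \<union> R. \<not> h \<sqsubseteq> s} \<subseteq> carrier L" using assms by auto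
  have "\<Squnion>{s \<in> X \<union> R. \<not> h \<sqsubseteq> s} \<sqsubseteq> \<Squnion>{s \<in> Y \<union> R. \<not> h \<sqsubseteq> s}"
  proof (rule J_least[OF c(1) J_closed[OF c(2)]])
    fix s assume s: "s \<in> {s \<in> X \<union> R. \<not> h \<sqsubseteq> s}"
    show "s \<sqsubseteq> \<Squnion>{s \<in> Y \<union> R. \<not> h \<sqsubseteq> s}"
    proof (cases "s \<in> R")
      case True
      then show ?thesis using J_upper[OF c(2)] s by auto
    next
      case False
      then have sX: "s \<in> X" using s by auto
      have "\<Squnion>Y \<sqsubseteq> \<Squnion>{s \<in> Y \<union> R. \<not> h \<sqsubseteq> s}" by (rule J_mono) (use assms(6) h c in auto)
      then have "\<Squnion>X \<sqsubseteq> \<Squnion>{s \<in> Y \<union> R. \<not> h \<sqsubseteq> s}"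
        using assms(5) le_trans[of "\<Squnion>X" "\<Squnion>Y"] J_closed assms(1,2) c(2) by auto
      then show ?thesis using J_upper[OF assms(1) sX] le_trans[of s "\<Squnion>X"] J_closed assms(1) c(2) sX by auto
    qed
  qed
  then have "h \<sqsubseteq> \<Squnion>{s \<in> Y \<union> R. \<not> h \<sqsubseteq> s}"
    using le_trans[OF h(2) _ _ J_closed[OF c(1)] J_closed[OF c(2)]] h(1) assms(4) by blast
  then show ?thesis using h by (auto simp: violates_def)
qed

lemma violates_atoms:
  assumes "upper Q" "X \<subseteq> atoms L" "Y \<subseteq> atoms L" "R \<subseteq> carrier L" "\<Squnion>X \<sqsubseteq> \<Squnion>Y" "violates Q (X \<union> R)"
  shows "violates Q (Y \<union> R)"
proof (rule violates_replace[of X Y R Q])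
  show "X \<subseteq> carrier L" "Y \<subseteq> carrier L" "Q \<subseteq> carrier L"
    using assms(1-3) atoms_carrier G_carrier by (auto simp: upper_def)
  show "\<not> h \<sqsubseteq> y" if "h \<in> Q" "y \<in> Y" for h y
    using not_le_atom[OF assms(1) that(1), of y] that(2) assms(3) by blast
qed (use assms in auto)

lemma two_elements:
  assumes "2 \<le> card A" shows "\<exists>b\<in>A. b \<noteq> a"
proof (rule ccontr)
  assume "\<not> ?thesis"
  then have "card A \<le> card {a}" by (intro card_mono) auto
  then show False using assms by simp
qed

text \<open>A violation by \<open>h\<close> is improved by \<open>factor\<close> to an element of
  \<open>Q\<close> that is itself a join of members of \<open>S\<close>, and the maximal ones among
  these form a forbidden antichain. Conversely, no member of an antichain with at least two elements
  lies above its join, so a join in \<open>Q\<close> is itself a violating element.\<close>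

theorem nested_iff:
  assumes "upper Q" "S \<subseteq> atoms L \<union> Q"
  shows "nested L (atoms L \<union> Q) S \<longleftrightarrow> \<not> violates Q S"
proof
  have SG: "S \<subseteq> G" using assms atoms_G by (auto simp: upper_def)
  have Sc: "S \<subseteq> carrier L" using SG G_carrier by auto
  have finS: "finite S" using Sc fin_carrier finite_subset by auto
  assume nst: "nested L (atoms L \<union> Q) S"
  show "\<not> violates Q S"
  proof
    assume "violates Q S"
    then obtain h where h: "h \<in> Q" "h \<sqsubseteq> \<Squnion>{s \<in> S. \<not> h \<sqsubseteq> s}" by (auto simp: violates_def)
    define A where "A = {s \<in> S. \<not> h \<sqsubseteq> s}"
    have hG: "h \<in> G" using h assms by (auto simp: upper_def)
    have AG: "A \<subseteq> G" using SG by (auto simp: A_def)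
    obtain z where z: "z \<in> G" "h \<sqsubseteq> z" "\<Squnion>{x \<in> A. x \<sqsubseteq> z} = z"
      using factor[OF AG hG h(2)[folded A_def]] by metis
    define X where "X = maxel {x \<in> A. x \<sqsubseteq> z}"
    have zX: "\<Squnion>X = z" unfolding X_def using maxel_join[of "{x \<in> A. x \<sqsubseteq> z}"] z AG G_carrier by auto
    have XA: "X \<subseteq> A" "X \<subseteq> S" using maxel_sub[of "{x \<in> A. x \<sqsubseteq> z}"] by (auto simp: X_def A_def)
    have Xc: "X \<subseteq> carrier L" "finite X" using XA Sc finS finite_subset by auto
    have zQ: "z \<in> Q" using h z assms by (auto simp: upper_def)
    have "\<not> 2 \<le> card X"
      using nst XA zQ zX maxel_antichain[of "{x \<in> A. x \<sqsubseteq> z}"] unfolding nested_def X_def by auto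
    then have "card X \<le> Suc 0" by auto
    then have X1: "\<forall>a\<in>X. \<forall>b\<in>X. a = b" using card_le_Suc0_iff_eq Xc by auto
    show False
    proof (cases "X = {}")
      case True
      then show False using zX J_empty z G_pos[of z] by auto
    next
      case False
      then obtain s where s: "X = {s}" using X1 by auto
      then have "z = s" using zX J_eqI[of "{s}" s] J_upper[of "{s}" s] Xc by auto
      then show False using s XA z by (auto simp: A_def)
    qed
  qed
next
  have SG: "S \<subseteq> G" using assms atoms_G by (auto simp: upper_def)
  have Sc: "S \<subseteq> carrier L" using SG G_carrier by auto
  assume nv: "\<not> violates Q S"
  have "\<Squnion>A \<notin> atoms L \<union> Q" if A: "A \<subseteq> S" "2 \<le> card A" "antichain_in L A" for A
  proof
    assume jA: "\<Squnion>A \<in> atoms L \<union> Q"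
    have Ac: "A \<subseteq> carrier L" using A Sc by auto
    note Ac = Ac finite_subset[OF Ac fin_carrier]
    have n: "\<not> \<Squnion>A \<sqsubseteq> a" if a: "a \<in> A" for a
    proof
      assume le: "\<Squnion>A \<sqsubseteq> a"
      obtain b where b: "b \<in> A" "b \<noteq> a" using two_elements[OF A(2), of a] by auto
      have "b \<sqsubseteq> a" using le J_upper[OF Ac(1) b(1)] le_trans[of b "\<Squnion>A" a] J_closed[OF Ac(1)] Ac a b by auto
      then show False using A(3) a b by (auto simp: antichain_in_def)
    qed
    show False
    proof (cases "\<Squnion>A \<in> atoms L")
      case True
      obtain a where a: "a \<in> A" using A(2) by fastforce
      have "a = \<bottom> \<or> a = \<Squnion>A" using atom_below[OF True, of a] J_upper[OF Ac(1) a] Ac a by auto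
      then show False using n[OF a] G_pos[of a] a A SG J_closed[OF Ac(1)] by auto
    next
      case False
      then have Q: "\<Squnion>A \<in> Q" using jA by auto
      have "\<Squnion>A \<sqsubseteq> \<Squnion>{s \<in> S. \<not> \<Squnion>A \<sqsubseteq> s}" by (rule J_mono) (use A n Sc in auto)
      then show False using nv Q by (auto simp: violates_def)
    qed
  qed
  then show "nested L (atoms L \<union> Q) S" using assms by (auto simp: nested_def)
qed

text \<open>Separates the violations that concern \<open>p\<close> alone. By minimality of
  \<open>p\<close>, the members of \<open>X\<close> strictly below \<open>p\<close> are atoms, so
  such a violation means that atoms of \<open>X\<close> span \<open>p\<close>. The two alternatives
  become the two kinds of elements of the blowup ideal.\<close>

lemma violates_remove_min:
  assumes "upper Q" "p \<in> Q" "\<And>q. q \<in> Q \<Longrightarrow> q \<sqsubseteq> p \<Longrightarrow> q = p" "X \<subseteq> atoms L \<union> Q" "violates Q X"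
  shows "violates (Q - {p}) X \<or> \<Squnion>{a \<in> X. a \<in> atoms L \<and> a \<sqsubseteq> p} = p"
proof -
  obtain h where h: "h \<in> Q" "h \<sqsubseteq> \<Squnion>{s \<in> X. \<not> h \<sqsubseteq> s}" using assms(5) by (auto simp: violates_def)
  show ?thesis
  proof (cases "h = p")
    case False
    then show ?thesis using h by (auto simp: violates_def)
  next
    case True
    define W where "W = {s \<in> X. \<not> p \<sqsubseteq> s}"
    have XG: "X \<subseteq> G" using assms atoms_G by (auto simp: upper_def)
    have WG: "W \<subseteq> G" using XG by (auto simp: W_def)
    have pG: "p \<in> G" using assms by (auto simp: upper_def)
    obtain z where z: "z \<in> G" "p \<sqsubseteq> z" "\<Squnion>{x \<in> W. x \<sqsubseteq> z} = z"
      using factor[OF WG pG] h True unfolding W_def by metis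
    have zQ: "z \<in> Q" using z assms by (auto simp: upper_def)
    have c: "p \<in> carrier L" "z \<in> carrier L" "X \<subseteq> carrier L" using pG z XG G_carrier by auto
    show ?thesis
    proof (cases "z = p")
      case False
      have "\<not> z \<sqsubseteq> s" if "s \<in> W" for s
        using that le_trans[of p z s] z c by (auto simp: W_def)
      then have "\<Squnion>{x \<in> W. x \<sqsubseteq> z} \<sqsubseteq> \<Squnion>{s \<in> X. \<not> z \<sqsubseteq> s}"
        by (intro J_mono) (use c in \<open>auto simp: W_def\<close>)
      then show ?thesis using z zQ False by (auto simp: violates_def)
    next
      case True
      have "{x \<in> W. x \<sqsubseteq> z} = {a \<in> X. a \<in> atoms L \<and> a \<sqsubseteq> p}"
        using assms(3,4) True c not_le_atom[OF assms(1,2)] by (fastforce simp: W_def)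
      then show ?thesis using z True by auto
    qed
  qed
qed

text \<open>The violating element is \<open>\<Squnion>{h, p}\<close>, which is in \<open>G\<close>
  because of the common atom and differs from \<open>p\<close>. In the blowup this says that x_h
  vanishes on the centre.\<close>

lemma violates_common_atom:
  assumes "upper Q" "p \<in> Q" "\<And>q. q \<in> Q \<Longrightarrow> q \<sqsubseteq> p \<Longrightarrow> q = p"
    "h \<in> Q" "\<not> p \<sqsubseteq> h" "a \<in> atoms L" "a \<sqsubseteq> p" "a \<sqsubseteq> h"
  shows "violates (Q - {p}) (insert h {b \<in> atoms L. b \<sqsubseteq> p})"
proof -
  let ?X = "insert h {b \<in> atoms L. b \<sqsubseteq> p}"
  define z where "z = \<Squnion>{h, p}"
  have c: "p \<in> carrier L" "h \<in> carrier L" "p \<in> G" "h \<in> G" using assms G_carrier by (auto simp: upper_def)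
  have z: "z \<in> G" unfolding z_def by (rule join_in_G) (use c assms in auto)
  have hz: "h \<sqsubseteq> z" "p \<sqsubseteq> z" unfolding z_def using c J_upper[of "{h,p}"] by auto
  have zc: "z \<in> carrier L" using z G_carrier by auto
  have zQ: "z \<in> Q" using z hz assms by (auto simp: upper_def)
  have nzh: "\<not> z \<sqsubseteq> h" using hz assms(5) le_trans[of p z h] c zc by auto
  have "z \<noteq> p"
  proof
    assume "z = p"
    then have "h = p" using assms(3)[OF assms(4)] hz by auto
    then show False using assms(5) c by auto
  qed
  moreover have "{s \<in> ?X. \<not> z \<sqsubseteq> s} = ?X"
    using nzh not_le_atom[OF assms(1) zQ] by auto
  moreover have "z \<sqsubseteq> \<Squnion>?X"
  proof -
    have Xc: "?X \<subseteq> carrier L" using c atoms_carrier by auto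
    have "p \<sqsubseteq> \<Squnion>?X"
    proof (rule atomistic_le[OF c(1) J_closed[OF Xc]])
      fix a assume "a \<in> atoms L" "a \<sqsubseteq> p"
      then show "a \<sqsubseteq> \<Squnion>?X" using J_upper[OF Xc, of a] by auto
    qed
    then show ?thesis unfolding z_def using J_upper[OF Xc, of h] c
      by (intro J_least) (auto simp: J_closed[OF Xc])
  qed
  ultimately show ?thesis using zQ unfolding violates_def by (intro bexI[of _ z]) auto
qed

text \<open>The atom \<open>c\<close> is reached from \<open>Y\<close> only with the help of
  \<open>b\<close>, hence of \<open>h\<close>. The member of \<open>G\<close> through which it is
  reached therefore lies above \<open>h\<close>, and strictly so, because it also lies above
  \<open>c\<close>.\<close>

lemma violates_exchange:
  assumes "upper Q" "p \<in> Q" "\<And>q. q \<in> Q \<Longrightarrow> q \<sqsubseteq> p \<Longrightarrow> q = p" "h \<in> Q" "h \<noteq> p"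
    "Y \<subseteq> atoms L" "b \<in> atoms L" "c \<in> atoms L" "b \<sqsubseteq> h" "\<not> c \<sqsubseteq> h"
    "c \<sqsubseteq> \<Squnion>(insert b Y)" "\<not> c \<sqsubseteq> \<Squnion>Y"
  shows "violates (Q - {p}) (insert h Y)"
proof -
  have car: "p \<in> carrier L" "h \<in> carrier L" "h \<in> G" "Y \<subseteq> carrier L" "b \<in> carrier L" "c \<in> carrier L"
    using assms G_carrier atoms_carrier by (auto simp: upper_def)
  have XG: "insert h Y \<subseteq> G" "insert h Y \<subseteq> carrier L" using assms atoms_G car by auto
  have "\<Squnion>(insert b Y) \<sqsubseteq> \<Squnion>(insert h Y)"
  proof (rule J_least)
    fix a assume "a \<in> insert b Y"
    then show "a \<sqsubseteq> \<Squnion>(insert h Y)" using J_upper[OF XG(2)] J_in_le[OF XG(2) car(5), of h] assms by auto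
  qed (use car XG J_closed in auto)
  then have "c \<sqsubseteq> \<Squnion>(insert h Y)"
    using assms(11) le_trans[of c "\<Squnion>(insert b Y)" "\<Squnion>(insert h Y)"] J_closed car XG by auto
  then obtain z where z: "z \<in> G" "c \<sqsubseteq> z" "\<Squnion>{x \<in> insert h Y. x \<sqsubseteq> z} = z"
    using factor[OF XG(1)] atoms_G assms by (metis subsetD)
  have zc: "z \<in> carrier L" using z G_carrier by auto
  have hz: "h \<sqsubseteq> z"
  proof (rule ccontr)
    assume "\<not> h \<sqsubseteq> z"
    then have "z \<sqsubseteq> \<Squnion>Y" using z(3) J_mono[of "{x \<in> insert h Y. x \<sqsubseteq> z}" Y] car by auto
    then show False using z assms(12) le_trans[of c z "\<Squnion>Y"] J_closed car zc by auto
  qed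
  then have zQ: "z \<in> Q" using z assms by (auto simp: upper_def)
  have "z \<noteq> p" using assms(3)[OF assms(4)] hz assms(5) by auto
  moreover have "\<not> z \<sqsubseteq> h" using z assms(10) le_trans[of c z h] car zc by auto
  then have "\<Squnion>{x \<in> insert h Y. x \<sqsubseteq> z} \<sqsubseteq> \<Squnion>{s \<in> insert h Y. \<not> z \<sqsubseteq> s}"
    by (intro J_mono) (use not_le_atom[OF assms(1) zQ] assms(6) XG in auto)
  ultimately show ?thesis using z zQ by (auto simp: violates_def)
qed

end

section \<open>Iterated blowups\<close>

context geo
begin

text \<open>The elements of an iterated blowup are pairs of an element x of L and a set T of blown-up
  elements; enc writes such a pair in the nested form produced by the successive blowups.\<close>

definition enc :: "'a list \<Rightarrow> 'a \<Rightarrow> 'a set \<Rightarrow> 'a blow" where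
  "enc ps x T = foldl (\<lambda>u p. if p \<in> T then Exc (Elem p) u else u) (Elem x) ps"

lemma enc_Nil: "enc [] x T = Elem x"
  by (simp add: enc_def)

lemma enc_snoc: "enc (ps @ [p]) x T = (if p \<in> T then Exc (Elem p) (enc ps x T) else enc ps x T)"
  by (simp add: enc_def)

lemma enc_cong: "T \<inter> set ps = U \<inter> set ps \<Longrightarrow> enc ps x T = enc ps x U"
  by (induction ps rule: rev_induct) (auto simp: enc_Nil enc_snoc)

lemma enc_empty: "enc ps x {} = Elem x"
  by (induction ps rule: rev_induct) (auto simp: enc_Nil enc_snoc)

lemma enc_Exc: "enc ps x T = Exc (Elem q) w \<Longrightarrow> q \<in> set ps"
  by (induction ps rule: rev_induct) (auto simp: enc_Nil enc_snoc split: if_splits)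

lemma enc_single: "distinct ps \<Longrightarrow> q \<in> set ps \<Longrightarrow> enc ps x {q} = Exc (Elem q) (Elem x)"
proof (induction ps rule: rev_induct)
  case (snoc p ps)
  show ?case
  proof (cases "p = q")
    case True
    then have "enc ps x {q} = enc ps x {}" using snoc by (intro enc_cong) auto
    then show ?thesis using True by (simp add: enc_snoc enc_empty)
  qed (use snoc in \<open>auto simp: enc_snoc\<close>)
qed simp

text \<open>The pairs that occur: blowing up p = ps ! j removes the elements above p, and at that time the
  elements of T that are blown up later still contribute to x.\<close>

definition admissible :: "'a list \<Rightarrow> 'a \<Rightarrow> 'a set \<Rightarrow> bool" where
  "admissible ps x T \<longleftrightarrow> (\<forall>j<length ps. \<not> ps ! j \<sqsubseteq> \<Squnion>(insert x (T \<inter> set (drop (Suc j) ps))))"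

lemma admissible_down:
  assumes "admissible ps y U" "set ps \<subseteq> carrier L" "x \<in> carrier L" "y \<in> carrier L" "x \<sqsubseteq> y" "T \<inter> set ps \<subseteq> U"
  shows "admissible ps x T"
  unfolding admissible_def
proof (intro allI impI notI)
  fix j assume j: "j < length ps" "ps ! j \<sqsubseteq> \<Squnion>(insert x (T \<inter> set (drop (Suc j) ps)))"
  let ?X = "insert x (T \<inter> set (drop (Suc j) ps))" and ?Y = "insert y (U \<inter> set (drop (Suc j) ps))"
  have d: "set (drop (Suc j) ps) \<subseteq> set ps" by (rule set_drop_subset)
  have c: "?X \<subseteq> carrier L" "?Y \<subseteq> carrier L" "ps ! j \<in> carrier L" using d j assms by auto
  have "\<Squnion>?X \<sqsubseteq> \<Squnion>?Y"
  proof (rule J_least[OF c(1) J_closed[OF c(2)]])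
    fix a assume "a \<in> ?X"
    then consider "a = x" | "a \<in> ?Y" using d assms(6) by auto
    then show "a \<sqsubseteq> \<Squnion>?Y"
      using J_in_le[OF c(2) assms(3), of y] assms(5) J_upper[OF c(2)] by cases auto
  qed
  then have "ps ! j \<sqsubseteq> \<Squnion>?Y" using le_trans[OF j(2) _ c(3) J_closed[OF c(1)] J_closed[OF c(2)]] by blast
  then show False using assms(1) j by (auto simp: admissible_def)
qed

lemma J_single: "x \<in> carrier L \<Longrightarrow> \<Squnion>{x} = x"
  by (rule J_eqI) (auto intro: J_upper)

text \<open>If the last centre \<open>p\<close> belongs to \<open>T\<close>, it still contributes to
  the base when the earlier centres are tested, which turns \<open>x\<close> into
  \<open>\<Squnion>{x, p}\<close>.\<close>

lemma admissible_snoc: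
  assumes "set ps \<subseteq> carrier L" "p \<in> carrier L" "x \<in> carrier L" "p \<notin> set ps"
  shows "admissible (ps @ [p]) x T \<longleftrightarrow> \<not> p \<sqsubseteq> x \<and> admissible ps (if p \<in> T then \<Squnion>{x, p} else x) T"
proof -
  have 1: "admissible (ps @ [p]) x T \<longleftrightarrow> \<not> p \<sqsubseteq> x \<and>
      (\<forall>j<length ps. \<not> ps ! j \<sqsubseteq> \<Squnion>(insert x (T \<inter> (insert p (set (drop (Suc j) ps))))))"
    using assms(3) by (auto simp: admissible_def nth_append less_Suc_eq J_single)
  have 2: "\<Squnion>(insert x (T \<inter> (insert p (set (drop (Suc j) ps))))) =
     \<Squnion>(insert (if p \<in> T then \<Squnion>{x, p} else x) (T \<inter> set (drop (Suc j) ps)))" for j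
  proof (cases "p \<in> T")
    case True
    have "insert x (T \<inter> set (drop (Suc j) ps)) \<subseteq> carrier L" using assms set_drop_subset by fastforce
    from J_insert_absorb[OF this, of "{p}"] show ?thesis using True assms by (simp add: insert_commute)
  qed auto
  show ?thesis unfolding 1 2 by (auto simp: admissible_def)
qed

section \<open>The iterated blowup as a poset of pairs\<close>

definition blow_ok :: "'a list \<Rightarrow> bool" where
  "blow_ok ps \<longleftrightarrow> distinct ps \<and> set ps \<subseteq> carrier L \<and> (\<forall>p\<in>set ps. \<not> p \<sqsubseteq> \<bottom>) \<and>
     (\<forall>i<length ps. \<forall>j<length ps. ps ! j \<sqsubseteq> ps ! i \<longrightarrow> i \<le> j)"

lemma blow_ok_snoc:
  assumes "blow_ok (ps @ [p])"
  shows "blow_ok ps" "p \<in> carrier L" "p \<notin> set ps" "\<not> p \<sqsubseteq> \<bottom>" "\<And>q. q \<in> set ps \<Longrightarrow> \<not> q \<sqsubseteq> p"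
proof -
  have ord: "\<And>i j. i < length (ps @ [p]) \<Longrightarrow> j < length (ps @ [p]) \<Longrightarrow>
      (ps @ [p]) ! j \<sqsubseteq> (ps @ [p]) ! i \<Longrightarrow> i \<le> j" using assms unfolding blow_ok_def by blast
  have "i \<le> j" if "i < length ps" "j < length ps" "ps ! j \<sqsubseteq> ps ! i" for i j
    using ord[of i j] that by (simp add: nth_append)
  then show "blow_ok ps" using assms unfolding blow_ok_def by auto
  show "p \<in> carrier L" "p \<notin> set ps" "\<not> p \<sqsubseteq> \<bottom>" using assms unfolding blow_ok_def by auto
  show "\<not> q \<sqsubseteq> p" if q: "q \<in> set ps" for q
  proof
    assume "q \<sqsubseteq> p"
    moreover obtain j where "j < length ps" "q = ps ! j" using q by (auto simp: in_set_conv_nth)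
    ultimately show False using ord[of "length ps" j] by (simp add: nth_append)
  qed
qed

lemma admissible_empty:
  assumes "x \<in> carrier L" "\<And>q. q \<in> set ps \<Longrightarrow> \<not> q \<sqsubseteq> x"
  shows "admissible ps x {}"
  using assms by (auto simp: admissible_def J_single)

definition stage :: "'a list \<Rightarrow> 'a blow set" where
  "stage ps = {enc ps x T | x T. x \<in> carrier L \<and> T \<subseteq> set ps \<and> admissible ps x T}"

lemma stageI: "x \<in> carrier L \<Longrightarrow> T \<subseteq> set ps \<Longrightarrow> admissible ps x T \<Longrightarrow> enc ps x T \<in> stage ps"
  by (auto simp: stage_def)

lemma stageE:
  assumes "u \<in> stage ps"
  obtains x T where "x \<in> carrier L" "T \<subseteq> set ps" "admissible ps x T" "u = enc ps x T"
  using assms by (auto simp: stage_def)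

text \<open>The order on pairs is the product order. Carrier and order are proved together because
  the carrier of the next stage depends, through the existence of joins with \<open>p\<close>, on
  the order of the present one.\<close>

lemma iterated_blowup_stage:
  assumes "blow_ok ps"
  shows "carrier (iterated_blowup L ps) = stage ps \<and>
    (\<forall>x\<in>carrier L. \<forall>y\<in>carrier L. \<forall>T U. T \<subseteq> set ps \<longrightarrow> U \<subseteq> set ps \<longrightarrow> admissible ps x T \<longrightarrow> admissible ps y U \<longrightarrow>
      (enc ps x T \<sqsubseteq>\<^bsub>iterated_blowup L ps\<^esub> enc ps y U \<longleftrightarrow> x \<sqsubseteq> y \<and> T \<subseteq> U))"
  using assms
proof (induction ps rule: rev_induct)
  case Nil
  show ?case by (auto simp: iterated_blowup_def blow_embed_def stage_def enc_Nil admissible_def)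
next
  case (snoc p ps)
  note ok = blow_ok_snoc[OF snoc.prems]
  define P where "P = iterated_blowup L ps"
  define P' where "P' = iterated_blowup L (ps @ [p])"
  have P': "P' = blowup P (Elem p)" by (simp add: P_def P'_def iterated_blowup_def)
  have car: "carrier P = stage ps"
    and ord: "\<And>x y T U. x \<in> carrier L \<Longrightarrow> y \<in> carrier L \<Longrightarrow> T \<subseteq> set ps \<Longrightarrow> U \<subseteq> set ps \<Longrightarrow>
      admissible ps x T \<Longrightarrow> admissible ps y U \<Longrightarrow> enc ps x T \<sqsubseteq>\<^bsub>P\<^esub> enc ps y U \<longleftrightarrow> x \<sqsubseteq> y \<and> T \<subseteq> U"
    using snoc.IH[OF ok(1)] unfolding P_def by blast+
  have psc: "set ps \<subseteq> carrier L" using ok(1) by (simp add: blow_ok_def)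
  have gp: "admissible ps p {}" using admissible_empty[OF ok(2)] ok(5) by blast
  have Ep: "Elem p = enc ps p {}" by (simp add: enc_empty)
  have ple: "Elem p \<sqsubseteq>\<^bsub>P\<^esub> enc ps x T \<longleftrightarrow> p \<sqsubseteq> x"
    if "x \<in> carrier L" "T \<subseteq> set ps" "admissible ps x T" for x T
    unfolding Ep using ord[OF ok(2) that(1) _ that(2) gp that(3)] by simp
  have old: "enc ps x T \<in> blow_old P (Elem p) \<longleftrightarrow> \<not> p \<sqsubseteq> x"
    if "x \<in> carrier L" "T \<subseteq> set ps" "admissible ps x T" for x T
    using ple[OF that] that stageI[OF that] car by (simp add: blow_old_def)
  have oldE: "\<exists>x T. x \<in> carrier L \<and> T \<subseteq> set ps \<and> admissible ps x T \<and> u = enc ps x T \<and> \<not> p \<sqsubseteq> x"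
    if "u \<in> blow_old P (Elem p)" for u
  proof -
    have "u \<in> stage ps" using that car by (simp add: blow_old_def)
    then obtain x T where "x \<in> carrier L" "T \<subseteq> set ps" "admissible ps x T" "u = enc ps x T" by (rule stageE)
    then show ?thesis using old[of x T] that by auto
  qed
  have jc: "\<Squnion>{x, p} \<in> carrier L" "x \<sqsubseteq> \<Squnion>{x, p}" "p \<sqsubseteq> \<Squnion>{x, p}" if "x \<in> carrier L" for x
    using that ok(2) J_closed[of "{x, p}"] J_upper[of "{x, p}"] by auto
  \<comment> \<open>The join of \<open>p\<close> with a pair \<open>(x, T)\<close> can only be
    \<open>(\<Squnion>{x, p}, T)\<close>, so it exists exactly when this pair is admissible.\<close>
  have link: "enc ps x T \<in> blow_link P (Elem p) \<longleftrightarrow> \<not> p \<sqsubseteq> x \<and> admissible ps (\<Squnion>{x, p}) T"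
    if x: "x \<in> carrier L" "T \<subseteq> set ps" "admissible ps x T" for x T
  proof
    assume "enc ps x T \<in> blow_link P (Elem p)"
    then have np: "\<not> p \<sqsubseteq> x" and "\<exists>s. is_lub P s {Elem p, enc ps x T}"
      using old[OF x] by (auto simp: blow_link_def)
    then obtain s where s: "is_lub P s {Elem p, enc ps x T}" by blast
    have Epc: "Elem p \<in> carrier P" "enc ps x T \<in> carrier P"
      unfolding car Ep by (auto intro!: stageI ok gp x)
    have s': "s \<in> carrier P" "Elem p \<sqsubseteq>\<^bsub>P\<^esub> s" "enc ps x T \<sqsubseteq>\<^bsub>P\<^esub> s"
      using s Epc by (auto simp: least_def Upper_def)
    then obtain y U where y: "y \<in> carrier L" "U \<subseteq> set ps" "admissible ps y U" "s = enc ps y U"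
      unfolding car by (elim stageE)
    have "p \<sqsubseteq> y" "x \<sqsubseteq> y" "T \<subseteq> U"
      using s' ple[OF y(1-3)] ord[OF x(1) y(1) x(2) y(2) x(3) y(3)] y(4) by auto
    then have "\<Squnion>{x, p} \<sqsubseteq> y" using x(1) ok(2) y(1) by (intro J_least) auto
    then have "admissible ps (\<Squnion>{x, p}) T"
      using admissible_down[OF y(3) psc jc(1)[OF x(1)] y(1)] \<open>T \<subseteq> U\<close> by blast
    then show "\<not> p \<sqsubseteq> x \<and> admissible ps (\<Squnion>{x, p}) T" using np by simp
  next
    assume a: "\<not> p \<sqsubseteq> x \<and> admissible ps (\<Squnion>{x, p}) T"
    then have g: "admissible ps (\<Squnion>{x, p}) T" by simp
    let ?s = "enc ps (\<Squnion>{x, p}) T"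
    have sc: "?s \<in> carrier P" unfolding car by (rule stageI) (use jc x g in auto)
    have "is_lub P ?s {Elem p, enc ps x T}"
      unfolding least_def
    proof (intro conjI ballI)
      show "?s \<in> Upper P {Elem p, enc ps x T}"
        using sc ple[OF jc(1)[OF x(1)] x(2) g] ord[OF x(1) jc(1)[OF x(1)] x(2) x(2) x(3) g] jc[OF x(1)]
        by (auto simp: Upper_def)
      fix u assume u: "u \<in> Upper P {Elem p, enc ps x T}"
      have Epc: "Elem p \<in> carrier P" "enc ps x T \<in> carrier P"
        unfolding car Ep by (auto intro!: stageI ok gp x)
      have u': "u \<in> carrier P" "Elem p \<sqsubseteq>\<^bsub>P\<^esub> u" "enc ps x T \<sqsubseteq>\<^bsub>P\<^esub> u"
        using u Epc by (auto simp: Upper_def)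
      then obtain y U where y: "y \<in> carrier L" "U \<subseteq> set ps" "admissible ps y U" "u = enc ps y U"
        unfolding car by (elim stageE)
      have "p \<sqsubseteq> y" "x \<sqsubseteq> y" "T \<subseteq> U"
        using u' ple[OF y(1-3)] ord[OF x(1) y(1) x(2) y(2) x(3) y(3)] y(4) by auto
      then show "?s \<sqsubseteq>\<^bsub>P\<^esub> u"
        unfolding y(4) using ord[OF jc(1)[OF x(1)] y(1) x(2) y(2) g y(3)] J_least[of "{x, p}" y] x ok(2) y
        by auto
    next
      show "Upper P {Elem p, enc ps x T} \<subseteq> carrier P" by (auto simp: Upper_def)
    qed
    then show "enc ps x T \<in> blow_link P (Elem p)" using old[OF x] a by (auto simp: blow_link_def)
  qed
  have gl: "admissible ps x T" if "admissible ps (\<Squnion>{x, p}) T" "x \<in> carrier L" "T \<subseteq> set ps" for x T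
    using admissible_down[OF that(1) psc that(2) jc(1)[OF that(2)] jc(2)[OF that(2)]] that(3) by auto
  have goodT: "admissible ps y T = admissible ps y (T - {p})" for y T
  proof -
    have "T \<inter> set (drop (Suc j) ps) = (T - {p}) \<inter> set (drop (Suc j) ps)" for j
      using ok(3) set_drop_subset[of "Suc j" ps] by auto
    then show ?thesis unfolding admissible_def by (simp only:)
  qed
  have encT: "enc ps y T = enc ps y (T - {p})" for y T
    using ok(3) by (intro enc_cong) auto
  \<comment> \<open>Old and exceptional elements of the new blowup are told apart by whether
    \<open>p\<close> belongs to \<open>T\<close>.\<close>
  have mem: "(u \<in> blow_old P (Elem p) \<longleftrightarrow> p \<notin> T) \<and>
     (p \<in> T \<longrightarrow> u = Exc (Elem p) (enc ps x (T - {p})) \<and> enc ps x (T - {p}) \<in> blow_link P (Elem p)) \<and>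
     (p \<notin> T \<longrightarrow> u = enc ps x T \<and> admissible ps x T \<and> T \<subseteq> set ps) \<and> admissible ps x (T - {p})"
    if "x \<in> carrier L" "T \<subseteq> set (ps @ [p])" "admissible (ps @ [p]) x T" "u = enc (ps @ [p]) x T" for x T u
  proof (cases "p \<in> T")
    case True
    have T: "T - {p} \<subseteq> set ps" using that by auto
    have np: "\<not> p \<sqsubseteq> x" and g: "admissible ps (\<Squnion>{x, p}) (T - {p})"
      using that(3) admissible_snoc[OF psc ok(2) that(1) ok(3)] True goodT by auto
    have gx: "admissible ps x (T - {p})" using gl[OF g that(1) T] .
    have l: "enc ps x (T - {p}) \<in> blow_link P (Elem p)" using link[OF that(1) T gx] np g by simp
    have u: "u = Exc (Elem p) (enc ps x (T - {p}))" using True that(4) encT[of x T] by (simp add: enc_snoc)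
    have "u \<notin> blow_old P (Elem p)"
    proof
      assume "u \<in> blow_old P (Elem p)"
      then obtain y U where "u = enc ps y U" using oldE by blast
      then have "enc ps y U = Exc (Elem p) (enc ps x (T - {p}))" using u by simp
      from enc_Exc[OF this] show False using ok(3) by simp
    qed
    then show ?thesis using True l u gx by auto
  next
    case False
    then have T: "T \<subseteq> set ps" using that by auto
    have np: "\<not> p \<sqsubseteq> x" and g: "admissible ps x T"
      using that(3) admissible_snoc[OF psc ok(2) that(1) ok(3)] False by auto
    have "u = enc ps x T" using False that(4) by (simp add: enc_snoc)
    then show ?thesis using False g T old[OF that(1) T g] np by auto
  qed
  have "carrier P' = stage (ps @ [p])"
  proof
    show "carrier P' \<subseteq> stage (ps @ [p])"
    proof
      fix u assume "u \<in> carrier P'"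
      then consider "u \<in> blow_old P (Elem p)" | w where "w \<in> blow_link P (Elem p)" "u = Exc (Elem p) w"
        unfolding P' blowup_def by auto
      then show "u \<in> stage (ps @ [p])"
      proof cases
        case 1
        then obtain x T where x: "x \<in> carrier L" "T \<subseteq> set ps" "admissible ps x T" "u = enc ps x T" "\<not> p \<sqsubseteq> x"
          using oldE by blast
        then have "p \<notin> T" using ok(3) by auto
        then have "u = enc (ps @ [p]) x T" "admissible (ps @ [p]) x T"
          using x admissible_snoc[OF psc ok(2) x(1) ok(3)] by (auto simp: enc_snoc)
        then show ?thesis using stageI[of x T "ps @ [p]"] x by auto
      next
        case 2
        have "w \<in> blow_old P (Elem p)" using 2 by (simp add: blow_link_def)
        then obtain x T where x: "x \<in> carrier L" "T \<subseteq> set ps" "admissible ps x T" "w = enc ps x T" "\<not> p \<sqsubseteq> x"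
          using oldE by blast
        then have g: "admissible ps (\<Squnion>{x, p}) T" using link[OF x(1-3)] 2 by simp
        have pT: "insert p T - {p} = T" using x ok(3) by auto
        have "u = enc (ps @ [p]) x (insert p T)"
          using x 2 encT[of x "insert p T"] pT by (simp add: enc_snoc)
        moreover have "admissible (ps @ [p]) x (insert p T)"
          using x admissible_snoc[OF psc ok(2) x(1) ok(3)] g goodT[of "\<Squnion>{x,p}" "insert p T"] pT by auto
        ultimately show ?thesis using stageI[of x "insert p T" "ps @ [p]"] x by auto
      qed
    qed
    show "stage (ps @ [p]) \<subseteq> carrier P'"
    proof
      fix u assume "u \<in> stage (ps @ [p])"
      then obtain x T where x: "x \<in> carrier L" "T \<subseteq> set (ps @ [p])" "admissible (ps @ [p]) x T" "u = enc (ps @ [p]) x T"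
        by (rule stageE)
      show "u \<in> carrier P'" using mem[OF x] unfolding P' blowup_def by (cases "p \<in> T") auto
    qed
  qed
  moreover have "enc (ps @ [p]) x T \<sqsubseteq>\<^bsub>P'\<^esub> enc (ps @ [p]) y U \<longleftrightarrow> x \<sqsubseteq> y \<and> T \<subseteq> U"
    if h: "x \<in> carrier L" "y \<in> carrier L" "T \<subseteq> set (ps @ [p])" "U \<subseteq> set (ps @ [p])"
      "admissible (ps @ [p]) x T" "admissible (ps @ [p]) y U" for x y T U
  proof -
    define u v where "u = enc (ps @ [p]) x T" and "v = enc (ps @ [p]) y U"
    note mu = mem[OF h(1,3,5) u_def] and mv = mem[OF h(2,4,6) v_def]
    have TU: "T - {p} \<subseteq> set ps" "U - {p} \<subseteq> set ps" using h by auto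
    have le: "enc ps x (T - {p}) \<sqsubseteq>\<^bsub>P\<^esub> enc ps y (U - {p}) \<longleftrightarrow> x \<sqsubseteq> y \<and> T - {p} \<subseteq> U - {p}"
      using ord[OF h(1,2) TU] mu mv by blast
    have nex: "u \<in> blow_old P (Elem p) \<Longrightarrow> u \<noteq> Exc (Elem p) w" "v \<in> blow_old P (Elem p) \<Longrightarrow> v \<noteq> Exc (Elem p) w" for w
      using oldE enc_Exc ok(3) by metis+
    have P'le: "u \<sqsubseteq>\<^bsub>P'\<^esub> v \<longleftrightarrow>
        (u \<in> blow_old P (Elem p) \<and> v \<in> blow_old P (Elem p) \<and> u \<sqsubseteq>\<^bsub>P\<^esub> v) \<or>
        (\<exists>x\<in>blow_link P (Elem p). \<exists>y\<in>blow_link P (Elem p). u = Exc (Elem p) x \<and> v = Exc (Elem p) y \<and> x \<sqsubseteq>\<^bsub>P\<^esub> y) \<or>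
        (u \<in> blow_old P (Elem p) \<and> (\<exists>y\<in>blow_link P (Elem p). v = Exc (Elem p) y \<and> u \<sqsubseteq>\<^bsub>P\<^esub> y))"
      unfolding P' blowup_def by simp
    have "u \<sqsubseteq>\<^bsub>P'\<^esub> v \<longleftrightarrow> x \<sqsubseteq> y \<and> T \<subseteq> U"
    proof -
      consider (tt) "p \<in> T" "p \<in> U" | (tf) "p \<in> T" "p \<notin> U" | (ft) "p \<notin> T" "p \<in> U" | (ff) "p \<notin> T" "p \<notin> U"
        by blast
      then show ?thesis
      proof cases
        case tt
        then have "T - {p} \<subseteq> U - {p} \<longleftrightarrow> T \<subseteq> U" by auto
        then show ?thesis unfolding P'le using mu mv le tt by auto
      next
        case tf
        then show ?thesis unfolding P'le using mu mv nex by auto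
      next
        case ft
        then have "T - {p} \<subseteq> U - {p} \<longleftrightarrow> T \<subseteq> U" "T - {p} = T" by auto
        then show ?thesis unfolding P'le using mu mv le nex ft by auto
      next
        case ff
        then have "T - {p} = T" "U - {p} = U" by auto
        then show ?thesis unfolding P'le using mu mv le nex ff by auto
      qed
    qed
    then show ?thesis unfolding u_def v_def .
  qed
  ultimately show ?case unfolding P'_def by blast
qed

text \<open>Independence in the matroid of an interval of the iterated blowup, in which all elements of Q are
  coloops.\<close>

definition lat_indep :: "'a set \<Rightarrow> bool" where
  "lat_indep X \<longleftrightarrow> (\<forall>a\<in>X \<inter> atoms L. \<not> a \<sqsubseteq> \<Squnion>(X \<inter> atoms L - {a}))"

section \<open>Circuits among the atoms of the lattice\<close>

definition lat_circuit :: "'a set \<Rightarrow> bool" where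
  "lat_circuit X \<longleftrightarrow> \<not> lat_indep X \<and> (\<forall>D. D \<subset> X \<longrightarrow> lat_indep D)"

text \<open>Coloops belong to no circuit: dropping them does not affect independence.\<close>

lemma lat_circuit_atoms:
  assumes "lat_circuit C" shows "C \<subseteq> atoms L"
proof (rule ccontr)
  assume "\<not> ?thesis"
  then have "lat_indep (C \<inter> atoms L)" using assms by (auto simp: lat_circuit_def)
  then have "lat_indep C" by (simp add: lat_indep_def Int_assoc)
  then show False using assms by (simp add: lat_circuit_def)
qed

text \<open>The dependence of some \<open>a\<close> is transferred to \<open>c\<close> by exchange.
  With \<open>y\<close> the join of the remaining elements, neither \<open>a\<close> nor
  \<open>c\<close> is below \<open>y\<close>, and \<open>\<Squnion>{y, c}\<close> covers
  \<open>y\<close>, so \<open>a\<close> and \<open>c\<close> produce the same join with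
  \<open>y\<close>.\<close>

lemma lat_circuit_dep:
  assumes "lat_circuit C" "c \<in> C" shows "c \<sqsubseteq> \<Squnion>(C - {c})"
proof -
  note at = lat_circuit_atoms[OF assms(1)]
  have car: "C \<subseteq> carrier L" using at atoms_carrier by auto
  have CA: "C \<inter> atoms L = C" using at by auto
  obtain a where a: "a \<in> C" "a \<sqsubseteq> \<Squnion>(C - {a})" using assms(1) CA by (auto simp: lat_circuit_def lat_indep_def)
  show ?thesis
  proof (cases "a = c")
    case False
    define y where "y = \<Squnion>(C - {a, c})"
    have yc: "y \<in> carrier L" unfolding y_def by (rule J_closed) (use car in auto)
    have ac: "a \<in> carrier L" "c \<in> carrier L" "c \<in> atoms L" using a assms at car by auto
    have j: "\<Squnion>(C - {a}) = \<Squnion>{y, c}" "\<Squnion>(C - {c}) = \<Squnion>{y, a}"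
    proof -
      have "\<Squnion>(insert d (C - {a, c})) = \<Squnion>{y, d}" if "d \<in> C" for d
      proof (rule J_eqI)
        have yd: "{y, d} \<subseteq> carrier L" using yc that car by auto
        show "\<Squnion>{y, d} \<in> carrier L" by (rule J_closed[OF yd])
        fix e assume "e \<in> insert d (C - {a, c})"
        then consider "e = d" | "e \<in> C - {a, c}" by auto
        then show "e \<sqsubseteq> \<Squnion>{y, d}"
        proof cases
          case 2
          then have "e \<sqsubseteq> y" unfolding y_def using J_upper[of "C - {a, c}" e] car by auto
          then show ?thesis using J_in_le[OF yd, of e y] 2 car by auto
        qed (use J_upper[OF yd] in auto)
      next
        have dc: "insert d (C - {a, c}) \<subseteq> carrier L" using that car by auto
        then show "insert d (C - {a, c}) \<subseteq> carrier L" .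
        have "y \<sqsubseteq> \<Squnion>(insert d (C - {a, c}))" unfolding y_def by (rule J_mono) (use dc in auto)
        then show "\<Squnion>{y, d} \<sqsubseteq> \<Squnion>(insert d (C - {a, c}))"
          using yc that car J_upper[OF dc] J_closed[OF dc] by (intro J_least) auto
      qed
      moreover have "insert c (C - {a, c}) = C - {a}" "insert a (C - {a, c}) = C - {c}"
        using False a assms by auto
      ultimately show "\<Squnion>(C - {a}) = \<Squnion>{y, c}" "\<Squnion>(C - {c}) = \<Squnion>{y, a}"
        using a assms by metis+
    qed
    have "lat_indep (C - {c})" using assms by (auto simp: lat_circuit_def)
    moreover have "(C - {c}) \<inter> atoms L - {a} = C - {a, c}" using at by auto
    moreover have "a \<in> (C - {c}) \<inter> atoms L" using a at False by auto
    ultimately have nay: "\<not> a \<sqsubseteq> y" unfolding lat_indep_def y_def by metis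
    have yac: "{y, a} \<subseteq> carrier L" "{y, c} \<subseteq> carrier L" using yc ac by auto
    have a_le: "a \<sqsubseteq> \<Squnion>{y, c}" using a j by simp
    have ncy: "\<not> c \<sqsubseteq> y"
    proof
      assume "c \<sqsubseteq> y"
      then have "\<Squnion>{y, c} \<sqsubseteq> y" using yac yc by (intro J_least) auto
      then show False using nay a_le le_trans[OF a_le _ ac(1) J_closed[OF yac(2)] yc] by blast
    qed
    have "\<Squnion>{y, a} = y \<or> \<Squnion>{y, a} = \<Squnion>{y, c}"
    proof (rule atom_cover[OF ac(3) yc ncy J_closed[OF yac(1)]])
      show "y \<sqsubseteq> \<Squnion>{y, a}" using J_upper[OF yac(1)] by auto
      show "\<Squnion>{y, a} \<sqsubseteq> \<Squnion>{y, c}"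
        using a_le J_upper[OF yac(2)] J_closed[OF yac(2)] yac(1) by (intro J_least) auto
    qed
    moreover have "\<Squnion>{y, a} \<noteq> y" using J_upper[OF yac(1), of a] nay by auto
    ultimately show ?thesis using j J_upper[OF yac(2), of c] by auto
  qed (use a in auto)
qed

lemma dep_contains_circuit:
  assumes "X \<subseteq> atoms L" "\<not> lat_indep X"
  shows "\<exists>C\<subseteq>X. lat_circuit C"
proof -
  have "finite X" using assms atoms_carrier fin_carrier by (meson finite_subset)
  then show ?thesis using assms
  proof (induction X rule: finite_psubset_induct)
    case (psubset X)
    show ?case
    proof (cases "\<forall>D. D \<subset> X \<longrightarrow> lat_indep D")
      case True
      then show ?thesis using psubset by (auto simp: lat_circuit_def)
    next
      case False
      then obtain D where "D \<subset> X" "\<not> lat_indep D" by auto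
      then show ?thesis using psubset.IH[of D] psubset.prems by blast
    qed
  qed
qed

end

context building
begin

text \<open>This pair will be the join in the blowup of the atoms belonging to \<open>S\<close>.
  Centres blown up after \<open>h\<close> do not lie above \<open>h\<close>, and neither do atoms,
  so a failure of admissibility at \<open>h\<close> is a violation.\<close>

lemma admissible_of_nested:
  assumes "upper Q" "blow_ok ps" "set ps = Q" "S \<subseteq> atoms L \<union> Q" "\<not> violates Q S"
  shows "admissible ps (\<Squnion>(S \<inter> atoms L)) (S \<inter> Q)"
  unfolding admissible_def
proof (intro allI impI notI)
  fix j assume j: "j < length ps"
    "ps ! j \<sqsubseteq> \<Squnion>(insert (\<Squnion>(S \<inter> atoms L)) (S \<inter> Q \<inter> set (drop (Suc j) ps)))"
  define h where "h = ps ! j"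
  have h: "h \<in> Q" using j assms(3) by (auto simp: h_def)
  have Qc: "Q \<subseteq> carrier L" using assms(1) G_carrier by (auto simp: upper_def)
  have Sc: "S \<subseteq> carrier L" using assms(4) Qc atoms_carrier by auto
  let ?W = "{s \<in> S. \<not> h \<sqsubseteq> s}"
  have Wc: "?W \<subseteq> carrier L" "S \<inter> atoms L \<subseteq> carrier L" using Sc by auto
  let ?X = "insert (\<Squnion>(S \<inter> atoms L)) (S \<inter> Q \<inter> set (drop (Suc j) ps))"
  have Xc: "?X \<subseteq> carrier L" using J_closed[OF Wc(2)] Sc by auto
  have "\<Squnion>?X \<sqsubseteq> \<Squnion>?W"
  proof (rule J_least[OF Xc J_closed[OF Wc(1)]])
    fix a assume "a \<in> ?X"
    then consider "a = \<Squnion>(S \<inter> atoms L)" | "a \<in> S" "a \<in> set (drop (Suc j) ps)" by auto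
    then show "a \<sqsubseteq> \<Squnion>?W"
    proof cases
      case 1
      show ?thesis unfolding 1
        by (rule J_mono) (use not_le_atom[OF assms(1) h] Wc in auto)
    next
      case 2
      then obtain i where i: "i < length ps - Suc j" "a = ps ! (Suc j + i)"
        by (auto simp: in_set_conv_nth)
      have "\<not> h \<sqsubseteq> a"
      proof
        assume "h \<sqsubseteq> a"
        then have "Suc j + i \<le> j" using assms(2) i j unfolding blow_ok_def h_def by auto
        then show False by auto
      qed
      then show ?thesis using J_upper[OF Wc(1)] 2 by auto
    qed
  qed
  then have "h \<sqsubseteq> \<Squnion>?W" using le_trans[OF j(2)[folded h_def] _ _ J_closed[OF Xc] J_closed[OF Wc(1)]] h Qc by blast
  then show False using assms(5) h by (auto simp: violates_def)
qed

section \<open>Atoms, flats and circuits of the iterated blowup\<close>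

context
  fixes Q :: "'a set" and ps :: "'a list"
  assumes Q: "upper Q" and seq: "blowup_sequence L (atoms L \<union> Q) ps"
begin

lemma Q_disj: "Q \<inter> atoms L = {}" and Q_G: "Q \<subseteq> G" and Q_car: "Q \<subseteq> carrier L"
  using Q G_carrier by (auto simp: upper_def)

lemma set_ps: "set ps = Q"
  using seq Q_disj by (auto simp: blowup_sequence_def)

lemma ps_ok: "blow_ok ps"
  using seq set_ps Q_car Q_G G_pos by (auto simp: blow_ok_def blowup_sequence_def)

abbreviation (input) "Bl \<equiv> iterated_blowup L ps"

lemma P_carrier: "carrier Bl = stage ps"
  using iterated_blowup_stage[OF ps_ok] by simp

lemma P_le: "x \<in> carrier L \<Longrightarrow> y \<in> carrier L \<Longrightarrow> T \<subseteq> Q \<Longrightarrow> U \<subseteq> Q \<Longrightarrow>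
      admissible ps x T \<Longrightarrow> admissible ps y U \<Longrightarrow> enc ps x T \<sqsubseteq>\<^bsub>Bl\<^esub> enc ps y U \<longleftrightarrow> x \<sqsubseteq> y \<and> T \<subseteq> U"
  using iterated_blowup_stage[OF ps_ok] set_ps by blast

lemma P_eq: "eq Bl = (=)"
proof -
  have "eq (foldl (\<lambda>Bl p. blowup Bl (Elem p)) P0 qs) = (=)" if "eq P0 = (=)" for P0 :: "'a blow gorder" and qs
    using that by (induction qs arbitrary: P0) (auto simp: blowup_def)
  then show ?thesis unfolding iterated_blowup_def by (auto simp: blow_embed_def)
qed

lemma P_antisym:
  assumes "u \<in> carrier Bl" "v \<in> carrier Bl" "u \<sqsubseteq>\<^bsub>Bl\<^esub> v" "v \<sqsubseteq>\<^bsub>Bl\<^esub> u"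
  shows "u = v"
proof -
  obtain x T where x: "x \<in> carrier L" "T \<subseteq> set ps" "admissible ps x T" "u = enc ps x T"
    using assms(1) unfolding P_carrier by (rule stageE)
  obtain y U where y: "y \<in> carrier L" "U \<subseteq> set ps" "admissible ps y U" "v = enc ps y U"
    using assms(2) unfolding P_carrier by (rule stageE)
  have "x \<sqsubseteq> y \<and> T \<subseteq> U" "y \<sqsubseteq> x \<and> U \<subseteq> T"
    using P_le[OF x(1) y(1) _ _ x(3) y(3)] P_le[OF y(1) x(1) _ _ y(3) x(3)] assms(3,4) x y set_ps
    by auto
  then show ?thesis using le_antisym[of x y] x y by auto
qed

text \<open>Bottom and joins of the blowup are chosen by \<open>SOME\<close>; antisymmetry makes the
  choice unique, so explicit pairs can be substituted for them.\<close>

lemma P_least_some: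
  assumes "least Bl e X" "X \<subseteq> carrier Bl"
  shows "(SOME x. least Bl x X) = e"
proof (rule some_equality[of "\<lambda>x. least Bl x X", OF assms(1)])
  fix f assume f: "least Bl f X"
  show "f = e" using assms f by (intro P_antisym) (auto simp: least_def)
qed

lemma admissible_bot: "admissible ps \<bottom> {}"
  by (rule admissible_empty) (use set_ps Q_G G_pos in auto)

lemma P_bottom: "\<bottom>\<^bsub>Bl\<^esub> = Elem \<bottom>"
  unfolding bottom_def[of Bl]
proof (rule P_least_some)
  have "enc ps \<bottom> {} \<sqsubseteq>\<^bsub>Bl\<^esub> u" if "u \<in> carrier Bl" for u
  proof -
    obtain x T where x: "x \<in> carrier L" "T \<subseteq> set ps" "admissible ps x T" "u = enc ps x T"
      using \<open>u \<in> carrier Bl\<close> unfolding P_carrier by (rule stageE)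
    then show ?thesis using P_le[OF _ x(1) _ _ admissible_bot x(3)] set_ps by auto
  qed
  moreover have "enc ps \<bottom> {} \<in> carrier Bl" unfolding P_carrier by (rule stageI) (use admissible_bot in auto)
  ultimately show "least Bl (Elem \<bottom>) (carrier Bl)" by (auto simp: least_def enc_empty)
qed simp

lemma admissible_atom: "a \<in> atoms L \<Longrightarrow> admissible ps a {}"
  by (rule admissible_empty) (use set_ps not_le_atom[OF Q] atoms_carrier in auto)

lemma admissible_point: assumes "q \<in> Q" shows "admissible ps \<bottom> {q}"
proof -
  have "violates Q {q} \<Longrightarrow> False"
  proof -
    assume "violates Q {q}"
    then obtain h where h: "h \<in> Q" "h \<sqsubseteq> \<Squnion>{s \<in> {q}. \<not> h \<sqsubseteq> s}" by (auto simp: violates_def)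
    show False
    proof (cases "h \<sqsubseteq> q")
      case True
      then have "{s \<in> {q}. \<not> h \<sqsubseteq> s} = {}" by auto
      then show False using h J_empty G_pos Q_G by (metis subsetD)
    next
      case False
      then have "{s \<in> {q}. \<not> h \<sqsubseteq> s} = {q}" by auto
      then show False using h J_single False assms Q_car by (metis subsetD)
    qed
  qed
  then have "admissible ps (\<Squnion>({q} \<inter> atoms L)) ({q} \<inter> Q)"
    using admissible_of_nested[OF Q ps_ok set_ps, of "{q}"] assms by auto
  moreover have "{q} \<inter> atoms L = {}" "{q} \<inter> Q = {q}" using assms Q_disj by auto
  ultimately show ?thesis by (simp add: J_empty)
qed

lemma blow_atom_enc:
  "a \<in> atoms L \<Longrightarrow> blow_atom L a = enc ps a {}"
  "q \<in> Q \<Longrightarrow> blow_atom L q = enc ps \<bottom> {q}"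
  using Q_disj enc_single[of ps q] ps_ok set_ps
  by (auto simp: blow_atom_def enc_empty blow_ok_def)

lemma P_covers:
  assumes "covers Bl \<bottom>\<^bsub>Bl\<^esub> u"  "u \<in> carrier Bl"
  shows "u \<in> blow_atom L ` (atoms L \<union> Q)"
proof -
  obtain x T where x: "x \<in> carrier L" "T \<subseteq> set ps" "admissible ps x T" "u = enc ps x T"
    using assms(2) unfolding P_carrier by (rule stageE)
  have T: "T \<subseteq> Q" using x set_ps by auto
  have ne: "u \<noteq> Elem \<bottom>" using assms(1) unfolding covers_def lless_def P_bottom P_eq by auto
  have between: "z = u" if "z \<in> carrier Bl" "z \<sqsubseteq>\<^bsub>Bl\<^esub> u" "z \<noteq> Elem \<bottom>" for z
  proof -
    obtain y U where y: "y \<in> carrier L" "U \<subseteq> set ps" "admissible ps y U" "z = enc ps y U"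
      using \<open>z \<in> carrier Bl\<close> unfolding P_carrier by (rule stageE)
    have "Elem \<bottom> \<sqsubseteq>\<^bsub>Bl\<^esub> z" using P_le[OF _ y(1) _ _ admissible_bot y(3)] y set_ps by (auto simp: enc_empty)
    then show ?thesis using assms(1) that unfolding covers_def lless_def P_bottom P_eq by auto
  qed
  show ?thesis
  proof (cases "T = {}")
    case True
    then have u: "u = Elem x" using x by (simp add: enc_empty)
    then have "x \<noteq> \<bottom>" using ne by auto
    then obtain a where a: "a \<in> atoms L" "a \<sqsubseteq> x" using atom_exists x by auto
    have ac: "a \<in> carrier L" "a \<noteq> \<bottom>" using a atoms_carrier atom_not_bot by auto
    have "enc ps a {} \<in> carrier Bl" unfolding P_carrier by (rule stageI) (use admissible_atom a ac in auto)
    moreover have "enc ps a {} \<sqsubseteq>\<^bsub>Bl\<^esub> u"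
      using P_le[OF ac(1) x(1) _ T admissible_atom[OF a(1)] x(3)] x a by auto
    ultimately have "enc ps a {} = u" using between ac by (auto simp: enc_empty)
    then show ?thesis using a blow_atom_enc(1)[OF a(1)] by (metis UnI1 image_eqI)
  next
    case False
    then obtain q where q: "q \<in> T" "q \<in> Q" using T by auto
    have "enc ps \<bottom> {q} \<in> carrier Bl" unfolding P_carrier
      by (rule stageI) (use admissible_point q set_ps in auto)
    moreover have "enc ps \<bottom> {q} \<sqsubseteq>\<^bsub>Bl\<^esub> u"
      using P_le[OF _ x(1) _ T admissible_point[OF q(2)] x(3)] x q by auto
    moreover have "enc ps \<bottom> {q} \<noteq> Elem \<bottom>" using enc_single[of ps q \<bottom>] ps_ok q set_ps by (auto simp: blow_ok_def)
    ultimately have "enc ps \<bottom> {q} = u" using between by auto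
    then show ?thesis using q blow_atom_enc(2)[OF q(2)] by (metis UnI2 image_eqI)
  qed
qed

lemma P_covers_atom:
  assumes "g \<in> atoms L \<union> Q"
  shows "blow_atom L g \<in> carrier Bl" "covers Bl \<bottom>\<^bsub>Bl\<^esub> (blow_atom L g)"
proof -
  \<comment> \<open>Both kinds of atoms are handled together as minimal pairs different from
    \<open>(\<bottom>, {})\<close>: they are \<open>(\<bottom>, {q})\<close> for \<open>q\<close> in
    \<open>Q\<close> and \<open>(a, {})\<close> for an atom \<open>a\<close>.\<close>
  obtain x T where x: "x \<in> carrier L" "T \<subseteq> Q" "admissible ps x T" "blow_atom L g = enc ps x T"
    and min: "\<And>y U. y \<in> carrier L \<Longrightarrow> U \<subseteq> T \<Longrightarrow> y \<sqsubseteq> x \<Longrightarrow> (y = x \<and> U = T) \<or> (y = \<bottom> \<and> U = {})"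
    and ne: "\<not> (x \<sqsubseteq> \<bottom> \<and> T = {})"
  proof (cases "g \<in> Q")
    case True
    have "(y = \<bottom> \<and> U = {g}) \<or> (y = \<bottom> \<and> U = {})" if "y \<in> carrier L" "U \<subseteq> {g}" "y \<sqsubseteq> \<bottom>" for y U
      using that le_antisym[of y \<bottom>] bottom_lower[of y] by auto
    then show ?thesis using True
      by (intro that[of \<bottom> "{g}"] admissible_point blow_atom_enc(2)) auto
  next
    case False
    then have g: "g \<in> atoms L" using assms by auto
    have "(y = g \<and> U = {}) \<or> (y = \<bottom> \<and> U = {})" if "y \<in> carrier L" "U \<subseteq> {}" "y \<sqsubseteq> g" for y U
      using that atom_below[OF g, of y] by auto
    moreover have "g \<in> carrier L" using g atoms_carrier by auto
    ultimately show ?thesis using g atom_not_bot[OF g]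
      by (intro that[of g "{}"] admissible_atom blow_atom_enc(1)) blast+
  qed
  show c: "blow_atom L g \<in> carrier Bl" unfolding x(4) P_carrier by (rule stageI) (use x set_ps in auto)
  have "enc ps \<bottom> {} \<sqsubseteq>\<^bsub>Bl\<^esub> enc ps x T" using P_le[OF _ x(1) _ x(2) admissible_bot x(3)] x by auto
  moreover have "enc ps \<bottom> {} \<noteq> enc ps x T"
    using P_le[OF x(1) _ x(2) _ x(3) admissible_bot] P_le[OF _ _ _ _ admissible_bot admissible_bot] ne by auto
  moreover have False
    if z: "z \<in> carrier Bl" "enc ps \<bottom> {} \<noteq> z" "z \<sqsubseteq>\<^bsub>Bl\<^esub> enc ps x T" "z \<noteq> enc ps x T" for z
  proof -
    obtain y U where y: "y \<in> carrier L" "U \<subseteq> set ps" "admissible ps y U" "z = enc ps y U"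
      using z(1) unfolding P_carrier by (rule stageE)
    have "y \<sqsubseteq> x" "U \<subseteq> T" using P_le[OF y(1) x(1) _ x(2) y(3) x(3)] y z set_ps by auto
    then show False using min[OF y(1)] y z by auto
  qed
  ultimately show "covers Bl \<bottom>\<^bsub>Bl\<^esub> (blow_atom L g)"
    unfolding covers_def lless_def P_bottom P_eq x(4) enc_empty[of ps \<bottom>, symmetric] by blast
qed

lemma P_atoms: "atoms Bl = blow_atom L ` (atoms L \<union> Q)"
  using P_covers P_covers_atom by (auto simp: atoms_def[of Bl])

lemma blow_atom_inj: "inj_on (blow_atom L) (atoms L \<union> Q)"
  using Q_disj by (auto simp: inj_on_def blow_atom_def)

text \<open>Below the join of the atoms belonging to \<open>S\<close> lie exactly the pairs
  \<open>(y, U)\<close> with \<open>y \<sqsubseteq> x0\<close> and \<open>U \<subseteq> T0\<close>.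
  The matroid of this interval is therefore that of \<open>[\<bottom>, x0]\<close> with the elements
  of \<open>T0\<close> added as coloops, and its circuits are those of the lattice.\<close>

lemma nested_circuit_iff:
  assumes "S \<subseteq> atoms L \<union> Q"
  shows "nested_circuit L (atoms L \<union> Q) ps S \<longleftrightarrow> nested L (atoms L \<union> Q) S \<and> lat_circuit S"
proof (cases "nested L (atoms L \<union> Q) S")
  case True
  then have nv: "\<not> violates Q S" using nested_iff[OF Q assms] by simp
  define x0 T0 where "x0 = \<Squnion>(S \<inter> atoms L)" and "T0 = S \<inter> Q"
  have Sat: "S \<inter> atoms L \<subseteq> carrier L" using atoms_carrier by auto
  have x0: "x0 \<in> carrier L" "T0 \<subseteq> Q" unfolding x0_def T0_def using J_closed[OF Sat] by auto
  have g0: "admissible ps x0 T0" unfolding x0_def T0_def by (rule admissible_of_nested[OF Q ps_ok set_ps assms nv])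
  define e where "e = enc ps x0 T0"
  define A where "A = blow_atom L ` S"
  have ec: "e \<in> carrier Bl" unfolding e_def P_carrier by (rule stageI) (use x0 g0 set_ps in auto)
  have ba_le: "blow_atom L g \<sqsubseteq>\<^bsub>Bl\<^esub> enc ps y U \<longleftrightarrow> (if g \<in> Q then g \<in> U else g \<sqsubseteq> y)"
    if "g \<in> atoms L \<union> Q" "y \<in> carrier L" "U \<subseteq> Q" "admissible ps y U" for g y U
  proof (cases "g \<in> Q")
    case True
    then show ?thesis
      using blow_atom_enc(2)[OF True] P_le[OF _ that(2) _ that(3) admissible_point[OF True] that(4)] that by auto
  next
    case False
    then have g: "g \<in> atoms L" using that by auto
    then show ?thesis using False blow_atom_enc(1)[OF g] P_le[OF _ that(2) _ that(3) admissible_atom[OF g] that(4)]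
      atoms_carrier by auto
  qed
  have Ac: "A \<subseteq> carrier Bl" unfolding A_def using P_covers_atom(1) assms by auto
  have "is_lub Bl e A"
    unfolding least_def
  proof (intro conjI ballI)
    have "blow_atom L g \<sqsubseteq>\<^bsub>Bl\<^esub> e" if "g \<in> S" for g
    proof -
      have g: "g \<in> atoms L \<union> Q" using that assms by auto
      show ?thesis unfolding e_def ba_le[OF g x0 g0]
        using that g J_upper[OF Sat, of g] by (auto simp: x0_def T0_def)
    qed
    then show "e \<in> Upper Bl A" using ec by (auto simp: Upper_def A_def)
    show "Upper Bl A \<subseteq> carrier Bl" by (auto simp: Upper_def)
    fix u assume u: "u \<in> Upper Bl A"
    then have "u \<in> carrier Bl" by (auto simp: Upper_def)
    then obtain y U where y: "y \<in> carrier L" "U \<subseteq> set ps" "admissible ps y U" "u = enc ps y U"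
      unfolding P_carrier by (rule stageE)
    have U: "U \<subseteq> Q" using y set_ps by auto
    have le: "if g \<in> Q then g \<in> U else g \<sqsubseteq> y" if "g \<in> S" for g
    proof -
      have "blow_atom L g \<sqsubseteq>\<^bsub>Bl\<^esub> u" using u that Ac by (auto simp: Upper_def A_def)
      then show ?thesis using ba_le[OF _ y(1) U y(3)] that assms y(4) by blast
    qed
    have "T0 \<subseteq> U" using le by (auto simp: T0_def)
    moreover have "a \<sqsubseteq> y" if "a \<in> S \<inter> atoms L" for a
      using le[of a] that Q_disj by (auto split: if_splits)
    then have "x0 \<sqsubseteq> y" unfolding x0_def by (rule J_least[OF Sat y(1)])
    ultimately show "e \<sqsubseteq>\<^bsub>Bl\<^esub> u" unfolding e_def y(4) using P_le[OF x0(1) y(1) x0(2) U g0 y(3)] by simp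
  qed
  then have je: "\<Squnion>\<^bsub>Bl\<^esub>A = e" unfolding Lattice.sup_def
    by (rule P_least_some) (auto simp: Upper_def)
  define F where "F = interval_flats Bl e"
  define flat where "flat y U = blow_atom L ` ({a \<in> atoms L. a \<sqsubseteq> y} \<union> U)" for y U
  have fl: "{a \<in> atoms Bl. a \<sqsubseteq>\<^bsub>Bl\<^esub> enc ps y U} = flat y U"
    if "y \<in> carrier L" "U \<subseteq> Q" "admissible ps y U" for y U
    unfolding P_atoms flat_def using ba_le[OF _ that] that(2) Q_disj by (auto split: if_splits)
  have gd: "admissible ps y U" if "y \<in> carrier L" "y \<sqsubseteq> x0" "U \<subseteq> T0" for y U
    by (rule admissible_down[OF g0 _ that(1) x0(1) that(2)]) (use that set_ps Q_car in auto)
  have F: "F = {flat y U | y U. y \<in> carrier L \<and> y \<sqsubseteq> x0 \<and> U \<subseteq> T0}"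
  proof
    show "F \<subseteq> {flat y U | y U. y \<in> carrier L \<and> y \<sqsubseteq> x0 \<and> U \<subseteq> T0}"
    proof
      fix X assume "X \<in> F"
      then obtain z where z: "z \<in> carrier Bl" "z \<sqsubseteq>\<^bsub>Bl\<^esub> e" "X = {a \<in> atoms Bl. a \<sqsubseteq>\<^bsub>Bl\<^esub> z}"
        by (auto simp: F_def interval_flats_def at_least_at_most_def)
      obtain y U where y: "y \<in> carrier L" "U \<subseteq> set ps" "admissible ps y U" "z = enc ps y U"
        using z(1) unfolding P_carrier by (rule stageE)
      have "y \<sqsubseteq> x0" "U \<subseteq> T0" using P_le[OF y(1) x0(1) _ x0(2) y(3) g0] y z set_ps e_def by auto
      then show "X \<in> {flat y U | y U. y \<in> carrier L \<and> y \<sqsubseteq> x0 \<and> U \<subseteq> T0}"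
        using z(3) fl[OF y(1) _ y(3)] y set_ps by auto
    qed
    show "{flat y U | y U. y \<in> carrier L \<and> y \<sqsubseteq> x0 \<and> U \<subseteq> T0} \<subseteq> F"
    proof
      fix X assume "X \<in> {flat y U | y U. y \<in> carrier L \<and> y \<sqsubseteq> x0 \<and> U \<subseteq> T0}"
      then obtain y U where y: "X = flat y U" "y \<in> carrier L" "y \<sqsubseteq> x0" "U \<subseteq> T0" by auto
      have UQ: "U \<subseteq> Q" using y x0 by auto
      note g = gd[OF y(2-4)]
      have "enc ps y U \<in> carrier Bl" unfolding P_carrier by (rule stageI) (use y UQ g set_ps in auto)
      moreover have "enc ps y U \<sqsubseteq>\<^bsub>Bl\<^esub> e" unfolding e_def using P_le[OF y(2) x0(1) UQ x0(2) g g0] y by simp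
      moreover have "\<bottom>\<^bsub>Bl\<^esub> \<sqsubseteq>\<^bsub>Bl\<^esub> enc ps y U"
        unfolding P_bottom using P_le[OF _ y(2) _ UQ admissible_bot g] y by (auto simp: enc_empty)
      ultimately show "X \<in> F" unfolding F_def interval_flats_def at_least_at_most_def y(1)
        using fl[OF y(2) UQ g] by (intro image_eqI[of _ _ "enc ps y U"]) auto
    qed
  qed
  \<comment> \<open>Closure takes all atoms below the join of the atoms in \<open>D\<close> and
    leaves the part in \<open>Q\<close> unchanged; this is how the coloops become visible.\<close>
  have cl: "flat_closure F (blow_atom L ` D) = flat (\<Squnion>(D \<inter> atoms L)) (D \<inter> Q)" if D: "D \<subseteq> S" for D
  proof -
    have Dat: "D \<inter> atoms L \<subseteq> carrier L" using atoms_carrier by auto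
    have DH: "D \<subseteq> atoms L \<union> Q" using D assms by auto
    have 1: "flat (\<Squnion>(D \<inter> atoms L)) (D \<inter> Q) \<in> F"
    proof -
      have "\<Squnion>(D \<inter> atoms L) \<sqsubseteq> x0" unfolding x0_def by (rule J_mono) (use Sat D in auto)
      moreover have "D \<inter> Q \<subseteq> T0" using D by (auto simp: T0_def)
      ultimately show ?thesis unfolding F using J_closed[OF Dat] by blast
    qed
    have 2: "blow_atom L ` D \<subseteq> flat (\<Squnion>(D \<inter> atoms L)) (D \<inter> Q)"
      unfolding flat_def using DH J_upper[OF Dat] by auto
    have 3: "flat (\<Squnion>(D \<inter> atoms L)) (D \<inter> Q) \<subseteq> X" if X: "X \<in> F" "blow_atom L ` D \<subseteq> X" for X
    proof -
      obtain y U where y: "X = flat y U" "y \<in> carrier L" "y \<sqsubseteq> x0" "U \<subseteq> T0" using X(1) unfolding F by auto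
      have sub: "{a \<in> atoms L. a \<sqsubseteq> y} \<union> U \<subseteq> atoms L \<union> Q" using y x0 by auto
      have DU: "D \<subseteq> {a \<in> atoms L. a \<sqsubseteq> y} \<union> U"
      proof
        fix d assume d: "d \<in> D"
        then have "blow_atom L d \<in> blow_atom L ` ({a \<in> atoms L. a \<sqsubseteq> y} \<union> U)"
          using X(2) unfolding y(1) flat_def by auto
        then show "d \<in> {a \<in> atoms L. a \<sqsubseteq> y} \<union> U"
          using inj_on_image_mem_iff[OF blow_atom_inj _ sub] d DH by blast
      qed
      have "a \<sqsubseteq> y" if "a \<in> D \<inter> atoms L" for a
        using DU that y(4) x0(2) Q_disj by blast
      then have "\<Squnion>(D \<inter> atoms L) \<sqsubseteq> y" by (rule J_least[OF Dat y(2)])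
      then have "{a \<in> atoms L. a \<sqsubseteq> \<Squnion>(D \<inter> atoms L)} \<subseteq> {a \<in> atoms L. a \<sqsubseteq> y}"
        using le_trans[OF _ _ _ J_closed[OF Dat] y(2)] atoms_carrier by blast
      moreover have "D \<inter> Q \<subseteq> U" using DU Q_disj by auto
      ultimately show ?thesis unfolding y(1) flat_def by blast
    qed
    show ?thesis unfolding flat_closure_def using 1 2 3 by blast
  qed
  have UF: "blow_atom L ` D \<subseteq> \<Union>F" if D: "D \<subseteq> S" for D
  proof -
    have "blow_atom L ` D \<subseteq> flat x0 T0"
      unfolding flat_def
    proof (rule image_mono, rule subsetI)
      fix d assume "d \<in> D"
      then have "d \<in> S" "d \<in> atoms L \<union> Q" using D assms by auto
      then show "d \<in> {a \<in> atoms L. a \<sqsubseteq> x0} \<union> T0"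
        using J_upper[OF Sat, of d] by (auto simp: x0_def T0_def)
    qed
    moreover have "flat x0 T0 \<in> F" unfolding F using x0 by auto
    ultimately show ?thesis by auto
  qed
  have ind: "matroid_indep F (blow_atom L ` D) \<longleftrightarrow> lat_indep D" if D: "D \<subseteq> S" for D
  proof -
    have DH: "D \<subseteq> atoms L \<union> Q" using D assms by auto
    have "blow_atom L a \<notin> flat_closure F (blow_atom L ` D - {blow_atom L a}) \<longleftrightarrow>
        \<not> (a \<in> atoms L \<and> a \<sqsubseteq> \<Squnion>(D \<inter> atoms L - {a}))" if a: "a \<in> D" for a
    proof -
      have aH: "a \<in> atoms L \<union> Q" using a DH by auto
      have im: "blow_atom L ` D - {blow_atom L a} = blow_atom L ` (D - {a})"
        using inj_on_image_set_diff[OF blow_atom_inj, of D "{a}"] DH aH by auto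
      have sub: "{b \<in> atoms L. b \<sqsubseteq> \<Squnion>((D - {a}) \<inter> atoms L)} \<union> ((D - {a}) \<inter> Q) \<subseteq> atoms L \<union> Q" by auto
      have eq: "(D - {a}) \<inter> atoms L = D \<inter> atoms L - {a}" by auto
      have "D - {a} \<subseteq> S" using D by auto
      then have "flat_closure F (blow_atom L ` D - {blow_atom L a}) =
        blow_atom L ` ({b \<in> atoms L. b \<sqsubseteq> \<Squnion>((D - {a}) \<inter> atoms L)} \<union> ((D - {a}) \<inter> Q))"
        unfolding im by (simp add: cl flat_def)
      then show ?thesis using inj_on_image_mem_iff[OF blow_atom_inj aH sub] by (auto simp: eq)
    qed
    then show ?thesis unfolding matroid_indep_def lat_indep_def using UF[OF D] by auto
  qed
  have sub_im: "(\<forall>D. D \<subset> A \<longrightarrow> matroid_indep F D) \<longleftrightarrow> (\<forall>D. D \<subset> S \<longrightarrow> lat_indep D)"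
  proof
    assume a: "\<forall>D. D \<subset> A \<longrightarrow> matroid_indep F D"
    show "\<forall>D. D \<subset> S \<longrightarrow> lat_indep D"
    proof (intro allI impI)
      fix D assume D: "D \<subset> S"
      have "blow_atom L ` D \<subset> A" unfolding A_def
        using D inj_on_image_eq_iff[OF blow_atom_inj, of D S] assms by blast
      then show "lat_indep D" using a ind[of D] D by auto
    qed
  next
    assume a: "\<forall>D. D \<subset> S \<longrightarrow> lat_indep D"
    show "\<forall>D. D \<subset> A \<longrightarrow> matroid_indep F D"
    proof (intro allI impI)
      fix D assume D: "D \<subset> A"
      then obtain D' where D': "D' \<subseteq> S" "D = blow_atom L ` D'" unfolding A_def by (meson psubset_imp_subset subset_imageE)
      then have "D' \<subset> S" using D unfolding A_def by auto
      then show "matroid_indep F D" using a ind[OF D'(1)] D'(2) by auto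
    qed
  qed
  have "matroid_circuit F A \<longleftrightarrow> lat_circuit S"
    unfolding matroid_circuit_def lat_circuit_def sub_im
    using UF[of S] ind[of S] by (simp add: A_def)
  then show ?thesis using True unfolding nested_circuit_def Let_def A_def[symmetric] je F_def[symmetric] by simp
next
  case False
  then show ?thesis by (simp add: nested_circuit_def)
qed

end

end

section \<open>Polynomials and the ideal of a blowup\<close>

abbreviation lkp :: "('a \<Rightarrow>\<^sub>0 'b::zero) \<Rightarrow> 'a \<Rightarrow> 'b" where "lkp \<equiv> Poly_Mapping.lookup"
abbreviation kys :: "('a \<Rightarrow>\<^sub>0 'b::zero) \<Rightarrow> 'a set" where "kys \<equiv> Poly_Mapping.keys"
abbreviation sgl :: "'a \<Rightarrow> 'b \<Rightarrow> ('a \<Rightarrow>\<^sub>0 'b::zero)" where "sgl \<equiv> Poly_Mapping.single"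

section \<open>Ideals of a commutative ring\<close>

definition cideal :: "'r::comm_ring_1 set \<Rightarrow> bool" where
  "cideal I \<longleftrightarrow> 0 \<in> I \<and> (\<forall>a\<in>I. \<forall>b\<in>I. a + b \<in> I) \<and> (\<forall>a\<in>I. \<forall>r. r * a \<in> I)"

lemma cideal_0: "cideal I \<Longrightarrow> 0 \<in> I"
  and cideal_add: "cideal I \<Longrightarrow> a \<in> I \<Longrightarrow> b \<in> I \<Longrightarrow> a + b \<in> I"
  and cideal_mult: "cideal I \<Longrightarrow> a \<in> I \<Longrightarrow> r * a \<in> I"
  by (simp_all add: cideal_def)

lemma cideal_multr: "cideal I \<Longrightarrow> a \<in> I \<Longrightarrow> a * r \<in> I"
  using cideal_mult[of I a r] by (simp add: mult.commute)

lemma cideal_uminus: "cideal I \<Longrightarrow> a \<in> I \<Longrightarrow> - a \<in> I"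
  using cideal_mult[of I a "-1"] by simp

lemma cideal_diff: "cideal I \<Longrightarrow> a \<in> I \<Longrightarrow> b \<in> I \<Longrightarrow> a - b \<in> I"
  using cideal_add[of I a "- b"] cideal_uminus[of I b] by simp

lemma cideal_sum: "cideal I \<Longrightarrow> (\<And>x. x \<in> A \<Longrightarrow> f x \<in> I) \<Longrightarrow> sum f A \<in> I"
  by (induction A rule: infinite_finite_induct) (auto intro: cideal_0 cideal_add)

inductive_set idl :: "'r::comm_ring_1 set \<Rightarrow> 'r set" for X where
  idl_0: "0 \<in> idl X"
| idl_step: "x \<in> X \<Longrightarrow> a \<in> idl X \<Longrightarrow> r * x + a \<in> idl X"

lemma idl_add: "a \<in> idl X \<Longrightarrow> b \<in> idl X \<Longrightarrow> a + b \<in> idl X"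
  by (induction a rule: idl.induct) (auto simp: add.assoc intro: idl_step)

lemma idl_mult: "a \<in> idl X \<Longrightarrow> r * a \<in> idl X"
proof (induction a rule: idl.induct)
  case idl_0
  then show ?case by (simp add: idl.idl_0)
next
  case (idl_step x a s)
  then show ?case using idl.idl_step[of x X "r * a" "r * s"] by (simp add: algebra_simps)
qed

lemma cideal_idl: "cideal (idl X)"
  by (auto simp: cideal_def intro: idl_0 idl_add idl_mult)

lemma idl_gen: "x \<in> X \<Longrightarrow> x \<in> idl X"
  using idl_step[of x X 0 1] idl_0[of X] by simp

lemma idl_least:
  assumes "cideal I" "X \<subseteq> I" shows "idl X \<subseteq> I"
proof
  fix a assume "a \<in> idl X"
  then show "a \<in> I"
    by induction (use assms in \<open>auto intro: cideal_0 cideal_add cideal_mult\<close>)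
qed

text \<open>For an ideal \<open>J\<close> this is its extension J[t] to the polynomial ring.\<close>

definition coeffs_in :: "'r::comm_ring_1 set \<Rightarrow> 'r poly set" where
  "coeffs_in J = {P. \<forall>d. Polynomial.coeff P d \<in> J}"

lemma cideal_coeffs_in:
  assumes "cideal J" shows "cideal (coeffs_in J)"
  unfolding cideal_def
proof (intro conjI ballI allI)
  show "0 \<in> coeffs_in J" using cideal_0[OF assms] by (simp add: coeffs_in_def)
  fix a b r assume a: "a \<in> coeffs_in J"
  show "a + b \<in> coeffs_in J" if "b \<in> coeffs_in J"
    using a that cideal_add[OF assms] by (simp add: coeffs_in_def)
  have "Polynomial.coeff (r * a) d \<in> J" for d
    unfolding coeff_mult
    using a by (auto simp: coeffs_in_def intro!: cideal_sum[OF assms] cideal_mult[OF assms])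
  then show "r * a \<in> coeffs_in J" by (simp add: coeffs_in_def)
qed

text \<open>The ideal of a ring extension A[t] obtained by adjoining a root of the monic polynomial q to A/J0 and
  killing the ideal K in positive degrees, as for the Chow ring of a blowup.\<close>

definition blow_ideal :: "'r::comm_ring_1 set \<Rightarrow> 'r set \<Rightarrow> 'r poly \<Rightarrow> 'r poly set" where
  "blow_ideal J0 K q = {q * g + s | g s. (\<forall>i\<ge>Polynomial.degree q. Polynomial.coeff s i = 0) \<and>
     Polynomial.coeff s 0 \<in> J0 \<and> (\<forall>i. Polynomial.coeff s i \<in> K)}"

lemma blow_idealI:
  "f = q * g + s \<Longrightarrow> (\<And>i. i \<ge> Polynomial.degree q \<Longrightarrow> Polynomial.coeff s i = 0) \<Longrightarrow>
    Polynomial.coeff s 0 \<in> J0 \<Longrightarrow> (\<And>i. Polynomial.coeff s i \<in> K) \<Longrightarrow> f \<in> blow_ideal J0 K q"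
  unfolding blow_ideal_def by blast

text \<open>The condition on \<open>K\<close> and the constant term of \<open>q\<close> makes the
  normal form stable under multiplication by t: reducing t s modulo \<open>q\<close> changes the
  constant term by an element of \<open>K\<close> times q(0).\<close>

locale blow_ideal_setting =
  fixes J0 K :: "'r::comm_ring_1 set" and q :: "'r poly"
  assumes J0: "cideal J0" and K: "cideal K" and sub: "J0 \<subseteq> K"
    and monic: "Polynomial.coeff q (Polynomial.degree q) = 1" and deg: "Polynomial.degree q > 0"
    and kill: "\<And>a. a \<in> K \<Longrightarrow> a * Polynomial.coeff q 0 \<in> J0"
begin

lemma blow_ideal_add:
  assumes "f \<in> blow_ideal J0 K q" "h \<in> blow_ideal J0 K q" shows "f + h \<in> blow_ideal J0 K q"
proof -
  obtain g s where 1: "f = q * g + s" "\<forall>i\<ge>Polynomial.degree q. Polynomial.coeff s i = 0"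
     "Polynomial.coeff s 0 \<in> J0" "\<forall>i. Polynomial.coeff s i \<in> K" using assms(1) by (auto simp: blow_ideal_def)
  obtain g' s' where 2: "h = q * g' + s'" "\<forall>i\<ge>Polynomial.degree q. Polynomial.coeff s' i = 0"
     "Polynomial.coeff s' 0 \<in> J0" "\<forall>i. Polynomial.coeff s' i \<in> K" using assms(2) by (auto simp: blow_ideal_def)
  show ?thesis
    by (rule blow_idealI[of _ _ "g + g'" "s + s'"])
       (use 1 2 J0 K in \<open>auto simp: algebra_simps intro: cideal_add\<close>)
qed

text \<open>A coefficient in degree \<open>Polynomial.degree q\<close> is still allowed, since a
  multiple of the monic \<open>q\<close> removes it; the price in the constant term is covered by
  \<open>kill\<close>.\<close>

lemma blow_ideal_small:
  assumes "\<And>i. Polynomial.coeff s i \<in> K" "\<And>i. i > Polynomial.degree q \<Longrightarrow> Polynomial.coeff s i = 0"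
    "Polynomial.coeff s 0 \<in> J0"
  shows "s \<in> blow_ideal J0 K q"
proof -
  define a where "a = Polynomial.coeff s (Polynomial.degree q)"
  have a: "a \<in> K" using assms by (simp add: a_def)
  show ?thesis
  proof (rule blow_idealI[of _ _ "[:a:]" "s - smult a q"])
    show "s = q * [:a:] + (s - smult a q)" by simp
    fix i
    show "Polynomial.coeff (s - smult a q) i = 0" if "i \<ge> Polynomial.degree q"
      using that monic assms(2)[of i] coeff_eq_0[of q i] by (cases "i = Polynomial.degree q") (auto simp: a_def)
    show "Polynomial.coeff (s - smult a q) i \<in> K" using assms a K by (auto intro!: cideal_diff cideal_multr)
    show "Polynomial.coeff (s - smult a q) 0 \<in> J0" using assms kill[OF a] J0 by (auto intro!: cideal_diff)
  qed
qed

lemma blow_ideal_t: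
  assumes "f \<in> blow_ideal J0 K q" shows "pCons 0 f \<in> blow_ideal J0 K q"
proof -
  obtain g s where 1: "f = q * g + s" "\<forall>i\<ge>Polynomial.degree q. Polynomial.coeff s i = 0"
     "Polynomial.coeff s 0 \<in> J0" "\<forall>i. Polynomial.coeff s i \<in> K" using assms(1) by (auto simp: blow_ideal_def)
  have "pCons 0 s \<in> blow_ideal J0 K q"
    by (rule blow_ideal_small)
       (use 1 J0 K in \<open>auto simp: coeff_pCons split: nat.splits intro: cideal_0\<close>)
  moreover have "q * pCons 0 g \<in> blow_ideal J0 K q"
    by (rule blow_idealI[of _ _ "pCons 0 g" 0]) (use J0 K in \<open>auto intro: cideal_0\<close>)
  moreover have "pCons 0 f = q * pCons 0 g + pCons 0 s" using 1 by simp
  ultimately show ?thesis using blow_ideal_add by metis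
qed

lemma blow_ideal_smult:
  assumes "f \<in> blow_ideal J0 K q" shows "smult a f \<in> blow_ideal J0 K q"
proof -
  obtain g s where 1: "f = q * g + s" "\<forall>i\<ge>Polynomial.degree q. Polynomial.coeff s i = 0"
     "Polynomial.coeff s 0 \<in> J0" "\<forall>i. Polynomial.coeff s i \<in> K" using assms(1) by (auto simp: blow_ideal_def)
  show ?thesis
    by (rule blow_idealI[of _ _ "smult a g" "smult a s"])
       (use 1 J0 K in \<open>auto simp: smult_add_right intro: cideal_mult\<close>)
qed

lemma cideal_blow_ideal: "cideal (blow_ideal J0 K q)"
proof -
  have "r * f \<in> blow_ideal J0 K q" if f: "f \<in> blow_ideal J0 K q" for r f
  proof (induction r)
    case 0
    then show ?case using blow_ideal_smult[OF f, of 0] by simp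
  next
    case (pCons a r)
    have "pCons a r * f = smult a f + pCons 0 (r * f)" by simp
    then show ?case using blow_ideal_add blow_ideal_smult[OF f] blow_ideal_t[OF pCons(2)] by simp
  qed
  moreover have "0 \<in> blow_ideal J0 K q"
    by (rule blow_idealI[of _ _ 0 0]) (use J0 K in \<open>auto intro: cideal_0\<close>)
  ultimately show ?thesis unfolding cideal_def using blow_ideal_add by blast
qed

lemma blow_ideal_q: "q \<in> blow_ideal J0 K q"
  by (rule blow_idealI[of _ _ 1 0]) (use J0 K in \<open>auto intro: cideal_0\<close>)

lemma blow_ideal_coeffs:
  assumes "\<And>i. Polynomial.coeff P i \<in> K" "Polynomial.coeff P 0 \<in> J0"
  shows "P \<in> blow_ideal J0 K q"
proof -
  have pos: "pCons 0 P' \<in> blow_ideal J0 K q" if "\<And>i. Polynomial.coeff P' i \<in> K" for P'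
    using that
  proof (induction P')
    case 0
    then show ?case using cideal_0[OF cideal_blow_ideal] by simp
  next
    case (pCons a P')
    have "a \<in> K" using pCons.prems[of 0] by simp
    then have "[:0, a:] \<in> blow_ideal J0 K q"
      by (intro blow_ideal_small) (use deg J0 K in \<open>auto simp: coeff_pCons split: nat.splits intro: cideal_0\<close>)
    moreover have "Polynomial.coeff P' i \<in> K" for i using pCons.prems[of "Suc i"] by simp
    then have "pCons 0 (pCons 0 P') \<in> blow_ideal J0 K q" using pCons.IH blow_ideal_t by blast
    moreover have "pCons 0 (pCons a P') = [:0, a:] + pCons 0 (pCons 0 P')" by simp
    ultimately show ?case using blow_ideal_add by metis
  qed
  obtain a P' where P: "P = pCons a P'" by (cases P)
  have "Polynomial.coeff P' i \<in> K" for i using assms(1)[of "Suc i"] by (simp add: P)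
  then have "pCons 0 P' \<in> blow_ideal J0 K q" by (rule pos)
  moreover have "[:a:] \<in> blow_ideal J0 K q"
    by (rule blow_ideal_small)
       (use assms(2) sub J0 K P in \<open>auto simp: coeff_pCons split: nat.splits intro: cideal_0\<close>)
  moreover have "P = [:a:] + pCons 0 P'" by (simp add: P)
  ultimately show ?thesis using blow_ideal_add by metis
qed

text \<open>Since \<open>q\<close> is monic, a nonzero multiple of it has at least its degree, even
  in the presence of zero divisors. Hence \<open>f\<close> is its own remainder.\<close>

lemma blow_ideal_low_degree:
  assumes "f \<in> blow_ideal J0 K q" "\<And>i. i \<ge> Polynomial.degree q \<Longrightarrow> Polynomial.coeff f i = 0"
  shows "Polynomial.coeff f 0 \<in> J0" "Polynomial.coeff f i \<in> K"
proof -
  obtain g s where 1: "f = q * g + s" "\<forall>i\<ge>Polynomial.degree q. Polynomial.coeff s i = 0"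
     "Polynomial.coeff s 0 \<in> J0" "\<forall>i. Polynomial.coeff s i \<in> K" using assms(1) by (auto simp: blow_ideal_def)
  have "g = 0"
  proof (rule ccontr)
    assume "g \<noteq> 0"
    have "Polynomial.coeff f (Polynomial.degree q + Polynomial.degree g) =
        Polynomial.coeff g (Polynomial.degree g)"
      using 1 monic coeff_mult_degree_sum[of q g] by simp
    then show False using assms(2)[of "Polynomial.degree q + Polynomial.degree g"] \<open>g \<noteq> 0\<close> by simp
  qed
  then show "Polynomial.coeff f 0 \<in> J0" "Polynomial.coeff f i \<in> K" using 1 by auto
qed

end

section \<open>Exponent vectors and substitution into polynomials\<close>

lemma poly_mapping_sum_singles: "(\<Sum>m\<in>kys f. sgl m (lkp f m)) = f"
proof (rule poly_mapping_eqI)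
  fix k
  have "lkp (\<Sum>m\<in>kys f. sgl m (lkp f m)) k = (\<Sum>m\<in>kys f. if m = k then lkp f m else 0)"
    by (simp add: lookup_sum lookup_single when_def)
  also have "\<dots> = lkp f k" by (simp add: in_keys_iff)
  finally show "lkp (\<Sum>m\<in>kys f. sgl m (lkp f m)) k = lkp f k" .
qed

definition pmon :: "('a \<Rightarrow> 'r::comm_ring_1) \<Rightarrow> ('a \<Rightarrow>\<^sub>0 nat) \<Rightarrow> 'r" where
  "pmon v m = (\<Prod>g\<in>kys m. v g ^ lkp m g)"

lemma pmon_superset: "finite A \<Longrightarrow> kys m \<subseteq> A \<Longrightarrow> pmon v m = (\<Prod>g\<in>A. v g ^ lkp m g)"
  unfolding pmon_def by (intro prod.mono_neutral_left) (auto simp: in_keys_iff)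

lemma pmon_add: "pmon v (m + n) = pmon v m * pmon v n"
proof -
  let ?A = "kys m \<union> kys n"
  have "pmon v (m + n) = (\<Prod>g\<in>?A. v g ^ lkp (m + n) g)"
    by (rule pmon_superset) (use Poly_Mapping.keys_add[of m n] in auto)
  also have "\<dots> = (\<Prod>g\<in>?A. v g ^ lkp m g) * (\<Prod>g\<in>?A. v g ^ lkp n g)"
    by (simp add: lookup_add power_add prod.distrib)
  also have "\<dots> = pmon v m * pmon v n"
    using pmon_superset[of ?A m v] pmon_superset[of ?A n v] by simp
  finally show ?thesis .
qed

lemma pmon_0 [simp]: "pmon v 0 = 1"
  by (simp add: pmon_def)

lemma pmon_single: "pmon v (sgl g k) = v g ^ k"
  by (simp add: pmon_def)

lemma pmon_qvar: "pmon qvar m = sgl m 1"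
proof -
  have p: "qvar g ^ k = sgl (sgl g k) 1" for g :: 'a and k
    by (induction k) (auto simp: qvar_def mult_single single_add[symmetric] add.commute)
  have "(\<Prod>g\<in>A. sgl (sgl g (lkp m g)) (1::rat)) = sgl (\<Sum>g\<in>A. sgl g (lkp m g)) 1" if "finite A" for A
    using that by induction (auto simp: mult_single)
  then show ?thesis by (simp add: pmon_def p poly_mapping_sum_singles)
qed

definition cst :: "rat \<Rightarrow> 'a qpoly poly" where "cst c = [:sgl 0 c:]"

lemma cst_simps: "cst 0 = 0" "cst 1 = 1" "cst (a + b) = cst a + cst b" "cst (a * b) = cst a * cst b"
  "cst (- a) = - cst a"
  by (simp_all add: cst_def single_add mult_single one_pCons single_uminus mult.commute)

text \<open>The target has an additional variable t, which stands for x_p under \<open>pvar\<close>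
  and counts degrees under \<open>ev\<close>.\<close>

definition qeval :: "('a \<Rightarrow> 'b qpoly poly) \<Rightarrow> 'a qpoly \<Rightarrow> 'b qpoly poly" where
  "qeval v f = (\<Sum>m\<in>kys f. cst (lkp f m) * pmon v m)"

lemma qeval_superset: "finite A \<Longrightarrow> kys f \<subseteq> A \<Longrightarrow> qeval v f = (\<Sum>m\<in>A. cst (lkp f m) * pmon v m)"
  unfolding qeval_def by (intro sum.mono_neutral_left) (auto simp: in_keys_iff cst_simps)

lemma qeval_add: "qeval v (f + g) = qeval v f + qeval v g"
proof -
  let ?A = "kys f \<union> kys g"
  have "qeval v (f + g) = (\<Sum>m\<in>?A. cst (lkp (f + g) m) * pmon v m)"
    by (rule qeval_superset) (use Poly_Mapping.keys_add[of f g] in auto)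
  also have "\<dots> = (\<Sum>m\<in>?A. cst (lkp f m) * pmon v m) + (\<Sum>m\<in>?A. cst (lkp g m) * pmon v m)"
    by (simp add: lookup_add cst_simps distrib_right sum.distrib)
  also have "\<dots> = qeval v f + qeval v g"
    using qeval_superset[of ?A f v] qeval_superset[of ?A g v] by simp
  finally show ?thesis .
qed

lemma qeval_0 [simp]: "qeval v 0 = 0"
  by (simp add: qeval_def)

lemma qeval_single: "qeval v (sgl m c) = cst c * pmon v m"
  by (simp add: qeval_def cst_simps)

lemma qeval_1 [simp]: "qeval v 1 = 1"
  using qeval_single[of v 0 1] by (simp add: cst_simps)

lemma qeval_sum: "qeval v (sum f A) = (\<Sum>x\<in>A. qeval v (f x))"
  by (induction A rule: infinite_finite_induct) (auto simp: qeval_add)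

lemma qeval_mult: "qeval v (f * g) = qeval v f * qeval v g"
proof -
  have "f * g = (\<Sum>m\<in>kys f. sgl m (lkp f m)) * (\<Sum>n\<in>kys g. sgl n (lkp g n))"
    by (simp add: poly_mapping_sum_singles)
  also have "\<dots> = (\<Sum>m\<in>kys f. \<Sum>n\<in>kys g. sgl (m + n) (lkp f m * lkp g n))"
    by (simp add: sum_product mult_single)
  finally have "qeval v (f * g) = (\<Sum>m\<in>kys f. \<Sum>n\<in>kys g. cst (lkp f m) * pmon v m * (cst (lkp g n) * pmon v n))"
    by (simp add: qeval_sum qeval_single pmon_add cst_simps ac_simps)
  also have "\<dots> = qeval v f * qeval v g" by (simp add: qeval_def sum_product)
  finally show ?thesis .
qed

lemma qeval_prod: "qeval v (prod f A) = (\<Prod>x\<in>A. qeval v (f x))"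
  by (induction A rule: infinite_finite_induct) (auto simp: qeval_mult)

lemma qeval_uminus: "qeval v (- f) = - qeval v f"
  using qeval_add[of v f "- f"] by (simp add: eq_neg_iff_add_eq_0 add.commute)

lemma qeval_power: "qeval v (f ^ n) = qeval v f ^ n"
  by (induction n) (auto simp: qeval_mult)

lemma qeval_qvar [simp]: "qeval v (qvar g) = v g"
  by (simp add: qvar_def qeval_single pmon_single cst_simps)

definition strip :: "'a \<Rightarrow> ('a \<Rightarrow>\<^sub>0 nat) \<Rightarrow> ('a \<Rightarrow>\<^sub>0 nat)" where
  "strip p m = m - sgl p (lkp m p)"

lemma lkp_strip: "lkp (strip p m) g = (if g = p then 0 else lkp m g)"
  by (simp add: strip_def lookup_minus lookup_single when_def)

lemma strip_add: "strip p m + sgl p (lkp m p) = m"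
  by (rule poly_mapping_eqI) (simp add: lookup_add lkp_strip lookup_single when_def)

lemma kys_strip: "kys (strip p m) = kys m - {p}"
  by (auto simp: in_keys_iff lkp_strip split: if_splits)

definition pvar :: "'a \<Rightarrow> 'a \<Rightarrow> 'a qpoly poly" where
  "pvar p g = (if g = p then [:0, 1:] else [:qvar g:])"

lemma const_poly_prod: "finite A \<Longrightarrow> (\<Prod>g\<in>A. [:f g:]) = [:prod f A:]"
  by (induction A rule: finite_induct) (auto simp: one_pCons mult.commute)

lemma const_poly_sum: "(\<Sum>g\<in>A. [:f g:]) = [:sum f A:]"
  by (induction A rule: infinite_finite_induct) auto

lemma pmon_pvar: "pmon (pvar p) m = Polynomial.monom (sgl (strip p m) 1) (lkp m p)"
proof -
  have "pmon (pvar p) m = pmon (pvar p) (strip p m) * pmon (pvar p) (sgl p (lkp m p))"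
    by (simp add: pmon_add[symmetric] strip_add)
  also have "pmon (pvar p) (sgl p (lkp m p)) = Polynomial.monom 1 (lkp m p)"
    by (simp add: pmon_single pvar_def monom_altdef)
  also have "pmon (pvar p) (strip p m) = (\<Prod>g\<in>kys (strip p m). [:qvar g ^ lkp (strip p m) g:])"
    unfolding pmon_def by (intro prod.cong) (auto simp: pvar_def kys_strip poly_const_pow)
  also have "\<dots> = [:pmon qvar (strip p m):]" by (simp add: const_poly_prod pmon_def)
  finally show ?thesis by (simp add: pmon_qvar smult_monom)
qed

text \<open>Viewing a polynomial as one in t = x_p leaves coefficients free of x_p, whence the
  condition \<open>lkp n p = 0\<close>.\<close>

lemma lkp_coeff_qeval_pvar:
  "lkp (Polynomial.coeff (qeval (pvar p) f) i) n =
    (if lkp n p = 0 then lkp f (n + sgl p i) else 0)"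
proof -
  have 1: "strip p m = n \<and> lkp m p = i \<longleftrightarrow> lkp n p = 0 \<and> m = n + sgl p i" for m
  proof
    assume a: "strip p m = n \<and> lkp m p = i"
    then show "lkp n p = 0 \<and> m = n + sgl p i" using strip_add[of p m] lkp_strip[of p m p] by auto
  next
    assume a: "lkp n p = 0 \<and> m = n + sgl p i"
    then show "strip p m = n \<and> lkp m p = i"
      by (auto intro!: poly_mapping_eqI simp: lkp_strip lookup_add lookup_single when_def)
  qed
  have "lkp (Polynomial.coeff (qeval (pvar p) f) i) n =
      (\<Sum>m\<in>kys f. if strip p m = n \<and> lkp m p = i then lkp f m else 0)"
    by (auto simp: qeval_def pmon_pvar cst_def smult_monom mult_single coeff_sum lookup_sum
        lookup_single when_def intro!: sum.cong)
  also have "\<dots> = (\<Sum>m\<in>kys f. if lkp n p = 0 \<and> m = n + sgl p i then lkp f m else 0)"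
    unfolding 1 ..
  also have "\<dots> = (if lkp n p = 0 then lkp f (n + sgl p i) else 0)"
    by (auto simp: in_keys_iff)
  finally show ?thesis .
qed

section \<open>Lexicographic comparison of exponent vectors, the tie-breaking part of the monomial
  order\<close>

definition lexless :: "'a rel \<Rightarrow> ('a \<Rightarrow>\<^sub>0 nat) \<Rightarrow> ('a \<Rightarrow>\<^sub>0 nat) \<Rightarrow> bool" where
  "lexless r a b \<longleftrightarrow> (\<exists>v. lkp a v < lkp b v \<and> (\<forall>w. precedes r v w \<longrightarrow> lkp a w = lkp b w))"

lemma lexless_add_right: "lexless r a b \<Longrightarrow> lexless r (a + c) (b + c)"
  by (auto simp: lexless_def lookup_add)

lemma lexless_trans:
  assumes "linear_order_on H r" "kys b \<subseteq> H" "kys c \<subseteq> H" "lexless r a b" "lexless r b c"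
  shows "lexless r a c"
proof -
  obtain v where v: "lkp a v < lkp b v" "\<And>w. precedes r v w \<Longrightarrow> lkp a w = lkp b w"
    using assms(4) by (auto simp: lexless_def)
  obtain u where u: "lkp b u < lkp c u" "\<And>w. precedes r u w \<Longrightarrow> lkp b w = lkp c w"
    using assms(5) by (auto simp: lexless_def)
  have "v \<in> H" "u \<in> H" using v u assms(2,3) by (auto simp: in_keys_iff subset_iff)
  moreover have tr: "trans r" and an: "antisym r" and tot: "total_on H r"
    using assms(1) by (auto simp: linear_order_on_def partial_order_on_def preorder_on_def)
  ultimately consider "u = v" | "precedes r u v" | "precedes r v u"
    by (auto simp: precedes_def total_on_def)
  moreover have ptr: "precedes r x z" if "precedes r x y" "precedes r y z" for x y z
    using that tr an by (auto simp: precedes_def dest: transD antisymD)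
  ultimately show ?thesis
  proof cases
    case 1
    then show ?thesis unfolding lexless_def using u v by (intro exI[of _ v]) auto
  next
    case 2
    then show ?thesis unfolding lexless_def using u v ptr[OF 2] by (intro exI[of _ v]) auto
  next
    case 3
    then show ?thesis unfolding lexless_def using u v ptr[OF 3] by (intro exI[of _ u]) auto
  qed
qed

lemma lexless_irrefl: "\<not> lexless r a a"
  by (auto simp: lexless_def)

definition lexle :: "'a rel \<Rightarrow> ('a \<Rightarrow>\<^sub>0 nat) \<Rightarrow> ('a \<Rightarrow>\<^sub>0 nat) \<Rightarrow> bool" where
  "lexle r a b \<longleftrightarrow> a = b \<or> lexless r a b"

lemma kys_plus_nat: "kys (a + b) = kys a \<union> kys (b :: 'a \<Rightarrow>\<^sub>0 nat)"
  by (auto simp: in_keys_iff lookup_add)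

lemma lexle_add:
  assumes "linear_order_on H r" "kys b \<subseteq> H" "kys c \<subseteq> H" "kys d \<subseteq> H" "lexle r a b" "lexle r c d"
  shows "lexle r (a + c) (b + d)"
proof -
  have 1: "a + c = b + c \<or> lexless r (a + c) (b + c)" using assms lexless_add_right[of r a b c] by (auto simp: lexle_def)
  have 2: "b + c = b + d \<or> lexless r (b + c) (b + d)"
    using assms lexless_add_right[of r c d b] by (auto simp: lexle_def add.commute)
  then show ?thesis using 1 lexless_trans[OF assms(1), of "b + c" "b + d" "a + c"] assms(2-4)
    by (auto simp: lexle_def kys_plus_nat)
qed

definition mdeg :: "('a \<Rightarrow>\<^sub>0 nat) \<Rightarrow> nat" where
  "mdeg m = (\<Sum>g\<in>kys m. lkp m g)"

lemma mdeg_superset: "finite A \<Longrightarrow> kys m \<subseteq> A \<Longrightarrow> mdeg m = (\<Sum>g\<in>A. lkp m g)"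
  unfolding mdeg_def by (intro sum.mono_neutral_left) (auto simp: in_keys_iff)

lemma mdeg_add: "mdeg (m + n) = mdeg m + mdeg n"
  using mdeg_superset[of "kys m \<union> kys n" m] mdeg_superset[of "kys m \<union> kys n" n]
  by (simp add: mdeg_def[of "m + n"] kys_plus_nat lookup_add sum.distrib)

lemma mdeg_single [simp]: "mdeg (sgl g k) = k"
  by (simp add: mdeg_def)

lemma mdeg_0 [simp]: "mdeg 0 = 0"
  by (simp add: mdeg_def)

text \<open>The invariant for a substitution that replaces each variable by t times a linear form in
  variables not exceeding it: monomials are never raised, and the power of t records the
  degree.\<close>

definition lexbounded :: "'a set \<Rightarrow> 'a rel \<Rightarrow> ('a \<Rightarrow>\<^sub>0 nat) \<Rightarrow> 'a qpoly poly \<Rightarrow> bool" where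
  "lexbounded H r u P \<longleftrightarrow>
     (\<forall>d. \<forall>n\<in>kys (Polynomial.coeff P d). d = mdeg u \<and> mdeg n = mdeg u \<and> lexle r n u \<and> kys n \<subseteq> H)"

lemma lexbounded_1: "lexbounded H r 0 1"
proof -
  have "Polynomial.coeff (1 :: 'a qpoly poly) d = (if d = 0 then 1 else 0)" for d by (simp add: coeff_1)
  then show ?thesis by (auto simp: lexbounded_def lexle_def split: if_splits)
qed

lemma lexbounded_mult:
  assumes "linear_order_on H r" "lexbounded H r u P" "lexbounded H r w R" "kys u \<subseteq> H" "kys w \<subseteq> H"
  shows "lexbounded H r (u + w) (P * R)"
  unfolding lexbounded_def
proof (intro allI ballI)
  fix d n assume "n \<in> kys (Polynomial.coeff (P * R) d)"
  then have "n \<in> kys (\<Sum>i\<le>d. Polynomial.coeff P i * Polynomial.coeff R (d - i))" by (simp add: coeff_mult)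
  then have "(\<Sum>i\<le>d. lkp (Polynomial.coeff P i * Polynomial.coeff R (d - i)) n) \<noteq> 0"
    by (simp add: in_keys_iff lookup_sum)
  then obtain i where i: "i \<le> d" "n \<in> kys (Polynomial.coeff P i * Polynomial.coeff R (d - i))"
    by (metis (no_types, lifting) atMost_iff in_keys_iff sum.neutral)
  then obtain a b where ab: "n = a + b" "a \<in> kys (Polynomial.coeff P i)" "b \<in> kys (Polynomial.coeff R (d - i))"
    using keys_mult[of "Polynomial.coeff P i" "Polynomial.coeff R (d - i)"] by blast
  have a: "i = mdeg u" "mdeg a = mdeg u" "lexle r a u" "kys a \<subseteq> H" using assms(2) ab by (auto simp: lexbounded_def)
  have b: "d - i = mdeg w" "mdeg b = mdeg w" "lexle r b w" "kys b \<subseteq> H" using assms(3) ab by (auto simp: lexbounded_def)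
  show "d = mdeg (u + w) \<and> mdeg n = mdeg (u + w) \<and> lexle r n (u + w) \<and> kys n \<subseteq> H"
    using a b i ab(1) lexle_add[OF assms(1) assms(4) b(4) assms(5) a(3) b(3)]
    by (auto simp: mdeg_add kys_plus_nat)
qed

lemma lexbounded_pmon:
  assumes "linear_order_on H r" "\<And>g. g \<in> H \<Longrightarrow> lexbounded H r (sgl g 1) (v g)" "kys m \<subseteq> H"
  shows "lexbounded H r m (pmon v m)"
  using assms(3)
proof (induction "mdeg m" arbitrary: m)
  case 0
  then have "m = 0" by (auto simp: mdeg_def intro!: poly_mapping_eqI) (metis in_keys_iff)
  then show ?case using lexbounded_1 by simp
next
  case (Suc d)
  then have "kys m \<noteq> {}" by (auto simp: mdeg_def)
  then obtain g where g: "g \<in> kys m" by blast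
  define n where "n = m - sgl g 1"
  have m: "m = sgl g 1 + n"
    using g by (intro poly_mapping_eqI) (auto simp: n_def lookup_add lookup_minus lookup_single when_def in_keys_iff)
  have sub: "kys n \<subseteq> H" "kys (sgl g (1::nat)) \<subseteq> H" using Suc(3) unfolding m kys_plus_nat by auto
  have "mdeg n = d" using Suc(2) unfolding m mdeg_add by simp
  then have "lexbounded H r n (pmon v n)" using Suc(1) sub by simp
  then show ?case unfolding m pmon_add pmon_single
    using lexbounded_mult[OF assms(1) assms(2)[of g] _ sub(2,1)] g Suc(3) by auto
qed

section \<open>The commutative ideals\<close>

lemma linear_order_facts:
  assumes "linear_order_on H r"
  shows "\<And>x y z. precedes r x y \<Longrightarrow> precedes r y z \<Longrightarrow> precedes r x z"
    "\<And>x y. precedes r x y \<Longrightarrow> \<not> precedes r y x"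
    "\<And>x y. x \<in> H \<Longrightarrow> y \<in> H \<Longrightarrow> x \<noteq> y \<Longrightarrow> precedes r x y \<or> precedes r y x"
    "\<And>x y. precedes r x y \<Longrightarrow> x \<in> H \<and> y \<in> H"
proof -
  have tr: "trans r" and an: "antisym r" and tot: "total_on H r" and sub: "r \<subseteq> H \<times> H"
    using assms by (auto simp: linear_order_on_def partial_order_on_def preorder_on_def)
  show "\<And>x y z. precedes r x y \<Longrightarrow> precedes r y z \<Longrightarrow> precedes r x z"
    using tr an by (auto simp: precedes_def dest: transD antisymD)
  show "\<And>x y. precedes r x y \<Longrightarrow> \<not> precedes r y x"
    using an by (auto simp: precedes_def dest: antisymD)
  show "\<And>x y. x \<in> H \<Longrightarrow> y \<in> H \<Longrightarrow> x \<noteq> y \<Longrightarrow> precedes r x y \<or> precedes r y x"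
    using tot by (auto simp: precedes_def total_on_def)
  show "\<And>x y. precedes r x y \<Longrightarrow> x \<in> H \<and> y \<in> H"
    using sub by (auto simp: precedes_def)
qed

text \<open>Stated for an arbitrary relation, so that it also yields minima by reversal and applies
  to elements, variables and monomials alike.\<close>

lemma finite_strict_max:
  assumes "finite X" "X \<noteq> {}" "\<And>x y. x \<in> X \<Longrightarrow> y \<in> X \<Longrightarrow> x \<noteq> y \<Longrightarrow> P x y \<or> P y x"
    "\<And>x y z. x \<in> X \<Longrightarrow> y \<in> X \<Longrightarrow> z \<in> X \<Longrightarrow> P x y \<Longrightarrow> P y z \<Longrightarrow> P x z"
  shows "\<exists>m\<in>X. \<forall>x\<in>X. x \<noteq> m \<longrightarrow> P x m"
  using assms
proof (induction X rule: finite_ne_induct)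
  case (singleton x)
  show ?case by simp
next
  case (insert u X)
  have "\<exists>m\<in>X. \<forall>x\<in>X. x \<noteq> m \<longrightarrow> P x m"
  proof (rule insert.IH)
    show "P x y \<or> P y x" if "x \<in> X" "y \<in> X" "x \<noteq> y" for x y
      using insert.prems(1)[of x y] that by simp
    show "P x z" if "x \<in> X" "y \<in> X" "z \<in> X" "P x y" "P y z" for x y z
      using insert.prems(2)[of x y z] that by simp
  qed
  then obtain m where m: "m \<in> X" "\<forall>x\<in>X. x \<noteq> m \<longrightarrow> P x m" by blast
  have "m \<noteq> u" using m insert.hyps by auto
  then consider "P u m" | "P m u" using insert.prems(1)[of m u] m by auto
  then show ?case
  proof cases
    case 1
    then show ?thesis using m by auto
  next
    case 2
    have "P x u" if "x \<in> X" for x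
      using that m 2 insert.prems(2)[of x m u] by (cases "x = m") auto
    then show ?thesis by auto
  qed
qed

text \<open>Degrees need not add in a ring with zero divisors; carrying the leading coefficient 1
  through the induction excludes cancellation.\<close>

lemma prod_monic_linear:
  fixes f :: "'b \<Rightarrow> 'r::comm_ring_1"
  assumes "finite V"
  shows "Polynomial.degree (\<Prod>a\<in>V. [:f a, 1:]) = card V \<and>
    Polynomial.coeff (\<Prod>a\<in>V. [:f a, 1:]) (card V) = 1"
  using assms
proof (induction V rule: finite_induct)
  case empty
  then show ?case by simp
next
  case (insert x V)
  let ?P = "\<Prod>a\<in>V. [:f a, 1:]"
  have c: "Polynomial.coeff ([:f x, 1:] * ?P) (Suc (card V)) = 1"
    using coeff_mult_degree_sum[of "[:f x, 1:]" ?P] insert.IH by simp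
  have "Polynomial.degree ([:f x, 1:] * ?P) \<le> Suc (card V)"
    using degree_mult_le[of "[:f x, 1:]" ?P] insert.IH by simp
  moreover have "Suc (card V) \<le> Polynomial.degree ([:f x, 1:] * ?P)"
    by (rule le_degree) (simp only: c, simp)
  ultimately show ?case using c insert by simp
qed

lemma coeff_0_prod: "Polynomial.coeff (prod F A) 0 = (\<Prod>a\<in>A. Polynomial.coeff (F a) 0)"
  by (simp add: poly_0_coeff_0[symmetric] poly_prod)

lemma lexless_cancel: "lexless r (a + c) (b + c) \<Longrightarrow> lexless r a b"
  by (auto simp: lexless_def lookup_add)

context building
begin

text \<open>Modulo the relation c_a, this is - x_a.\<close>

definition sg :: "'a set \<Rightarrow> 'a \<Rightarrow> 'a qpoly" where
  "sg Q a = (\<Sum>h\<in>{h \<in> Q. a \<sqsubseteq> h}. qvar h)"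

text \<open>What the relations of type (i) impose on the coefficient of e_N, after eliminating x_a for the
  atoms a.\<close>

definition local_ideal :: "'a set \<Rightarrow> 'a set \<Rightarrow> 'a qpoly set" where
  "local_ideal Q N = idl {prod qvar U * prod (sg Q) V | U V. U \<subseteq> Q \<and> V \<subseteq> atoms L \<and> violates Q (U \<union> V \<union> N)}"

lemma cideal_JI: "cideal (local_ideal Q N)"
  by (simp add: local_ideal_def cideal_idl)

lemma local_ideal_gen: "U \<subseteq> Q \<Longrightarrow> V \<subseteq> atoms L \<Longrightarrow> violates Q (U \<union> V \<union> N) \<Longrightarrow> prod qvar U * prod (sg Q) V \<in> local_ideal Q N"
  unfolding local_ideal_def by (rule idl_gen) blast

lemma local_ideal_mono: 
  assumes "N \<subseteq> N'" "N' \<subseteq> carrier L" "Q \<subseteq> carrier L"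
  shows "local_ideal Q N \<subseteq> local_ideal Q N'"
  unfolding local_ideal_def[of Q N]
proof (rule idl_least[OF cideal_JI], rule subsetI)
  fix x assume "x \<in> {prod qvar U * prod (sg Q) V | U V. U \<subseteq> Q \<and> V \<subseteq> atoms L \<and> violates Q (U \<union> V \<union> N)}"
  then obtain U V where "x = prod qvar U * prod (sg Q) V" and U: "U \<subseteq> Q" "V \<subseteq> atoms L" "violates Q (U \<union> V \<union> N)" by auto
  moreover have "violates Q (U \<union> V \<union> N')"
    by (rule violates_mono[OF U(3)]) (use U assms atoms_carrier in auto)
  ultimately show "x \<in> local_ideal Q N'" using local_ideal_gen by blast
qed

lemma upper_remove:
  assumes "upper Q" "\<And>q. q \<in> Q \<Longrightarrow> q \<sqsubseteq> p \<Longrightarrow> q = p"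
  shows "upper (Q - {p})"
  using assms unfolding upper_def by blast

end

text \<open>One step of the induction, modelled on Keel's presentation of the Chow ring of a blowup
  with centre \<open>p\<close>. In the picture of hyperplanes as atoms, \<open>B\<close> is a
  minimal family of hyperplanes that, together with those already in \<open>N\<close>, cuts out the
  centre.\<close>

locale keel = building +
  fixes Q N :: "'a set" and p :: 'a and B :: "'a set"
  assumes Qup: "upper Q" and pQ: "p \<in> Q" and pmin: "\<And>q. q \<in> Q \<Longrightarrow> q \<sqsubseteq> p \<Longrightarrow> q = p"
    and NQ: "N \<subseteq> atoms L \<union> Q" and Nn: "\<not> violates Q N"
    and Bsub: "B \<subseteq> {a \<in> atoms L. a \<sqsubseteq> p}"
    and Bspan: "\<Squnion>(B \<union> (N \<inter> {a \<in> atoms L. a \<sqsubseteq> p})) = p"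
    and Bmin: "\<And>V. V \<subseteq> B \<Longrightarrow> \<Squnion>(V \<union> (N \<inter> {a \<in> atoms L. a \<sqsubseteq> p})) = p \<Longrightarrow> V = B"
begin

definition "Q' = Q - {p}"
definition "Ap = {a \<in> atoms L. a \<sqsubseteq> p}"
definition "N0 = N \<inter> Ap"
text \<open>Restriction to the centre adds all atoms below \<open>p\<close>. Accordingly
  \<open>K\<close> plays the role of the kernel of this restriction.\<close>

definition "N1 = (N - {p}) \<union> Ap"
definition "K = local_ideal Q' N1"
text \<open>If \<open>p\<close> belongs to \<open>N\<close>, one is on the centre already, and the
  constant term is subject to the same relations as the other coefficients.\<close>

definition "J0 = (if p \<in> N then K else local_ideal Q' N)"
text \<open>For atoms below \<open>p\<close> this is the product of the \<open>sg Q a\<close> after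
  setting x_p = t: the element \<open>p\<close> above \<open>a\<close> contributes the summand
  t.\<close>

definition PV :: "'a set \<Rightarrow> 'a qpoly poly" where "PV V = (\<Prod>a\<in>V. [:sg Q' a, 1:])"
abbreviation "q \<equiv> PV B"

lemma cars: "Q \<subseteq> carrier L" "Q' \<subseteq> carrier L" "Ap \<subseteq> carrier L" "Ap \<subseteq> atoms L" "N \<subseteq> carrier L" "N1 \<subseteq> carrier L"
   "N0 \<subseteq> carrier L" "p \<in> carrier L" "B \<subseteq> Ap" "N0 \<subseteq> Ap" "N0 \<subseteq> N"
proof -
  show "Q \<subseteq> carrier L" using Qup G_carrier by (auto simp: upper_def)
  then show "Q' \<subseteq> carrier L" "p \<in> carrier L" "N \<subseteq> carrier L" using pQ NQ atoms_carrier by (auto simp: Q'_def)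
  show "Ap \<subseteq> carrier L" "Ap \<subseteq> atoms L" using atoms_carrier by (auto simp: Ap_def)
  show "B \<subseteq> Ap" using Bsub by (simp add: Ap_def)
  show "N0 \<subseteq> Ap" "N0 \<subseteq> N" by (auto simp: N0_def)
  show "N1 \<subseteq> carrier L" "N0 \<subseteq> carrier L" using \<open>N \<subseteq> carrier L\<close> \<open>Ap \<subseteq> carrier L\<close> by (auto simp: N1_def N0_def)
qed

lemma Q'up: "upper Q'"
  unfolding Q'_def by (rule upper_remove[OF Qup pmin])

lemma fin: "X \<subseteq> carrier L \<Longrightarrow> finite X"
  using fin_carrier finite_subset by auto

lemma Q'_not_le_p: "h \<in> Q' \<Longrightarrow> \<not> h \<sqsubseteq> p"
  using pmin by (auto simp: Q'_def)

lemma J_Ap: "\<Squnion>Ap = p"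
proof (rule le_antisym)
  show "\<Squnion>Ap \<sqsubseteq> p" by (rule J_least) (use cars in \<open>auto simp: Ap_def\<close>)
  show "p \<sqsubseteq> \<Squnion>Ap"
    by (rule atomistic_le) (use cars J_closed[OF cars(3)] J_upper[OF cars(3)] in \<open>auto simp: Ap_def\<close>)
qed (use cars J_closed in auto)

text \<open>\<open>p\<close> and the set of atoms below it have the same join, and neither
  \<open>p\<close> nor an atom lies above a member of \<open>Q'\<close>.\<close>

lemma Ap_p_swap:
  assumes "R \<subseteq> carrier L"
  shows "violates Q' (Ap \<union> R) \<longleftrightarrow> violates Q' (insert p R)"
proof
  assume "violates Q' (Ap \<union> R)"
  then have "violates Q' ({p} \<union> R)"
    by (rule violates_replace[OF cars(3) _ assms cars(2), rotated 3])
       (use cars J_Ap J_single[OF cars(8)] Q'_not_le_p in auto)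
  then show "violates Q' (insert p R)" by simp
next
  assume "violates Q' (insert p R)"
  then have "violates Q' ({p} \<union> R)" by simp
  then show "violates Q' (Ap \<union> R)"
    by (rule violates_replace[OF _ cars(3) assms cars(2), rotated 3])
       (use cars J_Ap J_single[OF cars(8)] not_le_atom[OF Q'up] in auto)
qed

text \<open>Otherwise \<open>p\<close> itself would be a violation in \<open>N\<close>. It follows
  that \<open>B\<close> is nonempty and that \<open>q\<close> has positive degree.\<close>

lemma N0_not_spanning: "\<Squnion>N0 \<noteq> p"
proof
  assume "\<Squnion>N0 = p"
  moreover have "\<Squnion>N0 \<sqsubseteq> \<Squnion>{s \<in> N. \<not> p \<sqsubseteq> s}"
    by (rule J_mono) (use cars not_le_atom[OF Qup pQ] in auto)
  ultimately show False using Nn pQ by (auto simp: violates_def)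
qed

lemma B_ne: "B \<noteq> {}"
proof
  assume "B = {}"
  then show False using Bspan N0_not_spanning by (simp add: N0_def Ap_def)
qed

lemma span_B: "\<Squnion>(B \<union> N0) = p"
  using Bspan by (simp add: N0_def Ap_def)

lemma min_B: "V \<subseteq> B \<Longrightarrow> \<Squnion>(V \<union> N0) = p \<Longrightarrow> V = B"
  using Bmin by (simp add: N0_def Ap_def)

lemma PV_degree: "V \<subseteq> Ap \<Longrightarrow> Polynomial.degree (PV V) = card V"
  "V \<subseteq> Ap \<Longrightarrow> Polynomial.coeff (PV V) (card V) = 1"
  using prod_monic_linear[of V "sg Q'"] fin[of V] cars by (auto simp: PV_def)

lemma PV_0: "Polynomial.coeff (PV V) 0 = prod (sg Q') V"
  by (simp add: PV_def coeff_0_prod)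

lemma J0_sub: "J0 \<subseteq> K"
  using local_ideal_mono[of N N1 Q'] cars by (auto simp: J0_def K_def N1_def)

text \<open>Since \<open>B\<close> and \<open>N0\<close> together span \<open>p\<close>, they may
  replace the atoms of \<open>Ap\<close> in a violation. The product over \<open>B\<close> supplies
  the new factors, and \<open>N0\<close> is already contained in \<open>N\<close>.\<close>

lemma kill:
  assumes "a \<in> K" shows "a * prod (sg Q') B \<in> J0"
proof (cases "p \<in> N")
  case True
  then show ?thesis using assms cideal_multr[OF cideal_JI] by (simp add: J0_def K_def)
next
  case False
  let ?I = "{a. a * prod (sg Q') B \<in> local_ideal Q' N}"
  have I: "cideal ?I"
    using cideal_JI[of Q' N] by (auto simp: cideal_def distrib_right mult.assoc)
  have "K \<subseteq> ?I" unfolding K_def local_ideal_def[of Q' N1]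
  proof (rule idl_least[OF I], rule subsetI)
    fix x assume "x \<in> {prod qvar U * prod (sg Q') V | U V. U \<subseteq> Q' \<and> V \<subseteq> atoms L \<and> violates Q' (U \<union> V \<union> N1)}"
    then obtain U V where x: "x = prod qvar U * prod (sg Q') V"
      and U: "U \<subseteq> Q'" "V \<subseteq> atoms L" "violates Q' (U \<union> V \<union> N1)" by auto
    have R: "U \<union> V \<union> N \<subseteq> carrier L" using U cars atoms_carrier by auto
    have "U \<union> V \<union> N1 = Ap \<union> (U \<union> V \<union> N)" using False by (auto simp: N1_def)
    then have 1: "violates Q' (Ap \<union> (U \<union> V \<union> N))" using U(3) by simp
    have "violates Q' ((B \<union> N0) \<union> (U \<union> V \<union> N))"
      by (rule violates_atoms[OF Q'up cars(4) _ R _ 1]) (use cars J_Ap span_B in auto)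
    moreover have "(B \<union> N0) \<union> (U \<union> V \<union> N) = U \<union> (V \<union> B) \<union> N" using cars by auto
    ultimately have "violates Q' (U \<union> (V \<union> B) \<union> N)" by simp
    then have "prod qvar U * prod (sg Q') (V \<union> B) \<in> local_ideal Q' N"
      by (intro local_ideal_gen) (use U cars in auto)
    \<comment> \<open>Atoms in both \<open>V\<close> and \<open>B\<close> occur twice in the
      product, whereas the generator contains them once; the intersection makes up the
      difference.\<close>
    then have "prod qvar U * prod (sg Q') (V \<union> B) * prod (sg Q') (V \<inter> B) \<in> local_ideal Q' N"
      by (rule cideal_multr[OF cideal_JI])
    moreover have "prod (sg Q') (V \<union> B) * prod (sg Q') (V \<inter> B) = prod (sg Q') V * prod (sg Q') B"
      by (rule prod.union_inter) (use U cars atoms_carrier fin in auto)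
    ultimately show "x \<in> ?I" by (simp add: x mult.assoc)
  qed
  then show ?thesis using assms False by (auto simp: J0_def)
qed

sublocale blow_ideal_setting J0 K "PV B"
proof
  show "cideal J0" "cideal K" using cideal_JI by (auto simp: J0_def K_def)
  show "J0 \<subseteq> K" by (rule J0_sub)
  show "Polynomial.coeff (PV B) (Polynomial.degree (PV B)) = 1" using PV_degree[of B] cars by simp
  show "0 < Polynomial.degree (PV B)" using PV_degree(1)[of B] B_ne cars fin[of B] by (auto simp: card_gt_0_iff)
  show "\<And>a. a \<in> K \<Longrightarrow> a * Polynomial.coeff (PV B) 0 \<in> J0" using kill by (simp add: PV_0)
qed

abbreviation "Jt \<equiv> blow_ideal J0 K (PV B)"

text \<open>As \<open>h\<close> shares the atom \<open>a\<close> with \<open>p\<close> but is not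
  above \<open>p\<close>, its variable lies in \<open>K\<close>. For the constant term,
  \<open>violates_exchange\<close> applies with \<open>W\<close> and \<open>N0\<close>.\<close>

lemma exchange_mem:
  assumes "W \<subseteq> Ap" "a \<in> Ap" "c \<in> Ap" "h \<in> Q'" "a \<sqsubseteq> h" "\<not> c \<sqsubseteq> h"
    "c \<sqsubseteq> \<Squnion>(insert a (W \<union> N0))" "\<not> c \<sqsubseteq> \<Squnion>(W \<union> N0)"
  shows "PV W * [:qvar h:] \<in> Jt"
proof -
  have hc: "h \<in> carrier L" "h \<in> Q" "h \<noteq> p" using assms cars by (auto simp: Q'_def)
  have cc: "c \<in> carrier L" "c \<sqsubseteq> p" "a \<in> atoms L" "a \<sqsubseteq> p" "c \<in> atoms L" using assms cars by (auto simp: Ap_def)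
  have np: "\<not> p \<sqsubseteq> h" using assms(6) le_trans[OF cc(2) _ cc(1) cars(8) hc(1)] by blast
  have "violates Q' (insert h Ap)"
    unfolding Q'_def Ap_def
    by (rule violates_common_atom[OF Qup pQ _ hc(2) np cc(3,4) assms(5)]) (rule pmin)
  then have "violates Q' ({h} \<union> {} \<union> N1)"
    by (rule violates_mono) (use hc cars in \<open>auto simp: N1_def\<close>)
  then have "prod qvar {h} * prod (sg Q') {} \<in> K" unfolding K_def
    by (intro local_ideal_gen) (use assms in auto)
  then have hK: "qvar h \<in> K" by simp
  have 0: "qvar h * prod (sg Q') W \<in> J0"
  proof (cases "p \<in> N")
    case True
    then show ?thesis using hK cideal_multr[OF cideal_JI] by (simp add: J0_def K_def)
  next
    case False
    have "violates Q' (insert h (W \<union> N0))" unfolding Q'_def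
      by (rule violates_exchange[OF Qup pQ _ hc(2,3) _ cc(3,5) assms(5,6,7,8)])
         (use pmin assms(1) cars in auto)
    then have "violates Q' ({h} \<union> W \<union> N)"
      by (rule violates_mono) (use hc assms(1) cars in auto)
    then have "prod qvar {h} * prod (sg Q') W \<in> local_ideal Q' N"
      by (intro local_ideal_gen) (use assms cars in auto)
    then show ?thesis using False by (simp add: J0_def)
  qed
  show ?thesis
  proof (rule blow_ideal_coeffs)
    show "Polynomial.coeff (PV W * [:qvar h:]) i \<in> K" for i
      using hK cideal_mult[OF cideal_JI] by (simp add: K_def mult.commute)
    show "Polynomial.coeff (PV W * [:qvar h:]) 0 \<in> J0"
      using 0 by (simp add: PV_0 mult.commute)
  qed
qed

lemma PV_union: "finite V \<Longrightarrow> W \<subseteq> V \<Longrightarrow> PV V = PV (V - W) * PV W"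
  unfolding PV_def by (rule prod.subset_diff) auto

lemma PV_insert: "finite V \<Longrightarrow> a \<notin> V \<Longrightarrow> PV (insert a V) = [:sg Q' a, 1:] * PV V"
  unfolding PV_def by simp

text \<open>Elements above both \<open>a\<close> and \<open>c\<close> cancel, and the remaining ones
  fall under \<open>exchange_mem\<close>.\<close>

lemma exchange_diff:
  assumes "W \<subseteq> Ap" "a \<in> Ap" "c \<in> Ap"
    "c \<sqsubseteq> \<Squnion>(insert a (W \<union> N0))" "a \<sqsubseteq> \<Squnion>(insert c (W \<union> N0))"
    "\<not> c \<sqsubseteq> \<Squnion>(W \<union> N0)" "\<not> a \<sqsubseteq> \<Squnion>(W \<union> N0)"
  shows "PV W * [:sg Q' a, 1:] - PV W * [:sg Q' c, 1:] \<in> Jt"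
proof -
  have finQ: "finite Q'" using fin cars by auto
  let ?both = "{h \<in> Q'. a \<sqsubseteq> h \<and> c \<sqsubseteq> h}"
  have s: "sg Q' a = sum qvar ?both + sum qvar {h \<in> Q'. a \<sqsubseteq> h \<and> \<not> c \<sqsubseteq> h}"
    "sg Q' c = sum qvar ?both + sum qvar {h \<in> Q'. c \<sqsubseteq> h \<and> \<not> a \<sqsubseteq> h}"
    unfolding sg_def using finQ by (subst sum.union_disjoint[symmetric]; auto intro!: sum.cong)+
  have "PV W * [:sg Q' a, 1:] - PV W * [:sg Q' c, 1:] = PV W * [:sg Q' a - sg Q' c:]"
    by (simp add: algebra_simps smult_diff_left)
  also have "[:sg Q' a - sg Q' c:] = (\<Sum>h\<in>{h \<in> Q'. a \<sqsubseteq> h \<and> \<not> c \<sqsubseteq> h}. [:qvar h:]) -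
      (\<Sum>h\<in>{h \<in> Q'. c \<sqsubseteq> h \<and> \<not> a \<sqsubseteq> h}. [:qvar h:])"
    unfolding const_poly_sum by (simp add: s)
  finally have eq: "PV W * [:sg Q' a, 1:] - PV W * [:sg Q' c, 1:] =
      (\<Sum>h\<in>{h \<in> Q'. a \<sqsubseteq> h \<and> \<not> c \<sqsubseteq> h}. PV W * [:qvar h:]) -
      (\<Sum>h\<in>{h \<in> Q'. c \<sqsubseteq> h \<and> \<not> a \<sqsubseteq> h}. PV W * [:qvar h:])"
    by (simp only: right_diff_distrib sum_distrib_left)
  show ?thesis unfolding eq
  proof (intro cideal_diff[OF cideal_blow_ideal] cideal_sum[OF cideal_blow_ideal])
    fix h assume "h \<in> {h \<in> Q'. a \<sqsubseteq> h \<and> \<not> c \<sqsubseteq> h}"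
    then show "PV W * [:qvar h:] \<in> Jt" by (intro exchange_mem[OF assms(1,2,3)]) (use assms in auto)
  next
    fix h assume "h \<in> {h \<in> Q'. c \<sqsubseteq> h \<and> \<not> a \<sqsubseteq> h}"
    then show "PV W * [:qvar h:] \<in> Jt" by (intro exchange_mem[OF assms(1,3,2)]) (use assms in auto)
  qed
qed

lemma minimal_spanning:
  assumes "V \<subseteq> Ap" "\<Squnion>(V \<union> N0) = p"
  shows "\<exists>V'\<subseteq>V. \<Squnion>(V' \<union> N0) = p \<and> (\<forall>W. W \<subset> V' \<longrightarrow> \<Squnion>(W \<union> N0) \<noteq> p)"
proof -
  have "finite V" by (rule fin) (use assms(1) cars(3) in auto)
  then show ?thesis using assms(2)
  proof (induction V rule: finite_psubset_induct)
    case (psubset V)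
    show ?case
    proof (cases "\<exists>W. W \<subset> V \<and> \<Squnion>(W \<union> N0) = p")
      case True
      then obtain W where W: "W \<subset> V" "\<Squnion>(W \<union> N0) = p" by auto
      then obtain V' where "V' \<subseteq> W" "\<Squnion>(V' \<union> N0) = p" "\<forall>W. W \<subset> V' \<longrightarrow> \<Squnion>(W \<union> N0) \<noteq> p"
        using psubset.IH[OF W] by blast
      then show ?thesis using W by blast
    qed (use psubset in blast)
  qed
qed

text \<open>The ideal is built with one spanning set, and basis exchange shows that it contains the
  products of all others. An element outside \<open>B\<close> is traded for one of \<open>B\<close>,
  at the cost of a difference in the ideal, until the minimal spanning set lies inside
  \<open>B\<close> and hence equals it.\<close>

lemma spanning_mem:
  assumes "V \<subseteq> Ap" "\<Squnion>(V \<union> N0) = p"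
  shows "PV V \<in> Jt"
  using assms
proof (induction "card (V - B)" arbitrary: V rule: less_induct)
  case less
  have finV: "finite V" by (rule fin) (use less.prems(1) cars(3) in auto)
  obtain V' where V': "V' \<subseteq> V" "\<Squnion>(V' \<union> N0) = p" "\<And>W. W \<subset> V' \<Longrightarrow> \<Squnion>(W \<union> N0) \<noteq> p"
    using minimal_spanning[OF less.prems] by blast
  have V'A: "V' \<subseteq> Ap" using V' less.prems by auto
  have finV': "finite V'" using V' finV finite_subset by auto
  have "PV V' \<in> Jt"
  proof (cases "V' \<subseteq> B")
    case True
    then have "V' = B" using min_B V' by auto
    then show ?thesis using blow_ideal_q by simp
  next
    case False
    then obtain v where v: "v \<in> V'" "v \<notin> B" by auto
    define W where "W = V' - {v}"
    define y where "y = \<Squnion>(W \<union> N0)"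
    have Wc: "W \<subseteq> Ap" "W \<union> N0 \<subseteq> carrier L" "v \<notin> W" "V' = insert v W" "finite W"
      using V'A v cars finV' by (auto simp: W_def)
    have y: "y \<in> carrier L" "y \<noteq> p" using J_closed[OF Wc(2)] V'(3)[of W] v by (auto simp: y_def W_def)
    have ins: "\<Squnion>(insert d (W \<union> N0)) = \<Squnion>{y, d}" if "d \<in> carrier L" for d
      using J_union[OF Wc(2), of "{d}"] that by (simp add: y_def)
    have yp: "y \<sqsubseteq> p" unfolding y_def
      by (rule J_least[OF Wc(2) cars(8)]) (use Wc(1) cars(10) in \<open>auto simp: Ap_def\<close>)
    have "\<exists>b\<in>B. \<not> b \<sqsubseteq> y"
    proof (rule ccontr)
      assume "\<not> ?thesis"
      then have all: "d \<sqsubseteq> y" if "d \<in> B \<union> N0" for d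
        using that J_upper[OF Wc(2)] by (auto simp: y_def)
      have "B \<union> N0 \<subseteq> carrier L" using cars by auto
      from J_least[OF this y(1) all] have "p \<sqsubseteq> y" by (simp add: span_B)
      then show False using y yp cars le_antisym by auto
    qed
    then obtain b where b: "b \<in> B" "\<not> b \<sqsubseteq> y" by auto
    have bv: "b \<in> Ap" "v \<in> Ap" "b \<in> atoms L" "v \<in> atoms L" "b \<in> carrier L" "v \<in> carrier L" "b \<sqsubseteq> p" "v \<sqsubseteq> p"
      using b v V'A cars by (auto simp: Ap_def)
    have yv: "\<Squnion>{y, v} = p" using V'(2) ins[OF bv(6)] Wc(4) by simp
    have nvy: "\<not> v \<sqsubseteq> y"
    proof
      assume "v \<sqsubseteq> y"
      then have "\<Squnion>{y, v} = y" using y bv J_upper[of "{y,v}" y] by (intro J_eqI) auto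
      then show False using yv y by simp
    qed
    have ybc: "{y, b} \<subseteq> carrier L" using y bv by auto
    have "\<Squnion>{y, b} = y \<or> \<Squnion>{y, b} = \<Squnion>{y, v}"
    proof (rule atom_cover[OF bv(4) y(1) nvy J_closed[OF ybc]])
      show "y \<sqsubseteq> \<Squnion>{y, b}" using J_upper[OF ybc] by auto
      show "\<Squnion>{y, b} \<sqsubseteq> \<Squnion>{y, v}" unfolding yv by (rule J_least[OF ybc cars(8)]) (use yp bv in auto)
    qed
    moreover have "\<Squnion>{y, b} \<noteq> y" using J_upper[OF ybc, of b] b by auto
    ultimately have yb: "\<Squnion>{y, b} = p" using yv by simp
    have bW: "b \<notin> W" using b J_upper[OF Wc(2), of b] by (auto simp: y_def)
    have "\<Squnion>(insert b W \<union> N0) = p" using ins[OF bv(5)] yb by simp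
    moreover have "insert b W - B \<subset> V - B" using b v V'(1) Wc by auto
    then have "card (insert b W - B) < card (V - B)" by (intro psubset_card_mono) (use finV in auto)
    ultimately have mb: "PV (insert b W) \<in> Jt" using less.hyps[of "insert b W"] Wc(1) bv by auto
    have "PV W * [:sg Q' v, 1:] - PV W * [:sg Q' b, 1:] \<in> Jt"
      by (rule exchange_diff[OF Wc(1) bv(2,1)])
         (use ins bv yv yb b nvy in \<open>auto simp: y_def[symmetric]\<close>)
    then have "(PV W * [:sg Q' v, 1:] - PV W * [:sg Q' b, 1:]) + PV (insert b W) \<in> Jt"
      using mb by (rule cideal_add[OF cideal_blow_ideal])
    moreover have "(PV W * [:sg Q' v, 1:] - PV W * [:sg Q' b, 1:]) + PV (insert b W) = PV V'"
      unfolding Wc(4) using PV_insert[OF Wc(5) bW] PV_insert[OF Wc(5) Wc(3)] by (simp add: mult.commute)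
    ultimately show ?thesis by simp
  qed
  then show ?case using PV_union[OF finV V'(1)] cideal_mult[OF cideal_blow_ideal] by simp
qed

lemma psi_sg: "a \<in> atoms L \<Longrightarrow> qeval (pvar p) (sg Q a) = (if a \<sqsubseteq> p then [:sg Q' a, 1:] else [:sg Q' a:])"
proof -
  have finQ: "finite Q'" using fin cars by auto
  have 1: "(\<Sum>h\<in>{h \<in> Q'. a \<sqsubseteq> h}. pvar p h) = [:sg Q' a:]"
  proof -
    have "(\<Sum>h\<in>{h \<in> Q'. a \<sqsubseteq> h}. pvar p h) = (\<Sum>h\<in>{h \<in> Q'. a \<sqsubseteq> h}. [:qvar h:])"
      by (rule sum.cong) (auto simp: pvar_def Q'_def)
    then show ?thesis by (simp add: const_poly_sum sg_def)
  qed
  have "{h \<in> Q. a \<sqsubseteq> h} = (if a \<sqsubseteq> p then insert p {h \<in> Q'. a \<sqsubseteq> h} else {h \<in> Q'. a \<sqsubseteq> h})"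
    using pQ by (auto simp: Q'_def)
  then show ?thesis using finQ 1
    by (simp add: sg_def[of Q] qeval_sum) (auto simp: Q'_def pvar_def)
qed

lemma psi_gen:
  assumes "U \<subseteq> Q" "V \<subseteq> atoms L"
  shows "qeval (pvar p) (prod qvar U * prod (sg Q) V) =
    (if p \<in> U then [:0, 1:] else 1) * [:prod qvar (U - {p}) * prod (sg Q') (V - Ap):] * PV (V \<inter> Ap)"
proof -
  have finU: "finite U" by (rule fin) (use assms(1) cars(1) in auto)
  have finV: "finite V" by (rule fin) (use assms(2) atoms_carrier in auto)
  have U: "(\<Prod>g\<in>U. pvar p g) = (if p \<in> U then [:0, 1:] else 1) * [:prod qvar (U - {p}):]"
  proof -
    have "(\<Prod>g\<in>U - {p}. pvar p g) = [:prod qvar (U - {p}):]"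
    proof -
      have "(\<Prod>g\<in>U - {p}. pvar p g) = (\<Prod>g\<in>U - {p}. [:qvar g:])"
        by (rule prod.cong) (auto simp: pvar_def)
      then show ?thesis using finU by (simp add: const_poly_prod)
    qed
    moreover have "pvar p p = [:0, 1:]" by (simp add: pvar_def)
    ultimately show ?thesis
      using finU prod.remove[of U p "pvar p"] by (cases "p \<in> U") simp_all
  qed
  have "(\<Prod>a\<in>V. qeval (pvar p) (sg Q a)) =
      (\<Prod>a\<in>V - (V \<inter> Ap). qeval (pvar p) (sg Q a)) * (\<Prod>a\<in>V \<inter> Ap. qeval (pvar p) (sg Q a))"
    using finV by (intro prod.subset_diff) auto
  also have "(\<Prod>a\<in>V \<inter> Ap. qeval (pvar p) (sg Q a)) = PV (V \<inter> Ap)"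
    unfolding PV_def by (rule prod.cong) (use psi_sg cars in \<open>auto simp: Ap_def\<close>)
  also have "V - (V \<inter> Ap) = V - Ap" by auto
  also have "(\<Prod>a\<in>V - Ap. qeval (pvar p) (sg Q a)) = (\<Prod>a\<in>V - Ap. [:sg Q' a:])"
    by (rule prod.cong) (use psi_sg assms in \<open>auto simp: Ap_def\<close>)
  also have "\<dots> = [:prod (sg Q') (V - Ap):]" using finV by (simp add: const_poly_prod)
  finally have V: "(\<Prod>a\<in>V. qeval (pvar p) (sg Q a)) = [:prod (sg Q') (V - Ap):] * PV (V \<inter> Ap)" .
  show ?thesis
    by (simp add: qeval_mult qeval_prod U V mult.commute[of "prod (sg Q') (V - Ap)"])
qed

text \<open>The alternatives of \<open>violates_remove_min\<close> lead to a multiple of a spanning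
  product in one case, and to a polynomial with all coefficients in \<open>K\<close> in the
  other.\<close>

lemma gen_mem:
  assumes "U \<subseteq> Q" "V \<subseteq> atoms L" "violates Q (U \<union> V \<union> N)"
  shows "qeval (pvar p) (prod qvar U * prod (sg Q) V) \<in> Jt"
proof -
  have X: "U \<union> V \<union> N \<subseteq> atoms L \<union> Q" using assms NQ by auto
  have Xc: "U \<union> V \<union> N \<subseteq> carrier L" using assms cars atoms_carrier by auto
  define \<kappa> where "\<kappa> = prod qvar (U - {p}) * prod (sg Q') (V - Ap)"
  define t where "t = (if p \<in> U then [:0, 1:] else (1 :: 'a qpoly poly))"
  note psi = psi_gen[OF assms(1,2), folded \<kappa>_def t_def]
  have "violates (Q - {p}) (U \<union> V \<union> N) \<or> \<Squnion>{a \<in> U \<union> V \<union> N. a \<in> atoms L \<and> a \<sqsubseteq> p} = p"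
    by (rule violates_remove_min[OF Qup pQ _ X assms(3)]) (rule pmin)
  then show ?thesis
  proof (elim disjE)
    assume "\<Squnion>{a \<in> U \<union> V \<union> N. a \<in> atoms L \<and> a \<sqsubseteq> p} = p"
    moreover have "{a \<in> U \<union> V \<union> N. a \<in> atoms L \<and> a \<sqsubseteq> p} = V \<inter> Ap \<union> N0"
      using assms Qup by (auto simp: Ap_def N0_def upper_def)
    ultimately have "PV (V \<inter> Ap) \<in> Jt" by (intro spanning_mem) auto
    then show ?thesis unfolding psi by (rule cideal_mult[OF cideal_blow_ideal])
  next
    assume v: "violates (Q - {p}) (U \<union> V \<union> N)"
    let ?R = "(U - {p}) \<union> V \<union> (N - {p})"
    have Rc: "?R \<subseteq> carrier L" using Xc by auto
    have "violates Q' (insert p ?R)" by (rule violates_mono[OF v]) (use Rc cars in \<open>auto simp: Q'_def\<close>)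
    then have "violates Q' (Ap \<union> ?R)" using Ap_p_swap[OF Rc] by simp
    moreover have "Ap \<union> ?R = (U - {p}) \<union> (V - Ap) \<union> N1" by (auto simp: N1_def)
    ultimately have \<kappa>K: "\<kappa> \<in> K" unfolding \<kappa>_def K_def
      by (intro local_ideal_gen) (use assms in \<open>auto simp: Q'_def\<close>)
    have psi': "qeval (pvar p) (prod qvar U * prod (sg Q) V) = smult \<kappa> (t * PV (V \<inter> Ap))"
      unfolding psi by (simp add: mult.assoc mult.left_commute)
    show ?thesis unfolding psi'
    proof (rule blow_ideal_coeffs)
      show "Polynomial.coeff (smult \<kappa> (t * PV (V \<inter> Ap))) i \<in> K" for i
        using \<kappa>K cideal_multr[OF cideal_JI] by (simp add: K_def)
      show "Polynomial.coeff (smult \<kappa> (t * PV (V \<inter> Ap))) 0 \<in> J0"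
      \<comment> \<open>The constant term vanishes if \<open>p\<close> is in \<open>U\<close>,
        because of the factor t; it only has to lie in \<open>K\<close> if \<open>p\<close> is in
        \<open>N\<close>; otherwise it is a generator of \<open>local_ideal Q' N\<close>.\<close>
      proof (cases "p \<in> U \<or> p \<in> N")
        case True
        then show ?thesis
        proof
          assume "p \<in> U"
          then show ?thesis using cideal_0 J0 by (simp add: t_def mult_pCons_left)
        next
          assume "p \<in> N"
          then show ?thesis using \<kappa>K cideal_multr[OF cideal_JI] by (simp add: J0_def K_def)
        qed
      next
        case False
        have "prod qvar U * prod (sg Q') V \<in> local_ideal Q' N"
          by (intro local_ideal_gen) (use assms v False in \<open>auto simp: Q'_def\<close>)
        moreover have "prod (sg Q') V = prod (sg Q') (V - Ap) * prod (sg Q') (V \<inter> Ap)"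
        proof -
          have "V - V \<inter> Ap = V - Ap" by auto
          then show ?thesis using prod.subset_diff[of "V \<inter> Ap" V "sg Q'"] assms(2) atoms_carrier fin[of V] by auto
        qed
        ultimately show ?thesis using False by (simp add: J0_def t_def \<kappa>_def PV_0 mult.assoc)
      qed
    qed
  qed
qed

lemma psi_mem: "f \<in> local_ideal Q N \<Longrightarrow> qeval (pvar p) f \<in> Jt"
proof -
  let ?I = "{f. qeval (pvar p) f \<in> Jt}"
  have "cideal ?I"
    using cideal_blow_ideal by (auto simp: cideal_def qeval_add qeval_mult)
  then have "local_ideal Q N \<subseteq> ?I" unfolding local_ideal_def
    by (rule idl_least) (use gen_mem in auto)
  then show "f \<in> local_ideal Q N \<Longrightarrow> qeval (pvar p) f \<in> Jt" by auto
qed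

text \<open>By minimality of \<open>p\<close>, only atoms can lie strictly below it. This identifies
  the interval that governs the exponent of x_p.\<close>

lemma below_p: "M \<subseteq> Q \<Longrightarrow> {n \<in> N \<union> M. n \<sqsubseteq> p \<and> n \<noteq> p} = N0"
  using NQ pmin Qup pQ by (auto simp: N0_def Ap_def upper_def)

lemma rank_bound: "interval_rank L (\<Squnion>N0) p \<le> card B"
  by (rule rank_le_card) (use cars J_closed J_union[of N0 B] span_B in \<open>auto simp: Un_commute\<close>)

lemma violates_back:
  assumes "violates Q' (N1 \<union> (M - {p}))" "M \<subseteq> carrier L" "p \<in> N \<union> M"
  shows "violates Q (N \<union> M)"
proof -
  let ?R = "(N - {p}) \<union> (M - {p})"
  have Rc: "?R \<subseteq> carrier L" using assms cars by auto
  have "N1 \<union> (M - {p}) = Ap \<union> ?R" by (auto simp: N1_def)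
  then have "violates Q' (insert p ?R)" using assms(1) Ap_p_swap[OF Rc] by simp
  then show ?thesis by (rule violates_mono) (use assms cars in \<open>auto simp: Q'_def\<close>)
qed

text \<open>The interval governing the exponent of x_g is unchanged when \<open>p\<close> is
  replaced by the atoms below it. If \<open>p\<close> is below \<open>g\<close>, the joins agree; if
  not, nestedness forbids a common atom of \<open>p\<close> and \<open>g\<close>.\<close>

lemma below_join:
  assumes "M \<subseteq> Q" "g \<in> Q'" "g \<in> M" "p \<in> N \<union> M" "\<not> violates Q (N \<union> M)"
  shows "\<Squnion>{n \<in> N1 \<union> (M - {p}). n \<sqsubseteq> g \<and> n \<noteq> g} = \<Squnion>{n \<in> N \<union> M. n \<sqsubseteq> g \<and> n \<noteq> g}"
proof -
  define D where "D = {n \<in> (N - {p}) \<union> (M - {p}). n \<sqsubseteq> g \<and> n \<noteq> g}"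
  have gc: "g \<in> carrier L" "g \<in> Q" "g \<noteq> p" "g \<notin> atoms L"
    using assms cars Qup by (auto simp: Q'_def upper_def)
  have Mc: "M \<subseteq> carrier L" using assms cars by auto
  have Dc: "D \<subseteq> carrier L" using assms cars by (auto simp: D_def)
  show ?thesis
  proof (cases "p \<sqsubseteq> g")
    case True
    have "a \<sqsubseteq> g" if "a \<in> Ap" for a
      using that True le_trans[of a p g] cars gc by (auto simp: Ap_def)
    then have 1: "{n \<in> N1 \<union> (M - {p}). n \<sqsubseteq> g \<and> n \<noteq> g} = Ap \<union> D"
      using gc cars by (auto simp: N1_def D_def)
    have 2: "{n \<in> N \<union> M. n \<sqsubseteq> g \<and> n \<noteq> g} = insert p D"
      using True gc assms(4) by (auto simp: D_def)
    show ?thesis unfolding 1 2 using J_union[OF cars(3) Dc] J_Ap by simp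
  next
    case False
    have no: "\<not> a \<sqsubseteq> g" if a: "a \<in> Ap" for a
    proof
      assume ag: "a \<sqsubseteq> g"
      have "violates Q' (insert g Ap)" unfolding Q'_def Ap_def
        by (rule violates_common_atom[OF Qup pQ _ gc(2) False _ _ ag]) (use a pmin in \<open>auto simp: Ap_def\<close>)
      then have "violates Q' (Ap \<union> {g})" by simp
      then have "violates Q' (insert p {g})" using Ap_p_swap[of "{g}"] gc by simp
      then have "violates Q (N \<union> M)"
        by (rule violates_mono) (use assms(3,4) Mc cars in \<open>auto simp: Q'_def\<close>)
      then show False using assms(5) by simp
    qed
    have "{n \<in> N1 \<union> (M - {p}). n \<sqsubseteq> g \<and> n \<noteq> g} = D" using no by (auto simp: N1_def D_def)
    moreover have "{n \<in> N \<union> M. n \<sqsubseteq> g \<and> n \<noteq> g} = D" using False by (auto simp: D_def)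
    ultimately show ?thesis by simp
  qed
qed

end

context building
begin

text \<open>The exponent \<open>i\<close> of x_p in \<open>m\<close> bounds the degree in t. Either
  it reaches \<open>card B\<close>, and then the rank of the interval ending in \<open>p\<close>, or
  the polynomial has degree below that of \<open>q\<close>. In the latter case its coefficient at
  t^i lies in \<open>K\<close> and has the initial exponent vector \<open>strip p m\<close>.\<close>

theorem commutative_initial:
  assumes "linear_order_on H r" "upper Q" "Q \<subseteq> H" "\<And>p q. p \<in> Q \<Longrightarrow> q \<in> Q \<Longrightarrow> q \<sqsubseteq> p \<Longrightarrow> q \<noteq> p \<Longrightarrow> precedes r p q"
    "N \<subseteq> atoms L \<union> Q" "\<not> violates Q N" "f \<in> local_ideal Q N" "\<And>m. m \<in> kys f \<Longrightarrow> kys m \<subseteq> Q"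
    "m \<in> kys f" "\<And>m'. m' \<in> kys f \<Longrightarrow> m' \<noteq> m \<Longrightarrow> lexless r m' m"
  shows "violates Q (N \<union> kys m) \<or>
    (\<exists>g\<in>kys m. interval_rank L (\<Squnion>{n \<in> N \<union> kys m. n \<sqsubseteq> g \<and> n \<noteq> g}) g \<le> lkp m g)"
  using assms(2-)
proof (induction "card Q" arbitrary: Q N f m)
  case 0
  have "Q \<subseteq> carrier L" using 0 G_carrier by (auto simp: upper_def)
  then have "Q = {}" using 0(1) fin_carrier finite_subset by fastforce
  then have "local_ideal Q N = idl {}" by (auto simp: local_ideal_def violates_def)
  moreover have "idl {} \<subseteq> {0 :: 'a qpoly}" by (rule idl_least) (auto simp: cideal_def)
  ultimately have "f = 0" using 0 by blast
  then show ?case using 0 by simp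
next
  case (Suc k)
  note prems = Suc.prems
  have Qc: "Q \<subseteq> carrier L" using prems(1) G_carrier by (auto simp: upper_def)
  have finQ: "finite Q" using Qc fin_carrier finite_subset by auto
  have Qne: "Q \<noteq> {}" using Suc(2) by auto
  \<comment> \<open>Being last in the order, \<open>p\<close> is minimal in \<open>Q\<close>, and
    its variable dominates the lexicographic comparison.\<close>
  obtain p where p: "p \<in> Q" "\<And>q. q \<in> Q \<Longrightarrow> q \<noteq> p \<Longrightarrow> precedes r q p"
  proof -
    have "\<exists>p\<in>Q. \<forall>q\<in>Q. q \<noteq> p \<longrightarrow> precedes r q p"
    proof (rule finite_strict_max[OF finQ Qne])
      show "precedes r x y \<or> precedes r y x" if "x \<in> Q" "y \<in> Q" "x \<noteq> y" for x y
        using linear_order_facts(3)[OF assms(1), of x y] that prems(2) by blast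
    qed (rule linear_order_facts(1)[OF assms(1)])
    then show ?thesis using that by blast
  qed
  have an: "antisym r" using assms(1) by (auto simp: linear_order_on_def partial_order_on_def)
  have asym: "\<not> precedes r x y" if "precedes r y x" for x y
    using that an by (auto simp: precedes_def dest: antisymD)
  have pmin: "q = p" if "q \<in> Q" "q \<sqsubseteq> p" for q
    using prems(3)[OF p(1) that] p(2)[OF that(1)] asym by blast
  define A where "A = {a \<in> atoms L. a \<sqsubseteq> p}"
  have Ac: "A \<subseteq> carrier L" using atoms_carrier by (auto simp: A_def)
  have pc: "p \<in> carrier L" using p Qc by auto
  have jA: "\<Squnion>A = p"
  proof (rule J_eqI[OF Ac pc])
    show "\<And>a. a \<in> A \<Longrightarrow> a \<sqsubseteq> p" by (simp add: A_def)
    show "p \<sqsubseteq> \<Squnion>A" by (rule atomistic_le[OF pc J_closed[OF Ac]]) (use J_upper[OF Ac] in \<open>auto simp: A_def\<close>)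
  qed
  have "\<exists>B. B \<subseteq> A \<and> \<Squnion>(B \<union> (N \<inter> A)) = p \<and> (\<forall>V. V \<subseteq> B \<longrightarrow> \<Squnion>(V \<union> (N \<inter> A)) = p \<longrightarrow> V = B)"
  proof -
    define S where "S = {B. B \<subseteq> A \<and> \<Squnion>(B \<union> (N \<inter> A)) = p}"
    have "A \<in> S" using jA by (simp add: S_def Un_absorb2)
    moreover have "finite S"
      by (rule finite_subset[of _ "Pow A"]) (use finite_subset[OF Ac fin_carrier] in \<open>auto simp: S_def\<close>)
    ultimately obtain B where "B \<in> S" "\<forall>V\<in>S. V \<subseteq> B \<longrightarrow> B = V"
      using finite_has_minimal[of S] by blast
    then show ?thesis unfolding S_def by blast
  qed
  then obtain B where B: "B \<subseteq> A" "\<Squnion>(B \<union> (N \<inter> A)) = p"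
    "\<And>V. V \<subseteq> B \<Longrightarrow> \<Squnion>(V \<union> (N \<inter> A)) = p \<Longrightarrow> V = B" by blast
  interpret keel L G Q N p B
    by unfold_locales
       (use prems(1,4,5) p(1) pmin B[unfolded A_def] in auto)
  define i where "i = lkp m p"
  define F where "F = Polynomial.coeff (qeval (pvar p) f) i"
  have mQ: "kys m \<subseteq> Q" using prems(7,8) by blast
  \<comment> \<open>No variable of \<open>Q\<close> comes after x_p, so the comparison with
    \<open>m\<close> bounds the exponent of x_p.\<close>
  have le_i: "lkp m' p \<le> i" if m': "m' \<in> kys f" for m'
  proof (cases "m' = m")
    case False
    then obtain v where v: "lkp m' v < lkp m v" "\<And>w. precedes r v w \<Longrightarrow> lkp m' w = lkp m w"
      using prems(9)[OF m'] by (auto simp: lexless_def)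
    have "v \<in> Q" using v(1) mQ by (auto simp: in_keys_iff subset_iff)
    then show ?thesis using v p(2)[of v] by (cases "v = p") (auto simp: i_def)
  qed (simp add: i_def)
  have high: "Polynomial.coeff (qeval (pvar p) f) j = 0" if "j > i" for j
  proof (rule poly_mapping_eqI)
    fix n
    have "lkp f (n + sgl p j) = 0"
    proof (rule ccontr)
      assume "lkp f (n + sgl p j) \<noteq> 0"
      then have "lkp (n + sgl p j) p \<le> i" by (intro le_i) (simp add: in_keys_iff)
      then show False using that by (simp add: lookup_add)
    qed
    then show "lkp (Polynomial.coeff (qeval (pvar p) f) j) n = lkp 0 n"
      by (simp add: lkp_coeff_qeval_pvar)
  qed
  have degB: "Polynomial.degree (PV B) = card B" using PV_degree(1) cars by auto
  have fJ: "qeval (pvar p) f \<in> Jt" by (rule psi_mem[OF prems(6)])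
  show ?case
  proof (cases "i \<ge> card B")
    case True
    have "card B > 0" using B_ne fin[of B] cars by (auto simp: card_gt_0_iff)
    then have "p \<in> kys m" using True by (auto simp: i_def in_keys_iff)
    moreover have "interval_rank L (\<Squnion>{n \<in> N \<union> kys m. n \<sqsubseteq> p \<and> n \<noteq> p}) p \<le> lkp m p"
      using rank_bound True below_p[OF mQ] by (simp add: i_def)
    ultimately show ?thesis by blast
  next
    case False
    have low: "Polynomial.coeff (qeval (pvar p) f) j = 0" if "j \<ge> Polynomial.degree (PV B)" for j
      using high[of j] that False degB by simp
    have Fmem: "F \<in> K" "i = 0 \<Longrightarrow> F \<in> J0"
      using blow_ideal_low_degree[OF fJ low] by (auto simp: F_def)
    define m0 where "m0 = strip p m"
    have Fk: "n \<in> kys F \<longleftrightarrow> lkp n p = 0 \<and> n + sgl p i \<in> kys f" for n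
      unfolding F_def by (simp add: in_keys_iff lkp_coeff_qeval_pvar)
    have m0m: "m0 + sgl p i = m" unfolding m0_def i_def by (rule strip_add)
    have m0F: "m0 \<in> kys F" unfolding Fk using m0m prems(8) by (simp add: m0_def lkp_strip)
    have km0: "kys m0 = kys m - {p}" by (simp add: m0_def kys_strip)
    have Fsub: "kys n \<subseteq> Q'" if "n \<in> kys F" for n
    proof -
      have "kys (n + sgl p i) \<subseteq> Q" using that Fk prems(7) by blast
      then have "kys n \<subseteq> Q" by (simp add: kys_plus_nat)
      moreover have "p \<notin> kys n" using that Fk by (simp add: in_keys_iff)
      ultimately show ?thesis by (auto simp: Q'_def)
    qed
    have Flex: "lexless r n m0" if "n \<in> kys F" "n \<noteq> m0" for n
    proof -
      have "n + sgl p i \<noteq> m" using that(2) m0m by auto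
      then have "lexless r (n + sgl p i) (m0 + sgl p i)" using that(1) Fk prems(9) m0m by simp
      then show ?thesis by (rule lexless_cancel)
    qed
    have card': "k = card Q'" using Suc(2) p(1) by (simp add: Q'_def)
    have Q'H: "Q' \<subseteq> H" using prems(2) by (auto simp: Q'_def)
    have ord': "\<And>p q. p \<in> Q' \<Longrightarrow> q \<in> Q' \<Longrightarrow> q \<sqsubseteq> p \<Longrightarrow> q \<noteq> p \<Longrightarrow> precedes r p q"
      using prems(3) by (simp add: Q'_def)
    have mc: "N \<union> kys m \<subseteq> carrier L" using cars mQ by auto
    show ?thesis
    \<comment> \<open>If \<open>p\<close> does not occur, the constant term already lies in the
      ideal for \<open>N\<close>. Otherwise the argument moves to the centre and continues with
      \<open>N1\<close>.\<close>
    proof (cases "p \<in> N \<union> kys m")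
      case False
      then have i0: "i = 0" and pN: "p \<notin> N" by (auto simp: i_def in_keys_iff)
      have mm: "m0 = m" using m0m i0 by simp
      have FJ: "F \<in> local_ideal Q' N" using Fmem(2)[OF i0] pN by (simp add: J0_def)
      have NQ': "N \<subseteq> atoms L \<union> Q'" using NQ pN by (auto simp: Q'_def)
      have nv: "\<not> violates Q' N"
      proof
        assume "violates Q' N"
        then have "violates Q N" by (rule violates_mono) (use cars in \<open>auto simp: Q'_def\<close>)
        then show False using Nn by simp
      qed
      have "violates Q' (N \<union> kys m) \<or>
        (\<exists>g\<in>kys m. interval_rank L (\<Squnion>{n \<in> N \<union> kys m. n \<sqsubseteq> g \<and> n \<noteq> g}) g \<le> lkp m g)"
        using Suc.hyps(1)[OF card' Q'up Q'H ord' NQ' nv FJ Fsub m0F Flex] unfolding mm .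
      moreover have "violates Q' (N \<union> kys m) \<Longrightarrow> violates Q (N \<union> kys m)"
        by (erule violates_mono) (use mc cars in \<open>auto simp: Q'_def\<close>)
      ultimately show ?thesis by blast
    next
      case True
      have FK: "F \<in> local_ideal Q' N1" using Fmem(1) by (simp add: K_def)
      have N1Q': "N1 \<subseteq> atoms L \<union> Q'" using NQ cars by (auto simp: N1_def Q'_def)
      show ?thesis
      \<comment> \<open>\<open>N1\<close> may fail to be nested, but then \<open>N\<close> together
        with \<open>kys m\<close> was not nested either.\<close>
      proof (cases "violates Q' N1")
        case v: True
        have "violates Q' (N1 \<union> (kys m - {p}))" by (rule violates_mono[OF v]) (use cars mc in auto)
        then show ?thesis using violates_back[of "kys m"] True mc by auto
      next
        case nv: False
        from Suc.hyps(1)[OF card' Q'up Q'H ord' N1Q' nv FK Fsub m0F Flex]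
        have "violates Q' (N1 \<union> (kys m - {p})) \<or>
          (\<exists>g\<in>kys m - {p}. interval_rank L (\<Squnion>{n \<in> N1 \<union> (kys m - {p}). n \<sqsubseteq> g \<and> n \<noteq> g}) g \<le> lkp m0 g)"
          unfolding km0 .
        then show ?thesis
        proof (elim disjE bexE)
          assume "violates Q' (N1 \<union> (kys m - {p}))"
          then show ?thesis using violates_back[of "kys m"] True mc by auto
        next
          fix g assume g: "g \<in> kys m - {p}"
            and le: "interval_rank L (\<Squnion>{n \<in> N1 \<union> (kys m - {p}). n \<sqsubseteq> g \<and> n \<noteq> g}) g \<le> lkp m0 g"
          have gQ: "g \<in> Q'" "g \<in> kys m" using g mQ by (auto simp: Q'_def)
          have "lkp m0 g = lkp m g" using g by (simp add: m0_def lkp_strip)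
          then show ?thesis using below_join[OF mQ gQ True] le gQ by metis
        qed
      qed
    qed
  qed
qed

end

section \<open>Initial monomials\<close>

lemma precedes_irrefl: "\<not> precedes r x x"
  by (simp add: precedes_def)

text \<open>The order is linear only among monomials in variables indexed by \<open>H\<close>, since
  \<open>r\<close> compares nothing else.\<close>

definition mon_ok :: "'a set \<Rightarrow> 'a gca_monomial \<Rightarrow> bool" where
  "mon_ok H M \<longleftrightarrow> fst M \<subseteq> H \<and> kys (snd M) \<subseteq> H"

definition var_set :: "'a set \<Rightarrow> 'a gca_var set" where
  "var_set H = XVar ` H \<union> EVar ` H"

lemma var_precedes_facts:
  assumes "linear_order_on H r"
  shows "\<And>x y z. var_precedes r x y \<Longrightarrow> var_precedes r y z \<Longrightarrow> var_precedes r x z"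
    "\<And>x y. var_precedes r x y \<Longrightarrow> \<not> var_precedes r y x"
    "\<And>x y. x \<in> var_set H \<Longrightarrow> y \<in> var_set H \<Longrightarrow> x \<noteq> y \<Longrightarrow> var_precedes r x y \<or> var_precedes r y x"
proof -
  note lo = linear_order_facts[OF assms]
  show "var_precedes r x z" if "var_precedes r x y" "var_precedes r y z" for x y z
    using that lo(1) by (cases x; cases y; cases z) auto
  show "\<not> var_precedes r y x" if "var_precedes r x y" for x y
    using that lo(2) by (cases x; cases y) auto
  show "var_precedes r x y \<or> var_precedes r y x" if "x \<in> var_set H" "y \<in> var_set H" "x \<noteq> y" for x y
    using that lo(3) by (cases x; cases y) (auto simp: var_set_def)
qed

lemma var_exponent_outside: "mon_ok H M \<Longrightarrow> v \<notin> var_set H \<Longrightarrow> var_exponent M v = 0"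
  by (cases M; cases v) (auto simp: mon_ok_def var_set_def in_keys_iff subset_iff)

lemma var_exponent_inject: "(\<And>v. var_exponent M v = var_exponent N v) \<Longrightarrow> M = N"
proof -
  assume a: "\<And>v. var_exponent M v = var_exponent N v"
  obtain S m where M: "M = (S, m)" by (cases M)
  obtain T n where N: "N = (T, n)" by (cases N)
  have "m = n" using a[of "XVar g" for g] by (intro poly_mapping_eqI) (simp add: M N)
  moreover have "g \<in> S \<longleftrightarrow> g \<in> T" for g using a[of "EVar g"] by (simp add: M N of_bool_def split: if_splits)
  ultimately show ?thesis by (auto simp: M N)
qed

lemma deglex_asym:
  assumes "linear_order_on H r" "mon_ok H M" "mon_ok H N" "deglex_less r M N"
  shows "\<not> deglex_less r N M"
proof
  assume b: "deglex_less r N M"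
  then have eq: "monomial_degree M = monomial_degree N" using assms(4) by (auto simp: deglex_less_def)
  obtain v where v: "var_exponent M v < var_exponent N v"
    "\<And>w. var_precedes r v w \<Longrightarrow> var_exponent M w = var_exponent N w"
    using assms(4) eq by (auto simp: deglex_less_def)
  obtain u where u: "var_exponent N u < var_exponent M u"
    "\<And>w. var_precedes r u w \<Longrightarrow> var_exponent N w = var_exponent M w"
    using b eq by (auto simp: deglex_less_def)
  have "v \<in> var_set H" using v(1) var_exponent_outside[OF assms(3), of v] by force
  moreover have "u \<in> var_set H" using u(1) var_exponent_outside[OF assms(2), of u] by force
  moreover have "u \<noteq> v" using u v by auto
  ultimately have "var_precedes r u v \<or> var_precedes r v u"
    using var_precedes_facts(3)[OF assms(1)] by blast
  then show False using u v by fastforce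
qed

lemma deglex_trans:
  assumes "linear_order_on H r" "mon_ok H M" "mon_ok H N" "mon_ok H P" "deglex_less r M N" "deglex_less r N P"
  shows "deglex_less r M P"
proof (cases "monomial_degree M < monomial_degree P")
  case True
  then show ?thesis by (simp add: deglex_less_def)
next
  case False
  then have eq: "monomial_degree M = monomial_degree N" "monomial_degree N = monomial_degree P"
    using assms(5,6) by (auto simp: deglex_less_def)
  obtain v where v: "var_exponent M v < var_exponent N v"
    "\<And>w. var_precedes r v w \<Longrightarrow> var_exponent M w = var_exponent N w"
    using assms(5) eq by (auto simp: deglex_less_def)
  obtain u where u: "var_exponent N u < var_exponent P u"
    "\<And>w. var_precedes r u w \<Longrightarrow> var_exponent N w = var_exponent P w"
    using assms(6) eq by (auto simp: deglex_less_def)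
  have "v \<in> var_set H" using v(1) var_exponent_outside[OF assms(3), of v] by force
  moreover have "u \<in> var_set H" using u(1) var_exponent_outside[OF assms(4), of u] by force
  ultimately consider "u = v" | "var_precedes r u v" | "var_precedes r v u"
    using var_precedes_facts(3)[OF assms(1)] by blast
  then have "\<exists>v. var_exponent M v < var_exponent P v \<and>
      (\<forall>w. var_precedes r v w \<longrightarrow> var_exponent M w = var_exponent P w)"
  proof cases
    case 1
    then show ?thesis using u v by (intro exI[of _ v]) auto
  next
    case 2
    then show ?thesis using u v var_precedes_facts(1)[OF assms(1) 2] by (intro exI[of _ v]) auto
  next
    case 3
    then show ?thesis using u v var_precedes_facts(1)[OF assms(1) 3] by (intro exI[of _ u]) auto
  qed
  then show ?thesis using eq by (simp add: deglex_less_def)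
qed

lemma deglex_total:
  assumes "linear_order_on H r" "finite H" "mon_ok H M" "mon_ok H N" "M \<noteq> N"
  shows "deglex_less r M N \<or> deglex_less r N M"
proof (cases "monomial_degree M = monomial_degree N")
  case False
  then show ?thesis by (auto simp: deglex_less_def)
next
  case True
  define X where "X = {v. var_exponent M v \<noteq> var_exponent N v}"
  have sub: "X \<subseteq> var_set H"
    using var_exponent_outside[OF assms(3)] var_exponent_outside[OF assms(4)] by (force simp: X_def)
  have "finite (var_set H)" using assms(2) by (simp add: var_set_def)
  then have fX: "finite X" using sub finite_subset by auto
  have "X \<noteq> {}" using var_exponent_inject[of M N] assms(5) by (auto simp: X_def)
  have "\<exists>m\<in>X. \<forall>x\<in>X. x \<noteq> m \<longrightarrow> var_precedes r x m"
  proof (rule finite_strict_max[OF fX \<open>X \<noteq> {}\<close>])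
    show "\<And>x y. x \<in> X \<Longrightarrow> y \<in> X \<Longrightarrow> x \<noteq> y \<Longrightarrow> var_precedes r x y \<or> var_precedes r y x"
      using var_precedes_facts(3)[OF assms(1)] sub by blast
  qed (rule var_precedes_facts(1)[OF assms(1)])
  then obtain v where v: "v \<in> X" "\<And>x. x \<in> X \<Longrightarrow> x \<noteq> v \<Longrightarrow> var_precedes r x v" by blast
  have above: "var_exponent M w = var_exponent N w" if "var_precedes r v w" for w
  proof (rule ccontr)
    assume "var_exponent M w \<noteq> var_exponent N w"
    then have "w \<in> X" by (simp add: X_def)
    moreover have "w \<noteq> v" using that var_precedes_facts(2)[OF assms(1)] by blast
    ultimately show False using v(2) that var_precedes_facts(2)[OF assms(1)] by blast
  qed
  have "var_exponent M v < var_exponent N v \<or> var_exponent N v < var_exponent M v"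
    using v(1) by (auto simp: X_def)
  then show ?thesis using above True unfolding deglex_less_def by metis
qed

lemma initial_monomial_eq:
  assumes "linear_order_on H r" "\<And>N. N \<in> gca_monomials f \<Longrightarrow> mon_ok H N"
    "M \<in> gca_monomials f" "\<And>N. N \<in> gca_monomials f \<Longrightarrow> N \<noteq> M \<Longrightarrow> deglex_less r N M"
  shows "initial_monomial r f = M"
  unfolding initial_monomial_def
proof (rule the_equality)
  show "M \<in> gca_monomials f \<and> (\<forall>N\<in>gca_monomials f - {M}. deglex_less r N M)" using assms(3,4) by blast
  fix M' assume M': "M' \<in> gca_monomials f \<and> (\<forall>N\<in>gca_monomials f - {M'}. deglex_less r N M')"
  show "M' = M"
  proof (rule ccontr)
    assume "M' \<noteq> M"
    then have "deglex_less r M' M" "deglex_less r M M'" using M' assms(3,4) by auto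
    then show False using deglex_asym[OF assms(1)] assms(2,3) M' by blast
  qed
qed

lemma initial_monomial_exists:
  assumes "linear_order_on H r" "finite H" "f \<in> carrier (gca_ring H r)" "f \<noteq> \<zero>\<^bsub>gca_ring H r\<^esub>"
  shows "initial_monomial r f \<in> gca_monomials f \<and> mon_ok H (initial_monomial r f) \<and>
    (\<forall>N\<in>gca_monomials f. mon_ok H N \<and> (N \<noteq> initial_monomial r f \<longrightarrow> deglex_less r N (initial_monomial r f)))"
proof -
  have car: "\<And>S. f S \<noteq> 0 \<Longrightarrow> S \<subseteq> H" "\<And>S. f S \<in> qpolys H"
    using assms(3) unfolding gca_ring_simps by blast+
  have ok: "mon_ok H N" if "N \<in> gca_monomials f" for N
  proof -
    obtain S m where N: "N = (S, m)" by (cases N)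
    then have "lkp (f S) m \<noteq> 0" using that by (simp add: gca_monomials_def)
    then have "f S \<noteq> 0" "m \<in> kys (f S)" by (auto simp: in_keys_iff)
    then show ?thesis using car by (auto simp: mon_ok_def N qpolys_def)
  qed
  have "gca_monomials f \<subseteq> (\<Union>S\<in>Pow H. Pair S ` kys (f S))"
  proof
    fix N assume N: "N \<in> gca_monomials f"
    obtain S m where Sm: "N = (S, m)" by (cases N)
    have "S \<in> Pow H" using ok[OF N] by (simp add: mon_ok_def Sm)
    moreover have "m \<in> kys (f S)" using N by (simp add: gca_monomials_def Sm in_keys_iff)
    ultimately show "N \<in> (\<Union>S\<in>Pow H. Pair S ` kys (f S))" using Sm by blast
  qed
  moreover have "finite (\<Union>S\<in>Pow H. Pair S ` kys (f S))" using assms(2) by simp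
  ultimately have fin: "finite (gca_monomials f)" by (rule finite_subset)
  obtain S where "f S \<noteq> 0" using assms(4) unfolding gca_ring_simps by auto
  then obtain m where "lkp (f S) m \<noteq> 0" by (metis lookup_zero poly_mapping_eqI)
  then have ne: "gca_monomials f \<noteq> {}" by (auto simp: gca_monomials_def)
  have "\<exists>M\<in>gca_monomials f. \<forall>N\<in>gca_monomials f. N \<noteq> M \<longrightarrow> deglex_less r N M"
    by (rule finite_strict_max[OF fin ne])
       (use deglex_total[OF assms(1,2)] deglex_trans[OF assms(1)] ok in \<open>blast+\<close>)
  then obtain M where M: "M \<in> gca_monomials f" "\<And>N. N \<in> gca_monomials f \<Longrightarrow> N \<noteq> M \<Longrightarrow> deglex_less r N M"
    by blast
  have "initial_monomial r f = M" by (rule initial_monomial_eq[OF assms(1) ok M])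
  then show ?thesis using M ok by blast
qed

lemma monomial_dvdI: "S \<subseteq> S' \<Longrightarrow> (\<And>g. lkp m g \<le> lkp m' g) \<Longrightarrow> monomial_dvd (S, m) (S', m')"
  unfolding monomial_dvd_def
proof
  fix v assume "S \<subseteq> S'" "\<And>g. lkp m g \<le> lkp m' g"
  then show "var_exponent (S, m) v \<le> var_exponent (S', m') v" by (cases v) auto
qed

lemma monomial_degree_eq: "monomial_degree (S, m) = card S + mdeg m"
  by (simp add: monomial_degree_def mdeg_def)

lemma deglex_same_set:
  "deglex_less r (S, n) (S, m) \<Longrightarrow> mdeg n = mdeg m \<Longrightarrow> lexless r n m"
proof -
  assume "deglex_less r (S, n) (S, m)" "mdeg n = mdeg m"
  then obtain v where v: "var_exponent (S, n) v < var_exponent (S, m) v"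
    "\<And>w. var_precedes r v w \<Longrightarrow> var_exponent (S, n) w = var_exponent (S, m) w"
    by (auto simp: deglex_less_def monomial_degree_eq)
  show ?thesis
  proof (cases v)
    case (XVar g)
    then show ?thesis using v v(2)[of "XVar w" for w] unfolding lexless_def by (intro exI[of _ g]) auto
  next
    case (EVar g)
    then show ?thesis using v by simp
  qed
qed

lemma deglex_same_setI:
  assumes "lexless r n m" "mdeg n = mdeg m" shows "deglex_less r (S, n) (S, m)"
proof -
  obtain v where v: "lkp n v < lkp m v" "\<And>w. precedes r v w \<Longrightarrow> lkp n w = lkp m w"
    using assms(1) by (auto simp: lexless_def)
  have "var_exponent (S, n) w = var_exponent (S, m) w" if "var_precedes r (XVar v) w" for w
    using that v(2) by (cases w) auto
  then show ?thesis using v(1) assms(2) unfolding deglex_less_def monomial_degree_eq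
    by (intro disjI2 conjI exI[of _ "XVar v"]) auto
qed

text \<open>Coefficient 1 at \<open>u\<close> makes the property multiplicative, as the product of
  the leading terms cannot cancel. Homogeneity lets \<open>lexless\<close> alone decide.\<close>

definition lead :: "'a set \<Rightarrow> 'a rel \<Rightarrow> ('a \<Rightarrow>\<^sub>0 nat) \<Rightarrow> 'a qpoly \<Rightarrow> bool" where
  "lead H r u f \<longleftrightarrow> kys u \<subseteq> H \<and> (\<exists>f'. f = sgl u 1 + f' \<and>
     (\<forall>n\<in>kys f'. mdeg n = mdeg u \<and> lexless r n u \<and> kys n \<subseteq> H))"

lemma lead_monomial: "kys u \<subseteq> H \<Longrightarrow> lead H r u (sgl u 1)"
  unfolding lead_def by (intro conjI exI[of _ 0]) auto

lemma lead_mult: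
  assumes "linear_order_on H r" "lead H r u f" "lead H r w g"
  shows "lead H r (u + w) (f * g)"
proof -
  obtain f' where f: "kys u \<subseteq> H" "f = sgl u 1 + f'" "\<And>n. n \<in> kys f' \<Longrightarrow> mdeg n = mdeg u \<and> lexless r n u \<and> kys n \<subseteq> H"
    using assms(2) by (auto simp: lead_def)
  obtain g' where g: "kys w \<subseteq> H" "g = sgl w 1 + g'" "\<And>n. n \<in> kys g' \<Longrightarrow> mdeg n = mdeg w \<and> lexless r n w \<and> kys n \<subseteq> H"
    using assms(3) by (auto simp: lead_def)
  let ?h = "sgl u 1 * g' + f' * sgl w 1 + f' * g'"
  have "f * g = sgl (u + w) 1 + ?h" by (simp add: f g algebra_simps mult_single)
  moreover have "mdeg n = mdeg (u + w) \<and> lexless r n (u + w) \<and> kys n \<subseteq> H" if "n \<in> kys ?h" for n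
  proof -
    have "n \<in> kys (sgl u 1 * g') \<or> n \<in> kys (f' * sgl w 1) \<or> n \<in> kys (f' * g')"
      using that Poly_Mapping.keys_add[of "sgl u 1 * g' + f' * sgl w 1" "f' * g'"]
        Poly_Mapping.keys_add[of "sgl u 1 * g'" "f' * sgl w 1"] by blast
    then consider b where "n = u + b" "b \<in> kys g'" | a where "n = a + w" "a \<in> kys f'"
      | a b where "n = a + b" "a \<in> kys f'" "b \<in> kys g'"
    proof (elim disjE)
      assume "n \<in> kys (sgl u 1 * g')"
      then obtain a b where "n = a + b" "a \<in> kys (sgl u (1::rat))" "b \<in> kys g'"
        using keys_mult[of "sgl u 1" g'] by blast
      then show thesis using that(1)[of b] by simp
    next
      assume "n \<in> kys (f' * sgl w 1)"
      then obtain a b where "n = a + b" "b \<in> kys (sgl w (1::rat))" "a \<in> kys f'"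
        using keys_mult[of f' "sgl w 1"] by blast
      then show thesis using that(2)[of a] by simp
    next
      assume "n \<in> kys (f' * g')"
      then obtain a b where "n = a + b" "a \<in> kys f'" "b \<in> kys g'"
        using keys_mult[of f' g'] by blast
      then show thesis using that(3)[of a b] by simp
    qed
    then show ?thesis
    proof cases
      case 1
      then show ?thesis using g(3)[OF 1(2)] f(1) lexless_add_right[of r b w u]
        by (auto simp: mdeg_add kys_plus_nat add.commute)
    next
      case 2
      then show ?thesis using f(3)[OF 2(2)] g(1) lexless_add_right[of r a u w]
        by (auto simp: mdeg_add kys_plus_nat)
    next
      case 3
      have "lexless r (a + b) (u + b)" "lexless r (u + b) (u + w)"
        using f(3)[OF 3(2)] g(3)[OF 3(3)] lexless_add_right[of r a u b] lexless_add_right[of r b w u]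
        by (auto simp: add.commute)
      then have "lexless r (a + b) (u + w)"
        using lexless_trans[OF assms(1), of "u + b" "u + w"] f(1) g(1) g(3)[OF 3(3)] by (auto simp: kys_plus_nat)
      then show ?thesis using 3 f(3)[OF 3(2)] g(3)[OF 3(3)] by (auto simp: mdeg_add kys_plus_nat)
    qed
  qed
  moreover have "kys (u + w) \<subseteq> H" using f(1) g(1) by (simp add: kys_plus_nat)
  ultimately show ?thesis unfolding lead_def by (intro conjI exI[of _ ?h]) simp_all
qed

lemma lead_1: "lead H r 0 1"
  using lead_monomial[of 0 H r] by simp

lemma lead_power: "linear_order_on H r \<Longrightarrow> lead H r (sgl g 1) f \<Longrightarrow> lead H r (sgl g k) (f ^ k)"
proof (induction k)
  case 0
  then show ?case using lead_1 by simp
next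
  case (Suc k)
  have "lead H r (sgl g 1 + sgl g k) (f * f ^ k)" by (rule lead_mult[OF Suc.prems(1,2) Suc.IH[OF Suc.prems]])
  then show ?case by (simp add: single_add[symmetric])
qed

lemma lead_lookup: "lead H r u f \<Longrightarrow> lkp f u = 1"
proof -
  assume "lead H r u f"
  then obtain f' where "f = sgl u 1 + f'" "\<And>n. n \<in> kys f' \<Longrightarrow> lexless r n u" by (auto simp: lead_def)
  then show ?thesis using lexless_irrefl[of r u] by (auto simp: lookup_add in_keys_iff)
qed

lemma lead_keys: "lead H r u f \<Longrightarrow> n \<in> kys f \<Longrightarrow> n \<noteq> u \<Longrightarrow> mdeg n = mdeg u \<and> lexless r n u \<and> kys n \<subseteq> H"
proof -
  assume "lead H r u f" and n: "n \<in> kys f" "n \<noteq> u"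
  then obtain f' where f: "f = sgl u 1 + f'" "\<And>n. n \<in> kys f' \<Longrightarrow> mdeg n = mdeg u \<and> lexless r n u \<and> kys n \<subseteq> H"
    by (auto simp: lead_def)
  then have "n \<in> kys f'" using n by (auto simp: in_keys_iff lookup_add lookup_single when_def)
  then show ?thesis by (rule f(2))
qed

text \<open>The exponent vector of x_T.\<close>

definition ind :: "'a set \<Rightarrow> ('a \<Rightarrow>\<^sub>0 nat)" where
  "ind T = (\<Sum>g\<in>T. sgl g 1)"

lemma lkp_ind: "finite T \<Longrightarrow> lkp (ind T) g = (if g \<in> T then 1 else 0)"
  by (simp add: ind_def lookup_sum lookup_single when_def)

lemma prod_qvar: "finite T \<Longrightarrow> prod qvar T = sgl (ind T) 1"
  by (induction T rule: finite_induct) (auto simp: ind_def qvar_def mult_single)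

lemma kys_ind: "finite T \<Longrightarrow> kys (ind T) = T"
  by (auto simp: in_keys_iff lkp_ind split: if_splits)

text \<open>The element q e_S; all relations except the boundaries have this form.\<close>

definition em :: "'a set \<Rightarrow> 'a qpoly \<Rightarrow> 'a gca" where
  "em S q = (\<lambda>A. if A = S then q else 0)"

lemma em_monomials: "gca_monomials (em S f) = Pair S ` kys f"
  by (auto simp: gca_monomials_def em_def in_keys_iff split: if_splits)

lemma initial_em:
  assumes "linear_order_on H r" "lead H r u f" "S \<subseteq> H"
  shows "initial_monomial r (em S f) = (S, u)" "em S f \<noteq> \<zero>\<^bsub>gca_ring H r\<^esub>"
proof -
  have u: "u \<in> kys f" using lead_lookup[OF assms(2)] by (simp add: in_keys_iff)
  show "initial_monomial r (em S f) = (S, u)"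
  proof (rule initial_monomial_eq[OF assms(1)])
    show "(S, u) \<in> gca_monomials (em S f)" using u by (simp add: em_monomials)
    fix N assume "N \<in> gca_monomials (em S f)"
    then obtain n where n: "N = (S, n)" "n \<in> kys f" by (auto simp: em_monomials)
    have "kys u \<subseteq> H" using assms(2) by (simp add: lead_def)
    then show "mon_ok H N" using n lead_keys[OF assms(2) n(2)] assms(3) by (cases "n = u") (auto simp: mon_ok_def)
    assume "N \<noteq> (S, u)"
    then show "deglex_less r N (S, u)" using n lead_keys[OF assms(2) n(2)] deglex_same_setI by auto
  qed
  show "em S f \<noteq> \<zero>\<^bsub>gca_ring H r\<^esub>"
    using u by (auto simp: em_def gca_ring_simps fun_eq_iff intro!: exI[of _ S])
qed

lemma e_mult_poly: "finite S \<Longrightarrow> gca_e S \<otimes>\<^bsub>gca_ring H r\<^esub> gca_poly p = em S p"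
  by (auto simp: gca_poly_mult gca_e_def em_def)

lemma poly_mult_em: "finite S \<Longrightarrow> gca_poly p \<otimes>\<^bsub>gca_ring H r\<^esub> em S f = em S (p * f)"
  by (auto simp: gca_poly_mult em_def)

lemma em_mult_poly: "finite S \<Longrightarrow> em S f \<otimes>\<^bsub>gca_ring H r\<^esub> gca_poly p = em S (p * f)"
  by (auto simp: gca_poly_mult em_def)

lemma gca_poly_em: "gca_poly p = em {} p"
  by (simp add: gca_poly_def em_def)

lemma em_add: "em S f \<oplus>\<^bsub>gca_ring H r\<^esub> em S g = em S (f + g)"
  by (auto simp: gca_ring_simps em_def)

lemma em_carrier: "S \<subseteq> H \<Longrightarrow> f \<in> qpolys H \<Longrightarrow> em S f \<in> carrier (gca_ring H r)"
  by (auto simp: gca_ring_simps em_def qpolys_closed)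

lemma gca_poly_power:
  assumes "finite H"
  shows "gca_poly p [^]\<^bsub>gca_ring H r\<^esub> (k::nat) = gca_poly (p ^ k)"
proof (induction k)
  case 0
  show ?case by (simp add: nat_pow_def gca_ring_simps gca_poly_def)
next
  case (Suc k)
  interpret ring "gca_ring H r" by (rule ring_gca_ring[OF assms])
  show ?case using Suc by (simp add: gca_poly_em em_mult_poly[of "{}", unfolded gca_poly_em])
qed

section \<open>Homomorphisms between exterior algebras\<close>

definition sgn1 :: "bool \<Rightarrow> 'r::comm_ring_1" where
  "sgn1 c = (if c then - 1 else 1)"

lemma sgn1_sq [simp]: "sgn1 c * sgn1 c = 1" "sgn1 c * (sgn1 c * x) = x"
  by (auto simp: sgn1_def)

lemma minus_one_card:
  assumes "finite X"
  shows "(- 1) ^ card {x \<in> X. P x} = (\<Prod>x\<in>X. sgn1 (P x))"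
proof -
  have "X \<inter> {x. P x} = {x \<in> X. P x}" by auto
  then show ?thesis unfolding sgn1_def using assms by (simp add: prod.If_cases)
qed

definition inv_sign :: "'a rel \<Rightarrow> ('a \<Rightarrow> 'a) \<Rightarrow> 'a \<Rightarrow> 'a \<Rightarrow> 'r::comm_ring_1" where
  "inv_sign r l a b = sgn1 (precedes r a b \<and> precedes r (l b) (l a))"

text \<open>The sign that reorders the image of e_A under l.\<close>

definition lsign :: "'a rel \<Rightarrow> ('a \<Rightarrow> 'a) \<Rightarrow> 'a set \<Rightarrow> 'r::comm_ring_1" where
  "lsign r l A = (\<Prod>a\<in>A. \<Prod>b\<in>A. inv_sign r l a b)"

text \<open>The sign \<open>shuffle_sign\<close>, with values in an arbitrary ring.\<close>

definition tau :: "'a rel \<Rightarrow> 'a set \<Rightarrow> 'a set \<Rightarrow> 'r::comm_ring_1" where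
  "tau r D D' = (\<Prod>i\<in>D. \<Prod>j\<in>D'. sgn1 (precedes r j i))"

definition transversals :: "'a set \<Rightarrow> ('a \<Rightarrow> 'a) \<Rightarrow> 'a set \<Rightarrow> 'a set set" where
  "transversals K l D = {A. A \<subseteq> K \<and> bij_betw l A D}"

text \<open>The homomorphism of exterior algebras induced by e_b \<mapsto> e_(l b) for b in K and e_b \<mapsto> 0
  otherwise, combined with a substitution of the polynomial variables; the coefficient of e_D is recorded.\<close>

definition Phi :: "'a rel \<Rightarrow> 'a set \<Rightarrow> ('a \<Rightarrow> 'a) \<Rightarrow> ('a \<Rightarrow> 'b qpoly poly) \<Rightarrow> 'a set \<Rightarrow> 'a gca \<Rightarrow> 'b qpoly poly" where
  "Phi r K l v D f = (\<Sum>A\<in>transversals K l D. lsign r l A * qeval v (f A))"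

text \<open>Only the pair in increasing order can contribute an inversion, so the identity follows
  by checking both orders of \<open>a\<close> and \<open>b\<close>.\<close>

lemma inv_sign_swap:
  assumes "linear_order_on H r" "a \<in> H" "b \<in> H" "a \<noteq> b" "l a \<in> H" "l b \<in> H" "l a \<noteq> l b"
  shows "inv_sign r l a b * inv_sign r l b a * sgn1 (precedes r b a) = (sgn1 (precedes r (l b) (l a)) :: 'r::comm_ring_1)"
  using linear_order_facts(2,3)[OF assms(1)] assms(2-) unfolding inv_sign_def sgn1_def by (smt (verit) mult_1 mult_1_right minus_mult_minus)

lemma qeval_minus_one_power: "qeval v ((- 1) ^ n) = (- 1) ^ n"
  by (simp add: qeval_power qeval_uminus)

lemma qeval_shuffle_sign:
  assumes "finite A" "finite B"
  shows "qeval v (shuffle_sign r A B) = (\<Prod>a\<in>A. \<Prod>b\<in>B. sgn1 (precedes r b a))"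
proof -
  have "{(a, b) \<in> A \<times> B. precedes r b a} = {x \<in> A \<times> B. precedes r (snd x) (fst x)}" by auto
  then have "qeval v (shuffle_sign r A B) = (- 1) ^ card {x \<in> A \<times> B. precedes r (snd x) (fst x)}"
    by (simp only: shuffle_sign_def qeval_minus_one_power)
  also have "\<dots> = (\<Prod>x\<in>A \<times> B. sgn1 (precedes r (snd x) (fst x)))"
    by (rule minus_one_card) (use assms in simp)
  finally show ?thesis by (simp add: prod.cartesian_product case_prod_beta)
qed

lemma lsign_union:
  assumes "finite A" "finite B" "A \<inter> B = {}"
  shows "lsign r l (A \<union> B) = lsign r l A * lsign r l B * (\<Prod>a\<in>A. \<Prod>b\<in>B. inv_sign r l a b * inv_sign r l b a)"
proof -
  have "lsign r l (A \<union> B) = (\<Prod>a\<in>A. \<Prod>b\<in>A \<union> B. inv_sign r l a b) * (\<Prod>a\<in>B. \<Prod>b\<in>A \<union> B. inv_sign r l a b)"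
    unfolding lsign_def using assms by (simp add: prod.union_disjoint)
  also have "\<dots> = (lsign r l A * (\<Prod>a\<in>A. \<Prod>b\<in>B. inv_sign r l a b)) * ((\<Prod>a\<in>B. \<Prod>b\<in>A. inv_sign r l a b) * lsign r l B)"
    unfolding lsign_def using assms by (simp add: prod.union_disjoint prod.distrib)
  also have "(\<Prod>a\<in>B. \<Prod>b\<in>A. inv_sign r l a b) = (\<Prod>b\<in>A. \<Prod>a\<in>B. (inv_sign r l a b :: 'b))"
    by (rule prod.swap)
  finally show ?thesis by (simp add: prod.distrib ac_simps)
qed

text \<open>Two ways of sorting the image of e_A e_B: sort the product and then apply
  \<open>l\<close>, or apply \<open>l\<close> to both factors, sort each image, and then sort their
  product. For each pair the identity is \<open>inv_sign_swap\<close>.\<close>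

lemma sign_product:
  assumes "linear_order_on H r" "finite A" "finite B" "A \<inter> B = {}" "A \<union> B \<subseteq> H" "l ` (A \<union> B) \<subseteq> H" "inj_on l (A \<union> B)"
  shows "lsign r l (A \<union> B) * (\<Prod>a\<in>A. \<Prod>b\<in>B. sgn1 (precedes r b a)) =
    tau r (l ` A) (l ` B) * lsign r l A * (lsign r l B :: 'r::comm_ring_1)"
proof -
  have injA: "inj_on l A" and injB: "inj_on l B" using assms(7) inj_on_subset by blast+
  have t: "tau r (l ` A) (l ` B) = (\<Prod>a\<in>A. \<Prod>b\<in>B. (sgn1 (precedes r (l b) (l a)) :: 'r))"
    unfolding tau_def using injA injB by (simp add: prod.reindex)
  have "(\<Prod>a\<in>A. \<Prod>b\<in>B. inv_sign r l a b * inv_sign r l b a) * (\<Prod>a\<in>A. \<Prod>b\<in>B. sgn1 (precedes r b a)) =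
      (\<Prod>a\<in>A. \<Prod>b\<in>B. inv_sign r l a b * inv_sign r l b a * (sgn1 (precedes r b a) :: 'r))"
    by (simp add: prod.distrib)
  also have "\<dots> = (\<Prod>a\<in>A. \<Prod>b\<in>B. sgn1 (precedes r (l b) (l a)))"
  proof (intro prod.cong refl)
    fix a b assume ab: "a \<in> A" "b \<in> B"
    have "l a \<noteq> l b" using ab assms(4,7) by (auto simp: inj_on_def)
    then show "inv_sign r l a b * inv_sign r l b a * sgn1 (precedes r b a) = (sgn1 (precedes r (l b) (l a)) :: 'r)"
      using inv_sign_swap[OF assms(1), of a b l] ab assms(4,5,6) by auto
  qed
  finally have e: "(\<Prod>a\<in>A. \<Prod>b\<in>B. inv_sign r l a b * inv_sign r l b a) * (\<Prod>a\<in>A. \<Prod>b\<in>B. sgn1 (precedes r b a)) =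
      (tau r (l ` A) (l ` B) :: 'r)" unfolding t .
  have "lsign r l (A \<union> B) * (\<Prod>a\<in>A. \<Prod>b\<in>B. sgn1 (precedes r b a)) = lsign r l A * lsign r l B *
     ((\<Prod>a\<in>A. \<Prod>b\<in>B. inv_sign r l a b * inv_sign r l b a) * (\<Prod>a\<in>A. \<Prod>b\<in>B. (sgn1 (precedes r b a) :: 'r)))"
    by (simp add: lsign_union[OF assms(2-4)] mult.assoc)
  then show ?thesis unfolding e by (simp add: ac_simps)
qed

lemma finite_transversals: "finite K \<Longrightarrow> finite (transversals K l D)"
  unfolding transversals_def by (rule finite_subset[of _ "Pow K"]) auto

text \<open>Multiplicativity of the homomorphism, read off at e_D. A transversal of \<open>D\<close>
  with a chosen subset is the same as a splitting of \<open>D\<close> with a transversal of each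
  part.\<close>

lemma Phi_mult:
  assumes "linear_order_on H r" "finite K" "K \<subseteq> H" "l ` K \<subseteq> H" "finite D"
  shows "Phi r K l v D (f \<otimes>\<^bsub>gca_ring H r\<^esub> g) =
    (\<Sum>D1\<in>Pow D. tau r D1 (D - D1) * Phi r K l v D1 f * Phi r K l v (D - D1) g)"
proof -
  let ?T = "transversals K l"
  let ?t = "\<lambda>A B. tau r (l ` A) (l ` B) * lsign r l A * lsign r l B * qeval v (f A) * qeval v (g B)"
  have finT: "finite (?T D)" for D by (rule finite_transversals[OF assms(2)])
  have finA: "finite A" if "A \<subseteq> K" for A using that assms(2) finite_subset by auto
  have 1: "lsign r l S * qeval v ((f \<otimes>\<^bsub>gca_ring H r\<^esub> g) S) = (\<Sum>A\<in>Pow S. ?t A (S - A))" if S: "S \<in> ?T D" for S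
  proof -
    have SK: "S \<subseteq> K" "inj_on l S" using S by (auto simp: transversals_def bij_betw_def)
    have "lsign r l S * qeval v ((f \<otimes>\<^bsub>gca_ring H r\<^esub> g) S) =
        (\<Sum>A\<in>Pow S. (lsign r l S * qeval v (shuffle_sign r A (S - A))) * qeval v (f A) * qeval v (g (S - A)))"
      unfolding gca_ring_simps qeval_sum qeval_mult by (simp add: sum_distrib_left mult.assoc)
    also have "\<dots> = (\<Sum>A\<in>Pow S. ?t A (S - A))"
    proof (rule sum.cong[OF refl])
      fix A assume A: "A \<in> Pow S"
      then have AS: "A \<union> (S - A) = S" by auto
      have "lsign r l (A \<union> (S - A)) * (\<Prod>a\<in>A. \<Prod>b\<in>S - A. sgn1 (precedes r b a)) =
        tau r (l ` A) (l ` (S - A)) * lsign r l A * (lsign r l (S - A) :: 'b qpoly poly)"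
      proof (rule sign_product[OF assms(1)])
        show "l ` (A \<union> (S - A)) \<subseteq> H" unfolding AS using SK(1) assms(4) by blast
      qed (use A AS SK finA assms(3) in auto)
      then have "lsign r l S * qeval v (shuffle_sign r A (S - A)) =
        tau r (l ` A) (l ` (S - A)) * lsign r l A * lsign r l (S - A)"
        unfolding AS using qeval_shuffle_sign[of A "S - A" v r] A SK finA by auto
      then show "(lsign r l S * qeval v (shuffle_sign r A (S - A))) * qeval v (f A) * qeval v (g (S - A)) = ?t A (S - A)"
        by simp
    qed
    finally show ?thesis .
  qed
  have "Phi r K l v D (f \<otimes>\<^bsub>gca_ring H r\<^esub> g) = (\<Sum>S\<in>?T D. \<Sum>A\<in>Pow S. ?t A (S - A))"
    unfolding Phi_def using 1 by (intro sum.cong) auto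
  also have "\<dots> = (\<Sum>(S, A)\<in>Sigma (?T D) Pow. ?t A (S - A))"
    by (rule sum.Sigma) (use finT finA in \<open>auto simp: transversals_def\<close>)
  also have "\<dots> = (\<Sum>(D1, A, B)\<in>Sigma (Pow D) (\<lambda>D1. ?T D1 \<times> ?T (D - D1)). ?t A B)"
  proof (rule sum.reindex_bij_witness[of _ "\<lambda>(D1, A, B). (A \<union> B, A)" "\<lambda>(S, A). (l ` A, A, S - A)"])
    fix x assume "x \<in> Sigma (?T D) Pow"
    then obtain S A where x: "x = (S, A)" "S \<subseteq> K" "bij_betw l S D" "A \<subseteq> S" by (auto simp: transversals_def)
    show "(case case x of (S, A) \<Rightarrow> (l ` A, A, S - A) of (D1, A, B) \<Rightarrow> (A \<union> B, A)) = x"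
      using x by auto
    have "bij_betw l A (l ` A)" using x(3,4) by (auto simp: bij_betw_def intro: inj_on_subset)
    moreover have "bij_betw l (S - A) (D - l ` A)"
      using x(3,4) by (auto simp: bij_betw_def intro: inj_on_subset simp: inj_on_def)
    moreover have "l ` A \<subseteq> D" using x(3,4) by (auto simp: bij_betw_def)
    ultimately show "(case x of (S, A) \<Rightarrow> (l ` A, A, S - A)) \<in> Sigma (Pow D) (\<lambda>D1. ?T D1 \<times> ?T (D - D1))"
      using x by (auto simp: transversals_def)
    show "(case case x of (S, A) \<Rightarrow> (l ` A, A, S - A) of (D1, A, B) \<Rightarrow> ?t A B) = (case x of (S, A) \<Rightarrow> ?t A (S - A))"
      using x by simp
  next
    fix y assume "y \<in> Sigma (Pow D) (\<lambda>D1. ?T D1 \<times> ?T (D - D1))"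
    then obtain D1 A B where y: "y = (D1, A, B)" "D1 \<subseteq> D" "A \<subseteq> K" "B \<subseteq> K" "bij_betw l A D1" "bij_betw l B (D - D1)"
      by (auto simp: transversals_def)
    have dis: "A \<inter> B = {}" using y(5,6) by (auto simp: bij_betw_def)
    then have "A \<union> B - A = B" by auto
    then show "(case case y of (D1, A, B) \<Rightarrow> (A \<union> B, A) of (S, A) \<Rightarrow> (l ` A, A, S - A)) = y"
      using y by (auto simp: bij_betw_def)
    have "bij_betw l (A \<union> B) (D1 \<union> (D - D1))" by (rule bij_betw_combine[OF y(5,6)]) auto
    moreover have "D1 \<union> (D - D1) = D" using y(2) by auto
    ultimately show "(case y of (D1, A, B) \<Rightarrow> (A \<union> B, A)) \<in> Sigma (?T D) Pow"
      using y by (auto simp: transversals_def)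
  qed
  also have "\<dots> = (\<Sum>D1\<in>Pow D. \<Sum>(A, B)\<in>?T D1 \<times> ?T (D - D1). ?t A B)"
    by (rule sum.Sigma[symmetric]) (use assms(5) finT in auto)
  also have "\<dots> = (\<Sum>D1\<in>Pow D. tau r D1 (D - D1) * Phi r K l v D1 f * Phi r K l v (D - D1) g)"
  proof (rule sum.cong[OF refl])
    fix D1 assume "D1 \<in> Pow D"
    have "(\<Sum>(A, B)\<in>?T D1 \<times> ?T (D - D1). ?t A B) =
      (\<Sum>(A, B)\<in>?T D1 \<times> ?T (D - D1). tau r D1 (D - D1) * ((lsign r l A * qeval v (f A)) * (lsign r l B * qeval v (g B))))"
      by (rule sum.cong) (auto simp: transversals_def bij_betw_def ac_simps)
    also have "\<dots> = tau r D1 (D - D1) * (Phi r K l v D1 f * Phi r K l v (D - D1) g)"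
      unfolding Phi_def sum_product sum.cartesian_product by (simp add: sum_distrib_left case_prod_beta)
    finally show "(\<Sum>(A, B)\<in>?T D1 \<times> ?T (D - D1). ?t A B) = tau r D1 (D - D1) * Phi r K l v D1 f * Phi r K l v (D - D1) g"
      by (simp add: mult.assoc)
  qed
  finally show ?thesis .
qed

lemma Phi_add: "Phi r K l v D (f \<oplus>\<^bsub>gca_ring H r\<^esub> g) = Phi r K l v D f + Phi r K l v D g"
  by (simp add: Phi_def gca_ring_simps qeval_add distrib_left sum.distrib)

lemma Phi_infinite: "finite K \<Longrightarrow> infinite D \<Longrightarrow> Phi r K l v D f = 0"
proof -
  assume "finite K" "infinite D"
  then have "transversals K l D = {}" by (auto simp: transversals_def dest: bij_betw_finite finite_subset)
  then show ?thesis by (simp add: Phi_def)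
qed

lemma Phi_em:
  assumes "finite K"
  shows "Phi r K l v D (em S q) = (if S \<in> transversals K l D then lsign r l S * qeval v q else 0)"
proof -
  have "Phi r K l v D (em S q) = (\<Sum>A\<in>transversals K l D. if A = S then lsign r l S * qeval v q else 0)"
    unfolding Phi_def em_def by (intro sum.cong) auto
  then show ?thesis using finite_transversals[OF assms] by simp
qed

text \<open>A preimage of an ideal. It is two-sided because the coefficients \<open>Phi\<close> lie
  in a commutative ring, so \<open>Phi_mult\<close> serves for both sides.\<close>

lemma ideal_Phi:
  assumes "linear_order_on H r" "finite H" "K \<subseteq> H" "l ` K \<subseteq> H" "cideal J"
  shows "ideal {f \<in> carrier (gca_ring H r). \<forall>D. Phi r K l v D f \<in> J} (gca_ring H r)"
proof -
  let ?R = "gca_ring H r"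
  let ?I = "{f \<in> carrier ?R. \<forall>D. Phi r K l v D f \<in> J}"
  interpret R: ring ?R by (rule ring_gca_ring[OF assms(2)])
  have finK: "finite K" using assms(2,3) finite_subset by auto
  have mult: "Phi r K l v D (f \<otimes>\<^bsub>?R\<^esub> g) \<in> J"
    if "\<And>D1 D2. tau r D1 D2 * Phi r K l v D1 f * Phi r K l v D2 g \<in> J" for D f g
  proof (cases "finite D")
    case True
    show ?thesis unfolding Phi_mult[OF assms(1) finK assms(3,4) True]
      by (rule cideal_sum[OF assms(5) that])
  qed (simp add: Phi_infinite[OF finK] cideal_0[OF assms(5)])
  show ?thesis
  proof (rule idealI)
    show "ring ?R" by (rule R.ring_axioms)
    show "subgroup ?I (add_monoid ?R)"
    proof
      show "?I \<subseteq> carrier (add_monoid ?R)" by auto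
      fix f g assume f: "f \<in> ?I" and g: "g \<in> ?I"
      then show "f \<otimes>\<^bsub>add_monoid ?R\<^esub> g \<in> ?I"
        using R.a_closed[of f g] cideal_add[OF assms(5)] by (auto simp: Phi_add)
    next
      show "\<one>\<^bsub>add_monoid ?R\<^esub> \<in> ?I"
        using R.zero_closed cideal_0[OF assms(5)] by (auto simp: Phi_def gca_ring_simps(4))
    next
      fix f assume f: "f \<in> ?I"
      then have fc: "f \<in> carrier ?R" by auto
      have "f \<oplus>\<^bsub>?R\<^esub> (\<ominus>\<^bsub>?R\<^esub> f) = \<zero>\<^bsub>?R\<^esub>" by (rule R.r_neg[OF fc])
      then have "f S + (\<ominus>\<^bsub>?R\<^esub> f) S = 0" for S unfolding gca_ring_simps by (rule fun_cong)
      then have "(\<ominus>\<^bsub>?R\<^esub> f) S = - f S" for S by (simp add: add_eq_0_iff)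
      then have "Phi r K l v D (\<ominus>\<^bsub>?R\<^esub> f) = - Phi r K l v D f" for D
        by (simp add: Phi_def qeval_uminus sum_negf)
      then have "\<ominus>\<^bsub>?R\<^esub> f \<in> ?I" using R.a_inv_closed[OF fc] f cideal_uminus[OF assms(5)] by auto
      then show "inv\<^bsub>add_monoid ?R\<^esub> f \<in> ?I" by (simp add: a_inv_def)
    qed
    fix a x assume a: "a \<in> ?I" and x: "x \<in> carrier ?R"
    have 1: "tau r D1 D2 * Phi r K l v D1 x * Phi r K l v D2 a \<in> J" for D1 D2
      by (rule cideal_mult[OF assms(5)]) (use a in auto)
    have 2: "tau r D1 D2 * Phi r K l v D1 a * Phi r K l v D2 x \<in> J" for D1 D2
      by (rule cideal_multr[OF assms(5)], rule cideal_mult[OF assms(5)]) (use a in auto)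
    show "x \<otimes>\<^bsub>?R\<^esub> a \<in> ?I" "a \<otimes>\<^bsub>?R\<^esub> x \<in> ?I"
      using a x R.m_closed mult[OF 1] mult[OF 2] by auto
  qed
qed

text \<open>If some term survives, \<open>l\<close> is injective on \<open>C\<close> without one
  element \<open>g0\<close>, but not on \<open>C\<close>. Then exactly one further element has the
  image of \<open>g0\<close>; only the terms omitting one of these two survive, and they are
  opposite. The condition on \<open>C - {g}\<close> holds when the atoms in \<open>K\<close> form a
  flat and \<open>C\<close> is a circuit.\<close>

lemma Phi_boundary:
  assumes "linear_order_on H r" "finite K" "C \<subseteq> H" "finite C" "l ` K \<subseteq> H"
    "\<And>g. g \<in> C \<Longrightarrow> C - {g} \<subseteq> K \<Longrightarrow> C \<subseteq> K" "C \<subseteq> K \<Longrightarrow> \<not> inj_on l C"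
  shows "Phi r K l v D (gca_boundary r C) = 0"
proof -
  let ?T = "transversals K l D"
  let ?n = "\<lambda>g. (- 1) ^ card {h \<in> C. precedes r h g} :: 'b qpoly poly"
  define w where "w g = (if C - {g} \<in> ?T then ?n g * lsign r l (C - {g}) else 0)" for g
  have "lsign r l A * qeval v (gca_boundary r C A) = (\<Sum>g\<in>C. if A = C - {g} then ?n g * lsign r l (C - {g}) else 0)" for A
    unfolding gca_boundary_def qeval_sum qeval_mult qeval_minus_one_power sum_distrib_left
    by (intro sum.cong) (auto simp: gca_e_def mult.commute)
  then have "Phi r K l v D (gca_boundary r C) =
      (\<Sum>A\<in>?T. \<Sum>g\<in>C. if A = C - {g} then ?n g * lsign r l (C - {g}) else 0)"
    by (simp add: Phi_def)
  also have "\<dots> = (\<Sum>g\<in>C. \<Sum>A\<in>?T. if A = C - {g} then ?n g * lsign r l (C - {g}) else 0)"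
    by (rule sum.swap)
  also have "\<dots> = (\<Sum>g\<in>C. w g)"
    using finite_transversals[OF assms(2)] by (simp add: w_def)
  finally have P: "Phi r K l v D (gca_boundary r C) = (\<Sum>g\<in>C. w g)" .
  show ?thesis
  proof (cases "\<exists>g\<in>C. C - {g} \<in> ?T")
    case False
    then show ?thesis unfolding P by (simp add: w_def)
  next
    case True
    then obtain g0 where g0: "g0 \<in> C" "C - {g0} \<in> ?T" by blast
    have bij0: "bij_betw l (C - {g0}) D" "C - {g0} \<subseteq> K" using g0 by (auto simp: transversals_def)
    have CK: "C \<subseteq> K" using assms(6)[OF g0(1) bij0(2)] .
    then have "\<not> inj_on l C" by (rule assms(7))
    moreover have "C = insert g0 (C - {g0})" using g0 by auto
    ultimately have "l g0 \<in> l ` (C - {g0})" using bij0(1) by (metis Diff_idemp bij_betw_def inj_on_insert)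
    then obtain g1 where "l g0 = l g1" "g1 \<in> C - {g0}" by (rule imageE)
    then have g1: "g1 \<in> C" "g1 \<noteq> g0" "l g1 = l g0" by auto
    define C0 where "C0 = C - {g0, g1}"
    have C0: "finite C0" "C0 \<subseteq> C" "g0 \<notin> C0" "g1 \<notin> C0" "C = insert g0 (insert g1 C0)"
      using assms(4) g0 g1 by (auto simp: C0_def)
    have e0: "C - {g0} = insert g1 C0" "C - {g1} = insert g0 C0" using C0 g1 by auto
    have "w g = 0" if "g \<in> C - {g0, g1}" for g
    proof -
      have "\<not> inj_on l (C - {g})" using that g0 g1 by (auto simp: inj_on_def)
      then show ?thesis by (auto simp: w_def transversals_def bij_betw_def)
    qed
    then have "(\<Sum>g\<in>C. w g) = (\<Sum>g\<in>{g0, g1}. w g)"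
      using assms(4) g0 g1 by (intro sum.mono_neutral_right) auto
    also have "\<dots> = w g0 + w g1" using g1 by simp
    finally have W: "(\<Sum>g\<in>C. w g) = w g0 + w g1" .
    have T1: "C - {g1} \<in> ?T"
    proof -
      have "l ` (C - {g1}) = l ` (C - {g0})" unfolding e0 using g1 by simp
      moreover have "inj_on l (C - {g1})" using bij0(1) g1(3) C0(3,4) unfolding e0
        by (auto simp: bij_betw_def inj_on_insert)
      ultimately show ?thesis using bij0 CK by (auto simp: transversals_def bij_betw_def)
    qed
    have ne: "l h \<noteq> l g1" if "h \<in> C0" for h
      using bij0(1) that C0(4) unfolding e0 by (auto simp: bij_betw_def inj_on_def)
    \<comment> \<open>Apart from the last factor, the sign is symmetric in the omitted element
      \<open>g\<close> and the retained one \<open>g'\<close>, because \<open>l\<close> takes the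
      same value at both. The last factor changes sign under the exchange.\<close>
    have val: "?n g * lsign r l (insert g' C0) =
       lsign r l C0 * (\<Prod>h\<in>C0. sgn1 (precedes r h g) * sgn1 (precedes r h g') * sgn1 (precedes r (l h) (l g'))) * sgn1 (precedes r g' g)"
      if g: "{g, g'} = {g0, g1}" for g g'
    proof -
      have gg: "g \<in> C" "g' \<in> C" "g \<noteq> g'" "g \<notin> C0" "g' \<notin> C0" "C = insert g (insert g' C0)" "l g' = l g1"
        using g g0 g1 C0 by (auto simp: doubleton_eq_iff)
      have n: "?n g = (\<Prod>h\<in>C0. sgn1 (precedes r h g)) * sgn1 (precedes r g' g)"
        unfolding minus_one_card[OF assms(4)] unfolding gg(6) using gg C0(1)
        by (simp add: precedes_irrefl mult.commute) (simp add: sgn1_def precedes_irrefl)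
      have s1: "lsign r l {g'} = (1 :: 'b qpoly poly)"
        by (simp add: lsign_def inv_sign_def sgn1_def precedes_irrefl)
      have "lsign r l ({g'} \<union> C0) = lsign r l {g'} * lsign r l C0 *
          (\<Prod>a\<in>{g'}. \<Prod>b\<in>C0. inv_sign r l a b * (inv_sign r l b a :: 'b qpoly poly))"
        by (rule lsign_union) (use C0 gg in auto)
      then have ls: "lsign r l (insert g' C0) = lsign r l C0 * (\<Prod>h\<in>C0. inv_sign r l g' h * (inv_sign r l h g' :: 'b qpoly poly))"
        using s1 by simp
      have "inv_sign r l g' h * inv_sign r l h g' = sgn1 (precedes r h g') * (sgn1 (precedes r (l h) (l g')) :: 'b qpoly poly)"
        if h: "h \<in> C0" for h
      proof -
        have hg: "h \<in> C" "h \<noteq> g'" "l h \<noteq> l g'" using h gg C0(2) ne[OF h] by auto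
        have "l z \<in> H" if "z \<in> C" for z using that CK assms(5) by blast
        then have "h \<in> H" "g' \<in> H" "h \<noteq> g'" "l h \<in> H" "l g' \<in> H" "l h \<noteq> l g'"
          using hg gg(2) assms(3) by blast+
        from inv_sign_swap[OF assms(1) this(2,1) _ this(5,4)] this
        have "inv_sign r l g' h * inv_sign r l h g' * sgn1 (precedes r h g') = (sgn1 (precedes r (l h) (l g')) :: 'b qpoly poly)"
          by metis
        then have "inv_sign r l g' h * inv_sign r l h g' * sgn1 (precedes r h g') * sgn1 (precedes r h g') =
            (sgn1 (precedes r (l h) (l g')) :: 'b qpoly poly) * sgn1 (precedes r h g')" by simp
        then show ?thesis by (simp add: mult.assoc mult.commute)
      qed
      then have "(\<Prod>h\<in>C0. inv_sign r l g' h * inv_sign r l h g') =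
          (\<Prod>h\<in>C0. sgn1 (precedes r h g') * (sgn1 (precedes r (l h) (l g')) :: 'b qpoly poly))"
        by (intro prod.cong) auto
      then show ?thesis unfolding n ls by (simp add: prod.distrib ac_simps)
    qed
    have "precedes r g1 g0 \<longleftrightarrow> \<not> precedes r g0 g1"
      using linear_order_facts(2)[OF assms(1), of g1 g0] linear_order_facts(3)[OF assms(1), of g1 g0]
        g0(1) g1(1,2) assms(3) by blast
    then have "sgn1 (precedes r g1 g0) = - (sgn1 (precedes r g0 g1) :: 'b qpoly poly)"
      by (simp add: sgn1_def)
    moreover have "w g0 = ?n g0 * lsign r l (C - {g0})" unfolding w_def using g0(2) by (rule if_P)
    note w0 = this[unfolded e0, unfolded val[OF refl]]
    have "w g1 = ?n g1 * lsign r l (C - {g1})" unfolding w_def using T1 by (rule if_P)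
    note w1 = this[unfolded e0, unfolded val[OF insert_commute]]
    define P0 where "P0 = (\<Prod>h\<in>C0. sgn1 (precedes r h g0) * sgn1 (precedes r h g1) *
      (sgn1 (precedes r (l h) (l g1)) :: 'b qpoly poly))"
    have P1: "(\<Prod>h\<in>C0. sgn1 (precedes r h g1) * sgn1 (precedes r h g0) *
      (sgn1 (precedes r (l h) (l g0)) :: 'b qpoly poly)) = P0"
      unfolding P0_def g1(3) by (intro prod.cong refl) (simp add: mult.commute)
    ultimately have "w g0 + w g1 = 0"
      unfolding w0 w1 P1 P0_def[symmetric] by simp
    then show ?thesis unfolding P W .
  qed
qed

section \<open>The ideal of a partial building set\<close>

lemma qpolys_prod: "(\<And>i. i \<in> A \<Longrightarrow> f i \<in> qpolys H) \<Longrightarrow> prod f A \<in> qpolys H"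
  by (induction A rule: infinite_finite_induct) (auto intro: qpolys_closed)

lemma qvar_qpolys: "g \<in> H \<Longrightarrow> qvar g \<in> qpolys H"
  by (simp add: qpolys_def qvar_def)

lemma kys_minus_one_power: "kys ((- 1) ^ n :: 'a qpoly) = {0}"
  by (cases "even n") auto

section \<open>Boundaries and their initial monomials\<close>

lemma gca_boundary_at:
  assumes "finite C" "g \<in> C"
  shows "gca_boundary r C (C - {g}) = (- 1) ^ card {h \<in> C. precedes r h g}"
proof -
  have "gca_boundary r C (C - {g}) = (\<Sum>h\<in>C. if h = g then (- 1) ^ card {h \<in> C. precedes r h g} else 0)"
    unfolding gca_boundary_def using assms(2) by (intro sum.cong) (auto simp: gca_e_def)
  then show ?thesis using assms by simp
qed

lemma gca_boundary_outside: "(\<And>g. g \<in> C \<Longrightarrow> A \<noteq> C - {g}) \<Longrightarrow> gca_boundary r C A = 0"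
  unfolding gca_boundary_def by (intro sum.neutral) (auto simp: gca_e_def)

lemma gca_boundary_monomials:
  assumes "finite C"
  shows "gca_monomials (gca_boundary r C) = (\<lambda>g. (C - {g}, 0)) ` C"
proof -
  have "lkp (gca_boundary r C A) m \<noteq> 0 \<longleftrightarrow> (\<exists>g\<in>C. A = C - {g} \<and> m = 0)" for A m
  proof (cases "\<exists>g\<in>C. A = C - {g}")
    case True
    then obtain g where "g \<in> C" "A = C - {g}" by blast
    then show ?thesis using gca_boundary_at[OF assms, of g r] kys_minus_one_power
      by (auto simp: in_keys_iff[symmetric])
  next
    case False
    then have "gca_boundary r C A = 0" by (intro gca_boundary_outside) blast
    then show ?thesis using False by auto
  qed
  then show ?thesis by (auto simp: gca_monomials_def)
qed

lemma gca_boundary_carrier: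
  assumes "C \<subseteq> H" shows "gca_boundary r C \<in> carrier (gca_ring H r)"
proof -
  have "gca_boundary r C A \<in> qpolys H" for A
    unfolding gca_boundary_def gca_e_def
    by (intro qpolys_sum qpolys_closed(6) qpolys_power qpolys_closed(3)) (auto intro: qpolys_closed)
  moreover have "A \<subseteq> H" if "gca_boundary r C A \<noteq> 0" for A
    using gca_boundary_outside[of C A r] that assms by blast
  ultimately show ?thesis by (simp add: gca_ring_simps(1))
qed

text \<open>All terms have the same degree, and omitting the earliest element keeps the largest
  variables. For a circuit the initial monomial is thus a broken circuit.\<close>

lemma gca_boundary_initial:
  assumes "linear_order_on H r" "finite C" "C \<subseteq> H" "b \<in> C" "\<And>g. g \<in> C \<Longrightarrow> g \<noteq> b \<Longrightarrow> precedes r b g"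
  shows "initial_monomial r (gca_boundary r C) = (C - {b}, 0)" "gca_boundary r C \<noteq> \<zero>\<^bsub>gca_ring H r\<^esub>"
proof -
  show "initial_monomial r (gca_boundary r C) = (C - {b}, 0)"
  proof (rule initial_monomial_eq[OF assms(1)])
    show "(C - {b}, 0) \<in> gca_monomials (gca_boundary r C)" using assms by (simp add: gca_boundary_monomials)
    fix N assume "N \<in> gca_monomials (gca_boundary r C)"
    then obtain g where g: "g \<in> C" "N = (C - {g}, 0)" using assms by (auto simp: gca_boundary_monomials)
    show "mon_ok H N" using g assms(3) by (auto simp: mon_ok_def)
    assume "N \<noteq> (C - {b}, 0)"
    then have gb: "g \<noteq> b" using g by auto
    then have bg: "precedes r b g" using assms(5) g by auto
    have "var_exponent (C - {g}, 0) w = var_exponent (C - {b}, 0) w" if "var_precedes r (EVar g) w" for w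
    proof (cases w)
      case (EVar h)
      then have "precedes r g h" using that by simp
      then have "h \<noteq> g" "h \<noteq> b" using bg linear_order_facts(2)[OF assms(1)] by (auto simp: precedes_def)
      then show ?thesis using EVar by simp
    qed (use that in simp)
    moreover have "card (C - {g}) = card (C - {b})" using g assms by simp
    ultimately show "deglex_less r N (C - {b}, 0)"
      unfolding g deglex_less_def monomial_degree_eq using g gb by (intro disjI2 conjI exI[of _ "EVar g"]) auto
  qed
  show "gca_boundary r C \<noteq> \<zero>\<^bsub>gca_ring H r\<^esub>"
  proof
    assume "gca_boundary r C = \<zero>\<^bsub>gca_ring H r\<^esub>"
    then have "gca_monomials (gca_boundary r C) = {}" by (simp add: gca_ring_simps gca_monomials_def)
    then show False using assms gca_boundary_monomials by blast
  qed
qed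

lemma pmon_degree_var: "pmon (\<lambda>h. [:0, qvar h:]) m = Polynomial.monom (sgl m 1) (mdeg m)"
proof -
  have p: "[:0, c:] ^ k = Polynomial.monom (c ^ k) k" for c :: "'a qpoly" and k
  proof -
    have "[:0, c:] = Polynomial.monom c 1" by (simp add: monom_altdef)
    then show ?thesis by (simp add: monom_power)
  qed
  have "(\<Prod>g\<in>A. Polynomial.monom (c g) (e g)) = Polynomial.monom (prod c A) (sum e A)" if "finite A"
    for A and c :: "'a \<Rightarrow> 'a qpoly" and e :: "'a \<Rightarrow> nat"
    using that by induction (auto simp: mult_monom one_pCons monom_0)
  then have "pmon (\<lambda>h. [:0, qvar h:]) m = Polynomial.monom (pmon qvar m) (mdeg m)"
    by (simp add: pmon_def p mdeg_def)
  then show ?thesis by (simp add: pmon_qvar)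
qed

locale nested_setting = building +
  fixes Q :: "'a set" and r :: "'a rel" and ps :: "'a list"
  assumes Q: "upper Q" and seq: "blowup_sequence L (atoms L \<union> Q) ps"
    and lin: "linear_order_on (atoms L \<union> Q) r"
    and ord: "\<And>p q. p \<in> atoms L \<union> Q \<Longrightarrow> q \<in> atoms L \<union> Q \<Longrightarrow> q \<sqsubseteq> p \<Longrightarrow> q \<noteq> p \<Longrightarrow> precedes r p q"
begin

abbreviation "H \<equiv> atoms L \<union> Q"
abbreviation "R \<equiv> gca_ring H r"

definition cp :: "'a \<Rightarrow> 'a qpoly" where "cp g = (\<Sum>h\<in>{h \<in> H. g \<sqsubseteq> h}. qvar h)"

lemma H_car: "H \<subseteq> carrier L" and Q_car: "Q \<subseteq> carrier L" and Q_atoms: "Q \<inter> atoms L = {}" and H_G: "H \<subseteq> G"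
  using Q G_carrier atoms_carrier atoms_G by (auto simp: upper_def)

lemma fin_H: "finite H"
  using H_car fin_carrier finite_subset by blast

lemma fin_sub: "X \<subseteq> H \<Longrightarrow> finite X"
  using fin_H finite_subset by blast

lemma nested_viol: "S \<subseteq> H \<Longrightarrow> nested L H S \<longleftrightarrow> \<not> violates Q S"
  by (rule nested_iff[OF Q])

lemma nonnested_eq: "nonnested_monomials L H r = {em S (prod qvar T) | S T. S \<subseteq> H \<and> T \<subseteq> H \<and> violates Q (S \<union> T)}"
proof -
  have 1: "gca_e S \<otimes>\<^bsub>R\<^esub> gca_x T = em S (prod qvar T)" if "S \<subseteq> H" for S T
    unfolding gca_x_def by (rule e_mult_poly[OF fin_sub[OF that]])
  have 2: "\<not> nested L H (S \<union> T) \<longleftrightarrow> violates Q (S \<union> T)" if "S \<subseteq> H" "T \<subseteq> H" for S T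
    using nested_viol[of "S \<union> T"] that by simp
  show ?thesis unfolding nonnested_monomials_def using 1 2 by (intro Collect_cong) metis
qed

text \<open>From here on the relations of type (ii) refer to circuits of the lattice instead of the
  blowup.\<close>

lemma circuits_eq: "circuit_boundaries L H r ps = {gca_boundary r C | C. C \<subseteq> atoms L \<and> lat_circuit C \<and> \<not> violates Q C}"
proof -
  have 1: "nested_circuit L H ps C \<longleftrightarrow> C \<subseteq> atoms L \<and> lat_circuit C \<and> \<not> violates Q C" for C
  proof
    assume a: "nested_circuit L H ps C"
    then have "C \<subseteq> H" by (simp add: nested_circuit_def nested_def)
    then show "C \<subseteq> atoms L \<and> lat_circuit C \<and> \<not> violates Q C"
      using nested_circuit_iff[OF Q seq, of C] a nested_viol lat_circuit_atoms by blast
  next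
    assume a: "C \<subseteq> atoms L \<and> lat_circuit C \<and> \<not> violates Q C"
    then show "nested_circuit L H ps C" using nested_circuit_iff[OF Q seq, of C] nested_viol by blast
  qed
  show ?thesis unfolding circuit_boundaries_def 1 ..
qed

lemma gca_c_em: "gca_c L H g = em {} (cp g)"
  by (simp add: gca_c_def cp_def gca_poly_em)

lemma cp_qpolys: "cp g \<in> qpolys H"
  unfolding cp_def by (intro qpolys_sum qvar_qpolys) auto

definition "X = nonnested_monomials L H r \<union> circuit_boundaries L H r ps \<union> gca_c L H ` atoms L"

lemma X_carrier: "X \<subseteq> carrier R"
proof
  fix f assume "f \<in> X"
  then consider S T where "S \<subseteq> H" "T \<subseteq> H" "f = em S (prod qvar T)" | C where "C \<subseteq> atoms L" "f = gca_boundary r C"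
    | a where "f = em {} (cp a)"
    unfolding X_def nonnested_eq circuits_eq gca_c_em by blast
  then show "f \<in> carrier R"
  proof cases
    case 1
    then show ?thesis by (auto intro!: em_carrier qpolys_prod qvar_qpolys)
  next
    case 2
    then show ?thesis by (auto intro!: gca_boundary_carrier)
  next
    case 3
    then show ?thesis by (auto intro!: em_carrier cp_qpolys)
  qed
qed

abbreviation "I \<equiv> nested_ideal L H r ps"

lemma I_eq: "I = Idl\<^bsub>R\<^esub> X"
  by (simp add: nested_ideal_def X_def)

lemma I_ideal: "ideal I R"
proof -
  interpret ring R by (rule ring_gca_ring[OF fin_H])
  show ?thesis unfolding I_eq by (rule genideal_ideal[OF X_carrier])
qed

lemma X_I: "X \<subseteq> I"
proof -
  interpret ring R by (rule ring_gca_ring[OF fin_H])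
  show ?thesis unfolding I_eq by (rule genideal_self[OF X_carrier])
qed

lemma I_least: "ideal I' R \<Longrightarrow> X \<subseteq> I' \<Longrightarrow> I \<subseteq> I'"
proof -
  interpret ring R by (rule ring_gca_ring[OF fin_H])
  show "ideal I' R \<Longrightarrow> X \<subseteq> I' \<Longrightarrow> I \<subseteq> I'" unfolding I_eq by (rule genideal_minimal)
qed

section \<open>Membership in the ideal\<close>

lemma em_I_mult: "S \<subseteq> H \<Longrightarrow> em S f \<in> I \<Longrightarrow> p \<in> qpolys H \<Longrightarrow> em S (p * f) \<in> I"
proof -
  assume a: "S \<subseteq> H" "em S f \<in> I" "p \<in> qpolys H"
  interpret ideal I R by (rule I_ideal)
  have "gca_poly p \<in> carrier R" unfolding gca_poly_em using a by (intro em_carrier) auto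
  then have "gca_poly p \<otimes>\<^bsub>R\<^esub> em S f \<in> I" using a by (intro I_l_closed) auto
  then show ?thesis using poly_mult_em[OF fin_sub[OF a(1)]] by metis
qed

lemma em_I_add: "em S f \<in> I \<Longrightarrow> em S g \<in> I \<Longrightarrow> em S (f + g) \<in> I"
proof -
  assume a: "em S f \<in> I" "em S g \<in> I"
  have "em S f \<oplus>\<^bsub>R\<^esub> em S g \<in> I"
    by (rule additive_subgroup.a_closed[OF ideal.axioms(1)[OF I_ideal] a])
  then show ?thesis by (simp add: em_add)
qed

lemma em_I_diff: "S \<subseteq> H \<Longrightarrow> em S f \<in> I \<Longrightarrow> em S g \<in> I \<Longrightarrow> em S (f - g) \<in> I"
  using em_I_add[of S f "- g"] em_I_mult[of S g "-1"] qpolys_closed(3)[of H] by simp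

lemma em_I_sum: "S \<subseteq> H \<Longrightarrow> em S 0 \<in> I"
proof -
  assume "S \<subseteq> H"
  interpret ideal I R by (rule I_ideal)
  have "\<zero>\<^bsub>R\<^esub> \<in> I" by (rule additive_subgroup.zero_closed) (rule additive_subgroup_axioms)
  moreover have "\<zero>\<^bsub>R\<^esub> = em S 0" by (auto simp: gca_ring_simps em_def)
  ultimately show ?thesis by simp
qed

lemma em_I_sums: "S \<subseteq> H \<Longrightarrow> (\<And>x. x \<in> A \<Longrightarrow> em S (f x) \<in> I) \<Longrightarrow> em S (sum f A) \<in> I"
  by (induction A rule: infinite_finite_induct) (auto intro: em_I_sum em_I_add)

lemma em_I_c: "S \<subseteq> H \<Longrightarrow> a \<in> atoms L \<Longrightarrow> f \<in> qpolys H \<Longrightarrow> em S (f * cp a) \<in> I"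
proof -
  assume a: "S \<subseteq> H" "a \<in> atoms L" "f \<in> qpolys H"
  interpret ideal I R by (rule I_ideal)
  have "em {} (cp a) \<in> I" using X_I a unfolding X_def gca_c_em by blast
  moreover have "em S f \<in> carrier R" using a by (intro em_carrier)
  ultimately have "em S f \<otimes>\<^bsub>R\<^esub> em {} (cp a) \<in> I" by (rule I_l_closed)
  then show ?thesis using em_mult_poly[OF fin_sub[OF a(1)], of _ _ f] unfolding gca_poly_em
    by (metis mult.commute)
qed

lemma em_I_nonnested: "S \<subseteq> H \<Longrightarrow> T \<subseteq> H \<Longrightarrow> violates Q (S \<union> T) \<Longrightarrow> em S (prod qvar T) \<in> I"
  using X_I unfolding X_def nonnested_eq by blast

lemma power_eq:
  "power_relations L H r = {em S (prod qvar T * cp g ^ k) | S T g k.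
        nested L H (S \<union> T) \<and> g \<in> H \<and> S \<inter> T = {} \<and> antichain_in L (S \<union> T) \<and>
        \<Squnion>(S \<union> T) \<sqsubset> g \<and> k = interval_rank L (\<Squnion>(S \<union> T)) g}"
proof -
  have "gca_e S \<otimes>\<^bsub>R\<^esub> gca_x T \<otimes>\<^bsub>R\<^esub> (gca_c L H g [^]\<^bsub>R\<^esub> k) = em S (prod qvar T * cp g ^ k)"
    if "nested L H (S \<union> T)" for S T g k
  proof -
    have S: "finite S" using that fin_sub by (simp add: nested_def)
    show ?thesis unfolding gca_x_def e_mult_poly[OF S] gca_c_def gca_poly_power[OF fin_H] em_mult_poly[OF S]
      cp_def by (simp add: mult.commute)
  qed
  then show ?thesis unfolding power_relations_def by (intro Collect_cong) metis
qed

text \<open>Let the atoms of \<open>B\<close> span \<open>g\<close> over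
  \<open>\<Squnion>(S \<union> T)\<close>, and write \<open>cp b = cp g + d b\<close>. The product
  of the \<open>d b\<close> expands into non-nested monomials, and modulo the linear relations each
  \<open>d b\<close> is \<open>- cp g\<close>. If \<open>g\<close> is an atom, \<open>cp g\<close>
  is itself a linear relation.\<close>

lemma power_in_I:
  assumes "nested L H (S \<union> T)" "g \<in> H" "\<Squnion>(S \<union> T) \<sqsubset> g" "k = interval_rank L (\<Squnion>(S \<union> T)) g"
  shows "em S (prod qvar T * cp g ^ k) \<in> I"
proof -
  have STH: "S \<subseteq> H" "T \<subseteq> H" using assms(1) by (auto simp: nested_def)
  have STc: "S \<union> T \<subseteq> carrier L" using STH H_car by auto
  define y where "y = \<Squnion>(S \<union> T)"
  have y: "y \<in> carrier L" "y \<sqsubseteq> g" "y \<noteq> g" using assms(3) J_closed[OF STc] by (auto simp: y_def lless_def eq_is_equal)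
  have gc: "g \<in> carrier L" using assms(2) H_car by auto
  have ngy: "\<not> g \<sqsubseteq> y" using y gc le_antisym by auto
  obtain B where B: "B \<subseteq> atoms L" "\<And>b. b \<in> B \<Longrightarrow> b \<sqsubseteq> g" "\<Squnion>(insert y B) = g" "card B \<le> k"
    using spanning_exists[OF y(1) gc y(2)] assms(4) y_def by blast
  have finB: "finite B" using B(1) fin_sub by auto
  have Bne: "B \<noteq> {}" using B(3) y J_single by auto
  have qT: "prod qvar T' \<in> qpolys H" if "T' \<subseteq> H" for T' :: "'a set"
    using that by (intro qpolys_prod qvar_qpolys) auto
  have less: "em S (prod qvar T * cp g ^ card B) \<in> I"
  proof (cases "g \<in> atoms L")
    case True
    obtain j where j: "card B = Suc j" using Bne finB by (metis card_gt_0_iff gr0_implies_Suc)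
    have "prod qvar T * cp g ^ j \<in> qpolys H"
      by (intro qpolys_closed(6) qT qpolys_power cp_qpolys STH)
    from em_I_c[OF STH(1) True this] show ?thesis unfolding j by (simp add: ac_simps)
  next
    case False
    then have gQ: "g \<in> Q" using assms(2) by auto
    define d where "d b = (\<Sum>h\<in>{h \<in> H. b \<sqsubseteq> h \<and> \<not> g \<sqsubseteq> h}. qvar h)" for b
    have dq: "d b \<in> qpolys H" for b unfolding d_def by (intro qpolys_sum qvar_qpolys) auto
    have cd: "cp b = cp g + d b" if b: "b \<in> B" for b
    proof -
      have bc: "b \<in> carrier L" "b \<sqsubseteq> g" using b B atoms_carrier by auto
      have "{h \<in> H. b \<sqsubseteq> h} = {h \<in> H. g \<sqsubseteq> h} \<union> {h \<in> H. b \<sqsubseteq> h \<and> \<not> g \<sqsubseteq> h}"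
        using le_trans[OF bc(2) _ bc(1) gc] H_car by blast
      then show ?thesis unfolding cp_def d_def using fin_H by (simp add: sum.union_disjoint[symmetric] Int_def)
    qed
    \<comment> \<open>\<open>T'\<close> collects the elements \<open>h\<close> chosen from the
      factors expanded so far. Once every atom of \<open>B\<close> lies below a member of
      \<open>T'\<close>, the join of \<open>S \<union> T'\<close> is above \<open>g\<close>, while
      no single member is.\<close>
    have expand: "em S (prod qvar T' * (\<Prod>b\<in>B'. d b)) \<in> I"
      if "B' \<subseteq> B" "T' \<subseteq> H" "T \<subseteq> T'" "\<And>t. t \<in> T' \<Longrightarrow> \<not> g \<sqsubseteq> t"
        "\<And>b. b \<in> B - B' \<Longrightarrow> \<exists>t\<in>T'. b \<sqsubseteq> t" for B' T'
      using finite_subset[OF that(1) finB] that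
    proof (induction B' arbitrary: T' rule: finite_induct)
      case empty
      have c: "S \<union> T' \<subseteq> carrier L" using STH empty H_car by auto
      have "\<not> g \<sqsubseteq> s" if s: "s \<in> S" for s
      proof
        assume "g \<sqsubseteq> s"
        moreover have "s \<sqsubseteq> y" unfolding y_def using J_upper[OF STc] s by auto
        ultimately show False using ngy le_trans[of g s y] gc y(1) s STc by auto
      qed
      then have eq: "{s \<in> S \<union> T'. \<not> g \<sqsubseteq> s} = S \<union> T'" using empty by auto
      have "y \<sqsubseteq> \<Squnion>(S \<union> T')" unfolding y_def by (rule J_mono) (use empty c in auto)
      moreover have "b \<sqsubseteq> \<Squnion>(S \<union> T')" if "b \<in> B" for b
      proof -
        obtain t where "t \<in> T'" "b \<sqsubseteq> t" using empty(5)[of b] \<open>b \<in> B\<close> by auto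
        then show ?thesis using J_in_le[OF c, of b t] that B atoms_carrier by auto
      qed
      ultimately have "g \<sqsubseteq> \<Squnion>(S \<union> T')"
        unfolding B(3)[symmetric]
        by (intro J_least) (use y B atoms_carrier J_closed[OF c] in auto)
      then have "violates Q (S \<union> T')" unfolding violates_def using gQ by (intro bexI[of _ g]) (simp only: eq)
      then show ?case using em_I_nonnested[OF STH(1) empty(2)] by simp
    next
      case (insert b B')
      let ?P = "\<Prod>b\<in>B'. d b"
      have Pq: "?P \<in> qpolys H" by (intro qpolys_prod dq)
      have "em S (prod qvar T' * ?P * qvar h) \<in> I" if h: "h \<in> H" "b \<sqsubseteq> h" "\<not> g \<sqsubseteq> h" for h
      proof -
        have IH: "em S (prod qvar (insert h T') * ?P) \<in> I"
        proof (rule insert.IH)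
          show "\<exists>t\<in>insert h T'. b' \<sqsubseteq> t" if "b' \<in> B - B'" for b'
            using insert.prems(5)[of b'] that h by (cases "b' = b") auto
        qed (use insert.prems h in auto)
        show ?thesis
        \<comment> \<open>A repeated choice produces a square, whereas the monomial relations are
          squarefree; the extra factor is split off.\<close>
        proof (cases "h \<in> T'")
          case True
          then have "insert h T' = T'" by auto
          then show ?thesis using em_I_mult[OF STH(1) IH qvar_qpolys[OF h(1)]] by (simp add: mult.commute)
        next
          case False
          then show ?thesis using IH fin_sub[OF insert.prems(2)] by (simp add: ac_simps)
        qed
      qed
      then have "em S (\<Sum>h\<in>{h \<in> H. b \<sqsubseteq> h \<and> \<not> g \<sqsubseteq> h}. prod qvar T' * ?P * qvar h) \<in> I"
        by (intro em_I_sums[OF STH(1)]) auto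
      then have "em S (prod qvar T' * ?P * d b) \<in> I" by (simp add: d_def sum_distrib_left)
      then show ?case using insert.hyps by (simp add: ac_simps)
    qed
    have base: "em S (prod qvar T * (\<Prod>b\<in>B. d b)) \<in> I"
    proof (rule expand)
      show "\<not> g \<sqsubseteq> t" if t: "t \<in> T" for t
      proof
        assume "g \<sqsubseteq> t"
        moreover have "t \<sqsubseteq> y" unfolding y_def using J_upper[OF STc] t by auto
        ultimately show False using ngy le_trans[of g t y] gc y(1) t STc by auto
      qed
    qed (use STH in auto)
    have "em S (prod qvar T * cp g ^ card B' * (\<Prod>b\<in>B - B'. d b)) \<in> I" if "B' \<subseteq> B" for B'
      using finite_subset[OF that finB] that
    proof (induction B' rule: finite_induct)
      case empty
      then show ?case using base by simp
    next
      case (insert b B')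
      let ?A = "prod qvar T * cp g ^ card B'" and ?P = "\<Prod>b\<in>B - insert b B'. d b"
      have bB: "b \<in> B - B'" using insert by auto
      have "B - B' - {b} = B - insert b B'" by auto
      then have P: "(\<Prod>b\<in>B - B'. d b) = d b * ?P" using prod.remove[of "B - B'" b d] bB finB by simp
      have "?A * ?P \<in> qpolys H" by (intro qpolys_closed(6) qT qpolys_power cp_qpolys STH qpolys_prod dq)
      then have 1: "em S (?A * ?P * cp b) \<in> I" using em_I_c[OF STH(1)] bB B by auto
      have 2: "em S (?A * (d b * ?P)) \<in> I" using insert.IH insert.prems P by simp
      have "em S (?A * ?P * cp b - ?A * (d b * ?P)) \<in> I" by (rule em_I_diff[OF STH(1) 1 2])
      moreover have "?A * ?P * cp b - ?A * (d b * ?P) = ?A * cp g * ?P"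
        using cd[of b] bB by (simp add: algebra_simps)
      ultimately show ?case using insert.hyps by (simp add: ac_simps)
    qed
    from this[of B] show ?thesis by simp
  qed
  have "cp g ^ (k - card B) \<in> qpolys H" by (intro qpolys_power cp_qpolys)
  from em_I_mult[OF STH(1) less this]
  have "em S (prod qvar T * (cp g ^ card B * cp g ^ (k - card B))) \<in> I" by (simp add: ac_simps)
  then show ?thesis using B(4) by (simp add: power_add[symmetric])
qed

text \<open>Each x_g is multiplied by a formal variable t, so that the coefficients in t are the homogeneous
  components.\<close>

definition ev :: "'a \<Rightarrow> 'a qpoly poly" where
  "ev g = (if g \<in> Q then [:0, qvar g:] else if g \<in> atoms L then [:0, - sg Q g:] else 0)"

lemma sg_sum: "sg Q a = (\<Sum>h\<in>{h \<in> Q. a \<sqsubseteq> h}. sgl (sgl h 1) 1)"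
  by (simp add: sg_def qvar_def)

text \<open>The variable of an atom is replaced by variables of elements above it, and these come
  earlier in the order.\<close>

lemma lexbounded_ev: "g \<in> H \<Longrightarrow> lexbounded H r (sgl g 1) (ev g)"
proof -
  assume g: "g \<in> H"
  have c: "Polynomial.coeff [:0, c:] d = (if d = 1 then c else 0)" for c :: "'a qpoly" and d
    by (cases d) (auto simp: coeff_pCons split: nat.splits)
  show ?thesis
  proof (cases "g \<in> Q")
    case True
    then show ?thesis unfolding lexbounded_def ev_def
      by (auto simp: c qvar_def lexle_def split: if_splits)
  next
    case False
    then have ga: "g \<in> atoms L" using g by auto
    have "mdeg n = 1 \<and> lexle r n (sgl g 1) \<and> kys n \<subseteq> H" if n: "n \<in> kys (sg Q g)" for n
    proof -
      have "kys (sg Q g) \<subseteq> (\<lambda>h. sgl h 1) ` {h \<in> Q. g \<sqsubseteq> h}"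
      proof
        fix n assume "n \<in> kys (sg Q g)"
        then have "(\<Sum>h\<in>{h \<in> Q. g \<sqsubseteq> h}. lkp (sgl (sgl h (1::nat)) (1::rat)) n) \<noteq> 0"
          by (simp add: sg_sum in_keys_iff lookup_sum)
        then obtain h where "h \<in> {h \<in> Q. g \<sqsubseteq> h}" "lkp (sgl (sgl h (1::nat)) (1::rat)) n \<noteq> 0"
          by (metis (no_types, lifting) sum.neutral)
        then show "n \<in> (\<lambda>h. sgl h 1) ` {h \<in> Q. g \<sqsubseteq> h}" by (auto simp: lookup_single when_def split: if_splits)
      qed
      then obtain h where h: "n = sgl h 1" "h \<in> Q" "g \<sqsubseteq> h" using n by auto
      then have hg: "precedes r h g" using ord[of h g] g Q_atoms ga by auto
      have "lkp n w = lkp (sgl g 1) w" if "precedes r g w" for w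
        using that hg linear_order_facts(2)[OF lin] unfolding h(1) by (auto simp: lookup_single when_def precedes_def)
      then have "lexless r n (sgl g 1)" unfolding lexless_def h(1)
        using hg by (intro exI[of _ g]) (auto simp: lookup_single when_def precedes_def)
      then show ?thesis using h by (auto simp: lexle_def)
    qed
    then show ?thesis using False ga unfolding lexbounded_def ev_def by (auto simp: c split: if_splits)
  qed
qed

lemma ev_qpolys: "Polynomial.coeff (ev g) d \<in> qpolys Q"
  unfolding ev_def sg_def
  by (auto simp: coeff_pCons qpolys_closed split: nat.splits intro!: qpolys_closed(4) qpolys_sum qvar_qpolys)

lemma coeffs_qpolys_mult:
  "(\<And>d. Polynomial.coeff P d \<in> qpolys Q) \<Longrightarrow> (\<And>d. Polynomial.coeff P' d \<in> qpolys Q) \<Longrightarrow>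
    Polynomial.coeff (P * P') d \<in> qpolys Q"
  unfolding coeff_mult by (intro qpolys_sum qpolys_closed(6))

lemma pmon_ev_qpolys: "Polynomial.coeff (pmon ev m) d \<in> qpolys Q"
proof -
  have pow: "Polynomial.coeff (ev g ^ k) d \<in> qpolys Q" for g k d
    by (induction k arbitrary: d) (auto intro: qpolys_closed(1,2) coeffs_qpolys_mult ev_qpolys)
  have "Polynomial.coeff (\<Prod>g\<in>A. ev g ^ e g) d \<in> qpolys Q" if "finite A" for A d e
    using that by (induction A arbitrary: d rule: finite_induct) (auto intro: qpolys_closed(1,2) coeffs_qpolys_mult pow)
  then show ?thesis by (simp add: pmon_def)
qed

text \<open>The substitution solves the linear relations: x_a becomes the negative of the sum of the
  other variables in c_a.\<close>

lemma ev_c: "a \<in> atoms L \<Longrightarrow> qeval ev (cp a) = 0"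
proof -
  assume a: "a \<in> atoms L"
  have ac: "a \<in> carrier L" using a atoms_carrier by auto
  have "b = a" if "b \<in> atoms L" "a \<sqsubseteq> b" for b
    using atom_below[OF that(1) ac that(2)] atom_not_bot[OF a] by auto
  then have "{h \<in> H. a \<sqsubseteq> h} = insert a {h \<in> Q. a \<sqsubseteq> h}" using a ac by auto
  moreover have "a \<notin> {h \<in> Q. a \<sqsubseteq> h}" using a Q_atoms by auto
  moreover have "finite {h \<in> Q. a \<sqsubseteq> h}" using fin_sub[of "{h \<in> Q. a \<sqsubseteq> h}"] by auto
  ultimately have "qeval ev (cp a) = ev a + (\<Sum>h\<in>{h \<in> Q. a \<sqsubseteq> h}. ev h)"
    by (simp add: cp_def qeval_add qeval_sum)
  also have "(\<Sum>h\<in>{h \<in> Q. a \<sqsubseteq> h}. ev h) = (\<Sum>h\<in>{h \<in> Q. a \<sqsubseteq> h}. [:0, 1:] * [:qvar h:])"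
    by (rule sum.cong) (auto simp: ev_def)
  also have "\<dots> = [:0, sg Q a:]" unfolding sum_distrib_left[symmetric] const_poly_sum sg_def by simp
  also have "ev a = [:0, - sg Q a:]" using a Q_atoms by (auto simp: ev_def)
  finally show ?thesis by simp
qed

text \<open>Signs and powers of t go into the cofactor; what remains has the shape of the generators
  of \<open>local_ideal\<close>.\<close>

lemma ev_monomial:
  assumes "T \<subseteq> H"
  shows "\<exists>P. qeval ev (prod qvar T) = P * [:prod qvar (T \<inter> Q) * prod (sg Q) (T \<inter> atoms L):]"
proof -
  have finT: "finite T" by (rule fin_sub[OF assms])
  have "T = (T \<inter> Q) \<union> (T \<inter> atoms L)" using assms by auto
  moreover have "(T \<inter> Q) \<inter> (T \<inter> atoms L) = {}" using Q_atoms by auto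
  ultimately have "qeval ev (prod qvar T) = (\<Prod>g\<in>T \<inter> Q. ev g) * (\<Prod>g\<in>T \<inter> atoms L. ev g)"
    using finT prod.union_disjoint[of "T \<inter> Q" "T \<inter> atoms L" ev] by (simp add: qeval_prod)
  also have "(\<Prod>g\<in>T \<inter> Q. ev g) = (\<Prod>g\<in>T \<inter> Q. [:0, 1:] * [:qvar g:])"
    by (rule prod.cong) (auto simp: ev_def)
  also have "\<dots> = (\<Prod>g\<in>T \<inter> Q. [:0, 1:]) * [:prod qvar (T \<inter> Q):]"
    unfolding prod.distrib using finT by (simp add: const_poly_prod)
  also have "(\<Prod>g\<in>T \<inter> atoms L. ev g) = (\<Prod>g\<in>T \<inter> atoms L. [:0, - 1:] * [:sg Q g:])"
    by (rule prod.cong) (use Q_atoms in \<open>auto simp: ev_def\<close>)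
  also have "\<dots> = (\<Prod>g\<in>T \<inter> atoms L. [:0, - 1:]) * [:prod (sg Q) (T \<inter> atoms L):]"
    unfolding prod.distrib using finT by (simp add: const_poly_prod)
  finally have "qeval ev (prod qvar T) = ((\<Prod>g\<in>T \<inter> Q. [:0, 1:]) * (\<Prod>g\<in>T \<inter> atoms L. [:0, - 1:])) *
      ([:prod qvar (T \<inter> Q):] * [:prod (sg Q) (T \<inter> atoms L):])" by (simp only: ac_simps)
  moreover have "[:prod qvar (T \<inter> Q):] * [:prod (sg Q) (T \<inter> atoms L):] =
      [:prod qvar (T \<inter> Q) * prod (sg Q) (T \<inter> atoms L):]" by simp
  ultimately show ?thesis by metis
qed

lemma coeffs_in_const: "cideal J \<Longrightarrow> c \<in> J \<Longrightarrow> P * [:c:] \<in> coeffs_in J"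
  by (simp add: coeffs_in_def cideal_mult mult.commute[of c] cideal_multr)

lemma ev_monomial_mem:
  assumes "T \<subseteq> H" "violates Q (T \<union> N)"
  shows "qeval ev (prod qvar T) \<in> coeffs_in (local_ideal Q N)"
proof -
  have "(T \<inter> Q) \<union> (T \<inter> atoms L) = T" using assms by auto
  then have "prod qvar (T \<inter> Q) * prod (sg Q) (T \<inter> atoms L) \<in> local_ideal Q N"
    by (intro local_ideal_gen) (use assms in auto)
  then show ?thesis using ev_monomial[OF assms(1)] coeffs_in_const[OF cideal_JI] by metis
qed

end

section \<open>Standard monomials\<close>

context nested_setting
begin

lemma lat_indep_mono:
  assumes "lat_indep S" "C \<subseteq> S" shows "lat_indep C"
  unfolding lat_indep_def
proof (intro ballI notI)
  fix a assume a: "a \<in> C \<inter> atoms L" "a \<sqsubseteq> \<Squnion>(C \<inter> atoms L - {a})"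
  have c: "C \<inter> atoms L - {a} \<subseteq> carrier L" "S \<inter> atoms L - {a} \<subseteq> carrier L" "a \<in> carrier L"
    using atoms_carrier a by auto
  have "\<Squnion>(C \<inter> atoms L - {a}) \<sqsubseteq> \<Squnion>(S \<inter> atoms L - {a})" by (rule J_mono) (use assms(2) c in auto)
  then have "a \<sqsubseteq> \<Squnion>(S \<inter> atoms L - {a})"
    using le_trans[OF a(2) _ c(3) J_closed[OF c(1)] J_closed[OF c(2)]] by blast
  then show False using assms a by (auto simp: lat_indep_def)
qed

section \<open>Layers of atoms with respect to an independent set\<close>

definition up :: "'a set \<Rightarrow> 'a \<Rightarrow> 'a set" where
  "up S a = {b \<in> S. b = a \<or> precedes r a b}"

text \<open>The joins of the sets up S a form a maximal chain of flats below the join of S, and the layer of an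
  atom b is the element of S that labels the step at which b appears.\<close>

lemma layers_exist:
  assumes S: "S \<subseteq> atoms L"
  shows "\<exists>l. \<forall>b\<in>atoms L. b \<sqsubseteq> \<Squnion>S \<longrightarrow>
     l b \<in> S \<and> b \<sqsubseteq> \<Squnion>(up S (l b)) \<and> (\<forall>a\<in>S. precedes r (l b) a \<longrightarrow> \<not> b \<sqsubseteq> \<Squnion>(up S a))"
proof -
  note lo = linear_order_facts[OF lin]
  have finS: "finite S" using S fin_sub by auto
  have "\<exists>z. z \<in> S \<and> b \<sqsubseteq> \<Squnion>(up S z) \<and> (\<forall>a\<in>S. precedes r z a \<longrightarrow> \<not> b \<sqsubseteq> \<Squnion>(up S a))"
    if b: "b \<in> atoms L" "b \<sqsubseteq> \<Squnion>S" for b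
  proof -
    have Sne: "S \<noteq> {}" using b atom_not_bot J_empty by auto
    have "\<exists>m\<in>S. \<forall>x\<in>S. x \<noteq> m \<longrightarrow> precedes r m x"
      by (rule finite_strict_max[OF finS Sne]) (use S lo(1,3) in blast)+
    then obtain m where m: "m \<in> S" "\<And>x. x \<in> S \<Longrightarrow> x \<noteq> m \<Longrightarrow> precedes r m x" by blast
    have "up S m = S" using m by (auto simp: up_def)
    define Z where "Z = {a \<in> S. b \<sqsubseteq> \<Squnion>(up S a)}"
    have Z: "finite Z" "Z \<noteq> {}" using finS m \<open>up S m = S\<close> b by (auto simp: Z_def)
    have "\<exists>z\<in>Z. \<forall>x\<in>Z. x \<noteq> z \<longrightarrow> precedes r x z"
      by (rule finite_strict_max[OF Z]) (use S lo(1,3) in \<open>unfold Z_def, blast\<close>)+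
    then obtain z where z: "z \<in> Z" "\<And>x. x \<in> Z \<Longrightarrow> x \<noteq> z \<Longrightarrow> precedes r x z" by blast
    have "\<not> b \<sqsubseteq> \<Squnion>(up S a)" if "a \<in> S" "precedes r z a" for a
    proof
      assume "b \<sqsubseteq> \<Squnion>(up S a)"
      then have "a \<in> Z" using that by (simp add: Z_def)
      moreover have "a \<noteq> z" using that by (auto simp: precedes_def)
      ultimately show False using z(2) that lo(2) by blast
    qed
    then show ?thesis using z(1) by (auto simp: Z_def)
  qed
  then show ?thesis by (intro exI[of _ "\<lambda>b. SOME z. z \<in> S \<and> b \<sqsubseteq> \<Squnion>(up S z) \<and> (\<forall>a\<in>S. precedes r z a \<longrightarrow> \<not> b \<sqsubseteq> \<Squnion>(up S a))"]
    ballI impI) (rule someI_ex, blast)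
qed

text \<open>A later layer would put \<open>s\<close> below the join of the other elements of
  \<open>S\<close>.\<close>

lemma layer_self:
  assumes S: "S \<subseteq> atoms L" "lat_indep S" "s \<in> S"
    "l \<in> S" "s \<sqsubseteq> \<Squnion>(up S l)" "\<forall>a\<in>S. precedes r l a \<longrightarrow> \<not> s \<sqsubseteq> \<Squnion>(up S a)"
  shows "l = s"
proof (rule ccontr)
  assume ne: "l \<noteq> s"
  have Sc: "S \<subseteq> carrier L" using S(1) atoms_carrier by auto
  have "s \<in> up S s" "up S s \<subseteq> carrier L" using S Sc by (auto simp: up_def)
  then have ss: "s \<sqsubseteq> \<Squnion>(up S s)" using J_upper by blast
  have "precedes r s l" using linear_order_facts(3)[OF lin, of s l] ne S ss by blast
  then have "up S l \<subseteq> S - {s}" using ne linear_order_facts(2)[OF lin] by (auto simp: up_def)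
  then have 1: "\<Squnion>(up S l) \<sqsubseteq> \<Squnion>(S - {s})" by (rule J_mono) (use Sc in auto)
  have "up S l \<subseteq> carrier L" "S - {s} \<subseteq> carrier L" "s \<in> carrier L" using Sc S(3) by (auto simp: up_def)
  then have "s \<sqsubseteq> \<Squnion>(S - {s})" using le_trans[OF S(5) 1] J_closed by blast
  moreover have "S \<inter> atoms L = S" using S(1) by auto
  ultimately show False using S by (auto simp: lat_indep_def)
qed

text \<open>If the layers were distinct, let \<open>c\<close> be the element of \<open>C\<close>
  with the earliest one. The others lie below the join of the later elements of \<open>S\<close>,
  hence so does \<open>c\<close>, whose layer would have to be later.\<close>

lemma circuit_not_layered:
  assumes S: "S \<subseteq> atoms L" and C: "lat_circuit C" "C \<noteq> {}"
    and l: "\<And>b. b \<in> C \<Longrightarrow> l b \<in> S \<and> b \<sqsubseteq> \<Squnion>(up S (l b)) \<and> (\<forall>a\<in>S. precedes r (l b) a \<longrightarrow> \<not> b \<sqsubseteq> \<Squnion>(up S a))"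
  shows "\<not> inj_on l C"
proof
  assume inj: "inj_on l C"
  note lo = linear_order_facts[OF lin]
  have Cat: "C \<subseteq> atoms L" by (rule lat_circuit_atoms[OF C(1)])
  have finC: "finite C" using Cat fin_sub by auto
  have lS: "l ` C \<subseteq> S" using l by auto
  have Sc: "S \<subseteq> carrier L" using S atoms_carrier by auto
  have "\<exists>m\<in>l ` C. \<forall>x\<in>l ` C. x \<noteq> m \<longrightarrow> precedes r m x"
  proof (rule finite_strict_max)
    show "finite (l ` C)" "l ` C \<noteq> {}" using finC C(2) by auto
    show "precedes r y x \<or> precedes r x y" if "x \<in> l ` C" "y \<in> l ` C" "x \<noteq> y" for x y
      using lo(3)[of x y] that lS S by blast
    show "precedes r z x" if "precedes r y x" "precedes r z y" for x y z
      by (rule lo(1)[OF that(2,1)])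
  qed
  then obtain c where c: "c \<in> C" "\<And>d. d \<in> C \<Longrightarrow> l d \<noteq> l c \<Longrightarrow> precedes r (l c) (l d)" by blast
  define Y where "Y = {a \<in> S. precedes r (l c) a}"
  have Yc: "Y \<subseteq> carrier L" using Sc by (auto simp: Y_def)
  have cc: "c \<in> carrier L" "C - {c} \<subseteq> carrier L" using c Cat atoms_carrier by auto
  have "\<Squnion>(C - {c}) \<sqsubseteq> \<Squnion>Y"
  proof (rule J_least[OF cc(2) J_closed[OF Yc]])
    fix d assume d: "d \<in> C - {c}"
    then have "l d \<noteq> l c" using inj c(1) by (auto simp: inj_on_def)
    then have "precedes r (l c) (l d)" using c d by auto
    then have "up S (l d) \<subseteq> Y" using l[of d] d lo(1) by (auto simp: up_def Y_def)
    then have 1: "\<Squnion>(up S (l d)) \<sqsubseteq> \<Squnion>Y" using J_mono Yc by blast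
    have "up S (l d) \<subseteq> carrier L" using Sc by (auto simp: up_def)
    moreover have "d \<sqsubseteq> \<Squnion>(up S (l d))" using l[of d] d by auto
    ultimately show "d \<sqsubseteq> \<Squnion>Y" using le_trans[OF _ 1, of d] J_closed Yc d cc(2) by blast
  qed
  then have cY: "c \<sqsubseteq> \<Squnion>Y"
    using le_trans[OF lat_circuit_dep[OF C(1) c(1)]] cc J_closed[OF cc(2)] J_closed[OF Yc] by blast
  show False
  proof (cases "Y = {}")
    case True
    then show False using cY J_empty atom_not_bot c Cat by auto
  next
    case False
    have "\<exists>m\<in>Y. \<forall>x\<in>Y. x \<noteq> m \<longrightarrow> precedes r m x"
    proof (rule finite_strict_max[OF _ False])
      show "finite Y" using S fin_sub[of Y] by (auto simp: Y_def)
      show "\<And>x y. x \<in> Y \<Longrightarrow> y \<in> Y \<Longrightarrow> x \<noteq> y \<Longrightarrow> precedes r y x \<or> precedes r x y"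
        using lo(3) S unfolding Y_def by blast
      show "\<And>x y z. x \<in> Y \<Longrightarrow> y \<in> Y \<Longrightarrow> z \<in> Y \<Longrightarrow> precedes r y x \<Longrightarrow> precedes r z y \<Longrightarrow> precedes r z x"
        using lo(1) by blast
    qed
    then obtain m where m: "m \<in> Y" "\<And>x. x \<in> Y \<Longrightarrow> x \<noteq> m \<Longrightarrow> precedes r m x" by blast
    have "Y \<subseteq> up S m" using m by (auto simp: up_def Y_def)
    moreover have "up S m \<subseteq> carrier L" using Sc by (auto simp: up_def)
    ultimately have "\<Squnion>Y \<sqsubseteq> \<Squnion>(up S m)" and uc: "up S m \<subseteq> carrier L" using J_mono by blast+
    then have "c \<sqsubseteq> \<Squnion>(up S m)" using le_trans[OF cY] cc J_closed[OF Yc] J_closed[OF uc] by blast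
    moreover have "m \<in> S" "precedes r (l c) m" using m by (auto simp: Y_def)
    ultimately show False using l[OF c(1)] by blast
  qed
qed

lemma lead_cp: "g \<in> H \<Longrightarrow> lead H r (sgl g 1) (cp g)"
proof -
  assume g: "g \<in> H"
  let ?rest = "\<Sum>h\<in>{h \<in> H. g \<sqsubseteq> h} - {g}. qvar h"
  have "cp g = qvar g + ?rest" unfolding cp_def
    by (rule sum.remove) (use fin_H g H_car in auto)
  then have cp: "cp g = sgl (sgl g 1) 1 + ?rest" by (simp add: qvar_def)
  have "mdeg n = mdeg (sgl g 1) \<and> lexless r n (sgl g 1) \<and> kys n \<subseteq> H" if n: "n \<in> kys ?rest" for n
  proof -
    have "(\<Sum>h\<in>{h \<in> H. g \<sqsubseteq> h} - {g}. lkp (qvar h) n) \<noteq> 0" using n by (simp add: in_keys_iff lookup_sum)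
    then obtain h where h: "h \<in> {h \<in> H. g \<sqsubseteq> h} - {g}" "lkp (qvar h) n \<noteq> 0"
      by (metis (no_types, lifting) sum.neutral)
    have nh: "n = sgl h 1" using h(2) by (simp add: qvar_def lookup_single when_def split: if_splits)
    have hg: "precedes r h g" using ord[of h g] h g by auto
    have "lkp n w = lkp (sgl g 1) w" if "precedes r g w" for w
      using that hg linear_order_facts(2)[OF lin] unfolding nh by (auto simp: lookup_single when_def precedes_def)
    then have "lexless r n (sgl g 1)" unfolding lexless_def nh
      using h by (intro exI[of _ g]) (auto simp: lookup_single when_def)
    then show ?thesis using h nh by auto
  qed
  then show ?thesis unfolding lead_def cp using g by (intro conjI exI[of _ ?rest]) auto
qed

lemma lead_power_relation:
  assumes "T \<subseteq> H" "g \<in> H"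
  shows "lead H r (ind T + sgl g k) (prod qvar T * cp g ^ k)"
proof (rule lead_mult[OF lin])
  show "lead H r (ind T) (prod qvar T)"
    using lead_monomial[of "ind T" H r] assms(1) fin_sub[OF assms(1)] by (simp add: prod_qvar kys_ind)
  show "lead H r (sgl g k) (cp g ^ k)" by (rule lead_power[OF lin lead_cp[OF assms(2)]])
qed

abbreviation "GB \<equiv> nonnested_monomials L H r \<union> circuit_boundaries L H r ps \<union> power_relations L H r"

lemma prod_sign:
  fixes h :: "'c \<Rightarrow> 'b qpoly poly"
  assumes "\<And>a. h a \<in> {1, - 1}"
  shows "prod h A \<in> {1, - 1}"
proof (induction A rule: infinite_finite_induct)
  case (insert x A)
  then show ?case using assms[of x] by auto
qed auto

lemma lsign_cases: "(lsign r l A :: 'b qpoly poly) \<in> {1, - 1}"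
  unfolding lsign_def by (intro prod_sign) (simp add: inv_sign_def sgn1_def)

section \<open>An element of the ideal with a standard initial monomial\<close>

context
  fixes f :: "'a gca" and S0 :: "'a set" and m :: "'a \<Rightarrow>\<^sub>0 nat"
  assumes fI: "f \<in> I" and f0: "f \<noteq> \<zero>\<^bsub>R\<^esub>" and init: "initial_monomial r f = (S0, m)"
    and std: "\<And>b. b \<in> GB \<Longrightarrow> b \<noteq> \<zero>\<^bsub>R\<^esub> \<Longrightarrow> \<not> monomial_dvd (initial_monomial r b) (S0, m)"
begin

lemma f_car: "f \<in> carrier R"
  using ideal.Icarr[OF I_ideal fI] .

lemma f_init: "(S0, m) \<in> gca_monomials f" "S0 \<subseteq> H" "kys m \<subseteq> H"
  "\<And>A n. (A, n) \<in> gca_monomials f \<Longrightarrow> A \<subseteq> H \<and> kys n \<subseteq> H \<and> ((A, n) \<noteq> (S0, m) \<longrightarrow> deglex_less r (A, n) (S0, m))"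
proof -
  have *: "(S0, m) \<in> gca_monomials f \<and> mon_ok H (S0, m) \<and>
    (\<forall>N\<in>gca_monomials f. mon_ok H N \<and> (N \<noteq> (S0, m) \<longrightarrow> deglex_less r N (S0, m)))"
    using initial_monomial_exists[OF lin fin_H f_car f0] unfolding init .
  then show "(S0, m) \<in> gca_monomials f" "S0 \<subseteq> H" "kys m \<subseteq> H" by (simp_all add: mon_ok_def)
  fix A n assume "(A, n) \<in> gca_monomials f"
  then have "mon_ok H (A, n) \<and> ((A, n) \<noteq> (S0, m) \<longrightarrow> deglex_less r (A, n) (S0, m))" using * by blast
  then show "A \<subseteq> H \<and> kys n \<subseteq> H \<and> ((A, n) \<noteq> (S0, m) \<longrightarrow> deglex_less r (A, n) (S0, m))"
    by (simp add: mon_ok_def)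
qed

lemma S0m_car: "S0 \<union> kys m \<subseteq> carrier L"
  using f_init(2,3) H_car by blast

lemma std_nested: "\<not> violates Q (S0 \<union> kys m)"
proof
  assume v: "violates Q (S0 \<union> kys m)"
  have "em S0 (prod qvar (kys m)) \<in> GB" unfolding nonnested_eq using v f_init by blast
  moreover have ld: "lead H r (ind (kys m)) (prod qvar (kys m))"
    using lead_monomial[of "ind (kys m)" H r] f_init by (simp add: prod_qvar kys_ind)
  moreover have "monomial_dvd (S0, ind (kys m)) (S0, m)"
    by (rule monomial_dvdI) (auto simp: lkp_ind in_keys_iff)
  ultimately show False using std initial_em[OF lin ld f_init(2)] by metis
qed

lemma std_circuit:
  assumes "lat_circuit C" "\<not> violates Q C" "b \<in> C" "\<And>g. g \<in> C \<Longrightarrow> g \<noteq> b \<Longrightarrow> precedes r b g" "C - {b} \<subseteq> S0"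
  shows False
proof -
  have C: "C \<subseteq> atoms L" by (rule lat_circuit_atoms[OF assms(1)])
  have "gca_boundary r C \<in> GB" unfolding circuits_eq using assms C by blast
  moreover have "monomial_dvd (C - {b}, 0) (S0, m)" by (rule monomial_dvdI) (use assms in auto)
  moreover have "C \<subseteq> H" "finite C" using C fin_sub by auto
  ultimately show False
    using std gca_boundary_initial[OF lin \<open>finite C\<close> \<open>C \<subseteq> H\<close> assms(3,4)] by metis
qed

text \<open>Because \<open>g\<close> is not in \<open>T'\<close>, the exponents coming from
  \<open>ind T'\<close> and from the power of x_g do not add up.\<close>

lemma std_power:
  assumes "S' \<subseteq> S0" "T' \<subseteq> kys m" "S' \<inter> T' = {}" "antichain_in L (S' \<union> T')" "g \<in> H" "g \<notin> T'"
    "\<Squnion>(S' \<union> T') \<sqsubset> g" "interval_rank L (\<Squnion>(S' \<union> T')) g \<le> lkp m g"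
  shows False
proof -
  let ?k = "interval_rank L (\<Squnion>(S' \<union> T')) g"
  have sub: "S' \<subseteq> H" "T' \<subseteq> H" "S' \<union> T' \<subseteq> S0 \<union> kys m"
    using assms(1,2) f_init(2,3) by blast+
  have "\<not> violates Q (S' \<union> T')"
  proof
    assume "violates Q (S' \<union> T')"
    then have "violates Q (S0 \<union> kys m)" by (rule violates_mono[OF _ subset_refl sub(3) S0m_car Q_car])
    then show False using std_nested by simp
  qed
  then have "nested L H (S' \<union> T')" using nested_viol[of "S' \<union> T'"] sub by simp
  then have "em S' (prod qvar T' * cp g ^ ?k) \<in> GB" unfolding power_eq using assms by blast
  moreover note ld = lead_power_relation[OF sub(2) assms(5), of ?k]
  have fT: "finite T'" using sub fin_sub by auto
  have "monomial_dvd (S', ind T' + sgl g ?k) (S0, m)"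
  proof (rule monomial_dvdI[OF assms(1)])
    fix h
    show "lkp (ind T' + sgl g ?k) h \<le> lkp m h"
    proof (cases "h \<in> T'")
      case True
      then have "h \<noteq> g" "lkp m h \<noteq> 0" using assms by (auto simp: in_keys_iff)
      then show ?thesis using True fT by (simp add: lookup_add lkp_ind lookup_single when_def)
    next
      case False
      then show ?thesis using assms(8) fT
        by (cases "h = g") (simp_all add: lookup_add lkp_ind lookup_single when_def)
    qed
  qed
  ultimately show False using std initial_em[OF lin ld sub(1)] by metis
qed

lemma kys_Q: "kys m \<subseteq> Q"
proof (rule ccontr)
  assume "\<not> ?thesis"
  then obtain a where "a \<in> kys m" "a \<notin> Q" by blast
  then have a: "a \<in> kys m" "a \<in> atoms L" using f_init(3) by blast+
  have "interval_rank L (\<Squnion>({} \<union> {})) a \<le> lkp m a"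
    using atom_rank[OF a(2)] a(1) by (simp add: J_empty in_keys_iff)
  moreover have "\<Squnion>({} \<union> {}) \<sqsubset> a"
    using a atoms_carrier atom_not_bot[OF a(2)] by (auto simp: J_empty lless_def eq_is_equal)
  ultimately show False using std_power[of "{}" "{}" a] a by (auto simp: antichain_in_def)
qed

definition "S1 = S0 \<inter> atoms L"
definition "T1 = S0 \<inter> Q"
definition "x1 = \<Squnion>S1"
text \<open>The indices whose e_b is not sent to zero: the flat spanned by \<open>S1\<close> and the
  coloops in \<open>S0\<close>.\<close>

definition "K1 = {a \<in> atoms L. a \<sqsubseteq> x1} \<union> T1"

lemma S1_sub: "S1 \<subseteq> atoms L" "S1 \<subseteq> carrier L" "S1 \<subseteq> S0" "S0 = S1 \<union> T1" "S1 \<inter> T1 = {}"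
  using f_init(2) atoms_carrier Q_atoms by (auto simp: S1_def T1_def)

lemma x1_car: "x1 \<in> carrier L"
  unfolding x1_def by (rule J_closed[OF S1_sub(2)])

lemma K1_sub: "K1 \<subseteq> H" "S0 \<subseteq> K1" "finite K1"
proof -
  show "K1 \<subseteq> H" by (auto simp: K1_def T1_def)
  then show "finite K1" by (rule fin_sub)
  show "S0 \<subseteq> K1"
  proof
    fix s assume "s \<in> S0"
    then have "s \<in> S1 \<or> s \<in> T1" using S1_sub(4) by blast
    then show "s \<in> K1" using S1_sub(1) J_upper[OF S1_sub(2), of s] by (auto simp: K1_def x1_def)
  qed
qed

text \<open>Such atoms can be replaced by \<open>S1\<close>, which is nested as part of the standard
  monomial. So circuits in the flat below \<open>x1\<close> do belong to the relations (ii).\<close>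

lemma below_x1_nested: "C \<subseteq> atoms L \<Longrightarrow> (\<And>c. c \<in> C \<Longrightarrow> c \<sqsubseteq> x1) \<Longrightarrow> \<not> violates Q C"
proof
  assume C: "C \<subseteq> atoms L" "\<And>c. c \<in> C \<Longrightarrow> c \<sqsubseteq> x1" and v: "violates Q C"
  have "C \<subseteq> carrier L" using C(1) atoms_carrier by auto
  from J_least[OF this x1_car C(2)] have 1: "\<Squnion>C \<sqsubseteq> \<Squnion>S1" by (simp add: x1_def)
  have "violates Q (S1 \<union> {})" by (rule violates_atoms[OF Q C(1) S1_sub(1) _ 1]) (use v in auto)
  then have "violates Q (S0 \<union> kys m)"
    by (rule violates_mono[OF _ subset_refl _ S0m_car Q_car]) (use S1_sub(3) in blast)
  then show False using std_nested by simp
qed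

text \<open>A circuit inside \<open>S1\<close> contains its own broken circuit, which a standard
  monomial excludes.\<close>

lemma S1_lind: "lat_indep S1"
proof (rule ccontr)
  assume "\<not> lat_indep S1"
  then obtain C where C: "C \<subseteq> S1" "lat_circuit C" using dep_contains_circuit[OF S1_sub(1)] by blast
  have Cne: "C \<noteq> {}" using C(2) by (auto simp: lat_circuit_def lat_indep_def)
  have CH: "C \<subseteq> H" "finite C" using C S1_sub fin_sub[of C] by auto
  have "\<exists>b\<in>C. \<forall>x\<in>C. x \<noteq> b \<longrightarrow> precedes r b x"
    by (rule finite_strict_max[OF CH(2) Cne]) (use linear_order_facts(1,3)[OF lin] CH(1) in blast)+
  then obtain b where b: "b \<in> C" "\<And>x. x \<in> C \<Longrightarrow> x \<noteq> b \<Longrightarrow> precedes r b x" by blast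
  have "\<not> violates Q C" by (rule below_x1_nested) (use C S1_sub J_upper[OF S1_sub(2)] in \<open>auto simp: x1_def\<close>)
  then show False using std_circuit[OF C(2) _ b] C S1_sub by blast
qed

lemma layering:
  "\<exists>l. (\<forall>b\<in>atoms L. b \<sqsubseteq> x1 \<longrightarrow>
     l b \<in> S1 \<and> b \<sqsubseteq> \<Squnion>(up S1 (l b)) \<and> (\<forall>a\<in>S1. precedes r (l b) a \<longrightarrow> \<not> b \<sqsubseteq> \<Squnion>(up S1 a))) \<and>
     (\<forall>b\<in>Q. l b = b)"
proof -
  obtain l where l: "\<forall>b\<in>atoms L. b \<sqsubseteq> \<Squnion>S1 \<longrightarrow>
     l b \<in> S1 \<and> b \<sqsubseteq> \<Squnion>(up S1 (l b)) \<and> (\<forall>a\<in>S1. precedes r (l b) a \<longrightarrow> \<not> b \<sqsubseteq> \<Squnion>(up S1 a))"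
    using layers_exist[OF S1_sub(1)] by blast
  define l' where "l' b = (if b \<in> Q then b else l b)" for b
  have "l' b = l b" if "b \<in> atoms L" for b using that Q_atoms by (auto simp: l'_def)
  then have "\<forall>b\<in>atoms L. b \<sqsubseteq> x1 \<longrightarrow>
     l' b \<in> S1 \<and> b \<sqsubseteq> \<Squnion>(up S1 (l' b)) \<and> (\<forall>a\<in>S1. precedes r (l' b) a \<longrightarrow> \<not> b \<sqsubseteq> \<Squnion>(up S1 a))"
    using l by (simp add: x1_def)
  moreover have "\<forall>b\<in>Q. l' b = b" by (simp add: l'_def)
  ultimately show ?thesis by blast
qed

text \<open>Otherwise b followed by the elements of S1 from its layer on contains a broken circuit.\<close>

lemma layer_below:
  assumes "b \<in> atoms L" "b \<sqsubseteq> x1" "z \<in> S1" "b \<sqsubseteq> \<Squnion>(up S1 z)" "b \<noteq> z"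
  shows "precedes r z b"
proof (rule ccontr)
  assume "\<not> precedes r z b"
  then have bz: "precedes r b z" using linear_order_facts(3)[OF lin, of b z] assms S1_sub by auto
  let ?U = "up S1 z"
  have U: "?U \<subseteq> S1" "?U \<subseteq> carrier L" "?U \<subseteq> atoms L" using S1_sub by (auto simp: up_def)
  have bU: "precedes r b u" if "u \<in> ?U" for u
    using that bz linear_order_facts(1)[OF lin, of b z u] by (auto simp: up_def)
  have nb: "b \<notin> ?U" using bU[of b] by (auto simp: precedes_def)
  have "insert b ?U \<inter> atoms L - {b} = ?U" using U nb by auto
  then have "\<not> lat_indep (insert b ?U)" using assms(1,4) by (auto simp: lat_indep_def)
  then obtain C where C: "C \<subseteq> insert b ?U" "lat_circuit C"
    using dep_contains_circuit[of "insert b ?U"] assms(1) U by auto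
  have bC: "b \<in> C"
  proof (rule ccontr)
    assume "b \<notin> C"
    then have "C \<subseteq> S1" using C U by auto
    then show False using lat_indep_mono[OF S1_lind] C(2) by (simp add: lat_circuit_def)
  qed
  have "c \<sqsubseteq> x1" if "c \<in> C" for c
    using that C(1) U(1) assms(2) J_upper[OF S1_sub(2)] by (auto simp: x1_def)
  then have "\<not> violates Q C" using below_x1_nested lat_circuit_atoms[OF C(2)] by blast
  then show False using std_circuit[OF C(2) _ bC] C(1) bU U S1_sub(3) by blast
qed

lemma contradiction: False
proof -
  obtain l where "(\<forall>b\<in>atoms L. b \<sqsubseteq> x1 \<longrightarrow>
     l b \<in> S1 \<and> b \<sqsubseteq> \<Squnion>(up S1 (l b)) \<and> (\<forall>a\<in>S1. precedes r (l b) a \<longrightarrow> \<not> b \<sqsubseteq> \<Squnion>(up S1 a))) \<and>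
     (\<forall>b\<in>Q. l b = b)"
    using layering by blast
  then have l: "\<And>b. b \<in> atoms L \<Longrightarrow> b \<sqsubseteq> x1 \<Longrightarrow>
     l b \<in> S1 \<and> b \<sqsubseteq> \<Squnion>(up S1 (l b)) \<and> (\<forall>a\<in>S1. precedes r (l b) a \<longrightarrow> \<not> b \<sqsubseteq> \<Squnion>(up S1 a))"
    and lQ: "\<And>b. b \<in> Q \<Longrightarrow> l b = b" by blast+
  have lK: "l b \<in> S0" if "b \<in> K1" for b
    using that l[of b] lQ[of b] S1_sub by (auto simp: K1_def T1_def)
  have lKH: "l ` K1 \<subseteq> H" using lK f_init(2) by blast
  have lS: "l s = s" if "s \<in> S0" for s
  proof (cases "s \<in> Q")
    case False
    then have "s \<in> S1" using that S1_sub by (auto simp: T1_def)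
    moreover have "s \<sqsubseteq> x1" unfolding x1_def using J_upper[OF S1_sub(2)] \<open>s \<in> S1\<close> by auto
    ultimately show ?thesis using layer_self[OF S1_sub(1) S1_lind, of s "l s"] l[of s] S1_sub(1) by blast
  qed (rule lQ)
  have lbelow: "precedes r (l b) b" if "b \<in> K1" "l b \<noteq> b" for b
    using that l[of b] lQ[of b] layer_below[of b "l b"] by (auto simp: K1_def T1_def)
  let ?J = "coeffs_in (local_ideal Q S0)"
  have J: "cideal ?J" by (rule cideal_coeffs_in[OF cideal_JI])
  let ?I = "{f \<in> carrier R. \<forall>D. Phi r K1 l ev D f \<in> ?J}"
  have idI: "ideal ?I R" by (rule ideal_Phi[OF lin fin_H K1_sub(1) lKH J])
  have XI: "X \<subseteq> ?I"
  proof
    fix h assume hX: "h \<in> X"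
    then have hc: "h \<in> carrier R" using X_carrier by auto
    have "Phi r K1 l ev D h \<in> ?J" for D
    proof -
      from hX consider A T where "A \<subseteq> H" "T \<subseteq> H" "violates Q (A \<union> T)" "h = em A (prod qvar T)"
        | C where "C \<subseteq> atoms L" "lat_circuit C" "h = gca_boundary r C"
        | a where "a \<in> atoms L" "h = em {} (cp a)"
        unfolding X_def nonnested_eq circuits_eq gca_c_em by blast
      then show ?thesis
      proof cases
        case 1
        show ?thesis
        proof (cases "A \<in> transversals K1 l D")
          case True
          then have AK: "A \<subseteq> K1" by (simp add: transversals_def)
          let ?B = "{a \<in> atoms L. a \<sqsubseteq> x1}"
          have Bc: "?B \<subseteq> carrier L" using atoms_carrier by auto
          have R: "T1 \<union> T \<subseteq> carrier L" using 1(2) H_car by (auto simp: T1_def)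
          \<comment> \<open>A surviving \<open>A\<close> consists of atoms below \<open>x1\<close>
            and elements of \<open>T1\<close>; the former may be exchanged for \<open>S1\<close>,
            which turns the violation into one for \<open>T \<union> S0\<close>.\<close>
          have "violates Q (?B \<union> (T1 \<union> T))"
            by (rule violates_mono[OF 1(3)]) (use AK R Bc Q_car in \<open>auto simp: K1_def\<close>)
          moreover have "\<Squnion>?B \<sqsubseteq> \<Squnion>S1" using J_least[OF Bc x1_car] by (auto simp: x1_def)
          ultimately have "violates Q (S1 \<union> (T1 \<union> T))"
            using violates_atoms[OF Q _ S1_sub(1) R, of ?B] by blast
          moreover have "S1 \<union> (T1 \<union> T) = T \<union> S0" using S1_sub by auto
          ultimately have "violates Q (T \<union> S0)" by simp
          then have "qeval ev (prod qvar T) \<in> ?J" by (rule ev_monomial_mem[OF 1(2)])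
          then show ?thesis unfolding 1(4) Phi_em[OF K1_sub(3)] using cideal_mult[OF J] cideal_0[OF J] by simp
        next
          case False
          then show ?thesis unfolding 1(4) Phi_em[OF K1_sub(3)] using cideal_0[OF J] by simp
        qed
      next
        case 2
        have CH: "C \<subseteq> H" "finite C" using 2 fin_sub[of C] by auto
        have "Phi r K1 l ev D (gca_boundary r C) = 0"
        proof (rule Phi_boundary[OF lin K1_sub(3) CH lKH])
          \<comment> \<open>The atoms below \<open>x1\<close> form a flat, so a circuit with all but
            one element there lies there completely.\<close>
          show "C \<subseteq> K1" if g: "g \<in> C" "C - {g} \<subseteq> K1" for g
          proof -
            have cc: "C - {g} \<subseteq> carrier L" "g \<in> carrier L" using 2 g atoms_carrier by auto
            have "c \<sqsubseteq> x1" if "c \<in> C - {g}" for c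
              using that g(2) 2(1) Q_atoms by (auto simp: K1_def T1_def)
            then have "\<Squnion>(C - {g}) \<sqsubseteq> x1" by (rule J_least[OF cc(1) x1_car])
            then have "g \<sqsubseteq> x1"
              using le_trans[OF lat_circuit_dep[OF 2(2) g(1)] _ cc(2) J_closed[OF cc(1)] x1_car] by blast
            then show ?thesis using g 2(1) by (auto simp: K1_def)
          qed
          show "\<not> inj_on l C" if "C \<subseteq> K1"
          proof (rule circuit_not_layered[OF S1_sub(1) 2(2)])
            show "C \<noteq> {}" using 2(2) by (auto simp: lat_circuit_def lat_indep_def)
            fix b assume "b \<in> C"
            then have "b \<in> atoms L" "b \<sqsubseteq> x1" using that 2(1) Q_atoms by (auto simp: K1_def T1_def)
            then show "l b \<in> S1 \<and> b \<sqsubseteq> \<Squnion>(up S1 (l b)) \<and> (\<forall>a\<in>S1. precedes r (l b) a \<longrightarrow> \<not> b \<sqsubseteq> \<Squnion>(up S1 a))"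
              by (rule l)
          qed
        qed
        then show ?thesis using 2 cideal_0[OF J] by simp
      next
        case 3
        then show ?thesis using ev_c[OF 3(1)] cideal_0[OF J] by (simp add: Phi_em[OF K1_sub(3)])
      qed
    qed
    then show "h \<in> ?I" using hc by simp
  qed
  have "f \<in> ?I" using I_least[OF idI XI] fI by blast
  then have PJ: "Phi r K1 l ev S0 f \<in> ?J" by simp
  \<comment> \<open>\<open>f\<close> may mix several degrees, so the part of x-degree
    \<open>mdeg m\<close> is isolated as a coefficient in t.\<close>
  define F where "F = Polynomial.coeff (qeval ev (f S0)) (mdeg m)"
  let ?T = "transversals K1 l S0"
  have S0T: "S0 \<in> ?T"
    unfolding transversals_def bij_betw_def using K1_sub(2) lS by (auto simp: inj_on_def)
  have ls1: "lsign r l S0 = (1 :: 'a qpoly poly)"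
  proof -
    have "inv_sign r l a b = (1 :: 'a qpoly poly)" if "a \<in> S0" "b \<in> S0" for a b
      using linear_order_facts(2)[OF lin] lS that by (auto simp: inv_sign_def sgn1_def)
    then show ?thesis by (simp add: lsign_def)
  qed
  have coeff_cst: "Polynomial.coeff (cst c * P') d = sgl 0 c * Polynomial.coeff P' d" for c and P' :: "'a qpoly poly" and d
    by (simp add: cst_def)
  have lb: "lexbounded H r n (pmon ev n)" if "kys n \<subseteq> H" for n
    by (rule lexbounded_pmon[OF lin lexbounded_ev that])
  \<comment> \<open>A transversal \<open>A\<close> other than \<open>S0\<close> is larger than
    \<open>S0\<close> in the order. A monomial of degree \<open>mdeg m\<close> in its coefficient
    would therefore exceed the initial monomial of \<open>f\<close>.\<close>
  have other: "Polynomial.coeff (lsign r l A * qeval ev (f A)) (mdeg m) = 0" if A: "A \<in> ?T" "A \<noteq> S0" for A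
  proof -
    have AK: "A \<subseteq> K1" "bij_betw l A S0" using A by (auto simp: transversals_def)
    have AH: "A \<subseteq> H" "finite A" using AK K1_sub fin_sub[of A] by auto
    have cardA: "card A = card S0" using AK(2) by (rule bij_betw_same_card)
    define X where "X = (A - S0) \<union> (S0 - A)"
    have X: "finite X" "X \<noteq> {}" "X \<subseteq> H" using AH f_init(2) fin_sub[OF f_init(2)] A(2) by (auto simp: X_def)
    have "\<exists>v\<in>X. \<forall>x\<in>X. x \<noteq> v \<longrightarrow> precedes r x v"
      by (rule finite_strict_max[OF X(1,2)]) (use linear_order_facts(1,3)[OF lin] X(3) in blast)+
    then obtain v where v: "v \<in> X" "\<And>x. x \<in> X \<Longrightarrow> x \<noteq> v \<Longrightarrow> precedes r x v" by blast
    have above: "w \<in> A \<longleftrightarrow> w \<in> S0" if "precedes r v w" for w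
    proof (rule ccontr)
      assume "\<not> ?thesis"
      then have "w \<in> X" by (auto simp: X_def)
      then show False using v(2)[of w] that linear_order_facts(2)[OF lin] by (metis precedes_irrefl)
    qed
    have vA: "v \<in> A" "v \<notin> S0"
    proof -
      \<comment> \<open>Otherwise the element of \<open>A\<close> mapped to \<open>v\<close> would
        come after \<open>v\<close>, where \<open>A\<close> and \<open>S0\<close> agree. It would
        then belong to \<open>S0\<close>, on which \<open>l\<close> is the identity.\<close>
      have "v \<notin> S0 - A"
      proof
        assume vS: "v \<in> S0 - A"
        then obtain b where b: "b \<in> A" "l b = v" using AK(2) unfolding bij_betw_def by blast
        have "b \<noteq> v" using b(1) vS by auto
        then have "precedes r v b" using lbelow[of b] AK(1) b by auto
        then have "b \<in> S0" using above b by blast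
        then show False using lS b vS by auto
      qed
      then show "v \<in> A" "v \<notin> S0" using v(1) by (auto simp: X_def)
    qed
    have small: "mdeg n \<noteq> mdeg m" if n: "n \<in> kys (f A)" for n
    proof
      assume eq: "mdeg n = mdeg m"
      have mon: "(A, n) \<in> gca_monomials f" using n by (simp add: gca_monomials_def in_keys_iff)
      then have 1: "deglex_less r (A, n) (S0, m)" using f_init(4) A(2) by blast
      have "var_exponent (S0, m) w = var_exponent (A, n) w" if "var_precedes r (EVar v) w" for w
        using that above by (cases w) auto
      then have "deglex_less r (S0, m) (A, n)"
        unfolding deglex_less_def monomial_degree_eq using cardA eq vA
        by (intro disjI2 conjI exI[of _ "EVar v"]) auto
      then show False using 1 deglex_asym[OF lin, of "(A, n)" "(S0, m)"] f_init(2,3) f_init(4)[OF mon]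
        by (auto simp: mon_ok_def)
    qed
    have "Polynomial.coeff (cst (lkp (f A) n) * pmon ev n) (mdeg m) = 0" if n: "n \<in> kys (f A)" for n
    proof -
      have "(A, n) \<in> gca_monomials f" using n by (simp add: gca_monomials_def in_keys_iff)
      then have "kys n \<subseteq> H" using f_init(4) by blast
      then have "kys (Polynomial.coeff (pmon ev n) (mdeg m)) = {}"
        using lb[of n] small[OF n] unfolding lexbounded_def by fastforce
      then show ?thesis by (simp add: coeff_cst)
    qed
    then have "Polynomial.coeff (qeval ev (f A)) (mdeg m) = 0" by (simp add: qeval_def coeff_sum)
    moreover have "lsign r l A = (1 :: 'a qpoly poly) \<or> lsign r l A = (- 1 :: 'a qpoly poly)"
      using lsign_cases by blast
    ultimately show ?thesis by (elim disjE) simp_all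
  qed
  have "Polynomial.coeff (Phi r K1 l ev S0 f) (mdeg m) =
      (\<Sum>A\<in>?T. Polynomial.coeff (lsign r l A * qeval ev (f A)) (mdeg m))"
    by (simp add: Phi_def coeff_sum)
  also have "\<dots> = (\<Sum>A\<in>{S0}. Polynomial.coeff (lsign r l A * qeval ev (f A)) (mdeg m))"
    by (rule sum.mono_neutral_right) (use finite_transversals[OF K1_sub(3)] S0T other in auto)
  also have "\<dots> = F" by (simp add: ls1 F_def)
  finally have PF: "Polynomial.coeff (Phi r K1 l ev S0 f) (mdeg m) = F" .
  have "Polynomial.coeff (Phi r K1 l ev S0 f) (mdeg m) \<in> local_ideal Q S0"
    using PJ by (simp add: coeffs_in_def)
  then have FJ: "F \<in> local_ideal Q S0" unfolding PF .
  have Feq: "F = (\<Sum>n\<in>kys (f S0). sgl 0 (lkp (f S0) n) * Polynomial.coeff (pmon ev n) (mdeg m))"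
    by (simp add: F_def qeval_def coeff_sum coeff_cst)
  have Slex: "n = m \<or> lexless r n m" "kys n \<subseteq> H" if n: "n \<in> kys (f S0)" "mdeg n = mdeg m" for n
  proof -
    have mon: "(S0, n) \<in> gca_monomials f" using n by (simp add: gca_monomials_def in_keys_iff)
    show "kys n \<subseteq> H" using f_init(4)[OF mon] by simp
    have "n \<noteq> m \<longrightarrow> deglex_less r (S0, n) (S0, m)" using f_init(4)[OF mon] by simp
    then show "n = m \<or> lexless r n m" using deglex_same_set n(2) by metis
  qed
  \<comment> \<open>The substitution does not raise exponent vectors, so nothing above
    \<open>m\<close> appears and only the term of \<open>m\<close> itself can produce
    \<open>m\<close>.\<close>
  have part: "n' = m \<or> lexless r n' m" "n' = m \<Longrightarrow> n = m"
    if n: "n \<in> kys (f S0)" "n' \<in> kys (sgl 0 (lkp (f S0) n) * Polynomial.coeff (pmon ev n) (mdeg m))" for n n'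
  proof -
    have "n' \<in> kys (Polynomial.coeff (pmon ev n) (mdeg m))"
      using n(2) keys_mult[of "sgl 0 (lkp (f S0) n)" "Polynomial.coeff (pmon ev n) (mdeg m)"]
      by (auto split: if_splits)
    moreover have nH: "kys n \<subseteq> H" using f_init(4)[of S0 n] n(1) by (auto simp: gca_monomials_def in_keys_iff)
    ultimately have a: "mdeg m = mdeg n" "lexle r n' n" using lb unfolding lexbounded_def by blast+
    have mn: "n = m \<or> lexless r n m" using Slex[OF n(1)] a by simp
    show 1: "n' = m \<or> lexless r n' m"
      using a(2) mn lexless_trans[OF lin nH f_init(3)] by (auto simp: lexle_def)
    show "n = m" if "n' = m"
    proof (rule ccontr)
      assume "n \<noteq> m"
      then have "lexless r n m" "lexless r m n" using mn a(2) that by (auto simp: lexle_def)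
      then show False using lexless_trans[OF lin nH f_init(3)] lexless_trans[OF lin f_init(3) nH] lexless_irrefl by blast
    qed
  qed
  have fm: "lkp (f S0) m \<noteq> 0" using f_init(1) by (simp add: gca_monomials_def)
  \<comment> \<open>Since \<open>m\<close> involves no variables of atoms, the substitution
    reproduces it up to the power of t.\<close>
  have evm: "pmon ev m = Polynomial.monom (sgl m 1) (mdeg m)"
  proof -
    have "pmon ev m = pmon (\<lambda>h. [:0, qvar h:]) m"
      unfolding pmon_def by (rule prod.cong) (use kys_Q in \<open>auto simp: ev_def\<close>)
    then show ?thesis by (simp add: pmon_degree_var)
  qed
  have "lkp F m = (\<Sum>n\<in>kys (f S0). lkp (sgl 0 (lkp (f S0) n) * Polynomial.coeff (pmon ev n) (mdeg m)) m)"
    by (simp add: Feq lookup_sum)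
  also have "\<dots> = (\<Sum>n\<in>{m}. lkp (sgl 0 (lkp (f S0) n) * Polynomial.coeff (pmon ev n) (mdeg m)) m)"
  proof (rule sum.mono_neutral_right)
    show "{m} \<subseteq> kys (f S0)" using fm by (simp add: in_keys_iff)
    show "\<forall>n\<in>kys (f S0) - {m}. lkp (sgl 0 (lkp (f S0) n) * Polynomial.coeff (pmon ev n) (mdeg m)) m = 0"
      using part(2) by (auto simp: in_keys_iff)
  qed simp
  also have "\<dots> = lkp (f S0) m" by (simp add: evm mult_single)
  finally have mF: "m \<in> kys F" using fm by (simp add: in_keys_iff)
  have Fmem: "n' = m \<or> lexless r n' m" if "n' \<in> kys F" for n'
  proof -
    have "(\<Sum>n\<in>kys (f S0). lkp (sgl 0 (lkp (f S0) n) * Polynomial.coeff (pmon ev n) (mdeg m)) n') \<noteq> 0"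
      using that by (simp add: Feq in_keys_iff lookup_sum)
    then obtain n where "n \<in> kys (f S0)" "lkp (sgl 0 (lkp (f S0) n) * Polynomial.coeff (pmon ev n) (mdeg m)) n' \<noteq> 0"
      by (metis (no_types, lifting) sum.neutral)
    then show ?thesis using part(1)[of n n'] by (simp add: in_keys_iff)
  qed
  have "F \<in> qpolys Q"
    unfolding Feq
  proof (intro qpolys_sum qpolys_closed(6) pmon_ev_qpolys)
    show "sgl 0 c \<in> qpolys Q" for c by (auto simp: qpolys_def split: if_splits)
  qed
  then have FQ: "kys n' \<subseteq> Q" if "n' \<in> kys F" for n' using that by (auto simp: qpolys_def)
  have nv0: "\<not> violates Q S0"
  proof
    assume "violates Q S0"
    then have "violates Q (S0 \<union> kys m)" by (rule violates_mono[OF _ subset_refl _ S0m_car Q_car]) blast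
    then show False using std_nested by simp
  qed
  have "violates Q (S0 \<union> kys m) \<or>
    (\<exists>g\<in>kys m. interval_rank L (\<Squnion>{n \<in> S0 \<union> kys m. n \<sqsubseteq> g \<and> n \<noteq> g}) g \<le> lkp m g)"
  proof (rule commutative_initial[OF lin Q _ _ f_init(2) nv0 FJ FQ mF])
    show "Q \<subseteq> H" by simp
    show "precedes r p q" if "p \<in> Q" "q \<in> Q" "q \<sqsubseteq> p" "q \<noteq> p" for p q using ord that by blast
    show "lexless r n' m" if "n' \<in> kys F" "n' \<noteq> m" for n' using Fmem that by blast
  qed
  then obtain g where g: "g \<in> kys m" "interval_rank L (\<Squnion>{n \<in> S0 \<union> kys m. n \<sqsubseteq> g \<and> n \<noteq> g}) g \<le> lkp m g"
    using std_nested by blast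
  define N where "N = {n \<in> S0 \<union> kys m. n \<sqsubseteq> g \<and> n \<noteq> g}"
  define A where "A = maxel N"
  have gQ: "g \<in> Q" "g \<in> carrier L" using g(1) kys_Q Q_car by auto
  have Nc: "N \<subseteq> carrier L" using S0m_car by (auto simp: N_def)
  have AN: "A \<subseteq> N" unfolding A_def by (rule maxel_sub)
  have jA: "\<Squnion>A = \<Squnion>N" unfolding A_def by (rule maxel_join[OF Nc])
  have "\<Squnion>N \<sqsubseteq> g" by (rule J_least[OF Nc gQ(2)]) (simp add: N_def)
  moreover have "\<Squnion>N \<noteq> g"
  proof
    assume eq: "\<Squnion>N = g"
    have "\<not> g \<sqsubseteq> n" if "n \<in> N" for n
      using that le_antisym[of n g] Nc gQ(2) by (auto simp: N_def)
    then have "N \<subseteq> {s \<in> S0 \<union> kys m. \<not> g \<sqsubseteq> s}" by (auto simp: N_def)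
    then have "\<Squnion>N \<sqsubseteq> \<Squnion>{s \<in> S0 \<union> kys m. \<not> g \<sqsubseteq> s}"
      by (rule J_mono) (use S0m_car in auto)
    then have "violates Q (S0 \<union> kys m)" using eq gQ(1) unfolding violates_def by (intro bexI[of _ g]) simp_all
    then show False using std_nested by simp
  qed
  ultimately have jless: "\<Squnion>A \<sqsubset> g" unfolding jA by (simp add: lless_def eq_is_equal)
  \<comment> \<open>Elements in both \<open>S0\<close> and \<open>kys m\<close> are assigned to the
    exterior part, which makes the two sets of the power relation disjoint.\<close>
  have split: "(A \<inter> S0) \<union> (A - S0) = A" by auto
  show False
  proof (rule std_power[of "A \<inter> S0" "A - S0" g])
    show "antichain_in L ((A \<inter> S0) \<union> (A - S0))" unfolding split unfolding A_def by (rule maxel_antichain)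
    show "\<Squnion>((A \<inter> S0) \<union> (A - S0)) \<sqsubset> g" unfolding split by (rule jless)
    show "interval_rank L (\<Squnion>((A \<inter> S0) \<union> (A - S0))) g \<le> lkp m g"
      unfolding split jA using g(2) by (simp add: N_def)
    show "A - S0 \<subseteq> kys m" using AN by (auto simp: N_def)
    show "g \<in> H" using gQ by simp
    show "g \<notin> A - S0" using AN by (auto simp: N_def)
  qed auto
qed

end

lemma GB_in_I: "GB \<subseteq> I"
proof (intro Un_least)
  show "nonnested_monomials L H r \<subseteq> I" "circuit_boundaries L H r ps \<subseteq> I"
    using X_I by (simp_all add: X_def)
  show "power_relations L H r \<subseteq> I" unfolding power_eq
  proof (rule subsetI, elim CollectE exE conjE)
    fix a S T g k
    assume "a = em S (prod qvar T * cp g ^ k)" "nested L H (S \<union> T)" "g \<in> H"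
      "\<Squnion>(S \<union> T) \<sqsubset> g" "k = interval_rank L (\<Squnion>(S \<union> T)) g"
    then show "a \<in> I" using power_in_I[of S T g k] by simp
  qed
qed

lemma groebner: "groebner_basis H r GB I"
  unfolding groebner_basis_def
proof (intro conjI ballI GB_in_I)
  fix f assume f: "f \<in> I - {\<zero>\<^bsub>R\<^esub>}"
  obtain S0 m where i: "initial_monomial r f = (S0, m)" by (cases "initial_monomial r f")
  show "\<exists>b\<in>GB - {\<zero>\<^bsub>R\<^esub>}. monomial_dvd (initial_monomial r b) (initial_monomial r f)"
  proof (rule ccontr)
    assume n: "\<not> ?thesis"
    have "\<not> monomial_dvd (initial_monomial r b) (S0, m)" if "b \<in> GB" "b \<noteq> \<zero>\<^bsub>R\<^esub>" for b
      using n that unfolding i by simp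
    then show False using contradiction[OF _ _ i] f by simp
  qed
qed

end

theorem theorem5p3p1:
  fixes L :: "'a gorder" and H :: "'a set" and r :: "'a rel" and ps :: "'a list"
  assumes "geometric_lattice L"
    and "partial_building_set L H"
    and "blowup_sequence L H ps"
    and "linear_order_on H r"
    and "\<forall>p\<in>H. \<forall>q\<in>H. q \<sqsubset>\<^bsub>L\<^esub> p \<longrightarrow> precedes r p q"
  shows "groebner_basis H r
    (nonnested_monomials L H r \<union> circuit_boundaries L H r ps \<union> power_relations L H r)
    (nested_ideal L H r ps)"
proof -
  interpret geo L by (rule geo.intro[OF assms(1)])
  obtain G where G: "building_set L G" "H \<subseteq> G" "atoms L \<subseteq> H"
    "\<forall>p\<in>H - atoms L. \<forall>g\<in>G. p \<sqsubseteq>\<^bsub>L\<^esub> g \<longrightarrow> g \<in> H - atoms L"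
    using assms(2) unfolding partial_building_set_def by blast
  define Q where "Q = H - atoms L"
  have HQ: "atoms L \<union> Q = H" using G(3) by (auto simp: Q_def)
  have bld: "building L G"
    using G by (intro building.intro building_axioms.intro geo_axioms) auto
  have "Q \<subseteq> G" using G(2) unfolding Q_def by blast
  moreover have "Q \<inter> atoms L = {}" unfolding Q_def by blast
  moreover have "\<forall>p\<in>Q. \<forall>g\<in>G. p \<sqsubseteq>\<^bsub>L\<^esub> g \<longrightarrow> g \<in> Q"
    using G(4) unfolding Q_def .
  ultimately have up: "building.upper L G Q"
    by (simp add: building.upper_def[OF bld])
  have pr: "precedes r p q" if "p \<in> H" "q \<in> H" "q \<sqsubseteq>\<^bsub>L\<^esub> p" "q \<noteq> p" for p q
  proof -
    have "q \<sqsubset>\<^bsub>L\<^esub> p" using that(3,4) by (simp add: lless_def eq_is_equal)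
    then show "precedes r p q" using assms(5) that(1,2) by blast
  qed
  have "nested_setting L G Q r ps"
    by (rule nested_setting.intro[OF bld nested_setting_axioms.intro], unfold HQ)
      (fact up assms(3,4) pr)+
  then show ?thesis using nested_setting.groebner[of L G Q r ps] by (simp add: HQ)
qed

end
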